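(* Assume (H1), (H2), (H3), (H4). Let $(u_n)\subset H_0^1(\Omega)$ be bounded with $j_\xi(x,u_n,\nabla u_n)\cdot\nabla u_n\in L^1(\Omega)$ for each $n$, and let $(w_n)\subset H^{-1}(\Omega)$ satisfy $$\int_\Omega j_s(x,u_n,\nabla u_n)v+\int_\Omega j_\xi(x,u_n,\nabla u_n)\cdot\nabla v=\langle w_n,v\rangle\qquad\forall v\in V_{u_n}.$$ If $(w_n)$ converges strongly in $H^{-1}(\Omega)$, then a subsequence of $(u_n)$ converges strongly in $H_0^1(\Omega)$.
   Context: $\Omega\subset\mathbb{R}^N$ bounded open, $N\ge3$. $j$ measurable in $x$, $C^1$ in $(s,\xi)$, partial derivatives $j_s,j_\xi$. (H1) $\xi\mapsto j(x,s,\xi)$ strictly convex; (H2) $\alpha_0|\xi|^2\le j(x,s,\xi)\le\alpha(|s|)|\xi|^2$ ($\alpha_0>0$, $\alpha$ positive increasing continuous); (H3) $|j_s(x,s,\xi)|\le\beta(|s|)|\xi|^2$ ($\beta$ positive increasing continuous); (H4) $j_s(x,s,\xi)s\ge0$ for $|s|\ge R$, some $R>0$. $V_u=\{v\in H_0^1(\Omega)\cap L^\infty(\Omega): u\in L^\infty(\{x:v(x)\ne0\})\}$. *)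

theory Defs
  imports "HOL-Analysis.Analysis"
begin

definition smooth_fun :: "('a::euclidean_space \<Rightarrow> real) \<Rightarrow> bool" where
  "smooth_fun f \<longleftrightarrow> (\<exists>F. f \<in> F \<and> (\<forall>g\<in>F. (\<forall>x. g differentiable (at x)) \<and>
        (\<forall>b\<in>Basis. (\<lambda>x. frechet_derivative g (at x) b) \<in> F)))"

definition test_fun :: "'a::euclidean_space set \<Rightarrow> ('a \<Rightarrow> real) \<Rightarrow> bool" where
  "test_fun \<Omega> \<phi> \<longleftrightarrow> smooth_fun \<phi> \<and>
     (\<exists>K. compact K \<and> K \<subseteq> \<Omega> \<and> (\<forall>x. x \<notin> K \<longrightarrow> \<phi> x = 0))"

definition is_weak_grad :: "'a::euclidean_space set \<Rightarrow> ('a \<Rightarrow> real) \<Rightarrow> ('a \<Rightarrow> 'a) \<Rightarrow> bool" where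
  "is_weak_grad \<Omega> u g \<longleftrightarrow>
     (\<forall>K. compact K \<and> K \<subseteq> \<Omega> \<longrightarrow> set_integrable lebesgue K u \<and> set_integrable lebesgue K g) \<and>
     (\<forall>\<phi>. test_fun \<Omega> \<phi> \<longrightarrow> (\<forall>b\<in>Basis.
        (LINT x:\<Omega>|lebesgue. u x * frechet_derivative \<phi> (at x) b)
          = - (LINT x:\<Omega>|lebesgue. (g x \<bullet> b) * \<phi> x)))"

text \<open>The weak gradient (unique up to null sets).\<close>
definition wgrad :: "'a::euclidean_space set \<Rightarrow> ('a \<Rightarrow> real) \<Rightarrow> ('a \<Rightarrow> 'a)" where
  "wgrad \<Omega> u = (SOME g. is_weak_grad \<Omega> u g)"

definition L2_on :: "'a::euclidean_space set \<Rightarrow> ('a \<Rightarrow> 'b::euclidean_space) \<Rightarrow> bool" where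
  "L2_on \<Omega> f \<longleftrightarrow> set_borel_measurable lebesgue \<Omega> f \<and>
     set_integrable lebesgue \<Omega> (\<lambda>x. (norm (f x))\<^sup>2)"

definition h1norm :: "'a::euclidean_space set \<Rightarrow> ('a \<Rightarrow> real) \<Rightarrow> real" where
  "h1norm \<Omega> u = sqrt ((LINT x:\<Omega>|lebesgue. (u x)\<^sup>2) + (LINT x:\<Omega>|lebesgue. (norm (wgrad \<Omega> u x))\<^sup>2))"

definition H01 :: "'a::euclidean_space set \<Rightarrow> ('a \<Rightarrow> real) \<Rightarrow> bool" where
  "H01 \<Omega> u \<longleftrightarrow> (\<exists>g. is_weak_grad \<Omega> u g) \<and> L2_on \<Omega> u \<and> L2_on \<Omega> (wgrad \<Omega> u) \<and>
     (\<exists>\<phi>. (\<forall>k. test_fun \<Omega> (\<phi> k)) \<and>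
        (\<lambda>k. h1norm \<Omega> (\<lambda>x. \<phi> k x - u x)) \<longlonglongrightarrow> 0)"

definition Hm1 :: "'a::euclidean_space set \<Rightarrow> (('a \<Rightarrow> real) \<Rightarrow> real) \<Rightarrow> bool" where
  "Hm1 \<Omega> w \<longleftrightarrow>
     (\<forall>u v. H01 \<Omega> u \<longrightarrow> H01 \<Omega> v \<longrightarrow> w (\<lambda>x. u x + v x) = w u + w v) \<and>
     (\<forall>c u. H01 \<Omega> u \<longrightarrow> w (\<lambda>x. c * u x) = c * w u) \<and>
     (\<exists>C. \<forall>v. H01 \<Omega> v \<longrightarrow> \<bar>w v\<bar> \<le> C * h1norm \<Omega> v)"

definition hm1norm :: "'a::euclidean_space set \<Rightarrow> (('a \<Rightarrow> real) \<Rightarrow> real) \<Rightarrow> real" where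
  "hm1norm \<Omega> w = Sup {\<bar>w v\<bar> | v. H01 \<Omega> v \<and> h1norm \<Omega> v \<le> 1}"

definition Vset :: "'a::euclidean_space set \<Rightarrow> ('a \<Rightarrow> real) \<Rightarrow> ('a \<Rightarrow> real) set" where
  "Vset \<Omega> u = {v. H01 \<Omega> v \<and> (\<exists>C. AE x in lebesgue. x \<in> \<Omega> \<longrightarrow> \<bar>v x\<bar> \<le> C) \<and>
                  (\<exists>C. AE x in lebesgue. x \<in> \<Omega> \<and> v x \<noteq> 0 \<longrightarrow> \<bar>u x\<bar> \<le> C)}"

definition strictly_convex_fun :: "('a::real_vector \<Rightarrow> real) \<Rightarrow> bool" where
  "strictly_convex_fun f \<longleftrightarrow> (\<forall>x y t. x \<noteq> y \<and> 0 < t \<and> t < 1 \<longrightarrow>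
      f ((1 - t) *\<^sub>R x + t *\<^sub>R y) < (1 - t) * f x + t * f y)"

end

theory Submission
  imports Defs "HOL-Complex_Analysis.Great_Picard"
begin

text \<open>Along a subsequence \<open>u\<^sub>n\<close> converges weakly in the Sobolev space and, by Rellich's theorem, almost
  everywhere, to some \<open>u\<close>. By (H4) the term with \<open>j\<^sub>s\<close> is nonnegative on large values of \<open>u\<^sub>n\<close>, so
  testing with the part of \<open>u\<^sub>n\<close> above a level \<open>k\<close> bounds the energy on \<open>{|u\<^sub>n| > k}\<close>, uniformly in \<open>n\<close>
  up to the error in \<open>w\<^sub>n\<close>, by a quantity that vanishes as \<open>k \<rightarrow> \<infinity>\<close>. Below the level \<open>k\<close> one tests
  with \<open>\<phi> (T\<^sub>k u\<^sub>n - T\<^sub>k u)\<close>, where \<open>T\<^sub>k\<close> is truncation and \<open>\<phi>\<close> grows exponentially: \<open>\<phi>'\<close> then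
  dominates the term with \<open>j\<^sub>s\<close>, which is quadratic in the gradient, and the integral of the
  monotonicity gap \<open>(j\<^sub>\<xi> (x, u\<^sub>n, \<nabla>T\<^sub>k u\<^sub>n) - j\<^sub>\<xi> (x, u\<^sub>n, \<nabla>T\<^sub>k u)) \<bullet> (\<nabla>T\<^sub>k u\<^sub>n - \<nabla>T\<^sub>k u)\<close> tends to zero.
  Strict convexity turns this into almost everywhere convergence of the gradients, and since the
  gap controls \<open>|\<nabla>T\<^sub>k u\<^sub>n|\<^sup>2\<close> the truncations converge strongly. Together with the bound on the tails
  this gives strong convergence.\<close>

section \<open>Hilbert spaces\<close>

text \<open>The obstacle is that neither \<open>u n\<close> nor the growth factors at |u_n| are
  bounded: the equation admits only test functions supported where \<open>u n\<close> is bounded,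
  and the flux is not known to be square integrable. The function built from the truncations need
  not vanish where \<open>u n\<close> is large, so it is cut off above a second level
  \<open>M\<close>, and the derivative of the cutoff meets the full energy density. The tail
  estimate bounds that energy independently of \<open>n\<close>, and the slope 1/M makes the product
  small; \<open>M\<close> is fixed first, then \<open>n\<close> tends to infinity. The limit
  functional is written with a pair (z, y) of L2 densities. Its action on the tails is then bounded
  by the norm of (z, y) over {|u_n| > k}, which dominated convergence makes small. The level
  \<open>k\<close> avoids the countably many values that |u| takes on sets of positive measure, so
  that the indicators of {|u_n| <= k} converge almost everywhere. Gradients are carried as explicit
  second components of pairs in L2, because \<open>wgrad\<close> is only a choice among almost
  everywhere equal functions.\<close>

lemma orthogonal_projection_exists:
  fixes S :: "'a::{real_inner,complete_space} set"
  assumes "closed S" "subspace S"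
  obtains p where "p \<in> S" "\<And>y. y \<in> S \<Longrightarrow> (x - p) \<bullet> y = 0"
proof -
  define d where "d = infdist x S"
  have ne: "S \<noteq> {}" using \<open>subspace S\<close> subspace_0 by blast
  have d0: "0 \<le> d" unfolding d_def by (rule infdist_nonneg)
  have dle: "d \<le> norm (x - y)" if "y \<in> S" for y
    unfolding d_def using infdist_le[OF that, of x] by (simp add: dist_norm)
  have "\<exists>y\<in>S. dist x y < d + 1 / (real n + 1)" for n :: nat
  proof -
    have "infdist x S < d + 1 / (real n + 1)" unfolding d_def by simp
    then show ?thesis using ne infdist_le2 by (metis infdist_notempty cINF_greatest linorder_not_le)
  qed
  then obtain y where yS: "\<And>n. y n \<in> S" and yd: "\<And>n. norm (x - y n) < d + 1 / (real n + 1)"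
    by (metis dist_norm)
  \<comment> \<open>The sequence \<open>y\<close> minimizes the distance to \<open>S\<close>.
    Midpoints stay in \<open>S\<close>, so the parallelogram identity leaves at most four times the
    excess of the squared distances over the minimum; that excess is bounded with (d + e)^2 <= d^2 +
    (2 d + 1) e for e <= 1.\<close>
  have par: "(norm (y m - y n))\<^sup>2 \<le> 4 * ((2 * d + 1) / (real N + 1))"
    if "N \<le> m" "N \<le> n" for m n N :: nat
  proof -
    have c: "(norm (x - y k))\<^sup>2 \<le> d\<^sup>2 + (2 * d + 1) / (real N + 1)" if "N \<le> k" for k
    proof -
      let ?e = "1 / (real N + 1)"
      have "1 / (real k + 1) \<le> ?e" using that by (simp add: frac_le)
      then have "norm (x - y k) \<le> d + ?e" using yd[of k] by linarith
      then have "(norm (x - y k))\<^sup>2 \<le> (d + ?e)\<^sup>2" by (simp add: power_mono)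
      also have "\<dots> = d\<^sup>2 + 2 * d * ?e + ?e * ?e" by (simp add: power2_eq_square algebra_simps)
      also have "?e * ?e \<le> 1 * ?e" by (rule mult_right_mono) auto
      finally show ?thesis by (simp add: add_divide_distrib)
    qed
    have "(1/2) *\<^sub>R (y m + y n) \<in> S" using yS assms(2) by (simp add: subspace_add subspace_mul)
    from dle[OF this] have "d\<^sup>2 \<le> (norm (x - (1/2) *\<^sub>R (y m + y n)))\<^sup>2"
      using d0 by (simp add: power_mono)
    moreover have "(norm (y m - y n))\<^sup>2 = 2 * (norm (x - y m))\<^sup>2 + 2 * (norm (x - y n))\<^sup>2
        - 4 * (norm (x - (1/2) *\<^sub>R (y m + y n)))\<^sup>2"
      unfolding power2_norm_eq_inner by (simp add: inner_simps inner_commute algebra_simps)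
    ultimately show ?thesis using c[OF that(1)] c[OF that(2)] by linarith
  qed
  have "Cauchy y"
  proof (rule metric_CauchyI)
    fix e :: real assume "0 < e"
    obtain N :: nat where N: "4 * (2 * d + 1) / e\<^sup>2 < real N" using reals_Archimedean2 by blast
    show "\<exists>N. \<forall>m\<ge>N. \<forall>n\<ge>N. dist (y m) (y n) < e"
    proof (intro exI[of _ N] allI impI)
      fix m n assume "N \<le> m" "N \<le> n"
      have "4 * (2 * d + 1) < e\<^sup>2 * (real N + 1)"
        using N \<open>0 < e\<close> by (simp add: field_simps)
          (smt (verit) zero_less_power)
      then have "4 * ((2 * d + 1) / (real N + 1)) < e\<^sup>2" by (simp add: field_simps)
      with par[OF \<open>N \<le> m\<close> \<open>N \<le> n\<close>] have "(norm (y m - y n))\<^sup>2 < e\<^sup>2" by linarith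
      then show "dist (y m) (y n) < e"
        using \<open>0 < e\<close> by (simp add: dist_norm power2_less_imp_less)
    qed
  qed
  then obtain p where p: "y \<longlonglongrightarrow> p" using Cauchy_convergent convergent_def by blast
  have pS: "p \<in> S" using closed_sequentially[OF \<open>closed S\<close> yS p] .
  have "(\<lambda>n. norm (x - y n)) \<longlonglongrightarrow> norm (x - p)" by (intro tendsto_intros p)
  moreover have "(\<lambda>n. d + 1 / (real n + 1)) \<longlonglongrightarrow> d + 0"
    by (intro tendsto_intros LIMSEQ_inverse_real_of_nat[simplified inverse_eq_divide, simplified add.commute[of 1]])
      (use LIMSEQ_inverse_real_of_nat in \<open>simp add: inverse_eq_divide add.commute\<close>)
  ultimately have pd: "norm (x - p) \<le> d"
    using LIMSEQ_le yd by (metis (no_types, lifting) add.right_neutral less_imp_le)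
  show thesis
  proof
    show "p \<in> S" by fact
    fix z assume "z \<in> S"
    show "(x - p) \<bullet> z = 0"
    proof (cases "z = 0")
      case False
      \<comment> \<open>This \<open>t\<close> minimizes the squared distance from \<open>x\<close>
        to the line through \<open>p\<close> in direction \<open>z\<close>; minimality of
        \<open>p\<close> then forces the inner product to vanish.\<close>
      define t where "t = ((x - p) \<bullet> z) / (z \<bullet> z)"
      have "p + t *\<^sub>R z \<in> S" using pS \<open>z \<in> S\<close> assms(2) by (simp add: subspace_add subspace_mul)
      from dle[OF this] pd have "(norm (x - p))\<^sup>2 \<le> (norm (x - (p + t *\<^sub>R z)))\<^sup>2"
        by (intro power_mono) auto
      also have "\<dots> = (norm (x - p))\<^sup>2 - 2 * t * ((x - p) \<bullet> z) + t * t * (z \<bullet> z)"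
        unfolding power2_norm_eq_inner by (simp add: inner_simps inner_commute algebra_simps)
      also have "t * t * (z \<bullet> z) = t * ((x - p) \<bullet> z)" using False by (simp add: t_def)
      finally have "t * ((x - p) \<bullet> z) \<le> 0" by linarith
      moreover have "t * ((x - p) \<bullet> z) = ((x - p) \<bullet> z)\<^sup>2 / (z \<bullet> z)"
        by (simp add: t_def power2_eq_square)
      ultimately show ?thesis using False
        by (smt (verit) inner_gt_zero_iff zero_less_divide_iff zero_less_power2)
    qed simp
  qed
qed

text \<open>Linearity and boundedness are asked on \<open>S\<close> only, because the functional
  represented later makes sense just on the closure of the test graph. A vector \<open>e\<close> of
  \<open>S\<close> orthogonal to the kernel spans \<open>S\<close> modulo the kernel, so a multiple
  of \<open>e\<close> represents \<open>f\<close>.\<close>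

lemma Riesz_representation_subspace:
  fixes S :: "'a::{real_inner,complete_space} set"
  assumes S: "closed S" "subspace S"
    and add: "\<And>x y. x \<in> S \<Longrightarrow> y \<in> S \<Longrightarrow> f (x + y) = f x + f y"
    and scale: "\<And>c x. x \<in> S \<Longrightarrow> f (c *\<^sub>R x) = c * f x"
    and bound: "\<And>x. x \<in> S \<Longrightarrow> \<bar>f x\<bar> \<le> C * norm x"
  obtains y where "y \<in> S" "\<And>x. x \<in> S \<Longrightarrow> f x = y \<bullet> x"
proof (cases "\<forall>x\<in>S. f x = 0")
  case True
  then show thesis using that[of 0] subspace_0[OF S(2)] by auto
next
  case False
  then obtain v where v: "v \<in> S" "f v \<noteq> 0" by blast
  have diff: "f (x - y) = f x - f y" if "x \<in> S" "y \<in> S" for x y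
    using add[of x "(-1) *\<^sub>R y"] scale[of y "-1"] that subspace_mul[OF S(2), of y "-1"] by simp
  define K where "K = {x \<in> S. f x = 0}"
  have "subspace K"
    unfolding K_def subspace_def using S(2) add scale scale[of 0 0]
    by (auto simp: subspace_0 subspace_add subspace_mul)
  moreover have "closed K"
    unfolding closed_sequential_limits
  proof (intro allI impI, elim conjE)
    fix x l assume x: "\<forall>n. x n \<in> K" "x \<longlonglongrightarrow> l"
    have l: "l \<in> S" using closed_sequentially[OF S(1), of x l] x by (auto simp: K_def)
    have "(\<lambda>n. C * norm (l - x n)) \<longlonglongrightarrow> C * norm (l - l)" by (intro tendsto_intros x)
    moreover have "\<bar>f l\<bar> \<le> C * norm (l - x n)" for n
      using bound[of "l - x n"] diff[of l "x n"] l x S(2) by (auto simp: K_def subspace_diff)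
    ultimately have "\<bar>f l\<bar> \<le> 0" using LIMSEQ_le_const by fastforce
    then show "l \<in> K" using l by (simp add: K_def)
  qed
  ultimately obtain p where p: "p \<in> K" "\<And>y. y \<in> K \<Longrightarrow> (v - p) \<bullet> y = 0"
    using orthogonal_projection_exists by blast
  define e where "e = v - p"
  have pS: "p \<in> S" "f p = 0" using p(1) by (auto simp: K_def)
  have e: "e \<in> S" "f e \<noteq> 0" using v pS diff S(2) by (auto simp: e_def subspace_diff)
  have "f 0 = 0" using scale[OF v(1), of 0] by simp
  then have e0: "e \<bullet> e \<noteq> 0" using e by auto
  show thesis
  proof
    show "(f e / (e \<bullet> e)) *\<^sub>R e \<in> S" using e S(2) by (simp add: subspace_mul)
    fix x assume x: "x \<in> S"
    have "x - (f x / f e) *\<^sub>R e \<in> K"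
      using x e S(2) diff[of x "(f x / f e) *\<^sub>R e"] scale[of e "f x / f e"]
      by (auto simp: K_def subspace_diff subspace_mul)
    from p(2)[OF this] have "e \<bullet> x = (f x / f e) * (e \<bullet> e)"
      by (simp add: e_def inner_simps)
    then show "f x = (f e / (e \<bullet> e)) *\<^sub>R e \<bullet> x" using e e0 by simp
  qed
qed

text \<open>Diagonal extraction is applied to the inner products with the countable set
  \<open>range x\<close>. The vectors against which the subsequence converges form a closed subspace
  \<open>T\<close> that contains this range; a vector orthogonal to \<open>T\<close> pairs to zero
  with every \<open>x n\<close>, so by projection \<open>T\<close> is the whole space.\<close>

lemma bounded_imp_weakly_convergent_subsequence:
  fixes x :: "nat \<Rightarrow> 'a::{real_inner,complete_space}"
  assumes S: "closed S" "subspace S" and xS: "\<And>n. x n \<in> S" and xB: "\<And>n. norm (x n) \<le> B"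
  obtains r l where "strict_mono (r::nat\<Rightarrow>nat)" "l \<in> S" "\<And>y. (\<lambda>n. x (r n) \<bullet> y) \<longlonglongrightarrow> l \<bullet> y"
proof -
  have B0: "0 \<le> B" using xB[of 0] norm_ge_zero order_trans by blast
  have "norm (x n \<bullet> y) \<le> B * B" if "y \<in> range x" for n y
  proof -
    have "\<bar>x n \<bullet> y\<bar> \<le> norm (x n) * norm y" by (rule Cauchy_Schwarz_ineq2)
    also have "\<dots> \<le> B * B" using that xB B0 by (intro mult_mono) auto
    finally show ?thesis by simp
  qed
  with function_convergent_subsequence[of "range x" "\<lambda>n y. x n \<bullet> y" "B * B"]
  obtain r where r: "strict_mono (r::nat\<Rightarrow>nat)"
    and conv: "\<And>y. y \<in> range x \<Longrightarrow> \<exists>l. (\<lambda>n. x (r n) \<bullet> y) \<longlonglongrightarrow> l" by auto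
  define T where "T = {y. convergent (\<lambda>n. x (r n) \<bullet> y)}"
  have sub: "subspace T"
    unfolding subspace_def T_def
    by (auto simp: inner_add_right convergent_const intro: convergent_add convergent_mult)
  have clT: "closed T"
    unfolding closed_sequential_limits
  proof (intro allI impI, elim conjE)
    fix y l assume y: "\<forall>n. y n \<in> T" "y \<longlonglongrightarrow> l"
    have "Cauchy (\<lambda>n. x (r n) \<bullet> l)"
    proof (rule metric_CauchyI)
      fix e :: real assume e: "0 < e"
      \<comment> \<open>Chosen so that \<open>(B + 1) * d\<close> is e / 3; the summand 1 keeps the
        denominator positive when \<open>B\<close> is 0.\<close>
      define d where "d = e / (3 * (B + 1))"
      have d: "0 < d" using e B0 by (simp add: d_def)
      obtain k where k: "norm (y k - l) < d"
        using y(2) d by (metis LIMSEQ_iff order_refl)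
      have "Cauchy (\<lambda>n. x (r n) \<bullet> y k)" using y(1) by (auto simp: T_def intro: convergent_Cauchy)
      then obtain N where N: "\<And>m n. N \<le> m \<Longrightarrow> N \<le> n \<Longrightarrow> \<bar>x (r m) \<bullet> y k - x (r n) \<bullet> y k\<bar> < e / 3"
        using e unfolding Cauchy_def dist_real_def by (metis zero_less_divide_iff zero_less_numeral)
      have small: "\<bar>x (r n) \<bullet> (y k - l)\<bar> \<le> e / 3" for n
      proof -
        have "\<bar>x (r n) \<bullet> (y k - l)\<bar> \<le> norm (x (r n)) * norm (y k - l)" by (rule Cauchy_Schwarz_ineq2)
        also have "\<dots> \<le> (B + 1) * d" using xB[of "r n"] k B0 by (intro mult_mono) auto
        also have "\<dots> = e / 3" using B0 by (simp add: d_def field_simps)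
        finally show ?thesis .
      qed
      show "\<exists>M. \<forall>m\<ge>M. \<forall>n\<ge>M. dist (x (r m) \<bullet> l) (x (r n) \<bullet> l) < e"
      proof (intro exI[of _ N] allI impI)
        fix m n assume "N \<le> m" "N \<le> n"
        from N[OF this] small[of m] small[of n] show "dist (x (r m) \<bullet> l) (x (r n) \<bullet> l) < e"
          unfolding dist_real_def inner_diff_right by linarith
      qed
    qed
    then show "l \<in> T" by (simp add: T_def Cauchy_convergent_iff)
  qed
  have all: "y \<in> T" for y
  proof -
    obtain p where p: "p \<in> T" "\<And>z. z \<in> T \<Longrightarrow> (y - p) \<bullet> z = 0"
      using orthogonal_projection_exists[OF clT sub] by blast
    have "x n \<in> T" for n using conv by (auto simp: T_def convergent_def)
    then have "(\<lambda>n. x (r n) \<bullet> (y - p)) = (\<lambda>n. 0)" using p(2) by (simp add: inner_commute[of "x _"])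
    then have "y - p \<in> T" by (simp add: T_def convergent_const)
    then have "(y - p) + p \<in> T" using p(1) sub subspace_add by blast
    then show ?thesis by simp
  qed
  define f where "f y = lim (\<lambda>n. x (r n) \<bullet> y)" for y
  have f: "(\<lambda>n. x (r n) \<bullet> y) \<longlonglongrightarrow> f y" for y
    using all[of y] unfolding T_def f_def by (simp add: convergent_LIMSEQ_iff)
  obtain l where l: "\<And>y. f y = l \<bullet> y"
  proof (rule Riesz_representation_subspace[of UNIV f B])
    fix y z :: 'a and c :: real
    show "f (y + z) = f y + f z"
      by (rule LIMSEQ_unique[OF f]) (auto simp: inner_add_right intro!: tendsto_intros f)
    show "f (c *\<^sub>R y) = c * f y"
      by (rule LIMSEQ_unique[OF f]) (auto intro!: tendsto_intros f)
    have "\<bar>x (r n) \<bullet> y\<bar> \<le> B * norm y" for n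
      using Cauchy_Schwarz_ineq2[of "x (r n)" y] mult_right_mono[OF xB[of "r n"], of "norm y"] by simp
    moreover have "(\<lambda>n. \<bar>x (r n) \<bullet> y\<bar>) \<longlonglongrightarrow> \<bar>f y\<bar>" by (intro tendsto_intros f)
    ultimately show "\<bar>f y\<bar> \<le> B * norm y" by (intro LIMSEQ_le_const2) auto
  qed (auto simp: that)
  \<comment> \<open>The weak limit lies in \<open>S\<close>: the vector l - p is orthogonal to every
    \<open>x n\<close>, hence to the limit \<open>l\<close>, and also to \<open>p\<close>.\<close>
  obtain p where p: "p \<in> S" "\<And>z. z \<in> S \<Longrightarrow> (l - p) \<bullet> z = 0"
    using orthogonal_projection_exists[OF S] by blast
  have "(\<lambda>n. x (r n) \<bullet> (l - p)) \<longlonglongrightarrow> l \<bullet> (l - p)" using f[of "l - p"] by (simp add: l)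
  moreover have "x (r n) \<bullet> (l - p) = 0" for n using p(2)[OF xS] by (metis inner_commute)
  ultimately have "l \<bullet> (l - p) = 0" by (simp add: LIMSEQ_const_iff)
  moreover have "p \<bullet> (l - p) = 0" using p by (metis inner_commute)
  ultimately have "(l - p) \<bullet> (l - p) = 0" by (simp add: inner_diff_left)
  then have "l \<in> S" using p(1) by simp
  then show thesis using that[OF r, of l] f l by auto
qed

section \<open>Square-integrable functions\<close>

text \<open>A predicate over an arbitrary measure, since square integrability is used with
  \<open>lebesgue\<close>, \<open>lborel\<close> and \<open>lebesgue_on \<Omega>\<close>.\<close>

definition sqi :: "'m measure \<Rightarrow> ('m \<Rightarrow> 'b::euclidean_space) \<Rightarrow> bool" where
  "sqi M f \<longleftrightarrow> f \<in> borel_measurable M \<and> integrable M (\<lambda>x. (norm (f x))\<^sup>2)"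

lemma sqi_measurable: "sqi M f \<Longrightarrow> f \<in> borel_measurable M"
  and sqi_integrable: "sqi M f \<Longrightarrow> integrable M (\<lambda>x. (norm (f x))\<^sup>2)"
  by (auto simp: sqi_def)

lemma sqi_dominated:
  assumes "sqi M F" "f \<in> borel_measurable M" "AE x in M. norm (f x) \<le> norm (F x)"
  shows "sqi M f"
  unfolding sqi_def
proof
  note [measurable] = assms(2)
  show "integrable M (\<lambda>x. (norm (f x))\<^sup>2)"
  proof (rule Bochner_Integration.integrable_bound[OF sqi_integrable[OF assms(1)]])
    show "AE x in M. norm ((norm (f x))\<^sup>2) \<le> norm ((norm (F x))\<^sup>2)"
      using assms(3) by eventually_elim (simp add: power_mono)
  qed measurable
qed fact

lemma power2_norm_add_le:
  fixes a b :: "'a::real_normed_vector"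
  shows "(norm (a + b))\<^sup>2 \<le> 2 * (norm a)\<^sup>2 + 2 * (norm b)\<^sup>2"
proof -
  have "(norm (a + b))\<^sup>2 \<le> (norm a + norm b)\<^sup>2" by (intro power_mono norm_triangle_ineq) auto
  also have "\<dots> \<le> 2 * (norm a)\<^sup>2 + 2 * (norm b)\<^sup>2"
    using sum_squares_bound[of "norm a" "norm b"] by (simp add: power2_sum)
  finally show ?thesis .
qed

lemma sqi_add:
  assumes "sqi M f" "sqi M g" shows "sqi M (\<lambda>x. f x + g x)"
proof -
  note [measurable] = sqi_measurable[OF assms(1)] sqi_measurable[OF assms(2)]
  have "integrable M (\<lambda>x. 2 * (norm (f x))\<^sup>2 + 2 * (norm (g x))\<^sup>2)"
    using assms by (auto simp: sqi_def)
  then have "integrable M (\<lambda>x. (norm (f x + g x))\<^sup>2)"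
    by (rule Bochner_Integration.integrable_bound) (auto simp: power2_norm_add_le)
  then show ?thesis unfolding sqi_def by simp
qed

lemma sqi_scaleR: "sqi M f \<Longrightarrow> sqi M (\<lambda>x. c *\<^sub>R f x)"
  by (auto simp: sqi_def power_mult_distrib)

lemma sqi_minus: "sqi M f \<Longrightarrow> sqi M (\<lambda>x. - f x)"
  by (auto simp: sqi_def)

lemma sqi_diff: "sqi M f \<Longrightarrow> sqi M g \<Longrightarrow> sqi M (\<lambda>x. f x - g x)"
  using sqi_add[of M f "\<lambda>x. - g x"] sqi_minus[of M g] by simp

lemma sqi_zero: "sqi M (\<lambda>x. 0)"
  by (auto simp: sqi_def)

lemma sqi_bounded_scaleR:
  fixes c :: "'m \<Rightarrow> real"
  assumes "sqi M f" "c \<in> borel_measurable M" "\<And>x. \<bar>c x\<bar> \<le> C"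
  shows "sqi M (\<lambda>x. c x *\<^sub>R f x)"
proof (rule sqi_dominated[OF sqi_scaleR[OF assms(1), of C]])
  show "(\<lambda>x. c x *\<^sub>R f x) \<in> borel_measurable M" using assms sqi_measurable by measurable
  show "AE x in M. norm (c x *\<^sub>R f x) \<le> norm (C *\<^sub>R f x)"
    using assms(3) by (auto intro!: mult_right_mono AE_I2 order_trans[OF _ abs_ge_self])
qed

lemma sqi_inner_integrable:
  assumes "sqi M f" "sqi M g" shows "integrable M (\<lambda>x. f x \<bullet> g x)"
proof -
  note [measurable] = sqi_measurable[OF assms(1)] sqi_measurable[OF assms(2)]
  have "integrable M (\<lambda>x. (norm (f x))\<^sup>2 + (norm (g x))\<^sup>2)"
    using assms by (auto simp: sqi_def)
  then show ?thesis
  proof (rule Bochner_Integration.integrable_bound)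
    show "AE x in M. norm (f x \<bullet> g x) \<le> norm ((norm (f x))\<^sup>2 + (norm (g x))\<^sup>2)"
    proof (rule AE_I2)
      fix x
      have "\<bar>f x \<bullet> g x\<bar> \<le> norm (f x) * norm (g x)" by (rule Cauchy_Schwarz_ineq2)
      also have "\<dots> \<le> (norm (f x))\<^sup>2 + (norm (g x))\<^sup>2"
        using sum_squares_bound[of "norm (f x)" "norm (g x)"]
          mult_nonneg_nonneg[OF norm_ge_zero[of "f x"] norm_ge_zero[of "g x"]] by linarith
      finally show "norm (f x \<bullet> g x) \<le> norm ((norm (f x))\<^sup>2 + (norm (g x))\<^sup>2)" by simp
    qed
  qed measurable
qed

lemma sqi_mult_integrable:
  fixes f g :: "'m \<Rightarrow> real"
  shows "sqi M f \<Longrightarrow> sqi M g \<Longrightarrow> integrable M (\<lambda>x. f x * g x)"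
  using sqi_inner_integrable[of M f g] by simp

lemma sqi_fst_snd:
  fixes u :: "'m \<Rightarrow> 'b::euclidean_space" and g :: "'m \<Rightarrow> 'c::euclidean_space"
  shows "sqi M (\<lambda>x. (u x, g x)) \<longleftrightarrow> sqi M u \<and> sqi M g"
proof
  assume a: "sqi M (\<lambda>x. (u x, g x))"
  have "(\<lambda>x. fst (u x, g x)) \<in> borel_measurable M" "(\<lambda>x. snd (u x, g x)) \<in> borel_measurable M"
    by (rule borel_measurable_continuous_on[OF _ sqi_measurable[OF a]], intro continuous_intros)+
  then have "u \<in> borel_measurable M" "g \<in> borel_measurable M" by simp_all
  then show "sqi M u \<and> sqi M g"
    using a by (auto intro!: sqi_dominated[OF a] norm_fst_le[of "(_,_)", simplified] 
       norm_snd_le[of "(_,_)", simplified] simp: norm_Pair real_le_rsqrt)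
next
  assume "sqi M u \<and> sqi M g"
  then show "sqi M (\<lambda>x. (u x, g x))"
    by (auto simp: sqi_def norm_Pair borel_measurable_Pair)
qed

lemma (in finite_measure) sqi_const: "sqi M (\<lambda>x. c)"
  by (auto simp: sqi_def)

lemma (in finite_measure) sqi_imp_integrable:
  assumes "sqi M f" shows "integrable M f"
proof -
  have "integrable M (\<lambda>x. 1 + (norm (f x))\<^sup>2)" using assms by (auto simp: sqi_def)
  then show ?thesis
  proof (rule Bochner_Integration.integrable_bound[OF _ sqi_measurable[OF assms]])
    have "norm (f x) \<le> 1 + (norm (f x))\<^sup>2" for x
      using sum_squares_bound[of 1 "norm (f x)"] norm_ge_zero[of "f x"] unfolding power_one mult_1_right by linarith
    then show "AE x in M. norm (f x) \<le> norm (1 + (norm (f x))\<^sup>2)" by auto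
  qed
qed

section \<open>The L2 norm, weak convergence and products of sequences\<close>

definition nrm2 :: "'m measure \<Rightarrow> ('m \<Rightarrow> 'b::euclidean_space) \<Rightarrow> real" where
  "nrm2 M f = sqrt (\<integral>x. (norm (f x))\<^sup>2 \<partial>M)"

lemma nrm2_nonneg: "0 \<le> nrm2 M f"
  by (simp add: nrm2_def)

lemma nrm2_power2: "(nrm2 M f)\<^sup>2 = (\<integral>x. (norm (f x))\<^sup>2 \<partial>M)"
  by (simp add: nrm2_def)

lemma Cauchy_Schwarz_sqi:
  assumes "sqi M f" "sqi M g"
  shows "\<bar>\<integral>x. f x \<bullet> g x \<partial>M\<bar> \<le> nrm2 M f * nrm2 M g"
proof -
  let ?A = "\<integral>x. (norm (f x))\<^sup>2 \<partial>M" and ?B = "\<integral>x. f x \<bullet> g x \<partial>M" and ?C = "\<integral>x. (norm (g x))\<^sup>2 \<partial>M"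
  note i = sqi_integrable[OF assms(1)] sqi_integrable[OF assms(2)] sqi_inner_integrable[OF assms]
  have q: "0 \<le> ?A + 2 * t * ?B + t\<^sup>2 * ?C" for t :: real
  proof -
    have "0 \<le> (\<integral>x. (norm (f x + t *\<^sub>R g x))\<^sup>2 \<partial>M)" by simp
    also have "\<dots> = (\<integral>x. (norm (f x))\<^sup>2 + 2 * t * (f x \<bullet> g x) + t\<^sup>2 * (norm (g x))\<^sup>2 \<partial>M)"
      unfolding power2_norm_eq_inner
      by (intro Bochner_Integration.integral_cong refl)
        (simp add: inner_simps inner_commute algebra_simps power2_eq_square)
    also have "\<dots> = ?A + 2 * t * ?B + t\<^sup>2 * ?C" using i by simp
    finally show ?thesis .
  qed
  have "?B\<^sup>2 \<le> ?A * ?C"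
  proof (cases "?C = 0")
    case True
    have "?B = 0"
    proof (rule ccontr)
      assume "?B \<noteq> 0"
      \<comment> \<open>With \<open>?C = 0\<close> this argument gives the nonnegative polynomial
        the value -1.\<close>
      then show False using q[of "- (?A + 1) / (2 * ?B)"] True by (simp add: field_simps)
    qed
    then show ?thesis using True by simp
  next
    case False
    have C: "0 \<le> ?C" by simp
    with False have C: "0 < ?C" by linarith
    have "0 \<le> ?A - ?B\<^sup>2 / ?C"
      using q[of "- ?B / ?C"] C by (simp add: field_simps power2_eq_square)
    then show ?thesis using C by (simp add: field_simps)
  qed
  then have "sqrt (?B\<^sup>2) \<le> sqrt (?A * ?C)" by (rule real_sqrt_le_mono)
  then show ?thesis by (simp add: nrm2_def real_sqrt_mult)
qed

lemma nrm2_triangle: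
  assumes "sqi M f" "sqi M g"
  shows "nrm2 M (\<lambda>x. f x + g x) \<le> nrm2 M f + nrm2 M g"
proof (rule power2_le_imp_le)
  note i = sqi_integrable[OF assms(1)] sqi_integrable[OF assms(2)] sqi_inner_integrable[OF assms]
  have "(nrm2 M (\<lambda>x. f x + g x))\<^sup>2 = (\<integral>x. (norm (f x))\<^sup>2 + 2 * (f x \<bullet> g x) + (norm (g x))\<^sup>2 \<partial>M)"
    unfolding nrm2_power2 power2_norm_eq_inner
    by (intro Bochner_Integration.integral_cong refl) (simp add: inner_simps inner_commute)
  also have "\<dots> = (nrm2 M f)\<^sup>2 + 2 * (\<integral>x. f x \<bullet> g x \<partial>M) + (nrm2 M g)\<^sup>2"
    using i by (simp add: nrm2_power2)
  also have "\<dots> \<le> (nrm2 M f + nrm2 M g)\<^sup>2"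
    using Cauchy_Schwarz_sqi[OF assms] by (simp add: power2_sum)
  finally show "(nrm2 M (\<lambda>x. f x + g x))\<^sup>2 \<le> (nrm2 M f + nrm2 M g)\<^sup>2" .
qed (simp add: nrm2_nonneg)

lemma nrm2_scaleR: "nrm2 M (\<lambda>x. c *\<^sub>R f x) = \<bar>c\<bar> * nrm2 M f"
  by (simp add: nrm2_def power_mult_distrib real_sqrt_mult)

lemma nrm2_mono:
  assumes "sqi M g" "f \<in> borel_measurable M" "AE x in M. norm (f x) \<le> norm (g x)"
  shows "nrm2 M f \<le> nrm2 M g"
  unfolding nrm2_def
proof (intro real_sqrt_le_mono integral_mono_AE)
  show "integrable M (\<lambda>x. (norm (f x))\<^sup>2)" using sqi_dominated[OF assms] by (rule sqi_integrable)
  show "AE x in M. (norm (f x))\<^sup>2 \<le> (norm (g x))\<^sup>2"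
    using assms(3) by eventually_elim (simp add: power_mono)
qed (use assms sqi_integrable in auto)

lemma nrm2_cong_AE:
  assumes "f \<in> borel_measurable M" "g \<in> borel_measurable M" "AE x in M. f x = g x"
  shows "nrm2 M f = nrm2 M g"
  unfolding nrm2_def using assms by (intro arg_cong[of _ _ sqrt] integral_cong_AE) auto

lemma nrm2_Pair:
  assumes "sqi M u" "sqi M g"
  shows "(nrm2 M (\<lambda>x. (u x, g x)))\<^sup>2 = (nrm2 M u)\<^sup>2 + (nrm2 M g)\<^sup>2"
  using assms by (simp add: nrm2_power2 norm_Pair sqi_integrable)

lemma nrm2_dominated_convergence:
  assumes H: "sqi M H" and f: "\<And>n. f n \<in> borel_measurable M" "f0 \<in> borel_measurable M"
    and le: "\<And>n. AE x in M. norm (f n x) \<le> norm (H x)"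
    and lim: "AE x in M. (\<lambda>n. f n x) \<longlonglongrightarrow> f0 x"
  shows "sqi M f0" "(\<lambda>n. nrm2 M (\<lambda>x. f n x - f0 x)) \<longlonglongrightarrow> 0"
proof -
  note [measurable] = f
  have le': "AE x in M. \<forall>n. norm (f n x) \<le> norm (H x)" using le by (simp add: AE_all_countable)
  have f0: "AE x in M. norm (f0 x) \<le> norm (H x)"
    using le' lim
  proof eventually_elim
    case (elim x)
    then show ?case by (intro LIMSEQ_le_const2[OF tendsto_norm[OF elim(2)]]) auto
  qed
  show "sqi M f0" by (rule sqi_dominated[OF H f(2) f0])
  have "(\<lambda>n. \<integral>x. (norm (f n x - f0 x))\<^sup>2 \<partial>M) \<longlonglongrightarrow> (\<integral>x. 0 \<partial>M)"
  proof (rule integral_dominated_convergence[where w="\<lambda>x. 4 * (norm (H x))\<^sup>2"])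
    show "integrable M (\<lambda>x. 4 * (norm (H x))\<^sup>2)" using H by (auto simp: sqi_def)
    show "AE x in M. (\<lambda>n. (norm (f n x - f0 x))\<^sup>2) \<longlonglongrightarrow> 0"
      using lim by eventually_elim (auto intro!: tendsto_eq_intros)
    show "AE x in M. norm ((norm (f n x - f0 x))\<^sup>2) \<le> 4 * (norm (H x))\<^sup>2" for n
      using le' f0
    proof eventually_elim
      case (elim x)
      have "norm (f n x - f0 x) \<le> 2 * norm (H x)"
        using elim norm_triangle_ineq4[of "f n x" "f0 x"] by (smt (verit))
      then have "(norm (f n x - f0 x))\<^sup>2 \<le> (2 * norm (H x))\<^sup>2" by (rule power_mono) simp
      then show ?case by (simp add: power_mult_distrib)
    qed
  qed (auto)
  from tendsto_real_sqrt[OF this] show "(\<lambda>n. nrm2 M (\<lambda>x. f n x - f0 x)) \<longlonglongrightarrow> 0"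
    by (simp add: nrm2_def)
qed

lemma bounded_times_vanishing:
  assumes f: "\<And>n. sqi M (f n)" "\<And>n. nrm2 M (f n) \<le> B"
    and h: "\<And>n. sqi M (h n)" "(\<lambda>n. nrm2 M (h n)) \<longlonglongrightarrow> 0"
  shows "(\<lambda>n. \<integral>x. f n x \<bullet> h n x \<partial>M) \<longlonglongrightarrow> 0"
proof (rule Lim_null_comparison)
  show "\<forall>\<^sub>F n in sequentially. norm (\<integral>x. f n x \<bullet> h n x \<partial>M) \<le> B * nrm2 M (h n)"
    using order_trans[OF Cauchy_Schwarz_sqi[OF f(1) h(1)] mult_right_mono[OF f(2) nrm2_nonneg]]
    by (intro always_eventually) auto
  show "(\<lambda>n. B * nrm2 M (h n)) \<longlonglongrightarrow> 0" using tendsto_mult_right_zero[OF h(2)] .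
qed

definition weakly_conv :: "'m measure \<Rightarrow> (nat \<Rightarrow> 'm \<Rightarrow> 'b::euclidean_space) \<Rightarrow> ('m \<Rightarrow> 'b) \<Rightarrow> bool" where
  "weakly_conv M f f0 \<longleftrightarrow> (\<forall>h. sqi M h \<longrightarrow> (\<lambda>n. \<integral>x. f n x \<bullet> h x \<partial>M) \<longlonglongrightarrow> (\<integral>x. f0 x \<bullet> h x \<partial>M))"

lemma bounded_times_dominated:
  assumes f: "\<And>n. sqi M (f n)" "\<And>n. nrm2 M (f n) \<le> B"
    and H: "sqi M H" and h: "\<And>n. h n \<in> borel_measurable M"
    and le: "\<And>n. AE x in M. norm (h n x) \<le> norm (H x)"
    and lim: "AE x in M. (\<lambda>n. h n x) \<longlonglongrightarrow> 0"
  shows "(\<lambda>n. \<integral>x. f n x \<bullet> h n x \<partial>M) \<longlonglongrightarrow> 0"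
proof (rule bounded_times_vanishing[OF f])
  show "sqi M (h n)" for n by (rule sqi_dominated[OF H h le])
  show "(\<lambda>n. nrm2 M (h n)) \<longlonglongrightarrow> 0"
    using nrm2_dominated_convergence(2)[OF H h _ le lim] by simp
qed

text \<open>The second factor converges strongly in L2 by dominated convergence, so its distance to
  the limit is negligible against the bounded first factor. In this form weakly convergent gradients
  are multiplied by coefficients that converge almost everywhere.\<close>

lemma weak_times_dominated:
  assumes f: "\<And>n. sqi M (f n)" "\<And>n. nrm2 M (f n) \<le> B" and weak: "weakly_conv M f f0"
    and H: "sqi M H" and h: "\<And>n. h n \<in> borel_measurable M" "h0 \<in> borel_measurable M"
    and le: "\<And>n. AE x in M. norm (h n x) \<le> norm (H x)"
    and lim: "AE x in M. (\<lambda>n. h n x) \<longlonglongrightarrow> h0 x"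
  shows "(\<lambda>n. \<integral>x. f n x \<bullet> h n x \<partial>M) \<longlonglongrightarrow> (\<integral>x. f0 x \<bullet> h0 x \<partial>M)"
proof -
  note dc = nrm2_dominated_convergence[OF H h le lim]
  have hn: "sqi M (h n)" for n by (rule sqi_dominated[OF H h(1) le])
  have "(\<lambda>n. \<integral>x. f n x \<bullet> (h n x - h0 x) \<partial>M) \<longlonglongrightarrow> 0"
    by (rule bounded_times_vanishing[OF f _ dc(2)]) (intro sqi_diff hn dc(1))
  moreover have "(\<lambda>n. \<integral>x. f n x \<bullet> h0 x \<partial>M) \<longlonglongrightarrow> (\<integral>x. f0 x \<bullet> h0 x \<partial>M)"
    using weak dc(1) by (simp add: weakly_conv_def)
  ultimately have "(\<lambda>n. (\<integral>x. f n x \<bullet> (h n x - h0 x) \<partial>M) + (\<integral>x. f n x \<bullet> h0 x \<partial>M))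
      \<longlonglongrightarrow> 0 + (\<integral>x. f0 x \<bullet> h0 x \<partial>M)" by (rule tendsto_add)
  moreover have "(\<integral>x. f n x \<bullet> (h n x - h0 x) \<partial>M) + (\<integral>x. f n x \<bullet> h0 x \<partial>M) = (\<integral>x. f n x \<bullet> h n x \<partial>M)" for n
    using sqi_inner_integrable[OF f(1)[of n] hn[of n]] sqi_inner_integrable[OF f(1)[of n] dc(1)]
    by (simp add: inner_diff_right)
  ultimately show ?thesis by simp
qed

lemma nrm2_tendsto_zero_AE_subseq:
  assumes "\<And>n. sqi M (f n)" "(\<lambda>n. nrm2 M (f n)) \<longlonglongrightarrow> 0"
  obtains r where "strict_mono (r::nat\<Rightarrow>nat)" "AE x in M. (\<lambda>n. f (r n) x) \<longlonglongrightarrow> 0"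
proof -
  have "(\<lambda>n. (nrm2 M (f n))\<^sup>2) \<longlonglongrightarrow> 0\<^sup>2" by (intro tendsto_intros assms)
  then have "(\<lambda>n. \<integral>x. norm ((norm (f n x))\<^sup>2) \<partial>M) \<longlonglongrightarrow> 0" by (simp add: nrm2_power2)
  from tendsto_L1_AE_subseq[OF sqi_integrable[OF assms(1)] this]
  obtain r where r: "strict_mono (r::nat\<Rightarrow>nat)" "AE x in M. (\<lambda>n. (norm (f (r n) x))\<^sup>2) \<longlonglongrightarrow> 0" by blast
  have "AE x in M. (\<lambda>n. f (r n) x) \<longlonglongrightarrow> 0"
    using r(2)
  proof eventually_elim
    case (elim x)
    from tendsto_real_sqrt[OF this] show ?case by (simp add: tendsto_norm_zero_iff)
  qed
  with r(1) that show thesis by blast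
qed

\<comment> \<open>Identification almost everywhere produces a type in \<open>real_inner\<close> and
  \<open>complete_space\<close>, to which the Hilbert space lemmas apply. The relation is partial
  because only square integrable functions represent an element. The measure is that of the whole
  space, as a type cannot depend on \<Omega>.\<close>
quotient_type (overloaded) ('a, 'b) ltwo = "'a::euclidean_space \<Rightarrow> 'b::euclidean_space" /
  partial: "\<lambda>f g. sqi lebesgue f \<and> sqi lebesgue g \<and> (AE x in lebesgue. f x = g x)"
proof (rule part_equivpI)
  show "\<exists>f::'a \<Rightarrow> 'b. sqi lebesgue f \<and> sqi lebesgue f \<and> (AE x in lebesgue. f x = f x)"
    using sqi_zero[of lebesgue] by auto
qed (auto intro!: sympI transpI elim: AE_mp)

lemma abs_ltwo_eq_iff:
  "sqi lebesgue f \<Longrightarrow> sqi lebesgue g \<Longrightarrow> abs_ltwo f = abs_ltwo g \<longleftrightarrow> (AE x in lebesgue. f x = g x)"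
  using Quotient_rel[OF Quotient_ltwo, of f g] by auto

lemma sqi_rep_ltwo: "sqi lebesgue (rep_ltwo z)"
  using Quotient_rep_reflp[OF Quotient_ltwo, of z] by blast

lemma abs_rep_ltwo: "abs_ltwo (rep_ltwo z) = z"
  by (rule Quotient_abs_rep[OF Quotient_ltwo])

instantiation ltwo :: (euclidean_space, euclidean_space) real_inner
begin

lift_definition zero_ltwo :: "('a, 'b) ltwo" is "\<lambda>x. 0"
  by (simp add: sqi_zero)

lift_definition plus_ltwo :: "('a, 'b) ltwo \<Rightarrow> ('a, 'b) ltwo \<Rightarrow> ('a, 'b) ltwo" is "\<lambda>f g x. f x + g x"
  using sqi_add by (fastforce elim: AE_mp)

lift_definition minus_ltwo :: "('a, 'b) ltwo \<Rightarrow> ('a, 'b) ltwo \<Rightarrow> ('a, 'b) ltwo" is "\<lambda>f g x. f x - g x"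
  using sqi_diff by (fastforce elim: AE_mp)

lift_definition uminus_ltwo :: "('a, 'b) ltwo \<Rightarrow> ('a, 'b) ltwo" is "\<lambda>f x. - f x"
  by (simp add: sqi_minus)

lift_definition scaleR_ltwo :: "real \<Rightarrow> ('a, 'b) ltwo \<Rightarrow> ('a, 'b) ltwo" is "\<lambda>c f x. c *\<^sub>R f x"
  by (simp add: sqi_scaleR)

lift_definition inner_ltwo :: "('a, 'b) ltwo \<Rightarrow> ('a, 'b) ltwo \<Rightarrow> real" is
  "\<lambda>f g. \<integral>x. f x \<bullet> g x \<partial>lebesgue"
proof (rule integral_cong_AE, goal_cases)
  case (1 f f' g g')
  then show ?case using borel_measurable_inner[OF sqi_measurable sqi_measurable] by blast
next
  case (2 f f' g g')
  then show ?case using borel_measurable_inner[OF sqi_measurable sqi_measurable] by blast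
next
  case (3 f f' g g')
  then have "AE x in lebesgue. f x = f' x" "AE x in lebesgue. g x = g' x" by auto
  then show ?case by eventually_elim simp
qed

definition norm_ltwo :: "('a, 'b) ltwo \<Rightarrow> real" where "norm_ltwo x = sqrt (x \<bullet> x)"

definition dist_ltwo :: "('a, 'b) ltwo \<Rightarrow> ('a, 'b) ltwo \<Rightarrow> real" where "dist_ltwo x y = norm (x - y)"

definition sgn_ltwo :: "('a, 'b) ltwo \<Rightarrow> ('a, 'b) ltwo" where "sgn_ltwo x = inverse (norm x) *\<^sub>R x"

definition uniformity_ltwo :: "(('a, 'b) ltwo \<times> ('a, 'b) ltwo) filter" where
  "uniformity_ltwo = (INF e\<in>{0<..}. principal {(x, y). dist x y < e})"

definition open_ltwo :: "('a, 'b) ltwo set \<Rightarrow> bool" where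
  "open_ltwo U \<longleftrightarrow> (\<forall>x\<in>U. \<forall>\<^sub>F (x', y) in uniformity. x' = x \<longrightarrow> y \<in> U)"

instance
proof
  fix x y z :: "('a, 'b) ltwo" and r s :: real
  show "x + y + z = x + (y + z)" by transfer (simp add: sqi_add add.assoc)
  show "x + y = y + x" by transfer (simp add: sqi_add add.commute)
  show "0 + x = x" by transfer simp
  show "- x + x = 0" by transfer (simp add: sqi_zero)
  show "x - y = x + - y" by transfer (simp add: sqi_diff)
  show "r *\<^sub>R (x + y) = r *\<^sub>R x + r *\<^sub>R y"
    by transfer (simp add: sqi_add sqi_scaleR scaleR_add_right)
  show "(r + s) *\<^sub>R x = r *\<^sub>R x + s *\<^sub>R x"
    by transfer (simp add: sqi_add sqi_scaleR scaleR_add_left)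
  show "r *\<^sub>R s *\<^sub>R x = (r * s) *\<^sub>R x"
    by transfer (simp add: sqi_scaleR)
  show "1 *\<^sub>R x = x" by transfer simp
  show "dist x y = norm (x - y)" by (rule dist_ltwo_def)
  show "sgn x = inverse (norm x) *\<^sub>R x" by (rule sgn_ltwo_def)
  show "uniformity = (INF e\<in>{0<..}. principal {(x::('a, 'b) ltwo, y). dist x y < e})"
    by (rule uniformity_ltwo_def)
  show "open U \<longleftrightarrow> (\<forall>x\<in>U. \<forall>\<^sub>F (x', y) in uniformity. x' = x \<longrightarrow> y \<in> U)" for U :: "('a, 'b) ltwo set"
    by (rule open_ltwo_def)
  show "x \<bullet> y = y \<bullet> x" by transfer (simp add: inner_commute)
  show "(x + y) \<bullet> z = x \<bullet> z + y \<bullet> z"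
    by transfer (simp add: inner_add_left sqi_inner_integrable)
  show "(r *\<^sub>R x) \<bullet> y = r * (x \<bullet> y)" by transfer simp
  show "0 \<le> x \<bullet> x" by transfer simp
  show "x \<bullet> x = 0 \<longleftrightarrow> x = 0"
  proof (transfer)
    fix f :: "'a \<Rightarrow> 'b"
    assume "sqi lebesgue f \<and> sqi lebesgue f \<and> (AE x in lebesgue. f x = f x)"
    then have f: "sqi lebesgue f" by blast
    have "(LINT x|lebesgue. f x \<bullet> f x) = 0 \<longleftrightarrow> (AE x in lebesgue. f x \<bullet> f x = 0)"
      using f by (intro integral_nonneg_eq_0_iff_AE sqi_inner_integrable) auto
    then show "((LINT x|lebesgue. f x \<bullet> f x) = 0) =
        (sqi lebesgue f \<and> sqi lebesgue (\<lambda>x. 0::'b) \<and> (AE x in lebesgue. f x = 0))"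
      using f sqi_zero by auto
  qed
  show "norm x = sqrt (x \<bullet> x)" by (rule norm_ltwo_def)
qed

end

lemma abs_ltwo_plus: "sqi lebesgue f \<Longrightarrow> sqi lebesgue g \<Longrightarrow> abs_ltwo f + abs_ltwo g = abs_ltwo (\<lambda>x. f x + g x)"
  by (rule plus_ltwo.abs_eq) auto

lemma abs_ltwo_minus: "sqi lebesgue f \<Longrightarrow> sqi lebesgue g \<Longrightarrow> abs_ltwo f - abs_ltwo g = abs_ltwo (\<lambda>x. f x - g x)"
  by (rule minus_ltwo.abs_eq) auto

lemma abs_ltwo_scaleR: "sqi lebesgue f \<Longrightarrow> c *\<^sub>R abs_ltwo f = abs_ltwo (\<lambda>x. c *\<^sub>R f x)"
  by (rule scaleR_ltwo.abs_eq) auto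

lemma abs_ltwo_inner: "sqi lebesgue f \<Longrightarrow> sqi lebesgue g \<Longrightarrow> abs_ltwo f \<bullet> abs_ltwo g = (\<integral>x. f x \<bullet> g x \<partial>lebesgue)"
  by (rule inner_ltwo.abs_eq) auto

lemma abs_ltwo_norm: "sqi lebesgue f \<Longrightarrow> norm (abs_ltwo f) = nrm2 lebesgue f"
  by (simp add: norm_ltwo_def abs_ltwo_inner nrm2_def power2_norm_eq_inner)

text \<open>Riesz-Fischer. For a fast subsequence, the weights \<open>2^k\<close> on the squared
  differences keep the series integrable and force geometric decay at almost every point, so the
  subsequence converges almost everywhere. Fatou's lemma then controls the distance to that
  limit.\<close>

lemma Cauchy_sqi_convergent:
  fixes f :: "nat \<Rightarrow> 'm \<Rightarrow> 'b::euclidean_space"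
  assumes f: "\<And>n. sqi M (f n)"
    and Cauchy: "\<And>e. 0 < e \<Longrightarrow> \<exists>N. \<forall>m\<ge>N. \<forall>n\<ge>N. nrm2 M (\<lambda>x. f m x - f n x) < e"
  obtains g where "sqi M g" "(\<lambda>n. nrm2 M (\<lambda>x. f n x - g x)) \<longlonglongrightarrow> 0"
proof -
  note [measurable] = sqi_measurable[OF f]
  have fd: "sqi M (\<lambda>x. f m x - f n x)" for m n by (intro sqi_diff f)
  have "\<exists>r. \<forall>k. (\<forall>m\<ge>r k. \<forall>n\<ge>r k. nrm2 M (\<lambda>x. f m x - f n x) < (1/2)^k) \<and> r k < (r (Suc k) :: nat)"
  proof (rule dependent_nat_choice)
    show "\<exists>N. \<forall>m\<ge>N. \<forall>n\<ge>N. nrm2 M (\<lambda>x. f m x - f n x) < (1/2)^0" using Cauchy[of 1] by simp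
    fix x k
    obtain N where "\<forall>m\<ge>N. \<forall>n\<ge>N. nrm2 M (\<lambda>x. f m x - f n x) < (1/2)^Suc k"
      using Cauchy[of "(1/2)^Suc k"] by auto
    then show "\<exists>y. (\<forall>m\<ge>y. \<forall>n\<ge>y. nrm2 M (\<lambda>x. f m x - f n x) < (1/2)^Suc k) \<and> x < y"
      by (intro exI[of _ "max N (Suc x)"]) auto
  qed
  then obtain r :: "nat \<Rightarrow> nat" where r: "\<And>k m n. r k \<le> m \<Longrightarrow> r k \<le> n \<Longrightarrow> nrm2 M (\<lambda>x. f m x - f n x) < (1/2)^k"
    and rm: "\<And>k. r k < r (Suc k)" by blast
  have rmono: "strict_mono r" using rm by (simp add: strict_mono_Suc_iff)
  define d where "d k x = f (r (Suc k)) x - f (r k) x" for k x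
  have [measurable]: "d k \<in> borel_measurable M" for k unfolding d_def by measurable
  \<comment> \<open>The norm of \<open>d k\<close> is below (1/2)^k, so its square (1/4)^k leaves
    room for the factor \<open>2^k\<close>.\<close>
  have dn: "(\<integral>\<^sup>+x. ennreal (2^k * (norm (d k x))\<^sup>2) \<partial>M) \<le> ennreal ((1/2)^k)" for k
  proof -
    have i: "integrable M (\<lambda>x. (norm (d k x))\<^sup>2)" unfolding d_def by (rule sqi_integrable[OF fd])
    have "(\<integral>\<^sup>+x. ennreal (2^k * (norm (d k x))\<^sup>2) \<partial>M) = ennreal (\<integral>x. 2^k * (norm (d k x))\<^sup>2 \<partial>M)"
      using i by (intro nn_integral_eq_integral) auto
    also have "(\<integral>x. 2^k * (norm (d k x))\<^sup>2 \<partial>M) = 2^k * (nrm2 M (d k))\<^sup>2" by (simp add: nrm2_power2)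
    also have "\<dots> \<le> 2^k * ((1/2)^k)\<^sup>2"
      using r[of k "r (Suc k)" "r k"] rm[of k]
      by (intro mult_left_mono power_mono) (auto simp: d_def[abs_def] nrm2_nonneg)
    also have "\<dots> = (1/2)^k" by (simp add: power2_eq_square power_divide field_simps)
    finally show ?thesis by (simp add: ennreal_leI)
  qed
  have "(\<integral>\<^sup>+x. (\<Sum>k. ennreal (2^k * (norm (d k x))\<^sup>2)) \<partial>M) = (\<Sum>k. \<integral>\<^sup>+x. ennreal (2^k * (norm (d k x))\<^sup>2) \<partial>M)"
    by (intro nn_integral_suminf) measurable
  also have "\<dots> \<le> (\<Sum>k. ennreal ((1/2)^k))" by (intro suminf_le dn) auto
  also have "\<dots> = ennreal (\<Sum>k. (1/2)^k)" by (intro suminf_ennreal2) auto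
  finally have "(\<integral>\<^sup>+x. (\<Sum>k. ennreal (2^k * (norm (d k x))\<^sup>2)) \<partial>M) \<noteq> \<infinity>"
    by (auto simp: top_unique)
  then have "AE x in M. (\<Sum>k. ennreal (2^k * (norm (d k x))\<^sup>2)) \<noteq> \<infinity>"
    by (intro nn_integral_noteq_infinite) measurable
  then have conv: "AE x in M. convergent (\<lambda>k. f (r k) x)"
  proof eventually_elim
    case (elim x)
    define C where "C = enn2real (\<Sum>k. ennreal (2^k * (norm (d k x))\<^sup>2))"
    have C: "ennreal C = (\<Sum>k. ennreal (2^k * (norm (d k x))\<^sup>2))"
      using elim by (simp add: C_def less_top)
    have dle: "norm (d k x) \<le> sqrt C * (sqrt (1/2))^k" for k
    proof -
      have "(\<Sum>k\<in>{k}. ennreal (2^k * (norm (d k x))\<^sup>2)) \<le> (\<Sum>k. ennreal (2^k * (norm (d k x))\<^sup>2))"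
        by (intro sum_le_suminf) auto
      then have "ennreal (2^k * (norm (d k x))\<^sup>2) \<le> ennreal C" using C by simp
      moreover have "0 \<le> C" by (simp add: C_def)
      ultimately have "2^k * (norm (d k x))\<^sup>2 \<le> C" by (simp add: ennreal_le_iff)
      then have "(norm (d k x))\<^sup>2 \<le> C * (1/2)^k" by (simp add: field_simps power_divide)
      then have "sqrt ((norm (d k x))\<^sup>2) \<le> sqrt (C * (1/2)^k)" by (rule real_sqrt_le_mono)
      then show ?thesis by (simp add: real_sqrt_mult real_sqrt_power)
    qed
    have "summable (\<lambda>k. sqrt C * (sqrt (1/2))^k)"
      by (intro summable_mult summable_geometric) auto
    then have "summable (\<lambda>k. d k x)" by (rule summable_comparison_test'[where N=0]) (rule dle)
    then have cs: "convergent (\<lambda>n. \<Sum>k<n. d k x)" by (simp add: summable_iff_convergent)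
    have "(\<Sum>k<n. d k x) = f (r n) x - f (r 0) x" for n
      by (induction n) (simp_all add: d_def)
    with cs have "convergent (\<lambda>n. f (r n) x - f (r 0) x)" by (simp only:)
    from convergent_add[OF this convergent_const[of "f (r 0) x"]] show ?case by simp
  qed
  define g where "g x = lim (\<lambda>k. f (r k) x)" for x
  have [measurable]: "g \<in> borel_measurable M" unfolding g_def by measurable
  have glim: "AE x in M. (\<lambda>k. f (r k) x) \<longlonglongrightarrow> g x"
    using conv by eventually_elim (simp add: g_def convergent_LIMSEQ_iff)
  \<comment> \<open>The first index \<open>n\<close> stays fixed and the limit is taken in the
    second one, along the subsequence; the bound holds for the full sequence in
    \<open>n\<close>.\<close>
  have Fatou: "(\<integral>\<^sup>+x. ennreal ((norm (f n x - g x))\<^sup>2) \<partial>M) \<le> ennreal (((1/2)^k)\<^sup>2)" if "r k \<le> n" for n k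
  proof -
    have "(\<integral>\<^sup>+x. ennreal ((norm (f n x - g x))\<^sup>2) \<partial>M)
        = (\<integral>\<^sup>+x. liminf (\<lambda>j. ennreal ((norm (f n x - f (r j) x))\<^sup>2)) \<partial>M)"
    proof (rule nn_integral_cong_AE)
      show "AE x in M. ennreal ((norm (f n x - g x))\<^sup>2) = liminf (\<lambda>j. ennreal ((norm (f n x - f (r j) x))\<^sup>2))"
        using glim
      proof eventually_elim
        case (elim x)
        have "(\<lambda>j. ennreal ((norm (f n x - f (r j) x))\<^sup>2)) \<longlonglongrightarrow> ennreal ((norm (f n x - g x))\<^sup>2)"
          by (intro tendsto_ennrealI tendsto_intros elim)
        from lim_imp_Liminf[OF sequentially_bot this] show ?case by (rule sym)
      qed
    qed
    also have "\<dots> \<le> liminf (\<lambda>j. \<integral>\<^sup>+x. ennreal ((norm (f n x - f (r j) x))\<^sup>2) \<partial>M)"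
      by (intro nn_integral_liminf) measurable
    also have "\<dots> \<le> liminf (\<lambda>j::nat. ennreal (((1/2)^k)\<^sup>2))"
    proof (rule Liminf_mono)
      show "\<forall>\<^sub>F j in sequentially. (\<integral>\<^sup>+x. ennreal ((norm (f n x - f (r j) x))\<^sup>2) \<partial>M) \<le> ennreal (((1/2)^k)\<^sup>2)"
        using eventually_ge_at_top[of k]
      proof eventually_elim
        case (elim j)
        have "r k \<le> r j" by (rule strict_mono_leD[OF rmono elim])
        have "(\<integral>\<^sup>+x. ennreal ((norm (f n x - f (r j) x))\<^sup>2) \<partial>M) = ennreal (\<integral>x. (norm (f n x - f (r j) x))\<^sup>2 \<partial>M)"
          by (intro nn_integral_eq_integral sqi_integrable[OF fd]) auto
        also have "(\<integral>x. (norm (f n x - f (r j) x))\<^sup>2 \<partial>M) \<le> ((1/2)^k)\<^sup>2"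
          unfolding nrm2_power2[symmetric]
          using r[OF that \<open>r k \<le> r j\<close>] by (intro power_mono) (auto simp: nrm2_nonneg)
        finally show ?case by (simp add: ennreal_leI)
      qed
    qed
    finally show ?thesis by (simp add: Liminf_const)
  qed
  have sd: "sqi M (\<lambda>x. f n x - g x)" and nd: "nrm2 M (\<lambda>x. f n x - g x) \<le> (1/2)^k" if "r k \<le> n" for n k
  proof -
    have i: "integrable M (\<lambda>x. (norm (f n x - g x))\<^sup>2)"
      by (rule integrableI_bounded) (use Fatou[OF that] in \<open>auto simp: le_less_trans[OF _ ennreal_less_top]\<close>)
    then show "sqi M (\<lambda>x. f n x - g x)" by (simp add: sqi_def)
    have "ennreal (\<integral>x. (norm (f n x - g x))\<^sup>2 \<partial>M) \<le> ennreal (((1/2)^k)\<^sup>2)"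
      using Fatou[OF that] nn_integral_eq_integral[OF i] by simp
    then have "(\<integral>x. (norm (f n x - g x))\<^sup>2 \<partial>M) \<le> ((1/2)^k)\<^sup>2" by (simp add: ennreal_le_iff)
    then have "sqrt (\<integral>x. (norm (f n x - g x))\<^sup>2 \<partial>M) \<le> sqrt (((1/2)^k)\<^sup>2)" by (rule real_sqrt_le_mono)
    then show "nrm2 M (\<lambda>x. f n x - g x) \<le> (1/2)^k" by (simp add: nrm2_def)
  qed
  show thesis
  proof
    have "sqi M (\<lambda>x. f (r 0) x - (f (r 0) x - g x))" by (intro sqi_diff f sd[of 0]) simp
    then show "sqi M g" by simp
    show "(\<lambda>n. nrm2 M (\<lambda>x. f n x - g x)) \<longlonglongrightarrow> 0"
    proof (rule LIMSEQ_I)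
      fix e :: real assume "0 < e"
      then obtain k where k: "(1/2)^k < e" using real_arch_pow_inv[of e "1/2"] by auto
      show "\<exists>N. \<forall>n\<ge>N. norm (nrm2 M (\<lambda>x. f n x - g x) - 0) < e"
        using nd[of k] k by (intro exI[of _ "r k"]) (auto simp: nrm2_nonneg intro: le_less_trans)
    qed
  qed
qed

instance ltwo :: (euclidean_space, euclidean_space) complete_space
proof
  fix X :: "nat \<Rightarrow> ('a, 'b) ltwo" assume X: "Cauchy X"
  define f where "f n = rep_ltwo (X n)" for n
  have f: "sqi lebesgue (f n)" "X n = abs_ltwo (f n)" for n
    by (simp_all add: f_def sqi_rep_ltwo abs_rep_ltwo)
  have d: "dist (X m) (X n) = nrm2 lebesgue (\<lambda>x. f m x - f n x)" for m n
    by (simp add: dist_norm f abs_ltwo_minus abs_ltwo_norm sqi_diff)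
  obtain g where g: "sqi lebesgue g" "(\<lambda>n. nrm2 lebesgue (\<lambda>x. f n x - g x)) \<longlonglongrightarrow> 0"
    using Cauchy_sqi_convergent[of lebesgue f] f(1) X unfolding Cauchy_def d by blast
  have "(\<lambda>n. dist (X n) (abs_ltwo g)) \<longlonglongrightarrow> 0"
    using g by (simp add: dist_norm f abs_ltwo_minus abs_ltwo_norm sqi_diff)
  then have "X \<longlonglongrightarrow> abs_ltwo g" by (rule iffD2[OF tendsto_dist_iff])
  then show "convergent X" by (auto simp: convergent_def)
qed

text \<open>Extension by zero from \<Omega>, an isometric copy of L2 over \<Omega> inside the
  whole-space type.\<close>

definition emb :: "'a::euclidean_space set \<Rightarrow> ('a \<Rightarrow> 'b::euclidean_space) \<Rightarrow> ('a, 'b) ltwo" where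
  "emb \<Omega> f = abs_ltwo (\<lambda>x. indicator \<Omega> x *\<^sub>R f x)"

context
  fixes \<Omega> :: "'a::euclidean_space set"
  assumes \<Omega>: "\<Omega> \<in> sets lebesgue"
begin

lemma sqi_lebesgue_on: "sqi (lebesgue_on \<Omega>) f \<longleftrightarrow> sqi lebesgue (\<lambda>x. indicator \<Omega> x *\<^sub>R f x)"
proof -
  have "(\<lambda>x. indicator \<Omega> x *\<^sub>R (norm (f x))\<^sup>2) = (\<lambda>x. (norm (indicator \<Omega> x *\<^sub>R f x))\<^sup>2)"
    by (auto simp: indicator_def)
  then show ?thesis unfolding sqi_def
    using \<Omega> by (simp add: borel_measurable_restrict_space_iff integrable_restrict_space)
qed

lemma emb_add: "sqi (lebesgue_on \<Omega>) f \<Longrightarrow> sqi (lebesgue_on \<Omega>) g \<Longrightarrow> emb \<Omega> f + emb \<Omega> g = emb \<Omega> (\<lambda>x. f x + g x)"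
  by (simp add: emb_def sqi_lebesgue_on abs_ltwo_plus scaleR_add_right)

lemma emb_diff: "sqi (lebesgue_on \<Omega>) f \<Longrightarrow> sqi (lebesgue_on \<Omega>) g \<Longrightarrow> emb \<Omega> f - emb \<Omega> g = emb \<Omega> (\<lambda>x. f x - g x)"
  by (simp add: emb_def sqi_lebesgue_on abs_ltwo_minus scaleR_diff_right)

lemma emb_scaleR: "sqi (lebesgue_on \<Omega>) f \<Longrightarrow> c *\<^sub>R emb \<Omega> f = emb \<Omega> (\<lambda>x. c *\<^sub>R f x)"
  by (simp add: emb_def sqi_lebesgue_on abs_ltwo_scaleR mult.commute)

lemma emb_inner:
  assumes "sqi (lebesgue_on \<Omega>) f" "sqi (lebesgue_on \<Omega>) g"
  shows "emb \<Omega> f \<bullet> emb \<Omega> g = (\<integral>x. f x \<bullet> g x \<partial>lebesgue_on \<Omega>)"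
proof -
  have "(\<lambda>x. (indicator \<Omega> x *\<^sub>R f x) \<bullet> (indicator \<Omega> x *\<^sub>R g x)) = (\<lambda>x. indicator \<Omega> x *\<^sub>R (f x \<bullet> g x))"
    by (auto simp: indicator_def)
  then show ?thesis
    using assms \<Omega> by (simp add: emb_def sqi_lebesgue_on abs_ltwo_inner integral_restrict_space)
qed

lemma emb_norm: "sqi (lebesgue_on \<Omega>) f \<Longrightarrow> norm (emb \<Omega> f) = nrm2 (lebesgue_on \<Omega>) f"
  by (simp add: norm_eq_sqrt_inner emb_inner nrm2_def)

lemma emb_cong_AE:
  assumes "sqi (lebesgue_on \<Omega>) f" "sqi (lebesgue_on \<Omega>) g" "AE x in lebesgue_on \<Omega>. f x = g x"
  shows "emb \<Omega> f = emb \<Omega> g"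
proof -
  have "AE x in lebesgue. x \<in> \<Omega> \<longrightarrow> f x = g x" using assms(3) \<Omega> by (simp add: AE_restrict_space_iff)
  then have "AE x in lebesgue. indicator \<Omega> x *\<^sub>R f x = indicator \<Omega> x *\<^sub>R g x"
    by eventually_elim (auto simp: indicator_def)
  then show ?thesis using assms by (simp add: emb_def sqi_lebesgue_on abs_ltwo_eq_iff)
qed

end

section \<open>Test functions\<close>

text \<open>Differentiating exp(-1/t) produces powers of 1/t; the index \<open>n\<close> makes the
  linear span of the family closed under differentiation.\<close>

definition flat :: "nat \<Rightarrow> real \<Rightarrow> real" where
  "flat n t = (if t > 0 then (1/t)^n * exp (- (1/t)) else 0)"

lemma flat_tendsto_zero: "(flat n \<longlongrightarrow> 0) (at 0)"
proof (rule filterlim_split_at)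
  show "(flat n \<longlongrightarrow> 0) (at_left 0)"
    by (rule tendsto_eventually) (auto simp: flat_def eventually_at_filter)
  have "((\<lambda>t. (inverse t)^n / exp (inverse t)) \<longlongrightarrow> 0) (at_right (0::real))"
    by (rule filterlim_compose[OF tendsto_power_div_exp_0 filterlim_inverse_at_top_right])
  then show "(flat n \<longlongrightarrow> 0) (at_right 0)"
    by (rule filterlim_mono_eventually)
      (auto simp: flat_def eventually_at_filter exp_minus inverse_eq_divide)
qed

lemma flat_has_real_derivative:
  "(flat n has_real_derivative flat (n + 2) t - real n * flat (n + 1) t) (at t)"
proof -
  consider "t > 0" | "t < 0" | "t = 0" by linarith
  then show ?thesis
  proof cases
    case 1
    have s: "((\<lambda>t. 1/t) has_real_derivative - ((1/t)\<^sup>2)) (at t)"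
      using 1 by (auto intro!: derivative_eq_intros simp: power2_eq_square)
    have "((\<lambda>t. (1/t)^n * exp (- (1/t))) has_real_derivative flat (n + 2) t - real n * flat (n + 1) t) (at t)"
      by (rule DERIV_cong[OF DERIV_mult[OF DERIV_power[OF s] DERIV_fun_exp[OF DERIV_minus[OF s]]]])
        (use 1 in \<open>cases n; simp add: flat_def power2_eq_square algebra_simps\<close>)
    then show ?thesis
      by (rule has_field_derivative_transform_within_open[where S="{0<..}"]) (use 1 in \<open>auto simp: flat_def\<close>)
  next
    case 2
    have "((\<lambda>t. 0) has_real_derivative flat (n + 2) t - real n * flat (n + 1) t) (at t)"
      using 2 by (simp add: flat_def)
    then show ?thesis
      by (rule has_field_derivative_transform_within_open[where S="{..<0}"]) (use 2 in \<open>auto simp: flat_def\<close>)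
  next
    case 3
    \<comment> \<open>At 0 the difference quotient of \<open>flat n\<close> is exactly
      \<open>flat (n + 1)\<close>, so differentiability there reduces to its limit.\<close>
    have "(\<lambda>h. (flat n (0 + h) - flat n 0) / h) = flat (n + 1)"
      by (auto simp: flat_def fun_eq_iff)
    then show ?thesis using flat_tendsto_zero[of "n + 1"] 3
      unfolding DERIV_def by (simp add: flat_def)
  qed
qed

lemma smooth_fun_differentiable: "smooth_fun f \<Longrightarrow> f differentiable (at x)"
  unfolding smooth_fun_def by blast

lemma smooth_fun_partial: "smooth_fun f \<Longrightarrow> b \<in> Basis \<Longrightarrow> smooth_fun (\<lambda>x. frechet_derivative f (at x) b)"
  unfolding smooth_fun_def by blast

text \<open>The closure of the smooth functions under these operations is stable under partial
  derivatives, hence it consists of smooth functions.\<close>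

inductive smooth_alg :: "('a::euclidean_space \<Rightarrow> real) \<Rightarrow> bool" where
  base: "smooth_fun f \<Longrightarrow> smooth_alg f"
| const: "smooth_alg (\<lambda>x. c)"
| flat: "smooth_alg (\<lambda>x. flat n (x \<bullet> v + c))"
| add: "smooth_alg f \<Longrightarrow> smooth_alg g \<Longrightarrow> smooth_alg (\<lambda>x. f x + g x)"
| mult: "smooth_alg f \<Longrightarrow> smooth_alg g \<Longrightarrow> smooth_alg (\<lambda>x. f x * g x)"

lemma smooth_alg_derivative:
  assumes "smooth_alg f"
  shows "(\<forall>x. f differentiable (at x)) \<and> (\<forall>b\<in>Basis. smooth_alg (\<lambda>x. frechet_derivative f (at x) b))"
  using assms
proof induction
  case (base f)
  then show ?case by (auto simp: smooth_fun_differentiable intro: smooth_alg.base smooth_fun_partial)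
next
  case (const c)
  then show ?case by (auto intro: smooth_alg.const)
next
  case (flat n v c)
  have d: "((\<lambda>x. flat n (x \<bullet> v + c)) has_derivative
      (\<lambda>h. (flat (n + 2) (x \<bullet> v + c) - real n * flat (n + 1) (x \<bullet> v + c)) * (h \<bullet> v))) (at x)" for x
  proof -
    have "((\<lambda>x. x \<bullet> v + c) has_derivative (\<lambda>h. h \<bullet> v)) (at x)" by (auto intro!: derivative_eq_intros)
    from has_derivative_compose[OF this flat_has_real_derivative[unfolded has_field_derivative_def]]
    show ?thesis by (simp add: mult.commute)
  qed
  have fd: "frechet_derivative (\<lambda>x. flat n (x \<bullet> v + c)) (at x) =
      (\<lambda>h. (flat (n + 2) (x \<bullet> v + c) - real n * flat (n + 1) (x \<bullet> v + c)) * (h \<bullet> v))" for x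
    using frechet_derivative_at[OF d] by simp
  have "smooth_alg (\<lambda>x. (flat (n + 2) (x \<bullet> v + c) + (- real n) * flat (n + 1) (x \<bullet> v + c)) * (b \<bullet> v))" for b
    by (intro smooth_alg.mult smooth_alg.add smooth_alg.flat smooth_alg.const)
  then show ?case unfolding fd using d by (auto simp: differentiable_def)
next
  case (add f g)
  then have d: "((\<lambda>x. f x + g x) has_derivative
      (\<lambda>h. frechet_derivative f (at x) h + frechet_derivative g (at x) h)) (at x)" for x
    by (intro has_derivative_add) (auto simp: frechet_derivative_works)
  have fd: "frechet_derivative (\<lambda>x. f x + g x) (at x) =
      (\<lambda>h. frechet_derivative f (at x) h + frechet_derivative g (at x) h)" for x
    using frechet_derivative_at[OF d] by simp
  show ?case unfolding fd using d add by (auto simp: differentiable_def intro: smooth_alg.add)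
next
  case (mult f g)
  then have d: "((\<lambda>x. f x * g x) has_derivative
      (\<lambda>h. f x * frechet_derivative g (at x) h + frechet_derivative f (at x) h * g x)) (at x)" for x
    by (intro has_derivative_mult) (auto simp: frechet_derivative_works)
  have fd: "frechet_derivative (\<lambda>x. f x * g x) (at x) =
      (\<lambda>h. f x * frechet_derivative g (at x) h + frechet_derivative f (at x) h * g x)" for x
    using frechet_derivative_at[OF d] by simp
  show ?case unfolding fd using d mult
    by (auto simp: differentiable_def intro!: smooth_alg.add smooth_alg.mult)
qed

lemma smooth_alg_imp_smooth_fun: "smooth_alg f \<Longrightarrow> smooth_fun f"
  unfolding smooth_fun_def using smooth_alg_derivative by (intro exI[of _ "Collect smooth_alg"]) auto

lemma smooth_fun_const: "smooth_fun (\<lambda>x. c)"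
  by (rule smooth_alg_imp_smooth_fun[OF smooth_alg.const])

lemma smooth_fun_add: "smooth_fun f \<Longrightarrow> smooth_fun g \<Longrightarrow> smooth_fun (\<lambda>x. f x + g x)"
  by (rule smooth_alg_imp_smooth_fun[OF smooth_alg.add[OF smooth_alg.base smooth_alg.base]])

lemma smooth_fun_mult: "smooth_fun f \<Longrightarrow> smooth_fun g \<Longrightarrow> smooth_fun (\<lambda>x. f x * g x)"
  by (rule smooth_alg_imp_smooth_fun[OF smooth_alg.mult[OF smooth_alg.base smooth_alg.base]])

lemma smooth_fun_power: "smooth_fun f \<Longrightarrow> smooth_fun (\<lambda>x. f x ^ n)"
  by (induction n) (auto intro: smooth_fun_const smooth_fun_mult)

lemma smooth_fun_sum:
  "finite I \<Longrightarrow> (\<And>i. i \<in> I \<Longrightarrow> smooth_fun (f i)) \<Longrightarrow> smooth_fun (\<lambda>x. \<Sum>i\<in>I. f i x)"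
  by (induction rule: finite_induct) (auto intro: smooth_fun_const smooth_fun_add)

lemma smooth_fun_prod:
  "finite I \<Longrightarrow> (\<And>i. i \<in> I \<Longrightarrow> smooth_fun (f i)) \<Longrightarrow> smooth_fun (\<lambda>x. \<Prod>i\<in>I. f i x)"
  by (induction rule: finite_induct) (auto intro: smooth_fun_const smooth_fun_mult)

lemma smooth_fun_flat: "smooth_fun (\<lambda>x. flat n (x \<bullet> v + c))"
  by (rule smooth_alg_imp_smooth_fun[OF smooth_alg.flat])

section \<open>Gradients of smooth functions and the algebra of test functions\<close>

definition grad :: "('a::euclidean_space \<Rightarrow> real) \<Rightarrow> 'a \<Rightarrow> 'a" where
  "grad f x = (\<Sum>b\<in>Basis. frechet_derivative f (at x) b *\<^sub>R b)"

lemma grad_inner_Basis: "b \<in> Basis \<Longrightarrow> grad f x \<bullet> b = frechet_derivative f (at x) b"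
  by (simp add: grad_def inner_sum_left inner_Basis sum.delta' if_distrib cong: if_cong)

lemma smooth_fun_has_derivative:
  assumes "smooth_fun f" shows "(f has_derivative (\<lambda>h. grad f x \<bullet> h)) (at x)"
proof -
  have d: "(f has_derivative frechet_derivative f (at x)) (at x)"
    using smooth_fun_differentiable[OF assms] by (simp add: frechet_derivative_works)
  then interpret linear "frechet_derivative f (at x)" using has_derivative_linear by blast
  have "frechet_derivative f (at x) h = grad f x \<bullet> h" for h
  proof -
    have "frechet_derivative f (at x) h = frechet_derivative f (at x) (\<Sum>b\<in>Basis. (h \<bullet> b) *\<^sub>R b)"
      by (simp add: euclidean_representation)
    also have "\<dots> = (\<Sum>b\<in>Basis. (h \<bullet> b) * frechet_derivative f (at x) b)" by (simp add: sum scale)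
    finally show ?thesis
      by (simp add: grad_def inner_sum_left) (simp add: inner_commute[of h] mult.commute)
  qed
  then have "frechet_derivative f (at x) = (\<lambda>h. grad f x \<bullet> h)" by auto
  with d show ?thesis by simp
qed

lemma grad_eqI:
  assumes "(f has_derivative (\<lambda>h. v \<bullet> h)) (at x)" shows "grad f x = v"
proof (rule euclidean_eqI)
  fix b :: 'a assume "b \<in> Basis"
  then show "grad f x \<bullet> b = v \<bullet> b"
    using fun_cong[OF frechet_derivative_at[OF assms], of b] by (simp add: grad_inner_Basis)
qed

lemma smooth_fun_continuous: "smooth_fun f \<Longrightarrow> continuous_on S f"
  by (meson continuous_at_imp_continuous_on differentiable_imp_continuous_within smooth_fun_differentiable)

lemma smooth_fun_continuous_grad: "smooth_fun f \<Longrightarrow> continuous_on S (grad f)"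
  unfolding grad_def[abs_def] by (intro continuous_intros smooth_fun_continuous smooth_fun_partial)

lemma grad_add: "smooth_fun f \<Longrightarrow> smooth_fun g \<Longrightarrow> grad (\<lambda>x. f x + g x) x = grad f x + grad g x"
  by (rule grad_eqI) (auto intro!: derivative_eq_intros smooth_fun_has_derivative simp: inner_add_left)

lemma grad_mult: "smooth_fun f \<Longrightarrow> smooth_fun g \<Longrightarrow> grad (\<lambda>x. f x * g x) x = f x *\<^sub>R grad g x + g x *\<^sub>R grad f x"
  by (rule grad_eqI) (auto intro!: derivative_eq_intros smooth_fun_has_derivative simp: inner_add_left)

lemma grad_cmult: "smooth_fun f \<Longrightarrow> grad (\<lambda>x. c * f x) x = c *\<^sub>R grad f x"
  by (rule grad_eqI) (auto intro!: derivative_eq_intros smooth_fun_has_derivative)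

lemma test_fun_smooth: "test_fun \<Omega> \<phi> \<Longrightarrow> smooth_fun \<phi>"
  by (simp add: test_fun_def)

lemma test_fun_zero: "test_fun \<Omega> (\<lambda>x. 0)"
  unfolding test_fun_def by (auto intro: smooth_fun_const exI[of _ "{}"])

lemma test_fun_add:
  assumes "test_fun \<Omega> \<phi>" "test_fun \<Omega> \<psi>" shows "test_fun \<Omega> (\<lambda>x. \<phi> x + \<psi> x)"
proof -
  obtain K L where "compact K" "K \<subseteq> \<Omega>" "\<And>x. x \<notin> K \<Longrightarrow> \<phi> x = 0"
    "compact L" "L \<subseteq> \<Omega>" "\<And>x. x \<notin> L \<Longrightarrow> \<psi> x = 0" using assms unfolding test_fun_def by metis
  then show ?thesis using assms unfolding test_fun_def
    by (auto intro!: smooth_fun_add exI[of _ "K \<union> L"])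
qed

lemma test_fun_mult:
  assumes "test_fun \<Omega> \<phi>" "smooth_fun \<psi>" shows "test_fun \<Omega> (\<lambda>x. \<phi> x * \<psi> x)"
proof -
  obtain K where "compact K" "K \<subseteq> \<Omega>" "\<And>x. x \<notin> K \<Longrightarrow> \<phi> x = 0"
    using assms unfolding test_fun_def by metis
  then have "\<exists>K. compact K \<and> K \<subseteq> \<Omega> \<and> (\<forall>x. x \<notin> K \<longrightarrow> \<phi> x * \<psi> x = 0)"
    by (intro exI[of _ K]) auto
  then show ?thesis unfolding test_fun_def
    using smooth_fun_mult[OF test_fun_smooth[OF assms(1)] assms(2)] by (intro conjI)
qed

lemma test_fun_cmult: "test_fun \<Omega> \<phi> \<Longrightarrow> test_fun \<Omega> (\<lambda>x. c * \<phi> x)"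
  using test_fun_mult[OF _ smooth_fun_const, of \<Omega> \<phi> c] by (simp add: mult.commute)

lemma test_fun_bounds:
  assumes "test_fun \<Omega> \<phi>"
  shows "\<exists>C r. 0 < C \<and> (\<forall>x. \<bar>\<phi> x\<bar> \<le> C) \<and> (\<forall>x. norm (grad \<phi> x) \<le> C)
    \<and> (\<forall>x. x \<notin> \<Omega> \<longrightarrow> \<phi> x = 0 \<and> grad \<phi> x = 0) \<and> (\<forall>x. r < norm x \<longrightarrow> \<phi> x = 0 \<and> grad \<phi> x = 0)"
proof -
  obtain K where K: "compact K" "K \<subseteq> \<Omega>" "\<And>x. x \<notin> K \<Longrightarrow> \<phi> x = 0" and s: "smooth_fun \<phi>"
    using assms unfolding test_fun_def by blast
  have g0: "grad \<phi> x = 0" if "x \<notin> K" for x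
  proof (rule grad_eqI)
    have "((\<lambda>x. 0) has_derivative (\<lambda>h. 0 \<bullet> h)) (at x)" by simp
    then show "(\<phi> has_derivative (\<lambda>h. 0 \<bullet> h)) (at x)"
      by (rule has_derivative_transform_within_open[where s="-K"])
        (use that K compact_imp_closed in auto)
  qed
  obtain r where r: "\<And>x. x \<in> K \<Longrightarrow> norm x \<le> r" using compact_imp_bounded[OF K(1)] bounded_iff by blast
  have "bounded (\<phi> ` K)" "bounded (grad \<phi> ` K)"
    using K(1) s by (auto intro!: compact_imp_bounded compact_continuous_image smooth_fun_continuous smooth_fun_continuous_grad)
  then obtain A B where AB: "\<And>x. x \<in> K \<Longrightarrow> \<bar>\<phi> x\<bar> \<le> A" "\<And>x. x \<in> K \<Longrightarrow> norm (grad \<phi> x) \<le> B"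
    unfolding bounded_iff by (metis imageI real_norm_def)
  show ?thesis
  proof (rule exI[of _ "\<bar>A\<bar> + \<bar>B\<bar> + 1"], rule exI[of _ r], intro conjI allI impI)
    fix x
    show "\<bar>\<phi> x\<bar> \<le> \<bar>A\<bar> + \<bar>B\<bar> + 1" using AB(1)[of x] K(3)[of x] by (cases "x \<in> K") auto
    show "norm (grad \<phi> x) \<le> \<bar>A\<bar> + \<bar>B\<bar> + 1" using AB(2)[of x] g0[of x] by (cases "x \<in> K") auto
    show "\<phi> x = 0" "grad \<phi> x = 0" if "x \<notin> \<Omega>" using that K g0 by blast+
    show "\<phi> x = 0" "grad \<phi> x = 0" if "r < norm x" using that K g0 r by (meson leD)+
  qed auto
qed

section \<open>Translations, difference quotients and integration by parts\<close>

lemma integrable_indicator_cball: "integrable lborel (\<lambda>x::'a::euclidean_space. C * indicator (cball 0 r) x :: real)"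
  using emeasure_lborel_cball_finite[of "0::'a" r]
  by (intro integrable_mult_right integrable_real_indicator) simp_all

lemma integrable_bounded_support_lborel:
  fixes f :: "'a::euclidean_space \<Rightarrow> 'b::euclidean_space"
  assumes "f \<in> borel_measurable borel" "\<And>x. norm (f x) \<le> C" "\<And>x. r < norm x \<Longrightarrow> f x = 0"
  shows "integrable lborel f"
proof (rule Bochner_Integration.integrable_bound)
  show "integrable lborel (\<lambda>x::'a. C * indicator (cball 0 r) x)"
    by (rule integrable_indicator_cball)
  have "0 \<le> C" using assms(2) norm_ge_zero order_trans by blast
  then show "AE x in lborel. norm (f x) \<le> norm (C * indicator (cball 0 r) x)"
    using assms(2,3) by (intro AE_I2) (auto simp: indicator_def not_le)
qed (use assms in auto)

lemma lborel_integral_translate: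
  fixes f :: "'a::euclidean_space \<Rightarrow> real"
  assumes "f \<in> borel_measurable borel"
  shows "(\<integral>x. f (x + c) \<partial>lborel) = (\<integral>x. f x \<partial>lborel)"
proof -
  have "(\<integral>x. f x \<partial>lborel) = (\<integral>x. f x \<partial>distr lborel borel ((+) c))" by (simp add: lborel_distr_plus)
  also have "\<dots> = (\<integral>x. f (c + x) \<partial>lborel)" using assms by (intro integral_distr) auto
  finally show ?thesis by (simp add: add.commute)
qed

text \<open>Steps 1/(n + 1) give a sequence to which dominated convergence applies. The majorant
  comes from the bound on the gradient and from the support, enlarged by
  \<open>norm h\<close>.\<close>

lemma test_fun_difference_quotient:
  assumes "test_fun \<Omega> \<phi>"
  shows "(\<lambda>n. (\<phi> (x + (1 / real (Suc n)) *\<^sub>R h) - \<phi> x) * real (Suc n)) \<longlonglongrightarrow> grad \<phi> x \<bullet> h"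
    and "\<exists>C r. \<forall>x n. \<bar>(\<phi> (x + (1 / real (Suc n)) *\<^sub>R h) - \<phi> x) * real (Suc n)\<bar> \<le> C * indicator (cball 0 r) x"
proof -
  note s = test_fun_smooth[OF assms]
  have "((\<lambda>t. x + t *\<^sub>R h) has_derivative (\<lambda>t. t *\<^sub>R h)) (at 0)"
    by (auto intro!: derivative_eq_intros)
  from has_derivative_compose[OF this, of \<phi> "\<lambda>v. grad \<phi> x \<bullet> v"]
  have "((\<lambda>t. \<phi> (x + t *\<^sub>R h)) has_derivative (\<lambda>t. t * (grad \<phi> x \<bullet> h))) (at 0)"
    using smooth_fun_has_derivative[OF s, of x] by simp
  moreover have "(\<lambda>t. t * (grad \<phi> x \<bullet> h)) = (*) (grad \<phi> x \<bullet> h)" by (auto simp: mult.commute)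
  ultimately have "((\<lambda>t. \<phi> (x + t *\<^sub>R h)) has_real_derivative (grad \<phi> x \<bullet> h)) (at 0)"
    by (simp only: has_field_derivative_def)
  then have "((\<lambda>t. (\<phi> (x + t *\<^sub>R h) - \<phi> x) / t) \<longlongrightarrow> grad \<phi> x \<bullet> h) (at 0)"
    by (simp add: DERIV_def)
  moreover have "filterlim (\<lambda>n. 1 / real (Suc n)) (at 0) sequentially"
    using LIMSEQ_inverse_real_of_nat by (auto simp: filterlim_at inverse_eq_divide)
  ultimately have "(\<lambda>n. (\<phi> (x + (1 / real (Suc n)) *\<^sub>R h) - \<phi> x) / (1 / real (Suc n))) \<longlonglongrightarrow> grad \<phi> x \<bullet> h"
    by (rule filterlim_compose)
  then show "(\<lambda>n. (\<phi> (x + (1 / real (Suc n)) *\<^sub>R h) - \<phi> x) * real (Suc n)) \<longlonglongrightarrow> grad \<phi> x \<bullet> h"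
    by simp
  obtain C r where C: "0 < C" "\<And>x. \<bar>\<phi> x\<bar> \<le> C" "\<And>x. norm (grad \<phi> x) \<le> C"
      "\<And>x. x \<notin> \<Omega> \<Longrightarrow> \<phi> x = 0 \<and> grad \<phi> x = 0" "\<And>x. r < norm x \<Longrightarrow> \<phi> x = 0 \<and> grad \<phi> x = 0"
    using test_fun_bounds[OF assms] by blast
  have "\<bar>(\<phi> (x + (1 / real (Suc n)) *\<^sub>R h) - \<phi> x) * real (Suc n)\<bar> \<le> (C * norm h) * indicator (cball 0 (r + norm h)) x" for x n
  proof (cases "x \<in> cball 0 (r + norm h)")
    case True
    have "norm (\<phi> (x + (1 / real (Suc n)) *\<^sub>R h) - \<phi> x) \<le> C * norm ((x + (1 / real (Suc n)) *\<^sub>R h) - x)"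
    proof (rule differentiable_bound[of UNIV \<phi> "\<lambda>x h. grad \<phi> x \<bullet> h"])
      show "onorm (\<lambda>h. grad \<phi> x \<bullet> h) \<le> C" for x
      proof (rule onorm_le)
        show "norm (grad \<phi> x \<bullet> h) \<le> C * norm h" for h
          using Cauchy_Schwarz_ineq2[of "grad \<phi> x" h] mult_right_mono[OF C(3)[of x], of "norm h"] by simp
      qed
    qed (auto intro: smooth_fun_has_derivative[OF s])
    then have "\<bar>\<phi> (x + (1 / real (Suc n)) *\<^sub>R h) - \<phi> x\<bar> * real (Suc n) \<le> C * norm h"
      by (simp add: field_simps)
    then show ?thesis using True by (simp add: abs_mult)
  next
    case False
    then have "r + norm h < norm x" by simp
    moreover have "norm ((1 / real (Suc n)) *\<^sub>R h) \<le> norm h" by (simp add: field_simps mult_le_cancel_left1)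
    moreover have "norm x \<le> norm (x + (1 / real (Suc n)) *\<^sub>R h) + norm ((1 / real (Suc n)) *\<^sub>R h)"
      using norm_triangle_ineq4[of "x + (1 / real (Suc n)) *\<^sub>R h" "(1 / real (Suc n)) *\<^sub>R h"] by simp
    ultimately have "r < norm x" "r < norm (x + (1 / real (Suc n)) *\<^sub>R h)"
      using norm_ge_zero[of h] by linarith+
    then show ?thesis using C(5) False by simp
  qed
  then show "\<exists>C r. \<forall>x n. \<bar>(\<phi> (x + (1 / real (Suc n)) *\<^sub>R h) - \<phi> x) * real (Suc n)\<bar> \<le> C * indicator (cball 0 r) x"
    by blast
qed

lemma smooth_fun_borel_measurable: "smooth_fun f \<Longrightarrow> f \<in> borel_measurable borel"
  by (rule borel_measurable_continuous_onI[OF smooth_fun_continuous])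

lemma smooth_fun_grad_borel_measurable: "smooth_fun f \<Longrightarrow> grad f \<in> borel_measurable borel"
  by (rule borel_measurable_continuous_onI[OF smooth_fun_continuous_grad])

lemma test_fun_integrable_lborel:
  assumes "test_fun \<Omega> \<phi>" shows "integrable lborel \<phi>"
proof -
  obtain C r where a: "0 < C" "\<And>x. \<bar>\<phi> x\<bar> \<le> C" "\<And>x. norm (grad \<phi> x) \<le> C"
      "\<And>x. x \<notin> \<Omega> \<Longrightarrow> \<phi> x = 0 \<and> grad \<phi> x = 0" "\<And>x. r < norm x \<Longrightarrow> \<phi> x = 0 \<and> grad \<phi> x = 0"
    using test_fun_bounds[OF assms] by blast
  show ?thesis
  proof (rule integrable_bounded_support_lborel[where C=C and r=r])
    show "\<phi> \<in> borel_measurable borel" by (rule smooth_fun_borel_measurable[OF test_fun_smooth[OF assms]])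
  qed (use a(2,5) in simp_all)
qed

text \<open>By translation invariance every difference quotient has integral zero, and dominated
  convergence passes this on to the derivative.\<close>

lemma integral_grad_test_fun:
  assumes "test_fun \<Omega> \<phi>"
  shows "(\<integral>x. grad \<phi> x \<bullet> h \<partial>lborel) = 0"
proof -
  have [measurable]: "\<phi> \<in> borel_measurable borel" "grad \<phi> \<in> borel_measurable borel"
    using test_fun_smooth[OF assms] by (rule smooth_fun_borel_measurable smooth_fun_grad_borel_measurable)+
  obtain C r where C: "\<And>x n. \<bar>(\<phi> (x + (1 / real (Suc n)) *\<^sub>R h) - \<phi> x) * real (Suc n)\<bar> \<le> C * indicator (cball 0 r) x"
    using test_fun_difference_quotient(2)[OF assms] by blast
  have "(\<lambda>n. \<integral>x. (\<phi> (x + (1 / real (Suc n)) *\<^sub>R h) - \<phi> x) * real (Suc n) \<partial>lborel) \<longlonglongrightarrow> (\<integral>x. grad \<phi> x \<bullet> h \<partial>lborel)"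
  proof (rule integral_dominated_convergence[where w="\<lambda>x. C * indicator (cball 0 r) x"])
    show "integrable lborel (\<lambda>x::'a. C * indicator (cball 0 r) x)"
      by (rule integrable_indicator_cball)
  qed (use C test_fun_difference_quotient(1)[OF assms] in auto)
  moreover have "(\<integral>x. (\<phi> (x + (1 / real (Suc n)) *\<^sub>R h) - \<phi> x) * real (Suc n) \<partial>lborel) = 0" for n
  proof -
    have i: "integrable lborel \<phi>" by (rule test_fun_integrable_lborel[OF assms])
    have "integrable (distr lborel borel ((+) ((1 / real (Suc n)) *\<^sub>R h))) \<phi>" using i by (simp add: lborel_distr_plus)
    then have "integrable lborel (\<lambda>x. \<phi> (x + (1 / real (Suc n)) *\<^sub>R h))"
      by (subst (asm) integrable_distr_eq) (auto simp: add.commute)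
    then show ?thesis using i by (simp add: lborel_integral_translate)
  qed
  ultimately show ?thesis by (simp add: LIMSEQ_const_iff)
qed

lemma test_fun_integration_by_parts:
  assumes "test_fun \<Omega> \<phi>" "test_fun \<Omega> \<psi>"
  shows "(\<integral>x. \<phi> x * (grad \<psi> x \<bullet> b) \<partial>lborel) = - (\<integral>x. (grad \<phi> x \<bullet> b) * \<psi> x \<partial>lborel)"
proof -
  note s = test_fun_smooth[OF assms(1)] test_fun_smooth[OF assms(2)]
  note [measurable] = smooth_fun_borel_measurable[OF s(1)] smooth_fun_borel_measurable[OF s(2)]
    smooth_fun_grad_borel_measurable[OF s(1)] smooth_fun_grad_borel_measurable[OF s(2)]
  obtain C r where C: "0 < C" "\<And>x. \<bar>\<phi> x\<bar> \<le> C" "\<And>x. norm (grad \<phi> x) \<le> C"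
      "\<And>x. x \<notin> \<Omega> \<Longrightarrow> \<phi> x = 0 \<and> grad \<phi> x = 0" "\<And>x. r < norm x \<Longrightarrow> \<phi> x = 0 \<and> grad \<phi> x = 0"
    using test_fun_bounds[OF assms(1)] by blast
  obtain D r' where D: "0 < D" "\<And>x. \<bar>\<psi> x\<bar> \<le> D" "\<And>x. norm (grad \<psi> x) \<le> D"
      "\<And>x. x \<notin> \<Omega> \<Longrightarrow> \<psi> x = 0 \<and> grad \<psi> x = 0" "\<And>x. r' < norm x \<Longrightarrow> \<psi> x = 0 \<and> grad \<psi> x = 0"
    using test_fun_bounds[OF assms(2)] by blast
  have g: "\<bar>v \<bullet> b\<bar> \<le> E * norm b" if "norm v \<le> E" for v E
    using Cauchy_Schwarz_ineq2[of v b] mult_right_mono[OF that, of "norm b"] by simp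
  have i: "integrable lborel (\<lambda>x. \<phi> x * (grad \<psi> x \<bullet> b))"
  proof (rule integrable_bounded_support_lborel[where C="C * (D * norm b)" and r=r])
    show "norm (\<phi> x * (grad \<psi> x \<bullet> b)) \<le> C * (D * norm b)" for x
      unfolding real_norm_def abs_mult using C(1) by (intro mult_mono C(2) g[OF D(3)]) auto
  qed (use C(5) in auto)
  have i2: "integrable lborel (\<lambda>x. (grad \<phi> x \<bullet> b) * \<psi> x)"
  proof (rule integrable_bounded_support_lborel[where C="(C * norm b) * D" and r=r])
    show "norm ((grad \<phi> x \<bullet> b) * \<psi> x) \<le> (C * norm b) * D" for x
      unfolding real_norm_def abs_mult using C(1) by (intro mult_mono D(2) g[OF C(3)]) auto
  qed (use C(5) in auto)
  have "(\<integral>x. grad (\<lambda>x. \<phi> x * \<psi> x) x \<bullet> b \<partial>lborel) = 0"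
    by (rule integral_grad_test_fun[OF test_fun_mult[OF assms(1) s(2)]])
  moreover have "grad (\<lambda>x. \<phi> x * \<psi> x) x \<bullet> b = \<phi> x * (grad \<psi> x \<bullet> b) + (grad \<phi> x \<bullet> b) * \<psi> x" for x
    by (simp add: grad_mult[OF s] inner_add_left)
  ultimately show ?thesis using i i2 by simp
qed


text \<open>Smooth approximations of the indicator of an open box, since exp(-1/(m t)) tends to 1
  for every t > 0. The arguments are spelled as \<open>x \<bullet> v + c\<close> to fit
  \<open>smooth_fun_flat\<close>; \<open>bump_eq\<close> is the readable form.\<close>

definition bump :: "'a::euclidean_space \<Rightarrow> 'a \<Rightarrow> nat \<Rightarrow> 'a \<Rightarrow> real" where
  "bump a b m x = (\<Prod>i\<in>Basis. flat 0 (x \<bullet> (real m *\<^sub>R i) + - (real m * (a \<bullet> i)))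
      * flat 0 (x \<bullet> (- real m *\<^sub>R i) + real m * (b \<bullet> i)))"

lemma bump_eq: "bump a b m x = (\<Prod>i\<in>Basis. flat 0 (real m * ((x - a) \<bullet> i)) * flat 0 (real m * ((b - x) \<bullet> i)))"
  by (simp add: bump_def inner_diff_left algebra_simps)

lemma flat_0_bounds: "0 \<le> flat 0 t" "flat 0 t \<le> 1"
  by (auto simp: flat_def)

lemma bump_outside: "x \<notin> box a b \<Longrightarrow> bump a b m x = 0"
proof -
  assume "x \<notin> box a b"
  then obtain i where i: "i \<in> Basis" "x \<bullet> i \<le> a \<bullet> i \<or> b \<bullet> i \<le> x \<bullet> i" by (auto simp: mem_box not_less)
  then have "real m * ((x - a) \<bullet> i) \<le> 0 \<or> real m * ((b - x) \<bullet> i) \<le> 0"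
    by (auto simp: inner_diff_left mult_nonneg_nonpos)
  then have "flat 0 (real m * ((x - a) \<bullet> i)) * flat 0 (real m * ((b - x) \<bullet> i)) = 0"
    by (auto simp: flat_def not_less)
  then show ?thesis unfolding bump_eq using i(1) by (meson finite_Basis prod_zero)
qed

lemma bump_bounds: "\<bar>bump a b m x\<bar> \<le> 1"
  unfolding bump_eq abs_prod
  by (intro prod_le_1) (auto simp: abs_mult flat_0_bounds mult_le_one)

lemma bump_tendsto: "(\<lambda>m. bump a b m x) \<longlonglongrightarrow> indicator (box a b) x"
proof (cases "x \<in> box a b")
  case True
  have "(\<lambda>m. flat 0 (real m * t)) \<longlonglongrightarrow> 1" if "0 < t" for t
  proof -
    have "(\<lambda>m. inverse t * inverse (real m)) \<longlonglongrightarrow> inverse t * 0"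
      by (intro tendsto_intros lim_inverse_n)
    then have "(\<lambda>m. exp (- (inverse t * inverse (real m)))) \<longlonglongrightarrow> exp (- 0)"
      by (intro tendsto_intros) simp
    moreover have "\<forall>\<^sub>F m in sequentially. exp (- (inverse t * inverse (real m))) = flat 0 (real m * t)"
      using eventually_gt_at_top[of "0::nat"] by eventually_elim (use that in \<open>auto simp: flat_def field_simps\<close>)
    ultimately show ?thesis by (simp add: tendsto_cong)
  qed
  then have "(\<lambda>m. bump a b m x) \<longlonglongrightarrow> (\<Prod>i\<in>(Basis::'a set). 1 * 1)"
    unfolding bump_eq by (intro tendsto_prod tendsto_mult) (use True in \<open>auto simp: mem_box inner_diff_left\<close>)
  then show ?thesis using True by simp
qed (simp add: bump_outside)

lemma test_fun_bump:
  assumes "cbox a b \<subseteq> \<Omega>" shows "test_fun \<Omega> (bump a b m)"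
proof -
  have "smooth_fun (bump a b m)"
    unfolding bump_def[abs_def] by (intro smooth_fun_prod smooth_fun_mult smooth_fun_flat) auto
  then show ?thesis unfolding test_fun_def using assms bump_outside[of _ a b m] box_subset_cbox[of a b]
    by (intro conjI exI[of _ "cbox a b"]) auto
qed

text \<open>Open boxes are stable under intersection and generate the Borel sets. The sets over
  which the integral vanishes are closed under complements, because the total integral is zero, and
  under countable disjoint unions.\<close>

lemma AE_zero_if_box_integrals_zero:
  fixes F :: "'a::euclidean_space \<Rightarrow> real"
  assumes F: "integrable lebesgue F" and F0: "(\<integral>x. F x \<partial>lebesgue) = 0"
    and box: "\<And>c d. (\<integral>x. indicator (box c d) x * F x \<partial>lebesgue) = 0"
  shows "AE x in lebesgue. F x = 0"
proof -
  \<comment> \<open>The generated \<sigma>-algebra is the Borel one, so \<open>F\<close> gives way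
    to a Borel function that equals it almost everywhere.\<close>
  obtain F' where F'm [measurable]: "F' \<in> borel_measurable lborel" and F'e: "AE x in lborel. F x = F' x"
    using completion_ex_borel_measurable_real[of F lborel] borel_measurable_integrable[OF F] by blast
  have e: "AE x in lebesgue. F x = F' x" using F'e by (simp add: AE_completion_iff)
  have F'l: "F' \<in> borel_measurable lebesgue" using F'm by (rule measurable_completion)
  have "integrable lebesgue F'" using F F'l e by (subst integrable_cong_AE[symmetric]) auto
  then have iF': "integrable lborel F'" by (simp add: integrable_completion)
  have tr: "(\<integral>x. indicator A x * F' x \<partial>lborel) = (\<integral>x. indicator A x * F x \<partial>lebesgue)" if [measurable]: "A \<in> sets borel" for A
  proof -
    have "(\<integral>x. indicator A x * F' x \<partial>lborel) = (\<integral>x. indicator A x * F' x \<partial>lebesgue)"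
      by (rule integral_completion[symmetric]) measurable
    also have "\<dots> = (\<integral>x. indicator A x * F x \<partial>lebesgue)"
    proof (rule integral_cong_AE)
      have "A \<in> sets lebesgue" using that by simp
      then show "(\<lambda>x. indicator A x * F' x) \<in> borel_measurable lebesgue"
          "(\<lambda>x. indicator A x * F x) \<in> borel_measurable lebesgue"
        using F'l borel_measurable_integrable[OF F] by (auto intro!: borel_measurable_times borel_measurable_indicator)
      show "AE x in lebesgue. indicator A x * F' x = indicator A x * F x" using e by eventually_elim simp
    qed
    finally show ?thesis .
  qed
  have all: "(\<integral>x. indicator A x * F' x \<partial>lborel) = 0" if "A \<in> sets borel" for A
  proof -
    let ?E = "range (\<lambda>(a, b). box a b::'a set)"
    have st: "Int_stable ?E" by (auto simp: Int_stable_def box_Int_box)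
    have sub: "?E \<subseteq> Pow UNIV" by simp
    have "A \<in> sigma_sets UNIV ?E" using that by (simp add: borel_eq_box)
    then show ?thesis
    proof (induction A rule: sigma_sets_induct_disjoint[OF st sub, consumes 1, case_names basic empty compl union])
      case (basic A)
      then obtain c d where A: "A = box c d" by auto
      show ?case using tr[of A] box[of c d] by (simp add: A)
    next
      case (compl A)
      then have A: "A \<in> sets borel" by (simp add: borel_eq_box)
      have "(\<integral>x. indicator (UNIV - A) x * F' x \<partial>lborel) = (\<integral>x. F' x - indicator A x * F' x \<partial>lborel)"
        by (intro Bochner_Integration.integral_cong) (auto simp: indicator_def)
      also have "\<dots> = (\<integral>x. F' x \<partial>lborel) - (\<integral>x. indicator A x * F' x \<partial>lborel)"
        using A iF' integrable_mult_indicator[of A lborel F'] by (intro Bochner_Integration.integral_diff) auto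
      also have "(\<integral>x. F' x \<partial>lborel) = 0" using tr[of UNIV] F0 by simp
      finally show ?case using compl by simp
    next
      case (union A)
      then have A: "A i \<in> sets lborel" for i by (auto simp: borel_eq_box)
      have "set_integrable lborel (\<Union>i. A i) F'"
        unfolding set_integrable_def using A by (intro integrable_mult_indicator iF') auto
      with A have "(LINT x:(\<Union>i. A i)|lborel. F' x) = (\<Sum>i. (LINT x:(A i)|lborel. F' x))"
        using union(1) by (intro lebesgue_integral_countable_add) (auto simp: disjoint_family_on_def)
      also have "\<dots> = 0" using union(3) by (simp add: set_lebesgue_integral_def)
      finally show ?case by (simp add: set_lebesgue_integral_def)
    qed auto
  qed
  have "AE x in lborel. F' x = 0"
    by (rule density_unique_real[OF iF']) (use all in \<open>auto simp: set_lebesgue_integral_def\<close>)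
  then have "AE x in lebesgue. F' x = 0" by (simp add: AE_completion_iff)
  with e show ?thesis by eventually_elim simp
qed

text \<open>Testing with \<open>bump\<close> and letting its index grow shows that the integrals
  over boxes vanish. As \<open>f\<close> is integrable only over compact subsets, the argument runs
  in each closed box of a countable cover of \<Omega>.\<close>

lemma fundamental_lemma_calculus_of_variations:
  fixes f :: "'a::euclidean_space \<Rightarrow> real"
  assumes \<Omega>: "open \<Omega>" and f: "\<And>K. compact K \<Longrightarrow> K \<subseteq> \<Omega> \<Longrightarrow> set_integrable lebesgue K f"
    and 0: "\<And>\<phi>. test_fun \<Omega> \<phi> \<Longrightarrow> (LINT x:\<Omega>|lebesgue. f x * \<phi> x) = 0"
  shows "AE x in lebesgue. x \<in> \<Omega> \<longrightarrow> f x = 0"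
proof -
  have bx: "integrable lebesgue (\<lambda>x. indicator (cbox a b) x * f x)"
    "integrable lebesgue (\<lambda>x. indicator (box a b) x * f x)"
    "(\<integral>x. indicator (box a b) x * f x \<partial>lebesgue) = 0" if ab: "cbox a b \<subseteq> \<Omega>" for a b
  proof -
    show i: "integrable lebesgue (\<lambda>x. indicator (cbox a b) x * f x)"
      using f[OF compact_cbox ab] by (simp add: set_integrable_def)
    have "integrable lebesgue (\<lambda>x. indicator (box a b) x *\<^sub>R (indicator (cbox a b) x * f x))"
      by (intro integrable_mult_indicator i) auto
    moreover have "(\<lambda>x. indicator (box a b) x *\<^sub>R (indicator (cbox a b) x * f x)) = (\<lambda>x. indicator (box a b) x * f x)"
      using box_subset_cbox[of a b] by (auto simp: indicator_def fun_eq_iff)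
    ultimately show i2: "integrable lebesgue (\<lambda>x. indicator (box a b) x * f x)" by simp
    have bm: "bump a b m \<in> borel_measurable lebesgue" for m
      using smooth_fun_borel_measurable[OF test_fun_smooth[OF test_fun_bump[OF ab]]]
      by (auto intro: measurable_completion)
    have "(\<lambda>m. \<integral>x. (indicator (cbox a b) x * f x) * bump a b m x \<partial>lebesgue) \<longlonglongrightarrow> (\<integral>x. indicator (box a b) x * f x \<partial>lebesgue)"
    proof (rule integral_dominated_convergence[where w="\<lambda>x. norm (indicator (cbox a b) x * f x)"])
      show "AE x in lebesgue. (\<lambda>m. indicator (cbox a b) x * f x * bump a b m x) \<longlonglongrightarrow> indicator (box a b) x * f x"
      proof (rule AE_I2)
        fix x
        have "(\<lambda>m. indicator (cbox a b) x * f x * bump a b m x) \<longlonglongrightarrow> indicator (cbox a b) x * f x * indicator (box a b) x"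
          by (intro tendsto_intros bump_tendsto)
        then show "(\<lambda>m. indicator (cbox a b) x * f x * bump a b m x) \<longlonglongrightarrow> indicator (box a b) x * f x"
          using box_subset_cbox[of a b] by (cases "x \<in> box a b") (auto simp: indicator_def)
      qed
      show "AE x in lebesgue. norm (indicator (cbox a b) x * f x * bump a b m x) \<le> norm (indicator (cbox a b) x * f x)" for m
        using bump_bounds[of a b m] by (intro AE_I2) (auto simp: abs_mult mult_left_le)
    qed (use i i2 bm borel_measurable_integrable in \<open>auto intro!: borel_measurable_times\<close>)
    moreover have "(\<integral>x. (indicator (cbox a b) x * f x) * bump a b m x \<partial>lebesgue) = 0" for m
    proof -
      have "(\<integral>x. (indicator (cbox a b) x * f x) * bump a b m x \<partial>lebesgue) = (LINT x:\<Omega>|lebesgue. f x * bump a b m x)"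
        unfolding set_lebesgue_integral_def
        using ab bump_outside[of _ a b m] box_subset_cbox[of a b]
        by (intro Bochner_Integration.integral_cong) (auto simp: indicator_def)
      then show ?thesis using 0[OF test_fun_bump[OF ab]] by simp
    qed
    ultimately show "(\<integral>x. indicator (box a b) x * f x \<partial>lebesgue) = 0" by (simp add: LIMSEQ_const_iff)
  qed
  have loc: "AE x in lebesgue. x \<in> cbox a b \<longrightarrow> f x = 0" if ab: "cbox a b \<subseteq> \<Omega>" for a b
  proof -
    have "AE x in lebesgue. indicator (box a b) x * f x = 0"
    proof (rule AE_zero_if_box_integrals_zero[OF bx(2)[OF ab] bx(3)[OF ab]])
      fix c d
      \<comment> \<open>Two boxes intersect in a box, whose closure stays in \<open>cbox a b\<close>
        if it is nonempty, so the vanishing just proved covers it.\<close>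
      obtain p q where pq: "box c d \<inter> box a b = box p q" by (auto simp: box_Int_box)
      have "(\<integral>x. indicator (box c d) x * (indicator (box a b) x * f x) \<partial>lebesgue) = (\<integral>x. indicator (box p q) x * f x \<partial>lebesgue)"
        unfolding pq[symmetric] by (intro Bochner_Integration.integral_cong) (auto simp: indicator_def)
      also have "\<dots> = 0"
      proof (cases "box p q = {}")
        case False
        have "box p q \<subseteq> cbox a b" using pq box_subset_cbox[of a b] by blast
        then have "cbox p q \<subseteq> cbox a b" using closure_box[OF False] closure_minimal closed_cbox by metis
        then show ?thesis using bx(3) ab by blast
      qed simp
      finally show "(\<integral>x. indicator (box c d) x * (indicator (box a b) x * f x) \<partial>lebesgue) = 0" .
    qed
    moreover have "AE x in lebesgue. x \<notin> cbox a b - box a b"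
      using negligible_frontier_interval[of a b] unfolding negligible_iff_null_sets by (rule AE_not_in)
    ultimately show ?thesis by eventually_elim (auto simp: indicator_def)
  qed
  obtain \<D> where D: "countable \<D>" "\<D> \<subseteq> Pow \<Omega>" "\<And>X. X \<in> \<D> \<Longrightarrow> \<exists>a b. X = cbox a b" "\<Union>\<D> = \<Omega>"
    using open_countable_Union_open_cbox[OF \<Omega>] by blast
  have "AE x in lebesgue. \<forall>X\<in>\<D>. x \<in> X \<longrightarrow> f x = 0"
    unfolding AE_ball_countable[OF D(1)] using D(2,3) loc by blast
  then show ?thesis by eventually_elim (use D(4) in blast)
qed

section \<open>The Sobolev space\<close>

lemma tendsto_zero_le:
  fixes a b :: "nat \<Rightarrow> real"
  assumes "\<And>n. 0 \<le> a n" "\<And>n. a n \<le> b n" "b \<longlonglongrightarrow> 0" shows "a \<longlonglongrightarrow> 0"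
  using assms by (intro tendsto_sandwich[OF _ _ tendsto_const assms(3)]) auto

lemma subspace_closure:
  fixes T :: "'a::real_normed_vector set"
  assumes "subspace T" shows "subspace (closure T)"
  unfolding subspace_def
proof (intro conjI ballI allI)
  show "0 \<in> closure T" using subspace_0[OF assms] closure_subset by blast
next
  fix x y assume "x \<in> closure T" "y \<in> closure T"
  then obtain a b where "\<forall>n. a n \<in> T" "a \<longlonglongrightarrow> x" "\<forall>n. b n \<in> T" "b \<longlonglongrightarrow> y"
    unfolding closure_sequential by blast
  then show "x + y \<in> closure T" unfolding closure_sequential
    using subspace_add[OF assms] by (intro exI[of _ "\<lambda>n. a n + b n"]) (auto intro: tendsto_add)
next
  fix c :: real and x assume "x \<in> closure T"
  then obtain a where "\<forall>n. a n \<in> T" "a \<longlonglongrightarrow> x" unfolding closure_sequential by blast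
  then show "c *\<^sub>R x \<in> closure T" unfolding closure_sequential
    using subspace_mul[OF assms] by (intro exI[of _ "\<lambda>n. c *\<^sub>R a n"]) (auto intro: tendsto_scaleR)
qed

lemma test_fun_support:
  assumes "test_fun \<Omega> \<phi>"
  shows "\<exists>K. compact K \<and> K \<subseteq> \<Omega> \<and> (\<forall>x. x \<notin> K \<longrightarrow> \<phi> x = 0 \<and> grad \<phi> x = 0)"
proof -
  obtain K where K: "compact K" "K \<subseteq> \<Omega>" "\<forall>x. x \<notin> K \<longrightarrow> \<phi> x = 0"
    using assms unfolding test_fun_def by blast
  have "grad \<phi> x = 0" if "x \<notin> K" for x
  proof (rule grad_eqI)
    have "((\<lambda>x. 0) has_derivative (\<lambda>h. 0 \<bullet> h)) (at x)" by simp
    then show "(\<phi> has_derivative (\<lambda>h. 0 \<bullet> h)) (at x)"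
      by (rule has_derivative_transform_within_open[where s="-K"])
        (use that K compact_imp_closed in auto)
  qed
  with K show ?thesis by blast
qed

locale bounded_domain =
  fixes \<Omega> :: "'a::euclidean_space set"
  assumes open_domain: "open \<Omega>" and bounded_domain: "bounded \<Omega>"
begin

abbreviation M\<Omega> :: "'a measure" where "M\<Omega> \<equiv> lebesgue_on \<Omega>"

lemma lmeasurable_domain: "\<Omega> \<in> lmeasurable"
  by (rule lmeasurable_open[OF bounded_domain open_domain])

lemma sets_domain: "\<Omega> \<in> sets lebesgue"
  using lmeasurable_domain by (rule fmeasurableD)

sublocale finite_measure M\<Omega>
  by (rule finite_measure_lebesgue_on[OF lmeasurable_domain])

lemma set_integral_domain:
  fixes f :: "'a \<Rightarrow> 'b::euclidean_space"
  shows "(LINT x:\<Omega>|lebesgue. f x) = (\<integral>x. f x \<partial>M\<Omega>)"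
  using sets_domain by (simp add: set_lebesgue_integral_def integral_restrict_space)

lemma set_integrable_domain:
  fixes f :: "'a \<Rightarrow> 'b::euclidean_space"
  shows "set_integrable lebesgue \<Omega> f \<longleftrightarrow> integrable M\<Omega> f"
  using sets_domain by (simp add: set_integrable_def integrable_restrict_space)

lemma set_borel_measurable_domain:
  fixes f :: "'a \<Rightarrow> 'b::euclidean_space"
  shows "set_borel_measurable lebesgue \<Omega> f \<longleftrightarrow> f \<in> borel_measurable M\<Omega>"
  using sets_domain by (simp add: set_borel_measurable_def borel_measurable_restrict_space_iff)

lemma AE_domain: "(AE x in M\<Omega>. P x) \<longleftrightarrow> (AE x in lebesgue. x \<in> \<Omega> \<longrightarrow> P x)"
  using sets_domain by (simp add: AE_restrict_space_iff)

lemma L2_on_domain: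
  fixes f :: "'a \<Rightarrow> 'b::euclidean_space"
  shows "L2_on \<Omega> f \<longleftrightarrow> sqi M\<Omega> f"
  by (simp add: L2_on_def sqi_def set_borel_measurable_domain set_integrable_domain)

lemma borel_measurable_domain_AE:
  fixes f g :: "'a \<Rightarrow> 'b::euclidean_space"
  assumes "f \<in> borel_measurable M\<Omega>" "AE x in M\<Omega>. f x = g x"
  shows "g \<in> borel_measurable M\<Omega>"
proof -
  have "(\<lambda>x. indicator \<Omega> x *\<^sub>R f x) \<in> borel_measurable lebesgue"
    using assms(1) sets_domain by (simp add: borel_measurable_restrict_space_iff)
  moreover have "AE x in lebesgue. x \<in> \<Omega> \<longrightarrow> f x = g x" using assms(2) by (simp only: AE_domain)
  then have "AE x in lebesgue. indicator \<Omega> x *\<^sub>R f x = indicator \<Omega> x *\<^sub>R g x"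
    by eventually_elim (auto simp: indicator_def)
  ultimately have "(\<lambda>x. indicator \<Omega> x *\<^sub>R g x) \<in> borel_measurable lebesgue"
    by (rule borel_measurable_AE)
  then show ?thesis using sets_domain by (simp add: borel_measurable_restrict_space_iff)
qed

lemma borel_imp_measurable_domain:
  fixes f :: "'a \<Rightarrow> 'b::euclidean_space"
  assumes "f \<in> borel_measurable borel" shows "f \<in> borel_measurable M\<Omega>"
  using assms by (intro measurable_restrict_space1 measurable_completion) simp

lemma sqi_bounded:
  fixes f :: "'a \<Rightarrow> 'b::euclidean_space"
  assumes "f \<in> borel_measurable M\<Omega>" "\<And>x. norm (f x) \<le> C" shows "sqi M\<Omega> f"
  by (rule sqi_dominated[OF sqi_const[of C] assms(1)])
    (use assms(2) in \<open>auto intro: order_trans[OF _ abs_ge_self]\<close>)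

lemma test_fun_sqi:
  assumes "test_fun \<Omega> \<phi>" shows "sqi M\<Omega> \<phi>" "sqi M\<Omega> (grad \<phi>)"
proof -
  obtain C where C: "\<And>x. \<bar>\<phi> x\<bar> \<le> C" "\<And>x. norm (grad \<phi> x) \<le> C"
    using test_fun_bounds[OF assms] by blast
  note s = test_fun_smooth[OF assms]
  show "sqi M\<Omega> \<phi>"
    by (rule sqi_bounded[OF borel_imp_measurable_domain[OF smooth_fun_borel_measurable[OF s]], of C]) (simp add: C(1))
  show "sqi M\<Omega> (grad \<phi>)"
    by (rule sqi_bounded[OF borel_imp_measurable_domain[OF smooth_fun_grad_borel_measurable[OF s]] C(2)])
qed

lemma integral_domain_lborel:
  fixes f :: "'a \<Rightarrow> 'b::euclidean_space"
  assumes "f \<in> borel_measurable borel" "\<And>x. x \<notin> \<Omega> \<Longrightarrow> f x = 0"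
  shows "(\<integral>x. f x \<partial>M\<Omega>) = (\<integral>x. f x \<partial>lborel)"
proof -
  have "(\<integral>x. f x \<partial>M\<Omega>) = (\<integral>x. indicator \<Omega> x *\<^sub>R f x \<partial>lebesgue)"
    using sets_domain by (simp add: integral_restrict_space)
  also have "(\<lambda>x. indicator \<Omega> x *\<^sub>R f x) = f" using assms(2) by (auto simp: indicator_def)
  also have "(\<integral>x. f x \<partial>lebesgue) = (\<integral>x. f x \<partial>lborel)" using assms(1) by (intro integral_completion) simp
  finally show ?thesis .
qed

text \<open>The norm of a pair (function, gradient) is the Sobolev norm, so the closure of this
  subspace is a Hilbert space copy of the Sobolev space with zero boundary values.\<close>

definition test_graph :: "('a, real \<times> 'a) ltwo set" where
  "test_graph = (\<lambda>\<phi>. emb \<Omega> (\<lambda>x. (\<phi> x, grad \<phi> x))) ` Collect (test_fun \<Omega>)"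

text \<open>\<open>H10 u g\<close>: the function \<open>u\<close> belongs to the closure of the test functions in the Sobolev norm,
  and \<open>g\<close> is its weak gradient.\<close>

definition H10 :: "('a \<Rightarrow> real) \<Rightarrow> ('a \<Rightarrow> 'a) \<Rightarrow> bool" where
  "H10 u g \<longleftrightarrow> sqi M\<Omega> u \<and> sqi M\<Omega> g \<and> emb \<Omega> (\<lambda>x. (u x, g x)) \<in> closure test_graph"

lemma H10_sqi: assumes "H10 u g" shows "sqi M\<Omega> u" "sqi M\<Omega> g" "sqi M\<Omega> (\<lambda>x. (u x, g x))"
  using assms by (auto simp: H10_def sqi_fst_snd)

lemma subspace_test_graph: "subspace test_graph"
  unfolding subspace_def
proof (intro conjI ballI allI)
  have z: "0 = emb \<Omega> (\<lambda>x. 0::real \<times> 'a)"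
    using emb_scaleR[OF sets_domain sqi_zero, of 0] by simp
  have "grad (\<lambda>x::'a. 0) = (\<lambda>x. 0)" by (rule ext, rule grad_eqI) simp
  then have "emb \<Omega> (\<lambda>x. (0::real, grad (\<lambda>x. 0) x)) = 0" unfolding z by (simp add: zero_prod_def)
  then show "0 \<in> test_graph" using test_fun_zero[of \<Omega>] unfolding test_graph_def
    by (intro image_eqI[of _ _ "\<lambda>x. 0"]) auto
next
  fix x y assume "x \<in> test_graph" "y \<in> test_graph"
  then obtain \<phi> \<psi> where t: "test_fun \<Omega> \<phi>" "test_fun \<Omega> \<psi>" and xy: "x = emb \<Omega> (\<lambda>x. (\<phi> x, grad \<phi> x))" "y = emb \<Omega> (\<lambda>x. (\<psi> x, grad \<psi> x))"
    unfolding test_graph_def by blast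
  have "x + y = emb \<Omega> (\<lambda>x. (\<phi> x, grad \<phi> x) + (\<psi> x, grad \<psi> x))" unfolding xy
    using test_fun_sqi[OF t(1)] test_fun_sqi[OF t(2)] by (intro emb_add[OF sets_domain]) (simp_all add: sqi_fst_snd)
  also have "\<dots> = emb \<Omega> (\<lambda>x. (\<phi> x + \<psi> x, grad (\<lambda>x. \<phi> x + \<psi> x) x))"
    by (simp add: grad_add[OF test_fun_smooth[OF t(1)] test_fun_smooth[OF t(2)]])
  finally show "x + y \<in> test_graph" using test_fun_add[OF t] unfolding test_graph_def
    by (intro image_eqI[of _ _ "\<lambda>x. \<phi> x + \<psi> x"]) auto
next
  fix c :: real and x assume "x \<in> test_graph"
  then obtain \<phi> where t: "test_fun \<Omega> \<phi>" and x: "x = emb \<Omega> (\<lambda>x. (\<phi> x, grad \<phi> x))"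
    unfolding test_graph_def by blast
  have "c *\<^sub>R x = emb \<Omega> (\<lambda>x. c *\<^sub>R (\<phi> x, grad \<phi> x))" unfolding x
    using test_fun_sqi[OF t] by (intro emb_scaleR[OF sets_domain]) (simp_all add: sqi_fst_snd)
  also have "\<dots> = emb \<Omega> (\<lambda>x. (c * \<phi> x, grad (\<lambda>x. c * \<phi> x) x))"
    by (simp add: grad_cmult[OF test_fun_smooth[OF t]])
  finally show "c *\<^sub>R x \<in> test_graph" using test_fun_cmult[OF t] unfolding test_graph_def
    by (intro image_eqI[of _ _ "\<lambda>x. c * \<phi> x"]) auto
qed

lemma subspace_closure_test_graph: "subspace (closure test_graph)"
  by (rule subspace_closure[OF subspace_test_graph])

lemma H10_test: "test_fun \<Omega> \<phi> \<Longrightarrow> H10 \<phi> (grad \<phi>)"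
  unfolding H10_def using test_fun_sqi closure_subset[of test_graph] by (auto simp: test_graph_def)

lemma H10_add:
  assumes "H10 u g" "H10 v h" shows "H10 (\<lambda>x. u x + v x) (\<lambda>x. g x + h x)"
proof -
  note s = H10_sqi[OF assms(1)] H10_sqi[OF assms(2)]
  have "emb \<Omega> (\<lambda>x. (u x, g x)) + emb \<Omega> (\<lambda>x. (v x, h x)) \<in> closure test_graph"
    using assms by (intro subspace_add[OF subspace_closure_test_graph]) (auto simp: H10_def)
  then show ?thesis unfolding H10_def using s by (auto simp: emb_add[OF sets_domain] sqi_add)
qed

lemma H10_scale:
  assumes "H10 u g" shows "H10 (\<lambda>x. c * u x) (\<lambda>x. c *\<^sub>R g x)"
proof -
  note s = H10_sqi[OF assms(1)]
  have "c *\<^sub>R emb \<Omega> (\<lambda>x. (u x, g x)) \<in> closure test_graph"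
    using assms by (intro subspace_mul[OF subspace_closure_test_graph]) (auto simp: H10_def)
  then show ?thesis unfolding H10_def using s sqi_scaleR[OF s(1), of c] by (auto simp: emb_scaleR[OF sets_domain] sqi_scaleR)
qed

lemma H10_diff: "H10 u g \<Longrightarrow> H10 v h \<Longrightarrow> H10 (\<lambda>x. u x - v x) (\<lambda>x. g x - h x)"
  using H10_add[of u g "\<lambda>x. -1 * v x" "\<lambda>x. -1 *\<^sub>R h x"] H10_scale[of v h "-1"] by simp

lemma H10_cong_AE:
  assumes "H10 u g" "AE x in M\<Omega>. u x = v x" "AE x in M\<Omega>. g x = h x"
  shows "H10 v h"
proof -
  note s = H10_sqi[OF assms(1)]
  have "sqi M\<Omega> v"
    by (rule sqi_dominated[OF s(1) borel_measurable_domain_AE[OF sqi_measurable[OF s(1)] assms(2)]])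
      (use assms(2) in \<open>eventually_elim, simp\<close>)
  moreover have "sqi M\<Omega> h"
    by (rule sqi_dominated[OF s(2) borel_measurable_domain_AE[OF sqi_measurable[OF s(2)] assms(3)]])
      (use assms(3) in \<open>eventually_elim, simp\<close>)
  moreover have "emb \<Omega> (\<lambda>x. (u x, g x)) = emb \<Omega> (\<lambda>x. (v x, h x))"
  proof (rule emb_cong_AE[OF sets_domain s(3)])
    show "AE x in M\<Omega>. (u x, g x) = (v x, h x)" using assms(2,3) by eventually_elim simp
  qed (use calculation in \<open>simp add: sqi_fst_snd\<close>)
  ultimately show ?thesis using assms(1) by (simp add: H10_def)
qed

lemma nrm2_components:
  fixes u :: "'a \<Rightarrow> real" and g :: "'a \<Rightarrow> 'a"
  assumes "sqi M\<Omega> u" "sqi M\<Omega> g"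
  shows "nrm2 M\<Omega> u \<le> nrm2 M\<Omega> (\<lambda>x. (u x, g x))" "nrm2 M\<Omega> g \<le> nrm2 M\<Omega> (\<lambda>x. (u x, g x))"
    "nrm2 M\<Omega> (\<lambda>x. (u x, g x)) \<le> nrm2 M\<Omega> u + nrm2 M\<Omega> g"
proof -
  note p = nrm2_Pair[OF assms]
  show "nrm2 M\<Omega> u \<le> nrm2 M\<Omega> (\<lambda>x. (u x, g x))"
    by (rule power2_le_imp_le) (simp_all add: p nrm2_nonneg)
  show "nrm2 M\<Omega> g \<le> nrm2 M\<Omega> (\<lambda>x. (u x, g x))"
    by (rule power2_le_imp_le) (simp_all add: p nrm2_nonneg)
  show "nrm2 M\<Omega> (\<lambda>x. (u x, g x)) \<le> nrm2 M\<Omega> u + nrm2 M\<Omega> g"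
    by (rule power2_le_imp_le) (simp_all add: p nrm2_nonneg power2_sum)
qed

lemma dist_emb_pair:
  fixes u v :: "'a \<Rightarrow> real" and g h :: "'a \<Rightarrow> 'a"
  assumes "sqi M\<Omega> u" "sqi M\<Omega> g" "sqi M\<Omega> v" "sqi M\<Omega> h"
  shows "dist (emb \<Omega> (\<lambda>x. (u x, g x))) (emb \<Omega> (\<lambda>x. (v x, h x))) = nrm2 M\<Omega> (\<lambda>x. (u x - v x, g x - h x))"
  using assms by (simp add: dist_norm emb_diff[OF sets_domain] emb_norm[OF sets_domain] sqi_fst_snd sqi_diff)

lemma emb_pair_tendsto_iff:
  fixes v :: "'a \<Rightarrow> real" and h :: "'a \<Rightarrow> 'a"
  assumes s: "\<And>n. sqi M\<Omega> (u n)" "\<And>n. sqi M\<Omega> (g n)" "sqi M\<Omega> v" "sqi M\<Omega> h"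
  shows "(\<lambda>n. emb \<Omega> (\<lambda>x. (u n x, g n x))) \<longlonglongrightarrow> emb \<Omega> (\<lambda>x. (v x, h x)) \<longleftrightarrow>
    (\<lambda>n. nrm2 M\<Omega> (\<lambda>x. u n x - v x)) \<longlonglongrightarrow> 0 \<and> (\<lambda>n. nrm2 M\<Omega> (\<lambda>x. g n x - h x)) \<longlonglongrightarrow> 0"
proof -
  let ?p = "\<lambda>n. nrm2 M\<Omega> (\<lambda>x. (u n x - v x, g n x - h x))"
  let ?u = "\<lambda>n. nrm2 M\<Omega> (\<lambda>x. u n x - v x)" and ?g = "\<lambda>n. nrm2 M\<Omega> (\<lambda>x. g n x - h x)"
  have c: "?u n \<le> ?p n" "?g n \<le> ?p n" "?p n \<le> ?u n + ?g n" for n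
    using nrm2_components[OF sqi_diff[OF s(1)[of n] s(3)] sqi_diff[OF s(2)[of n] s(4)]] by auto
  have "(\<lambda>n. emb \<Omega> (\<lambda>x. (u n x, g n x))) \<longlonglongrightarrow> emb \<Omega> (\<lambda>x. (v x, h x)) \<longleftrightarrow> ?p \<longlonglongrightarrow> 0"
    unfolding tendsto_dist_iff[of "\<lambda>n. emb \<Omega> (\<lambda>x. (u n x, g n x))"] by (simp only: dist_emb_pair[OF s(1,2,3,4)])
  also have "\<dots> \<longleftrightarrow> ?u \<longlonglongrightarrow> 0 \<and> ?g \<longlonglongrightarrow> 0"
  proof
    assume p: "?p \<longlonglongrightarrow> 0"
    show "?u \<longlonglongrightarrow> 0 \<and> ?g \<longlonglongrightarrow> 0"
      by (intro conjI tendsto_zero_le[OF nrm2_nonneg c(1) p] tendsto_zero_le[OF nrm2_nonneg c(2) p])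
  next
    assume "?u \<longlonglongrightarrow> 0 \<and> ?g \<longlonglongrightarrow> 0"
    then have "(\<lambda>n. ?u n + ?g n) \<longlonglongrightarrow> 0 + 0" by (intro tendsto_add) auto
    then show "?p \<longlonglongrightarrow> 0"
      by (intro tendsto_zero_le[of ?p "\<lambda>n. ?u n + ?g n"] nrm2_nonneg c(3)) simp
  qed
  finally show ?thesis .
qed

lemma H10_limit:
  assumes "\<And>n. H10 (u n) (g n)" "sqi M\<Omega> v" "sqi M\<Omega> h"
    "(\<lambda>n. nrm2 M\<Omega> (\<lambda>x. u n x - v x)) \<longlonglongrightarrow> 0" "(\<lambda>n. nrm2 M\<Omega> (\<lambda>x. g n x - h x)) \<longlonglongrightarrow> 0"
  shows "H10 v h"
proof -
  have "(\<lambda>n. emb \<Omega> (\<lambda>x. (u n x, g n x))) \<longlonglongrightarrow> emb \<Omega> (\<lambda>x. (v x, h x))"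
    using assms by (subst emb_pair_tendsto_iff) (auto simp: H10_def)
  then have "emb \<Omega> (\<lambda>x. (v x, h x)) \<in> closure test_graph"
    using closed_sequentially[OF closed_closure, of "\<lambda>n. emb \<Omega> (\<lambda>x. (u n x, g n x))"] assms(1) by (auto simp: H10_def)
  then show ?thesis using assms by (simp add: H10_def)
qed

lemma H10_dominated_limit:
  assumes H: "\<And>n. H10 (u n) (g n)" and v: "v \<in> borel_measurable M\<Omega>" "h \<in> borel_measurable M\<Omega>"
    and A: "sqi M\<Omega> (A::'a \<Rightarrow> 'b::euclidean_space)" "\<And>n. AE x in M\<Omega>. norm (u n x) \<le> norm (A x)" "AE x in M\<Omega>. (\<lambda>n. u n x) \<longlonglongrightarrow> v x"
    and B: "sqi M\<Omega> (B::'a \<Rightarrow> 'c::euclidean_space)" "\<And>n. AE x in M\<Omega>. norm (g n x) \<le> norm (B x)" "AE x in M\<Omega>. (\<lambda>n. g n x) \<longlonglongrightarrow> h x"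
  shows "H10 v h"
proof -
  have A': "sqi M\<Omega> (\<lambda>x. norm (A x))" by (rule sqi_dominated[OF A(1)]) (use sqi_measurable[OF A(1)] in auto)
  \<comment> \<open>\<open>norm (B x)\<close> times a unit vector is a majorant of the same norm
    with values in the space of gradients.\<close>
  have B': "sqi M\<Omega> (\<lambda>x. norm (B x) *\<^sub>R (SOME b::'a. b \<in> Basis))"
    by (rule sqi_dominated[OF B(1)]) (use sqi_measurable[OF B(1)] in \<open>auto simp: some_in_eq\<close>)
  have m: "u n \<in> borel_measurable M\<Omega>" "g n \<in> borel_measurable M\<Omega>" for n using H10_sqi[OF H[of n]] sqi_measurable by auto
  have 1: "sqi M\<Omega> v" "(\<lambda>n. nrm2 M\<Omega> (\<lambda>x. u n x - v x)) \<longlonglongrightarrow> 0"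
    by (rule nrm2_dominated_convergence[OF A' m(1) v(1)]; use A in simp)+
  have nb: "norm (norm (B x) *\<^sub>R (SOME b::'a. b \<in> Basis)) = norm (B x)" for x
    by (simp add: some_in_eq)
  have 2: "sqi M\<Omega> h" "(\<lambda>n. nrm2 M\<Omega> (\<lambda>x. g n x - h x)) \<longlonglongrightarrow> 0"
    by (rule nrm2_dominated_convergence[OF B' m(2) v(2)]; use B nb in simp)+
  show ?thesis by (rule H10_limit[OF H 1(1) 2(1) 1(2) 2(2)])
qed

lemma H10_approx:
  assumes "H10 u g"
  shows "\<exists>\<phi>. (\<forall>k. test_fun \<Omega> (\<phi> k)) \<and> (\<lambda>k. nrm2 M\<Omega> (\<lambda>x. \<phi> k x - u x)) \<longlonglongrightarrow> 0
    \<and> (\<lambda>k. nrm2 M\<Omega> (\<lambda>x. grad (\<phi> k) x - g x)) \<longlonglongrightarrow> 0"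
proof -
  obtain z where z: "\<forall>n. z n \<in> test_graph" "z \<longlonglongrightarrow> emb \<Omega> (\<lambda>x. (u x, g x))"
    using assms unfolding H10_def closure_sequential by blast
  have "\<forall>n. \<exists>\<phi>. test_fun \<Omega> \<phi> \<and> z n = emb \<Omega> (\<lambda>x. (\<phi> x, grad \<phi> x))" using z(1) by (auto simp: test_graph_def)
  then obtain \<phi> where \<phi>: "\<And>n. test_fun \<Omega> (\<phi> n)" "\<And>n. z n = emb \<Omega> (\<lambda>x. (\<phi> n x, grad (\<phi> n) x))" by metis
  have "(\<lambda>n. emb \<Omega> (\<lambda>x. (\<phi> n x, grad (\<phi> n) x))) \<longlonglongrightarrow> emb \<Omega> (\<lambda>x. (u x, g x))"
    using z(2) by (simp add: \<phi>(2)[abs_def])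
  then show ?thesis
    by (subst (asm) emb_pair_tendsto_iff) (use \<phi>(1) test_fun_sqi H10_sqi[OF assms] in auto)
qed

section \<open>Weak gradients, and comparison of the closure of the test functions with
  \<open>H01\<close>\<close>

lemma set_integrable_times_compact_support:
  fixes f q :: "'a \<Rightarrow> real"
  assumes f: "set_integrable lebesgue K f" and K: "K \<subseteq> \<Omega>"
    and q: "q \<in> borel_measurable borel" "\<And>x. \<bar>q x\<bar> \<le> C" "\<And>x. x \<notin> K \<Longrightarrow> q x = 0"
  shows "integrable M\<Omega> (\<lambda>x. f x * q x)"
proof -
  have qm: "q \<in> borel_measurable lebesgue" using q(1) by (intro measurable_completion) simp
  have fi: "integrable lebesgue (\<lambda>x. indicator K x * f x)" using f by (simp add: set_integrable_def)
  have "integrable lebesgue (\<lambda>x. (indicator K x * f x) * q x)"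
  proof (rule Bochner_Integration.integrable_bound[OF integrable_mult_right[OF fi, of C]])
    show "AE x in lebesgue. norm (indicator K x * f x * q x) \<le> norm (C * (indicator K x * f x))"
    proof (rule AE_I2)
      fix x
      have "\<bar>q x\<bar> * \<bar>indicator K x * f x\<bar> \<le> \<bar>C\<bar> * \<bar>indicator K x * f x\<bar>"
        using q(2)[of x] by (intro mult_right_mono) auto
      then show "norm (indicator K x * f x * q x) \<le> norm (C * (indicator K x * f x))"
        by (simp add: abs_mult mult_ac)
    qed
  qed (use fi qm in \<open>auto intro: borel_measurable_times\<close>)
  moreover have "(\<lambda>x. (indicator K x * f x) * q x) = (\<lambda>x. indicator \<Omega> x *\<^sub>R (f x * q x))"
    using K q(3) by (auto simp: indicator_def fun_eq_iff)
  ultimately show ?thesis using sets_domain by (simp add: integrable_restrict_space)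
qed

lemma is_weak_grad_integrable:
  assumes wg: "is_weak_grad \<Omega> u g" and t: "test_fun \<Omega> \<phi>" and b: "b \<in> Basis"
  shows "integrable M\<Omega> (\<lambda>x. u x * frechet_derivative \<phi> (at x) b)" "integrable M\<Omega> (\<lambda>x. (g x \<bullet> b) * \<phi> x)"
proof -
  obtain K where K: "compact K" "K \<subseteq> \<Omega>" "\<And>x. x \<notin> K \<Longrightarrow> \<phi> x = 0 \<and> grad \<phi> x = 0"
    using test_fun_support[OF t] by blast
  obtain C where C: "\<And>x. \<bar>\<phi> x\<bar> \<le> C" "\<And>x. norm (grad \<phi> x) \<le> C" using test_fun_bounds[OF t] by blast
  note s = test_fun_smooth[OF t]
  have u: "set_integrable lebesgue K u" and g: "set_integrable lebesgue K g"
    using wg K unfolding is_weak_grad_def by auto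
  have gb: "set_integrable lebesgue K (\<lambda>x. g x \<bullet> b)"
    using integrable_inner_left[of b lebesgue "\<lambda>x. indicator K x *\<^sub>R g x"] g by (simp add: set_integrable_def)
  show "integrable M\<Omega> (\<lambda>x. u x * frechet_derivative \<phi> (at x) b)"
  proof (rule set_integrable_times_compact_support[OF u K(2), of _ C])
    show "(\<lambda>x. frechet_derivative \<phi> (at x) b) \<in> borel_measurable borel"
      by (rule smooth_fun_borel_measurable[OF smooth_fun_partial[OF s b]])
    fix x
    show "\<bar>frechet_derivative \<phi> (at x) b\<bar> \<le> C"
      unfolding grad_inner_Basis[OF b, symmetric] using Basis_le_norm[OF b, of "grad \<phi> x"] C(2)[of x] by linarith
    show "x \<notin> K \<Longrightarrow> frechet_derivative \<phi> (at x) b = 0"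
      unfolding grad_inner_Basis[OF b, symmetric] using K(3) by simp
  qed
  show "integrable M\<Omega> (\<lambda>x. (g x \<bullet> b) * \<phi> x)"
    by (rule set_integrable_times_compact_support[OF gb K(2) smooth_fun_borel_measurable[OF s] C(1)]) (use K(3) in simp)
qed

lemma is_weak_grad_diff:
  assumes "is_weak_grad \<Omega> u g" "is_weak_grad \<Omega> v h"
  shows "is_weak_grad \<Omega> (\<lambda>x. u x - v x) (\<lambda>x. g x - h x)"
  unfolding is_weak_grad_def
proof (intro conjI allI impI ballI)
  fix K assume "compact K \<and> K \<subseteq> \<Omega>"
  then show "set_integrable lebesgue K (\<lambda>x. u x - v x)" "set_integrable lebesgue K (\<lambda>x. g x - h x)"
    using assms unfolding is_weak_grad_def by (auto intro: set_integral_diff)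
next
  fix \<phi> and b :: 'a assume t: "test_fun \<Omega> \<phi>" and b: "b \<in> Basis"
  note i = is_weak_grad_integrable[OF assms(1) t b] is_weak_grad_integrable[OF assms(2) t b]
  have "(LINT x:\<Omega>|lebesgue. (u x - v x) * frechet_derivative \<phi> (at x) b)
    = (LINT x:\<Omega>|lebesgue. u x * frechet_derivative \<phi> (at x) b) - (LINT x:\<Omega>|lebesgue. v x * frechet_derivative \<phi> (at x) b)"
    unfolding set_integral_domain left_diff_distrib using i by (intro Bochner_Integration.integral_diff)
  moreover have "(LINT x:\<Omega>|lebesgue. ((g x - h x) \<bullet> b) * \<phi> x)
    = (LINT x:\<Omega>|lebesgue. (g x \<bullet> b) * \<phi> x) - (LINT x:\<Omega>|lebesgue. (h x \<bullet> b) * \<phi> x)"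
    unfolding set_integral_domain left_diff_distrib inner_diff_left using i by (intro Bochner_Integration.integral_diff)
  ultimately show "(LINT x:\<Omega>|lebesgue. (u x - v x) * frechet_derivative \<phi> (at x) b)
      = - (LINT x:\<Omega>|lebesgue. ((g x - h x) \<bullet> b) * \<phi> x)"
    using assms t b unfolding is_weak_grad_def by simp
qed

text \<open>The difference \<open>g - h\<close> is a weak gradient of zero, and the fundamental
  lemma applies to each component. Since \<open>wgrad\<close> is a choice, this is what lets an
  explicit gradient replace it.\<close>

lemma weak_grad_unique:
  assumes "is_weak_grad \<Omega> u g" "is_weak_grad \<Omega> u h"
  shows "AE x in M\<Omega>. g x = h x"
proof -
  note d = is_weak_grad_diff[OF assms]
  have "AE x in lebesgue. x \<in> \<Omega> \<longrightarrow> (g x - h x) \<bullet> b = 0" if b: "b \<in> Basis" for b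
  proof (rule fundamental_lemma_calculus_of_variations[OF open_domain])
    fix K assume K: "compact K" "K \<subseteq> \<Omega>"
    then have "set_integrable lebesgue K (\<lambda>x. g x - h x)" using d unfolding is_weak_grad_def by blast
    then show "set_integrable lebesgue K (\<lambda>x. (g x - h x) \<bullet> b)"
      using integrable_inner_left[of b lebesgue "\<lambda>x. indicator K x *\<^sub>R (g x - h x)"] by (simp add: set_integrable_def)
  next
    fix \<phi> assume "test_fun \<Omega> \<phi>"
    then have "(LINT x:\<Omega>|lebesgue. (u x - u x) * frechet_derivative \<phi> (at x) b)
      = - (LINT x:\<Omega>|lebesgue. ((g x - h x) \<bullet> b) * \<phi> x)" using d b unfolding is_weak_grad_def by blast
    then show "(LINT x:\<Omega>|lebesgue. ((g x - h x) \<bullet> b) * \<phi> x) = 0" by (simp add: set_lebesgue_integral_def)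
  qed
  then have "AE x in lebesgue. \<forall>b\<in>Basis. x \<in> \<Omega> \<longrightarrow> (g x - h x) \<bullet> b = 0"
    by (subst AE_ball_countable) (auto intro: countable_finite)
  then have "AE x in lebesgue. x \<in> \<Omega> \<longrightarrow> g x = h x"
  proof eventually_elim
    case (elim x)
    show ?case
    proof (rule impI, rule euclidean_eqI)
      fix b :: 'a assume "x \<in> \<Omega>" "b \<in> Basis"
      then have "(g x - h x) \<bullet> b = 0" using elim by blast
      then show "g x \<bullet> b = h x \<bullet> b" unfolding inner_diff_left by linarith
    qed
  qed
  then show ?thesis by (simp only: AE_domain)
qed

text \<open>Integration by parts holds for the approximating test functions, and both of its sides
  are continuous in L2.\<close>

lemma H10_is_weak_grad:
  assumes "H10 u g" shows "is_weak_grad \<Omega> u g"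
  unfolding is_weak_grad_def
proof (intro conjI allI impI ballI)
  note s = H10_sqi[OF assms]
  fix K assume K: "compact K \<and> K \<subseteq> \<Omega>"
  then have Km: "K \<in> sets lebesgue" using lmeasurable_compact fmeasurableD by blast
  have "set_integrable lebesgue K f" if "integrable M\<Omega> f" for f :: "'a \<Rightarrow> 'c::euclidean_space"
  proof -
    have "set_integrable lebesgue \<Omega> f" using that by (simp only: set_integrable_domain)
    then show ?thesis by (rule set_integrable_subset) (use K Km in auto)
  qed
  then show "set_integrable lebesgue K u" "set_integrable lebesgue K g"
    using sqi_imp_integrable[OF s(1)] sqi_imp_integrable[OF s(2)] by auto
next
  note s = H10_sqi[OF assms]
  fix \<psi> and b :: 'a assume t: "test_fun \<Omega> \<psi>" and b: "b \<in> Basis"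
  obtain \<phi> where \<phi>: "\<And>k. test_fun \<Omega> (\<phi> k)" "(\<lambda>k. nrm2 M\<Omega> (\<lambda>x. \<phi> k x - u x)) \<longlonglongrightarrow> 0"
    "(\<lambda>k. nrm2 M\<Omega> (\<lambda>x. grad (\<phi> k) x - g x)) \<longlonglongrightarrow> 0" using H10_approx[OF assms] by blast
  note fs = test_fun_sqi[OF \<phi>(1)] and ps = test_fun_sqi[OF t]
  have dm: "(\<lambda>x. grad \<psi> x \<bullet> b) \<in> borel_measurable M\<Omega>" using sqi_measurable[OF ps(2)] by simp
  have db: "sqi M\<Omega> (\<lambda>x. grad \<psi> x \<bullet> b)"
    by (rule sqi_dominated[OF ps(2) dm]) (simp add: Basis_le_norm[OF b])
  have pb: "sqi M\<Omega> (\<lambda>x. \<psi> x *\<^sub>R b)"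
    by (rule sqi_dominated[OF ps(1)]) (use sqi_measurable[OF ps(1)] b in auto)
  have 1: "(\<lambda>k. \<integral>x. (grad \<psi> x \<bullet> b) \<bullet> (\<phi> k x - u x) \<partial>M\<Omega>) \<longlonglongrightarrow> 0"
    by (rule bounded_times_vanishing[OF db order_refl sqi_diff[OF fs(1) s(1)] \<phi>(2)])
  have 2: "(\<lambda>k. \<integral>x. (\<psi> x *\<^sub>R b) \<bullet> (grad (\<phi> k) x - g x) \<partial>M\<Omega>) \<longlonglongrightarrow> 0"
    by (rule bounded_times_vanishing[OF pb order_refl sqi_diff[OF fs(2) s(2)] \<phi>(3)])
  have ibp: "(\<integral>x. (grad \<psi> x \<bullet> b) \<bullet> \<phi> k x \<partial>M\<Omega>) = - (\<integral>x. (\<psi> x *\<^sub>R b) \<bullet> grad (\<phi> k) x \<partial>M\<Omega>)" for k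
  proof -
    note sm = test_fun_smooth[OF \<phi>(1)[of k]] test_fun_smooth[OF t]
    note [measurable] = smooth_fun_borel_measurable[OF sm(1)] smooth_fun_borel_measurable[OF sm(2)]
      smooth_fun_grad_borel_measurable[OF sm(1)] smooth_fun_grad_borel_measurable[OF sm(2)]
    have K: "\<phi> k x = 0" "grad (\<phi> k) x = 0" if "x \<notin> \<Omega>" for x
      using test_fun_support[OF \<phi>(1)[of k]] that by blast+
    have "(\<integral>x. (grad \<psi> x \<bullet> b) \<bullet> \<phi> k x \<partial>M\<Omega>) = (\<integral>x. \<phi> k x * (grad \<psi> x \<bullet> b) \<partial>lborel)"
      using K by (subst integral_domain_lborel) (auto simp: mult.commute)
    also have "\<dots> = - (\<integral>x. (grad (\<phi> k) x \<bullet> b) * \<psi> x \<partial>lborel)" by (rule test_fun_integration_by_parts[OF \<phi>(1) t])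
    also have "(\<integral>x. (grad (\<phi> k) x \<bullet> b) * \<psi> x \<partial>lborel) = (\<integral>x. (grad (\<phi> k) x \<bullet> b) * \<psi> x \<partial>M\<Omega>)"
      using K by (subst integral_domain_lborel) auto
    finally show ?thesis by (simp add: inner_commute mult.commute)
  qed
  \<comment> \<open>Integration by parts removes the index \<open>k\<close> from this sum of two
    null sequences, so the constant that remains is zero.\<close>
  have "(\<integral>x. (grad \<psi> x \<bullet> b) \<bullet> (\<phi> k x - u x) \<partial>M\<Omega>) + (\<integral>x. (\<psi> x *\<^sub>R b) \<bullet> (grad (\<phi> k) x - g x) \<partial>M\<Omega>)
      = - ((\<integral>x. (grad \<psi> x \<bullet> b) \<bullet> u x \<partial>M\<Omega>) + (\<integral>x. (\<psi> x *\<^sub>R b) \<bullet> g x \<partial>M\<Omega>))" for k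
  proof -
    have "(\<integral>x. (grad \<psi> x \<bullet> b) \<bullet> (\<phi> k x - u x) \<partial>M\<Omega>) = (\<integral>x. (grad \<psi> x \<bullet> b) \<bullet> \<phi> k x \<partial>M\<Omega>) - (\<integral>x. (grad \<psi> x \<bullet> b) \<bullet> u x \<partial>M\<Omega>)"
      unfolding inner_diff_right
      by (intro Bochner_Integration.integral_diff sqi_inner_integrable db fs s)
    moreover have "(\<integral>x. (\<psi> x *\<^sub>R b) \<bullet> (grad (\<phi> k) x - g x) \<partial>M\<Omega>) = (\<integral>x. (\<psi> x *\<^sub>R b) \<bullet> grad (\<phi> k) x \<partial>M\<Omega>) - (\<integral>x. (\<psi> x *\<^sub>R b) \<bullet> g x \<partial>M\<Omega>)"
      unfolding inner_diff_right
      by (intro Bochner_Integration.integral_diff sqi_inner_integrable pb fs s)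
    ultimately show ?thesis using ibp[of k] by simp
  qed
  with tendsto_add[OF 1 2] have "(\<integral>x. (grad \<psi> x \<bullet> b) \<bullet> u x \<partial>M\<Omega>) + (\<integral>x. (\<psi> x *\<^sub>R b) \<bullet> g x \<partial>M\<Omega>) = 0"
    by (simp add: LIMSEQ_const_iff)
  moreover have "(\<integral>x. (grad \<psi> x \<bullet> b) \<bullet> u x \<partial>M\<Omega>) = (\<integral>x. u x * frechet_derivative \<psi> (at x) b \<partial>M\<Omega>)"
    by (simp add: grad_inner_Basis[OF b] mult.commute)
  moreover have "(\<integral>x. (\<psi> x *\<^sub>R b) \<bullet> g x \<partial>M\<Omega>) = (\<integral>x. (g x \<bullet> b) * \<psi> x \<partial>M\<Omega>)"
    by (simp add: inner_commute mult.commute)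
  ultimately show "(LINT x:\<Omega>|lebesgue. u x * frechet_derivative \<psi> (at x) b) = - (LINT x:\<Omega>|lebesgue. (g x \<bullet> b) * \<psi> x)"
    unfolding set_integral_domain by linarith
qed

lemma is_weak_grad_wgrad: "is_weak_grad \<Omega> u g \<Longrightarrow> is_weak_grad \<Omega> u (wgrad \<Omega> u)"
  unfolding wgrad_def by (rule someI[of "is_weak_grad \<Omega> u"])

lemma wgrad_AE: "is_weak_grad \<Omega> u g \<Longrightarrow> AE x in M\<Omega>. wgrad \<Omega> u x = g x"
  using weak_grad_unique is_weak_grad_wgrad by blast

lemma h1norm_eq:
  assumes "is_weak_grad \<Omega> u g" "sqi M\<Omega> u" "sqi M\<Omega> g"
  shows "h1norm \<Omega> u = nrm2 M\<Omega> (\<lambda>x. (u x, g x))"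
proof -
  note a = wgrad_AE[OF assms(1)]
  have "AE x in M\<Omega>. g x = wgrad \<Omega> u x" using a by eventually_elim simp
  note m = borel_measurable_domain_AE[OF sqi_measurable[OF assms(3)] this]
  have "nrm2 M\<Omega> (wgrad \<Omega> u) = nrm2 M\<Omega> g" by (rule nrm2_cong_AE[OF m sqi_measurable[OF assms(3)] a])
  then have "(nrm2 M\<Omega> u)\<^sup>2 + (nrm2 M\<Omega> (wgrad \<Omega> u))\<^sup>2 = (nrm2 M\<Omega> (\<lambda>x. (u x, g x)))\<^sup>2"
    by (simp add: nrm2_Pair[OF assms(2,3)])
  then show ?thesis by (simp add: h1norm_def set_integral_domain nrm2_power2 nrm2_def)
qed

text \<open>\<open>H01\<close> measures the approximation by \<open>h1norm\<close>, which contains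
  the chosen gradient of a difference. Uniqueness of weak gradients turns that number into the norm
  of an explicit pair, and the pair is then a limit of points of the test graph.\<close>

lemma H01_imp_H10:
  assumes "H01 \<Omega> u" shows "H10 u (wgrad \<Omega> u)"
proof -
  have wg: "is_weak_grad \<Omega> u (wgrad \<Omega> u)" and s: "sqi M\<Omega> u" "sqi M\<Omega> (wgrad \<Omega> u)"
    using assms is_weak_grad_wgrad unfolding H01_def L2_on_domain by blast+
  obtain \<phi> where \<phi>: "\<And>k. test_fun \<Omega> (\<phi> k)" "(\<lambda>k. h1norm \<Omega> (\<lambda>x. \<phi> k x - u x)) \<longlonglongrightarrow> 0"
    using assms unfolding H01_def by blast
  note fs = test_fun_sqi[OF \<phi>(1)]
  have e: "h1norm \<Omega> (\<lambda>x. \<phi> k x - u x) = nrm2 M\<Omega> (\<lambda>x. (\<phi> k x - u x, grad (\<phi> k) x - wgrad \<Omega> u x))" for k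
    by (intro h1norm_eq is_weak_grad_diff wg sqi_diff s fs H10_is_weak_grad H10_test \<phi>(1))
  note c = nrm2_components[OF sqi_diff[OF fs(1) s(1)] sqi_diff[OF fs(2) s(2)]]
  show ?thesis
  proof (rule H10_limit[OF H10_test[OF \<phi>(1)] s])
    show "(\<lambda>n. nrm2 M\<Omega> (\<lambda>x. \<phi> n x - u x)) \<longlonglongrightarrow> 0"
      by (rule tendsto_zero_le[OF nrm2_nonneg c(1) \<phi>(2)[unfolded e]])
    show "(\<lambda>n. nrm2 M\<Omega> (\<lambda>x. grad (\<phi> n) x - wgrad \<Omega> u x)) \<longlonglongrightarrow> 0"
      by (rule tendsto_zero_le[OF nrm2_nonneg c(2) \<phi>(2)[unfolded e]])
  qed
qed

lemma H10_h1norm: "H10 u g \<Longrightarrow> h1norm \<Omega> u = nrm2 M\<Omega> (\<lambda>x. (u x, g x))"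
  by (intro h1norm_eq H10_is_weak_grad H10_sqi)

lemma H10_wgrad_AE: "H10 u g \<Longrightarrow> AE x in M\<Omega>. wgrad \<Omega> u x = g x"
  by (intro wgrad_AE H10_is_weak_grad)

lemma H10_imp_H01:
  assumes "H10 u g" shows "H01 \<Omega> u"
proof -
  note s = H10_sqi[OF assms]
  have a: "AE x in M\<Omega>. g x = wgrad \<Omega> u x" using H10_wgrad_AE[OF assms] by eventually_elim simp
  have "H10 u (wgrad \<Omega> u)" by (rule H10_cong_AE[OF assms _ a]) simp
  note s' = H10_sqi[OF this]
  obtain \<phi> where \<phi>: "\<And>k. test_fun \<Omega> (\<phi> k)" "(\<lambda>k. nrm2 M\<Omega> (\<lambda>x. \<phi> k x - u x)) \<longlonglongrightarrow> 0"
    "(\<lambda>k. nrm2 M\<Omega> (\<lambda>x. grad (\<phi> k) x - g x)) \<longlonglongrightarrow> 0" using H10_approx[OF assms] by blast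
  note d = H10_diff[OF H10_test[OF \<phi>(1)] assms]
  have "(\<lambda>k. nrm2 M\<Omega> (\<lambda>x. \<phi> k x - u x) + nrm2 M\<Omega> (\<lambda>x. grad (\<phi> k) x - g x)) \<longlonglongrightarrow> 0 + 0"
    by (intro tendsto_add \<phi>)
  then have "(\<lambda>k. h1norm \<Omega> (\<lambda>x. \<phi> k x - u x)) \<longlonglongrightarrow> 0"
    using nrm2_components(3)[OF H10_sqi(1)[OF d] H10_sqi(2)[OF d]]
    by (intro tendsto_zero_le[of "\<lambda>k. h1norm \<Omega> (\<lambda>x. \<phi> k x - u x)" "\<lambda>k. nrm2 M\<Omega> (\<lambda>x. \<phi> k x - u x) + nrm2 M\<Omega> (\<lambda>x. grad (\<phi> k) x - g x)"])
      (simp_all add: H10_h1norm[OF d] nrm2_nonneg)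
  then show ?thesis unfolding H01_def L2_on_domain
    using H10_is_weak_grad[OF assms] s(1) s'(2) \<phi>(1) by blast
qed

end

section \<open>Chain rules\<close>

lemma max_zero_power2_has_real_derivative:
  "((\<lambda>t. (max 0 t)\<^sup>2) has_real_derivative 2 * max 0 t) (at t)"
proof -
  consider "t > 0" | "t < 0" | "t = 0" by linarith
  then show ?thesis
  proof cases
    case 1
    have "((\<lambda>t. t\<^sup>2) has_real_derivative 2 * max 0 t) (at t)"
      using 1 by (auto intro!: derivative_eq_intros)
    then show ?thesis
      by (rule has_field_derivative_transform_within_open[where S="{0<..}"]) (use 1 in auto)
  next
    case 2
    have "((\<lambda>t. 0) has_real_derivative 2 * max 0 t) (at t)" using 2 by simp
    then show ?thesis
      by (rule has_field_derivative_transform_within_open[where S="{..<0}"]) (use 2 in auto)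
  next
    case 3
    have "((\<lambda>h::real. max 0 h) \<longlongrightarrow> max 0 0) (at 0)" by (intro tendsto_intros)
    moreover have "(\<lambda>h::real. ((max 0 (0 + h))\<^sup>2 - (max 0 0)\<^sup>2) / h) = max 0"
      by (auto simp: fun_eq_iff max_def power2_eq_square)
    ultimately show ?thesis using 3 unfolding DERIV_def by simp
  qed
qed

lemma continuous_has_antiderivative:
  fixes f :: "real \<Rightarrow> real"
  assumes "continuous_on UNIV f"
  obtains F where "F 0 = 0" "\<And>x. (F has_real_derivative f x) (at x)"
proof -
  define F where "F = (\<lambda>u. LBINT y=ereal 0..ereal u. f y)"
  have "(F has_real_derivative f x) (at x)" for x
  proof -
    have "((\<lambda>u. LBINT y=ereal 0..ereal u. f y) has_vector_derivative (f x)) (at x within {-\<bar>x\<bar>-1..\<bar>x\<bar>+1})"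
      by (rule interval_integral_FTC2) (use assms continuous_on_subset in auto)
    then show ?thesis
      unfolding F_def has_real_derivative_iff_has_vector_derivative
      by (subst (asm) at_within_interior) auto
  qed
  moreover have "F 0 = 0" by (simp add: F_def)
  ultimately show thesis using that by blast
qed

lemma derivative_bound_imp_Lipschitz:
  fixes \<Phi> \<Phi>' :: "real \<Rightarrow> real"
  assumes "\<And>t. (\<Phi> has_real_derivative \<Phi>' t) (at t)" "\<And>t. \<bar>\<Phi>' t\<bar> \<le> L"
  shows "\<bar>\<Phi> s - \<Phi> t\<bar> \<le> L * \<bar>s - t\<bar>"
  using field_differentiable_bound[of UNIV \<Phi> \<Phi>' L s t] assms by simp

context bounded_domain
begin

text \<open>A polynomial without constant term preserves compact support. The coefficients
  \<open>a i / real (Suc i)\<close> are those of the antiderivative of the polynomial with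
  coefficients \<open>a i\<close>.\<close>

lemma test_fun_polynomial:
  assumes t: "test_fun \<Omega> \<phi>"
  defines "P \<equiv> \<lambda>a n t::real. \<Sum>i\<le>n. a i / real (Suc i) * t ^ Suc i"
  shows "test_fun \<Omega> (\<lambda>x. P a n (\<phi> x))" "grad (\<lambda>x. P a n (\<phi> x)) x = (\<Sum>i\<le>n. a i * \<phi> x ^ i) *\<^sub>R grad \<phi> x"
    "(P a n has_real_derivative (\<Sum>i\<le>n. a i * s ^ i)) (at s)"
proof -
  note s = test_fun_smooth[OF t]
  have sm: "smooth_fun (\<lambda>x. P a n (\<phi> x))"
    unfolding P_def by (rule smooth_fun_sum, simp, rule smooth_fun_mult[OF smooth_fun_const smooth_fun_power[OF s]])
  show "test_fun \<Omega> (\<lambda>x. P a n (\<phi> x))"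
  proof -
    obtain K where "compact K" "K \<subseteq> \<Omega>" "\<And>x. x \<notin> K \<Longrightarrow> \<phi> x = 0" using t unfolding test_fun_def by metis
    then have "\<exists>K. compact K \<and> K \<subseteq> \<Omega> \<and> (\<forall>x. x \<notin> K \<longrightarrow> P a n (\<phi> x) = 0)"
      by (intro exI[of _ K]) (auto simp: P_def)
    with sm show ?thesis unfolding test_fun_def by blast
  qed
  show d: "(P a n has_real_derivative (\<Sum>i\<le>n. a i * s ^ i)) (at s)" for s
    unfolding P_def by (auto intro!: derivative_eq_intros sum.cong simp del: power_Suc)
  show "grad (\<lambda>x. P a n (\<phi> x)) x = (\<Sum>i\<le>n. a i * \<phi> x ^ i) *\<^sub>R grad \<phi> x"
  proof (rule grad_eqI)
    show "((\<lambda>x. P a n (\<phi> x)) has_derivative (\<lambda>h. ((\<Sum>i\<le>n. a i * \<phi> x ^ i) *\<^sub>R grad \<phi> x) \<bullet> h)) (at x)"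
      using has_derivative_compose[OF smooth_fun_has_derivative[OF s, of x] d[unfolded has_field_derivative_def]]
      by (simp only: inner_scaleR_left)
  qed
qed

text \<open>The composition is in general not smooth, hence not a test function. Polynomials that
  approximate \<open>\<Phi>'\<close> uniformly on the range of \<open>\<phi>\<close>, integrated
  from 0, provide test functions that converge together with their gradients.\<close>

lemma H10_chain_test:
  assumes t: "test_fun \<Omega> \<phi>" and d: "\<And>t. (\<Phi> has_real_derivative \<Phi>' t) (at t)"
    and c: "continuous_on UNIV \<Phi>'" and 0: "\<Phi> 0 = 0"
  shows "H10 (\<lambda>x. \<Phi> (\<phi> x)) (\<lambda>x. \<Phi>' (\<phi> x) *\<^sub>R grad \<phi> x)"
proof -
  obtain C where C: "0 < C" "\<And>x. \<bar>\<phi> x\<bar> \<le> C" using test_fun_bounds[OF t] by blast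
  note s = test_fun_sqi[OF t] note m = sqi_measurable[OF s(1)] sqi_measurable[OF s(2)]
  have c\<Phi>: "continuous_on UNIV \<Phi>"
    using d by (meson DERIV_isCont continuous_at_imp_continuous_on)
  let ?I = "{-C..C}"
  have \<phi>I: "\<phi> x \<in> ?I" for x using C(2)[of x] by auto
  have "bounded (\<Phi> ` ?I)" "bounded (\<Phi>' ` ?I)"
    using c c\<Phi> by (auto intro!: compact_imp_bounded compact_continuous_image intro: continuous_on_subset)
  then obtain B1 B2 where B: "\<And>t. t \<in> ?I \<Longrightarrow> \<bar>\<Phi> t\<bar> \<le> B1" "\<And>t. t \<in> ?I \<Longrightarrow> \<bar>\<Phi>' t\<bar> \<le> B2"
    unfolding bounded_iff by (metis imageI real_norm_def)
  have "\<exists>a n. \<forall>t\<in>?I. \<bar>\<Phi>' t - (\<Sum>i\<le>n. a i * t^i)\<bar> < 1 / real (Suc k)" for k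
  proof -
    obtain p where p: "real_polynomial_function p" "\<And>x. x \<in> ?I \<Longrightarrow> \<bar>\<Phi>' x - p x\<bar> < 1 / real (Suc k)"
      using Stone_Weierstrass_real_polynomial_function[of ?I \<Phi>' "1 / real (Suc k)"] continuous_on_subset[OF c, of ?I]
      by (auto intro: that)
    then show ?thesis unfolding real_polynomial_function_iff_sum by blast
  qed
  then obtain a n where an: "\<And>k t. t \<in> ?I \<Longrightarrow> \<bar>\<Phi>' t - (\<Sum>i\<le>n k. a k i * t^i)\<bar> < 1 / real (Suc k)" by metis
  define P where "P k t = (\<Sum>i\<le>n k. a k i / real (Suc i) * t ^ Suc i)" for k and t :: real
  define p where "p k t = (\<Sum>i\<le>n k. a k i * t ^ i)" for k and t :: real
  have Pd: "(P k has_real_derivative p k t) (at t)" for k t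
    using test_fun_polynomial(3)[OF t, where n="n k" and a="a k" and s=t] by (simp add: P_def[abs_def] p_def)
  have HP: "H10 (\<lambda>x. P k (\<phi> x)) (\<lambda>x. p k (\<phi> x) *\<^sub>R grad \<phi> x)" for k
    using H10_test[OF test_fun_polynomial(1)[OF t, where n="n k" and a="a k"]]
    unfolding test_fun_polynomial(2)[OF t, abs_def] by (simp add: P_def p_def)
  have pc: "\<bar>p k t - \<Phi>' t\<bar> \<le> 1 / real (Suc k)" if "t \<in> ?I" for k t
    using an[OF that, of k] by (simp add: p_def abs_minus_commute)
  have Pc: "\<bar>P k t - \<Phi> t\<bar> \<le> C * (1 / real (Suc k))" if "t \<in> ?I" for k t
  proof -
    have "norm ((P k t - \<Phi> t) - (P k 0 - \<Phi> 0)) \<le> (1 / real (Suc k)) * norm (t - 0)"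
    proof (rule field_differentiable_bound[of ?I _ "\<lambda>t. p k t - \<Phi>' t"])
      show "((\<lambda>a. P k a - \<Phi> a) has_field_derivative p k z - \<Phi>' z) (at z within ?I)" for z
        using DERIV_diff[OF Pd d] by (rule DERIV_subset) simp
    qed (use that C pc in auto)
    also have "\<dots> \<le> (1 / real (Suc k)) * C" using that by (intro mult_left_mono) auto
    finally show ?thesis using 0 by (simp add: P_def mult.commute)
  qed
  have lim: "(\<lambda>k. C * (1 / real (Suc k))) \<longlonglongrightarrow> 0" for C :: real
    using tendsto_mult_right_zero[OF LIMSEQ_inverse_real_of_nat, of C] by (simp only: inverse_eq_divide)
  have one: "1 / real (Suc k) \<le> 1" for k by simp
  have L: "(\<lambda>k. P k (\<phi> x)) \<longlonglongrightarrow> \<Phi> (\<phi> x)" for x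
    by (rule LIM_zero_cancel, rule Lim_null_comparison[OF _ lim[of C]]) (use Pc[OF \<phi>I[of x]] in auto)
  have L': "(\<lambda>k. p k (\<phi> x)) \<longlonglongrightarrow> \<Phi>' (\<phi> x)" for x
    by (rule LIM_zero_cancel, rule Lim_null_comparison[OF _ lim[of 1]]) (use pc[OF \<phi>I[of x]] in auto)
  show ?thesis
  proof (rule H10_dominated_limit[OF HP])
    show "(\<lambda>x. \<Phi> (\<phi> x)) \<in> borel_measurable M\<Omega>"
      using m(1) borel_measurable_continuous_onI[OF c\<Phi>] by (rule measurable_compose)
    show "(\<lambda>x. \<Phi>' (\<phi> x) *\<^sub>R grad \<phi> x) \<in> borel_measurable M\<Omega>"
      using measurable_compose[OF m(1) borel_measurable_continuous_onI[OF c]] m(2) by (rule borel_measurable_scaleR)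
    show "sqi M\<Omega> (\<lambda>x. B1 + C)" by (rule sqi_const)
    show "sqi M\<Omega> (\<lambda>x. (B2 + 1) *\<^sub>R grad \<phi> x)" by (rule sqi_scaleR[OF s(2)])
    show "AE x in M\<Omega>. (\<lambda>n. P n (\<phi> x)) \<longlonglongrightarrow> \<Phi> (\<phi> x)" using L by simp
    show "AE x in M\<Omega>. (\<lambda>n. p n (\<phi> x) *\<^sub>R grad \<phi> x) \<longlonglongrightarrow> \<Phi>' (\<phi> x) *\<^sub>R grad \<phi> x"
      using L' by (intro AE_I2 tendsto_scaleR tendsto_const)
    show "AE x in M\<Omega>. norm (P k (\<phi> x)) \<le> norm (B1 + C)" for k
    proof (rule AE_I2)
      fix x
      have "C * (1 / real (Suc k)) \<le> C * 1" using C by (intro mult_left_mono one) auto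
      then show "norm (P k (\<phi> x)) \<le> norm (B1 + C)"
        using Pc[OF \<phi>I[of x], of k] B(1)[OF \<phi>I[of x]] by simp
    qed
    show "AE x in M\<Omega>. norm (p k (\<phi> x) *\<^sub>R grad \<phi> x) \<le> norm ((B2 + 1) *\<^sub>R grad \<phi> x)" for k
    proof (rule AE_I2)
      fix x
      have "\<bar>p k (\<phi> x)\<bar> \<le> \<bar>B2 + 1\<bar>"
        using pc[OF \<phi>I[of x], of k] B(2)[OF \<phi>I[of x]] one[of k] by linarith
      then show "norm (p k (\<phi> x) *\<^sub>R grad \<phi> x) \<le> norm ((B2 + 1) *\<^sub>R grad \<phi> x)"
        by (simp add: mult_right_mono)
    qed
  qed
qed

text \<open>Approximating test functions \<open>\<psi> n\<close> converge in the Sobolev norm and,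
  along a subsequence, almost everywhere. The gradient error splits into
  \<open>\<Phi>' (\<psi> n)\<close> times the gradient error of \<open>\<psi> n\<close>, and the
  change of \<open>\<Phi>'\<close> times the fixed \<open>g\<close>, to which dominated convergence
  applies.\<close>

lemma H10_chain:
  assumes u: "H10 u g" and d: "\<And>t. (\<Phi> has_real_derivative \<Phi>' t) (at t)"
    and c: "continuous_on UNIV \<Phi>'" and 0: "\<Phi> 0 = 0" and L: "\<And>t. \<bar>\<Phi>' t\<bar> \<le> L"
  shows "H10 (\<lambda>x. \<Phi> (u x)) (\<lambda>x. \<Phi>' (u x) *\<^sub>R g x)"
proof -
  note s = H10_sqi[OF u] note m = sqi_measurable[OF s(1)] sqi_measurable[OF s(2)]
  have L0: "0 \<le> L" using L[of 0] by linarith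
  have lip: "\<bar>\<Phi> a - \<Phi> b\<bar> \<le> L * \<bar>a - b\<bar>" for a b by (rule derivative_bound_imp_Lipschitz[OF d L])
  have c\<Phi>: "continuous_on UNIV \<Phi>"
    using d by (meson DERIV_isCont continuous_at_imp_continuous_on)
  have m\<Phi>: "\<Phi> \<in> borel_measurable borel" "\<Phi>' \<in> borel_measurable borel"
    using c c\<Phi> by (auto intro: borel_measurable_continuous_onI)
  obtain f where f: "\<And>k. test_fun \<Omega> (f k)" "(\<lambda>k. nrm2 M\<Omega> (\<lambda>x. f k x - u x)) \<longlonglongrightarrow> 0"
    "(\<lambda>k. nrm2 M\<Omega> (\<lambda>x. grad (f k) x - g x)) \<longlonglongrightarrow> 0" using H10_approx[OF u] by blast
  note fs = test_fun_sqi[OF f(1)]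
  obtain r where r: "strict_mono (r::nat\<Rightarrow>nat)" "AE x in M\<Omega>. (\<lambda>n. f (r n) x - u x) \<longlonglongrightarrow> 0"
    using nrm2_tendsto_zero_AE_subseq[OF sqi_diff[OF fs(1) s(1)] f(2)] by blast
  define \<psi> where "\<psi> n = f (r n)" for n
  have \<psi>: "test_fun \<Omega> (\<psi> k)" for k by (simp add: \<psi>_def f)
  have \<psi>1: "(\<lambda>k. nrm2 M\<Omega> (\<lambda>x. \<psi> k x - u x)) \<longlonglongrightarrow> 0"
    using LIMSEQ_subseq_LIMSEQ[OF f(2) r(1)] by (simp add: \<psi>_def o_def)
  have \<psi>2: "(\<lambda>k. nrm2 M\<Omega> (\<lambda>x. grad (\<psi> k) x - g x)) \<longlonglongrightarrow> 0"
    using LIMSEQ_subseq_LIMSEQ[OF f(3) r(1)] by (simp add: \<psi>_def o_def)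
  have \<psi>3: "AE x in M\<Omega>. (\<lambda>n. \<psi> n x) \<longlonglongrightarrow> u x"
    using r(2) by eventually_elim (simp add: \<psi>_def LIM_zero_cancel)
  note ps = test_fun_sqi[OF \<psi>]
  note pm = sqi_measurable[OF ps(1)] sqi_measurable[OF ps(2)]
  have s\<Phi>: "sqi M\<Omega> (\<lambda>x. \<Phi> (u x))"
  proof (rule sqi_dominated[OF sqi_scaleR[OF s(1), of L]])
    show "(\<lambda>x. \<Phi> (u x)) \<in> borel_measurable M\<Omega>" using measurable_compose[OF m(1) m\<Phi>(1)] .
    show "AE x in M\<Omega>. norm (\<Phi> (u x)) \<le> norm (L *\<^sub>R u x)"
      using lip[of "u _" 0] 0 L0 by (simp add: abs_mult)
  qed
  have s\<Phi>': "sqi M\<Omega> (\<lambda>x. \<Phi>' (u x) *\<^sub>R g x)"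
    by (rule sqi_bounded_scaleR[OF s(2) measurable_compose[OF m(1) m\<Phi>(2)] L])
  show ?thesis
  proof (rule H10_limit[OF H10_chain_test[OF \<psi> d c 0] s\<Phi> s\<Phi>'])
    have "nrm2 M\<Omega> (\<lambda>x. \<Phi> (\<psi> n x) - \<Phi> (u x)) \<le> nrm2 M\<Omega> (\<lambda>x. L *\<^sub>R (\<psi> n x - u x))" for n
    proof (rule nrm2_mono[OF sqi_scaleR[OF sqi_diff[OF ps(1) s(1)]]])
      show "(\<lambda>x. \<Phi> (\<psi> n x) - \<Phi> (u x)) \<in> borel_measurable M\<Omega>"
        by (intro borel_measurable_diff measurable_compose[OF m(1) m\<Phi>(1)] measurable_compose[OF pm(1) m\<Phi>(1)])
      show "AE x in M\<Omega>. norm (\<Phi> (\<psi> n x) - \<Phi> (u x)) \<le> norm (L *\<^sub>R (\<psi> n x - u x))"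
        using lip L0 by (simp add: abs_mult)
    qed
    then show "(\<lambda>n. nrm2 M\<Omega> (\<lambda>x. \<Phi> (\<psi> n x) - \<Phi> (u x))) \<longlonglongrightarrow> 0"
      by (rule tendsto_zero_le[OF nrm2_nonneg])
        (simp only: nrm2_scaleR tendsto_mult_right_zero[OF \<psi>1])
    have a: "sqi M\<Omega> (\<lambda>x. \<Phi>' (\<psi> n x) *\<^sub>R (grad (\<psi> n) x - g x))" for n
      by (rule sqi_bounded_scaleR[OF sqi_diff[OF ps(2) s(2)] measurable_compose[OF pm(1) m\<Phi>(2)] L])
    have b': "sqi M\<Omega> (\<lambda>x. \<Phi>' (\<psi> n x) *\<^sub>R g x)" for n
      by (rule sqi_bounded_scaleR[OF s(2) measurable_compose[OF pm(1) m\<Phi>(2)] L])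
    have b: "sqi M\<Omega> (\<lambda>x. \<Phi>' (\<psi> n x) *\<^sub>R g x - \<Phi>' (u x) *\<^sub>R g x)" for n
      by (rule sqi_diff[OF b' s\<Phi>'])
    have lim2: "(\<lambda>n. nrm2 M\<Omega> (\<lambda>x. \<Phi>' (\<psi> n x) *\<^sub>R g x - \<Phi>' (u x) *\<^sub>R g x)) \<longlonglongrightarrow> 0"
    proof (rule nrm2_dominated_convergence(2)[OF sqi_scaleR[OF s(2), of L] sqi_measurable[OF b'] sqi_measurable[OF s\<Phi>']])
      show "AE x in M\<Omega>. norm (\<Phi>' (\<psi> n x) *\<^sub>R g x) \<le> norm (L *\<^sub>R g x)" for n
        using L L0 by (simp add: mult_right_mono)
      show "AE x in M\<Omega>. (\<lambda>n. \<Phi>' (\<psi> n x) *\<^sub>R g x) \<longlonglongrightarrow> \<Phi>' (u x) *\<^sub>R g x"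
        using \<psi>3
      proof eventually_elim
        case (elim x)
        have "(\<lambda>n. \<Phi>' (\<psi> n x)) \<longlonglongrightarrow> \<Phi>' (u x)"
          by (rule continuous_on_tendsto_compose[OF c elim]) auto
        then show ?case by (intro tendsto_scaleR tendsto_const)
      qed
    qed
    have lim1: "(\<lambda>n. nrm2 M\<Omega> (\<lambda>x. \<Phi>' (\<psi> n x) *\<^sub>R (grad (\<psi> n) x - g x))) \<longlonglongrightarrow> 0"
    proof (rule tendsto_zero_le[OF nrm2_nonneg])
      show "nrm2 M\<Omega> (\<lambda>x. \<Phi>' (\<psi> n x) *\<^sub>R (grad (\<psi> n) x - g x)) \<le> nrm2 M\<Omega> (\<lambda>x. L *\<^sub>R (grad (\<psi> n) x - g x))" for n
        by (rule nrm2_mono[OF sqi_scaleR[OF sqi_diff[OF ps(2) s(2)]] sqi_measurable[OF a]])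
          (use L L0 in \<open>simp add: mult_right_mono\<close>)
      show "(\<lambda>n. nrm2 M\<Omega> (\<lambda>x. L *\<^sub>R (grad (\<psi> n) x - g x))) \<longlonglongrightarrow> 0"
        by (simp only: nrm2_scaleR tendsto_mult_right_zero[OF \<psi>2])
    qed
    show "(\<lambda>n. nrm2 M\<Omega> (\<lambda>x. \<Phi>' (\<psi> n x) *\<^sub>R grad (\<psi> n) x - \<Phi>' (u x) *\<^sub>R g x)) \<longlonglongrightarrow> 0"
    proof (rule tendsto_zero_le[OF nrm2_nonneg])
      show "(\<lambda>n. nrm2 M\<Omega> (\<lambda>x. \<Phi>' (\<psi> n x) *\<^sub>R (grad (\<psi> n) x - g x)) + nrm2 M\<Omega> (\<lambda>x. \<Phi>' (\<psi> n x) *\<^sub>R g x - \<Phi>' (u x) *\<^sub>R g x)) \<longlonglongrightarrow> 0"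
        using tendsto_add[OF lim1 lim2] by simp
      have e: "(\<lambda>x. \<Phi>' (\<psi> n x) *\<^sub>R grad (\<psi> n) x - \<Phi>' (u x) *\<^sub>R g x)
          = (\<lambda>x. \<Phi>' (\<psi> n x) *\<^sub>R (grad (\<psi> n) x - g x) + (\<Phi>' (\<psi> n x) *\<^sub>R g x - \<Phi>' (u x) *\<^sub>R g x))" for n
        by (simp add: scaleR_diff_right)
      show "nrm2 M\<Omega> (\<lambda>x. \<Phi>' (\<psi> n x) *\<^sub>R grad (\<psi> n) x - \<Phi>' (u x) *\<^sub>R g x)
          \<le> nrm2 M\<Omega> (\<lambda>x. \<Phi>' (\<psi> n x) *\<^sub>R (grad (\<psi> n) x - g x)) + nrm2 M\<Omega> (\<lambda>x. \<Phi>' (\<psi> n x) *\<^sub>R g x - \<Phi>' (u x) *\<^sub>R g x)" for n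
        unfolding e by (rule nrm2_triangle[OF a b])
    qed
  qed
qed

lemma H10_chain_bounded:
  assumes u: "H10 u g" and A: "\<And>x. \<bar>u x\<bar> \<le> A" and d: "\<And>t. (\<Phi> has_real_derivative \<Phi>' t) (at t)"
    and c: "continuous_on UNIV \<Phi>'" and 0: "\<Phi> 0 = 0"
  shows "H10 (\<lambda>x. \<Phi> (u x)) (\<lambda>x. \<Phi>' (u x) *\<^sub>R g x)"
proof -
  have A0: "0 \<le> A" using A[of undefined] by linarith
  define q where "q t = \<Phi>' (max (-A) (min A t))" for t
  have cq: "continuous_on UNIV q" unfolding q_def
    by (intro continuous_on_compose2[OF c] continuous_intros) auto
  obtain F where F: "F 0 = 0" "\<And>x. (F has_real_derivative q x) (at x)"
    using continuous_has_antiderivative[OF cq] by blast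
  have "bounded (\<Phi>' ` {-A..A})"
    using c by (auto intro!: compact_imp_bounded compact_continuous_image intro: continuous_on_subset)
  then obtain L where L: "\<And>t. t \<in> {-A..A} \<Longrightarrow> \<bar>\<Phi>' t\<bar> \<le> L"
    unfolding bounded_iff by (metis imageI real_norm_def)
  have qL: "\<bar>q t\<bar> \<le> L" for t unfolding q_def by (rule L) (use A0 in auto)
  have "\<exists>k. \<forall>x\<in>{-A..A}. F x - \<Phi> x = k"
  proof (rule has_field_derivative_zero_constant)
    fix x assume x: "x \<in> {-A..A}"
    then have "q x = \<Phi>' x" by (simp add: q_def)
    then have "((\<lambda>x. F x - \<Phi> x) has_field_derivative 0) (at x)"
      using DERIV_diff[OF F(2)[of x] d[of x]] by simp
    then show "((\<lambda>x. F x - \<Phi> x) has_field_derivative 0) (at x within {-A..A})"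
      by (rule DERIV_subset) simp
  qed simp
  then obtain k where k: "\<And>x. x \<in> {-A..A} \<Longrightarrow> F x - \<Phi> x = k" by blast
  have e: "F t = \<Phi> t" if "t \<in> {-A..A}" for t using k[OF that] k[of 0] F(1) 0 A0 by simp
  have e': "q t = \<Phi>' t" if "t \<in> {-A..A}" for t using that by (simp add: q_def)
  have uI: "u x \<in> {-A..A}" for x using A[of x] by auto
  show ?thesis using H10_chain[OF u F(2) cq F(1) qL] by (simp add: e[OF uI] e'[OF uI])
qed

text \<open>The positive part is approximated by sqrt(e^2 + max(0, t - a)^2) - e, which is
  continuously differentiable because the square of a positive part is. Its derivative at t = a is
  0, hence the strict inequality in the indicator; \<open>0 \<le> a\<close> makes the approximations
  vanish at 0.\<close>

lemma H10_pospart: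
  assumes u: "H10 u g" and a: "0 \<le> a"
  shows "H10 (\<lambda>x. max 0 (u x - a)) (\<lambda>x. (if u x > a then 1 else 0) *\<^sub>R g x)"
proof -
  note s = H10_sqi[OF u] note [measurable] = sqi_measurable[OF s(1)] sqi_measurable[OF s(2)]
  define e where "e k = 1 / real (Suc k)" for k
  have e0: "0 < e k" for k by (simp add: e_def)
  have elim0: "e \<longlonglongrightarrow> 0" unfolding e_def using LIMSEQ_inverse_real_of_nat by (simp only: inverse_eq_divide)
  define F where "F k t = sqrt ((e k)\<^sup>2 + (max 0 (t - a))\<^sup>2) - e k" for k t
  define f where "f k t = max 0 (t - a) / sqrt ((e k)\<^sup>2 + (max 0 (t - a))\<^sup>2)" for k t
  have pos: "0 < (e k)\<^sup>2 + t\<^sup>2" for k t using e0[of k] by (simp add: add_pos_nonneg)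
  have d: "(F k has_real_derivative f k t) (at t)" for k t
  proof -
    have "((\<lambda>t. (max 0 (t - a))\<^sup>2) has_real_derivative 2 * max 0 (t - a)) (at t)"
      using DERIV_chain2[OF max_zero_power2_has_real_derivative DERIV_diff[OF DERIV_ident DERIV_const], of a t]
      by simp
    then have q: "((\<lambda>t. (e k)\<^sup>2 + (max 0 (t - a))\<^sup>2) has_real_derivative 2 * max 0 (t - a)) (at t)"
      using DERIV_add[OF DERIV_const] by fastforce
    have "((\<lambda>t. sqrt ((e k)\<^sup>2 + (max 0 (t - a))\<^sup>2)) has_real_derivative
        (inverse (sqrt ((e k)\<^sup>2 + (max 0 (t - a))\<^sup>2)) / 2) * (2 * max 0 (t - a))) (at t)"
      by (rule DERIV_chain2[where f=sqrt and g="\<lambda>t. (e k)\<^sup>2 + (max 0 (t - a))\<^sup>2", OF DERIV_real_sqrt[OF pos] q])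
    from DERIV_diff[OF this DERIV_const[of "e k"]]
    have "((\<lambda>t. sqrt ((e k)\<^sup>2 + (max 0 (t - a))\<^sup>2) - e k) has_real_derivative
        (inverse (sqrt ((e k)\<^sup>2 + (max 0 (t - a))\<^sup>2)) / 2) * (2 * max 0 (t - a))) (at t)" by simp
    then show ?thesis by (simp add: F_def[abs_def] f_def field_simps)
  qed
  have fb: "\<bar>f k t\<bar> \<le> 1" for k t
  proof -
    have "max 0 (t - a) \<le> sqrt ((e k)\<^sup>2 + (max 0 (t - a))\<^sup>2)" by (intro real_le_rsqrt) simp
    then show ?thesis using real_sqrt_gt_zero[OF pos[of k "max 0 (t - a)"]] by (simp add: f_def divide_le_eq)
  qed
  have cf: "continuous_on UNIV (f k)" for k
    unfolding f_def[abs_def] using pos[of k] by (intro continuous_intros) (metis less_irrefl real_sqrt_eq_zero_cancel_iff)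
  have F0: "F k 0 = 0" for k using a e0[of k] by (simp add: F_def)
  have H: "H10 (\<lambda>x. F k (u x)) (\<lambda>x. f k (u x) *\<^sub>R g x)" for k
    by (rule H10_chain[OF u d cf F0 fb])
  show ?thesis
  proof (rule H10_dominated_limit[OF H _ _ s(1) _ _ s(2)])
    show "(\<lambda>x. max 0 (u x - a)) \<in> borel_measurable M\<Omega>" by measurable
    show "(\<lambda>x. (if u x > a then 1 else 0) *\<^sub>R g x) \<in> borel_measurable M\<Omega>" by measurable
    show "AE x in M\<Omega>. norm (F n (u x)) \<le> norm (u x)" for n
      using derivative_bound_imp_Lipschitz[OF d fb, of n "u _" 0] F0 by simp
    show "AE x in M\<Omega>. norm (f n (u x) *\<^sub>R g x) \<le> norm (g x)" for n
      using fb by (simp add: mult_left_le_one_le)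
    have "(\<lambda>n. F n t) \<longlonglongrightarrow> max 0 (t - a)" for t
    proof -
      have "(\<lambda>n. sqrt ((e n)\<^sup>2 + (max 0 (t - a))\<^sup>2) - e n) \<longlonglongrightarrow> sqrt (0\<^sup>2 + (max 0 (t - a))\<^sup>2) - 0"
        by (intro tendsto_intros elim0)
      then show ?thesis by (simp add: F_def)
    qed
    then show "AE x in M\<Omega>. (\<lambda>n. F n (u x)) \<longlonglongrightarrow> max 0 (u x - a)" by simp
    have "(\<lambda>n. f n t) \<longlonglongrightarrow> (if t > a then 1 else 0)" for t
    proof (cases "t > a")
      case True
      have "(\<lambda>n. max 0 (t - a) / sqrt ((e n)\<^sup>2 + (max 0 (t - a))\<^sup>2)) \<longlonglongrightarrow> max 0 (t - a) / sqrt (0\<^sup>2 + (max 0 (t - a))\<^sup>2)"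
        using True by (intro tendsto_intros elim0) auto
      then show ?thesis using True by (simp add: f_def)
    qed (simp add: f_def)
    then show "AE x in M\<Omega>. (\<lambda>n. f n (u x) *\<^sub>R g x) \<longlonglongrightarrow> (if u x > a then 1 else 0) *\<^sub>R g x"
      by (intro AE_I2 tendsto_scaleR tendsto_const)
  qed
qed

lemma H10_square_bounded:
  assumes "H10 u g" "\<And>x. \<bar>u x\<bar> \<le> A"
  shows "H10 (\<lambda>x. (u x)\<^sup>2) (\<lambda>x. (2 * u x) *\<^sub>R g x)"
proof (rule H10_chain_bounded[OF assms, of "\<lambda>t. t\<^sup>2" "\<lambda>t. 2 * t"])
  show "((\<lambda>t. t\<^sup>2) has_real_derivative 2 * t) (at t)" for t :: real by (auto intro!: derivative_eq_intros)
qed (auto intro!: continuous_intros)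

text \<open>Polarization: u v = ((u + v)^2 - (u - v)^2) / 4 reduces the product rule to the chain
  rule for squares.\<close>

lemma H10_mult:
  assumes u: "H10 u g" "\<And>x. \<bar>u x\<bar> \<le> A" and v: "H10 v h" "\<And>x. \<bar>v x\<bar> \<le> B"
  shows "H10 (\<lambda>x. u x * v x) (\<lambda>x. u x *\<^sub>R h x + v x *\<^sub>R g x)"
proof -
  have b: "\<bar>u x + v x\<bar> \<le> A + B" "\<bar>u x - v x\<bar> \<le> A + B" for x using u(2)[of x] v(2)[of x] by linarith+
  have "H10 (\<lambda>x. (1/4) * ((u x + v x)\<^sup>2 - (u x - v x)\<^sup>2))
     (\<lambda>x. (1/4) *\<^sub>R ((2 * (u x + v x)) *\<^sub>R (g x + h x) - (2 * (u x - v x)) *\<^sub>R (g x - h x)))"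
    by (rule H10_scale[OF H10_diff[OF H10_square_bounded[OF H10_add[OF u(1) v(1)] b(1)]
        H10_square_bounded[OF H10_diff[OF u(1) v(1)] b(2)]]])
  moreover have "(1/4) * ((u x + v x)\<^sup>2 - (u x - v x)\<^sup>2) = u x * v x" for x
    by (simp add: power2_eq_square algebra_simps)
  moreover have "(1/4) *\<^sub>R ((2 * (u x + v x)) *\<^sub>R (g x + h x) - (2 * (u x - v x)) *\<^sub>R (g x - h x)) = u x *\<^sub>R h x + v x *\<^sub>R g x" for x
  proof (rule euclidean_eqI)
    fix b :: 'a
    show "((1/4) *\<^sub>R ((2 * (u x + v x)) *\<^sub>R (g x + h x) - (2 * (u x - v x)) *\<^sub>R (g x - h x))) \<bullet> b = (u x *\<^sub>R h x + v x *\<^sub>R g x) \<bullet> b"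
      by (simp add: inner_simps algebra_simps)
  qed
  ultimately show ?thesis by simp
qed

end

section \<open>Compactness\<close>

lemma nrm2_le_diff_add: "sqi M f \<Longrightarrow> sqi M k \<Longrightarrow> nrm2 M f \<le> nrm2 M (\<lambda>x. f x - k x) + nrm2 M k"
  using nrm2_triangle[OF sqi_diff, of M f k k] by simp

lemma nrm2_diff_le: "sqi M f \<Longrightarrow> sqi M k \<Longrightarrow> nrm2 M (\<lambda>x. f x - k x) \<le> nrm2 M f + nrm2 M k"
  using nrm2_triangle[OF _ sqi_minus, of M f k] nrm2_scaleR[of M "-1" k] by simp

section \<open>Translation estimates for test functions\<close>

lemma nrm2_translate_lborel:
  fixes f :: "'a::euclidean_space \<Rightarrow> real"
  assumes "f \<in> borel_measurable borel"
  shows "nrm2 lborel (\<lambda>x. f (x + c)) = nrm2 lborel f"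
proof -
  have "(\<lambda>x. (norm (f x))\<^sup>2) \<in> borel_measurable borel" using assms by measurable
  from lborel_integral_translate[OF this, of c] show ?thesis by (simp add: nrm2_def)
qed

lemma test_fun_translate_sqi:
  assumes "test_fun \<Omega> \<phi>" shows "sqi lborel (\<lambda>x. \<phi> (x + c))"
proof -
  obtain C r where C: "\<And>x. \<bar>\<phi> x\<bar> \<le> C" "\<And>x. r < norm x \<Longrightarrow> \<phi> x = 0"
    using test_fun_bounds[OF assms] by blast
  note [measurable] = smooth_fun_borel_measurable[OF test_fun_smooth[OF assms]]
  have "integrable lborel (\<lambda>x. (norm (\<phi> (x + c)))\<^sup>2)"
  proof (rule integrable_bounded_support_lborel[where C="C\<^sup>2" and r="r + norm c"])
    show "(\<lambda>x. (norm (\<phi> (x + c)))\<^sup>2) \<in> borel_measurable borel" by measurable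
    show "norm ((norm (\<phi> (x + c)))\<^sup>2) \<le> C\<^sup>2" for x
      using power_mono[OF C(1)[of "x + c"], of 2] by simp
    show "(norm (\<phi> (x + c)))\<^sup>2 = 0" if "r + norm c < norm x" for x
    proof -
      have "norm x \<le> norm (x + c) + norm c" using norm_triangle_ineq4[of "x + c" c] by simp
      then show ?thesis using C(2)[of "x + c"] that by simp
    qed
  qed
  then show ?thesis by (simp add: sqi_def)
qed

lemma test_fun_translation_telescope:
  assumes t: "test_fun \<Omega> \<phi>"
  shows "nrm2 lborel (\<lambda>x. \<phi> (x + real k *\<^sub>R e) - \<phi> x) \<le> real k * nrm2 lborel (\<lambda>x. \<phi> (x + e) - \<phi> x)"
proof (induction k)
  case 0
  then show ?case by (simp add: nrm2_def)
next
  case (Suc k)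
  note [measurable] = smooth_fun_borel_measurable[OF test_fun_smooth[OF t]]
  let ?f = "\<lambda>x. \<phi> (x + real k *\<^sub>R e) - \<phi> x"
  have 0: "sqi lborel \<phi>" using test_fun_translate_sqi[OF t, of 0] by simp
  have "sqi lborel (\<lambda>x. \<phi> (x + (e + real k *\<^sub>R e)) - \<phi> (x + e))"
    by (intro sqi_diff test_fun_translate_sqi[OF t])
  then have 1: "sqi lborel (\<lambda>x. ?f (x + e))" by (simp add: add.assoc)
  have 2: "sqi lborel (\<lambda>x. \<phi> (x + e) - \<phi> x)" by (intro sqi_diff test_fun_translate_sqi[OF t] 0)
  have "(\<lambda>x. \<phi> (x + real (Suc k) *\<^sub>R e) - \<phi> x) = (\<lambda>x. ?f (x + e) + (\<phi> (x + e) - \<phi> x))"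
    by (simp add: algebra_simps)
  then have "nrm2 lborel (\<lambda>x. \<phi> (x + real (Suc k) *\<^sub>R e) - \<phi> x)
      \<le> nrm2 lborel (\<lambda>x. ?f (x + e)) + nrm2 lborel (\<lambda>x. \<phi> (x + e) - \<phi> x)"
    using nrm2_triangle[OF 1 2] by simp
  also have "nrm2 lborel (\<lambda>x. ?f (x + e)) = nrm2 lborel ?f"
    by (rule nrm2_translate_lborel) measurable
  finally show ?case using Suc.IH by (simp add: algebra_simps)
qed

text \<open>Cutting the translation by \<open>h\<close> into n + 1 equal steps bounds it by the norm
  of the difference quotient with step 1/(n + 1), and this norm tends to that of the directional
  derivative.\<close>

lemma test_fun_translation_bound:
  assumes t: "test_fun \<Omega> \<phi>"
  shows "nrm2 lborel (\<lambda>x. \<phi> (x + h) - \<phi> x) \<le> norm h * nrm2 lborel (grad \<phi>)"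
proof -
  note [measurable] = smooth_fun_borel_measurable[OF test_fun_smooth[OF t]] smooth_fun_grad_borel_measurable[OF test_fun_smooth[OF t]]
  let ?q = "\<lambda>n x. (\<phi> (x + (1 / real (Suc n)) *\<^sub>R h) - \<phi> x) * real (Suc n)"
  have le: "nrm2 lborel (\<lambda>x. \<phi> (x + h) - \<phi> x) \<le> nrm2 lborel (?q n)" for n
  proof -
    have "nrm2 lborel (\<lambda>x. \<phi> (x + real (Suc n) *\<^sub>R ((1 / real (Suc n)) *\<^sub>R h)) - \<phi> x)
       \<le> real (Suc n) * nrm2 lborel (\<lambda>x. \<phi> (x + (1 / real (Suc n)) *\<^sub>R h) - \<phi> x)"
      by (rule test_fun_translation_telescope[OF t])
    also have "\<dots> = nrm2 lborel (\<lambda>x. real (Suc n) *\<^sub>R (\<phi> (x + (1 / real (Suc n)) *\<^sub>R h) - \<phi> x))"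
      unfolding nrm2_scaleR by simp
    also have "\<dots> = nrm2 lborel (?q n)" by (simp add: mult.commute)
    finally show ?thesis by simp
  qed
  obtain C r where C: "\<And>x n. \<bar>?q n x\<bar> \<le> C * indicator (cball 0 r) x"
    using test_fun_difference_quotient(2)[OF t, of h] by blast
  have "(\<lambda>n. \<integral>x. (norm (?q n x))\<^sup>2 \<partial>lborel) \<longlonglongrightarrow> (\<integral>x. (norm (grad \<phi> x \<bullet> h))\<^sup>2 \<partial>lborel)"
  proof (rule integral_dominated_convergence[where w="\<lambda>x. C\<^sup>2 * indicator (cball 0 r) x"])
    show "integrable lborel (\<lambda>x::'a. C\<^sup>2 * indicator (cball 0 r) x)" by (rule integrable_indicator_cball)
    show "AE x in lborel. (\<lambda>n. (norm (?q n x))\<^sup>2) \<longlonglongrightarrow> (norm (grad \<phi> x \<bullet> h))\<^sup>2"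
      by (intro AE_I2 tendsto_intros test_fun_difference_quotient(1)[OF t])
    show "AE x in lborel. norm ((norm (?q n x))\<^sup>2) \<le> C\<^sup>2 * indicator (cball 0 r) x" for n
    proof (rule AE_I2)
      fix x
      have "(\<bar>?q n x\<bar>)\<^sup>2 \<le> (C * indicator (cball 0 r) x)\<^sup>2" by (rule power_mono[OF C]) simp
      also have "\<dots> = C\<^sup>2 * indicator (cball 0 r) x" by (auto simp: indicator_def)
      finally show "norm ((norm (?q n x))\<^sup>2) \<le> C\<^sup>2 * indicator (cball 0 r) x" by simp
    qed
  qed auto
  from tendsto_real_sqrt[OF this] have "(\<lambda>n. nrm2 lborel (?q n)) \<longlonglongrightarrow> nrm2 lborel (\<lambda>x. grad \<phi> x \<bullet> h)"
    unfolding nrm2_def .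
  then have "nrm2 lborel (\<lambda>x. \<phi> (x + h) - \<phi> x) \<le> nrm2 lborel (\<lambda>x. grad \<phi> x \<bullet> h)"
    using le by (intro LIMSEQ_le_const) auto
  also have "\<dots> \<le> nrm2 lborel (\<lambda>x. norm h *\<^sub>R grad \<phi> x)"
  proof (rule nrm2_mono)
    obtain C r where C: "\<And>x. norm (grad \<phi> x) \<le> C" "\<And>x. r < norm x \<Longrightarrow> grad \<phi> x = 0"
      using test_fun_bounds[OF t] by blast
    have "integrable lborel (\<lambda>x. (norm (grad \<phi> x))\<^sup>2)"
      by (rule integrable_bounded_support_lborel[where C="C\<^sup>2" and r=r]) (use C in \<open>auto intro: power_mono\<close>)
    then have "sqi lborel (grad \<phi>)" by (simp add: sqi_def)
    then show "sqi lborel (\<lambda>x. norm h *\<^sub>R grad \<phi> x)" by (rule sqi_scaleR)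
    show "AE x in lborel. norm (grad \<phi> x \<bullet> h) \<le> norm (norm h *\<^sub>R grad \<phi> x)"
      using Cauchy_Schwarz_ineq2[of "grad \<phi> _" h] by (simp add: mult.commute)
  qed measurable
  also have "\<dots> = norm h * nrm2 lborel (grad \<phi>)" by (simp add: nrm2_scaleR)
  finally show ?thesis .
qed

section \<open>Compact embedding into L2 by averaging over translations\<close>

context bounded_domain
begin

lemma nrm2_domain_lborel:
  fixes f :: "'a \<Rightarrow> 'b::euclidean_space"
  assumes [measurable]: "f \<in> borel_measurable borel" and "\<And>x. x \<notin> \<Omega> \<Longrightarrow> f x = 0"
  shows "nrm2 M\<Omega> f = nrm2 lborel f"
  unfolding nrm2_def using assms(2) by (subst integral_domain_lborel) auto

text \<open>The squared norm of the translation difference equals twice the squared norm of \<phi>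
  minus twice the correlation with its translate; a factor 1/2 in front of the gradient term is
  given away.\<close>

lemma test_fun_autocorrelation:
  assumes t: "test_fun \<Omega> \<phi>"
  shows "(nrm2 M\<Omega> \<phi>)\<^sup>2 \<le> (norm h)\<^sup>2 * (nrm2 M\<Omega> (grad \<phi>))\<^sup>2 + (\<integral>x. \<phi> x * \<phi> (x + h) \<partial>lborel)"
proof -
  note s = test_fun_smooth[OF t]
  note [measurable] = smooth_fun_borel_measurable[OF s]
  have out: "\<phi> x = 0" "grad \<phi> x = 0" if "x \<notin> \<Omega>" for x using test_fun_bounds[OF t] that by blast+
  have e: "nrm2 M\<Omega> \<phi> = nrm2 lborel \<phi>" "nrm2 M\<Omega> (grad \<phi>) = nrm2 lborel (grad \<phi>)"
    using out by (auto intro!: nrm2_domain_lborel smooth_fun_borel_measurable smooth_fun_grad_borel_measurable s)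
  have q: "sqi lborel \<phi>" "sqi lborel (\<lambda>x. \<phi> (x + h))"
    using test_fun_translate_sqi[OF t, of 0] test_fun_translate_sqi[OF t, of h] by simp_all
  have "(nrm2 lborel (\<lambda>x. \<phi> (x + h) - \<phi> x))\<^sup>2 = (\<integral>x. (norm (\<phi> (x + h)))\<^sup>2 - 2 * (\<phi> x * \<phi> (x + h)) + (norm (\<phi> x))\<^sup>2 \<partial>lborel)"
    unfolding nrm2_power2 by (intro Bochner_Integration.integral_cong refl) (simp add: power2_eq_square algebra_simps)
  also have "\<dots> = (nrm2 lborel (\<lambda>x. \<phi> (x + h)))\<^sup>2 - 2 * (\<integral>x. \<phi> x * \<phi> (x + h) \<partial>lborel) + (nrm2 lborel \<phi>)\<^sup>2"
    unfolding nrm2_power2 using sqi_integrable[OF q(1)] sqi_integrable[OF q(2)] sqi_mult_integrable[OF q] by simp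
  also have "nrm2 lborel (\<lambda>x. \<phi> (x + h)) = nrm2 lborel \<phi>" by (rule nrm2_translate_lborel) measurable
  finally have "2 * (nrm2 lborel \<phi>)\<^sup>2 = (nrm2 lborel (\<lambda>x. \<phi> (x + h) - \<phi> x))\<^sup>2 + 2 * (\<integral>x. \<phi> x * \<phi> (x + h) \<partial>lborel)" by simp
  moreover have "(nrm2 lborel (\<lambda>x. \<phi> (x + h) - \<phi> x))\<^sup>2 \<le> (norm h * nrm2 lborel (grad \<phi>))\<^sup>2"
    by (intro power_mono test_fun_translation_bound[OF t] nrm2_nonneg)
  moreover have "(norm h * nrm2 lborel (grad \<phi>))\<^sup>2 \<ge> 0" by simp
  ultimately show ?thesis unfolding e power_mult_distrib by linarith
qed

text \<open>The previous bound is integrated over \<open>h\<close> in a ball of radius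
  \<open>r\<close>. Fubini turns the correlation into the pairing of \<phi> with its unnormalized
  ball means \<open>m\<close>, which weak convergence controls at every point.\<close>

lemma test_fun_averaged_autocorrelation:
  assumes t: "test_fun \<Omega> \<phi>" and r: "0 < r"
  defines "m \<equiv> \<lambda>x. \<integral>y. \<phi> y * indicator (cball x r) y \<partial>M\<Omega>"
  shows "measure lborel (cball (0::'a) r) * (nrm2 M\<Omega> \<phi>)\<^sup>2
      \<le> measure lborel (cball (0::'a) r) * (r\<^sup>2 * (nrm2 M\<Omega> (grad \<phi>))\<^sup>2) + (\<integral>x. \<phi> x * m x \<partial>M\<Omega>)"
    and "m \<in> borel_measurable M\<Omega>"
proof -
  note s = test_fun_smooth[OF t]
  note [measurable] = smooth_fun_borel_measurable[OF s]
  have out: "\<phi> x = 0" if "x \<notin> \<Omega>" for x using test_fun_bounds[OF t] that by blast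
  obtain C R where C: "0 < C" "\<And>x. \<bar>\<phi> x\<bar> \<le> C" "\<And>x. R < norm x \<Longrightarrow> \<phi> x = 0"
    using test_fun_bounds[OF t] by blast
  have indm: "(\<lambda>y. \<phi> y * indicator (cball x r) y) \<in> borel_measurable borel" for x
    by (intro borel_measurable_times borel_measurable_indicator) auto
  let ?B = "cball (0::'a) r"
  define F where "F h x = indicator ?B h * (\<phi> x * \<phi> (x + h))" for h x
  have Fm: "(\<lambda>p. F (fst p) (snd p)) \<in> borel_measurable borel"
  proof -
    have "(\<lambda>p::'a\<times>'a. indicator ?B (fst p) :: real) \<in> borel_measurable borel"
      by (rule measurable_compose[OF borel_measurable_continuous_onI[OF continuous_on_fst[OF continuous_on_id]]])
        (rule borel_measurable_indicator, simp)
    moreover have "(\<lambda>p::'a\<times>'a. \<phi> (snd p) * \<phi> (snd p + fst p)) \<in> borel_measurable borel"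
      by (rule borel_measurable_continuous_onI)
        (intro continuous_intros continuous_on_compose2[OF smooth_fun_continuous[OF s, of UNIV]]; simp)
    ultimately show ?thesis unfolding F_def by (rule borel_measurable_times)
  qed
  have "integrable lborel (\<lambda>p. F (fst p) (snd p))"
  proof (rule integrable_bounded_support_lborel[OF Fm, where C="C * C" and r="r + R"])
    fix p :: "'a \<times> 'a"
    have "\<bar>\<phi> (snd p)\<bar> * \<bar>\<phi> (snd p + fst p)\<bar> \<le> C * C" using C by (intro mult_mono) auto
    then show "norm (F (fst p) (snd p)) \<le> C * C" using C(1) by (auto simp: F_def indicator_def abs_mult)
    assume a: "r + R < norm p"
    have "norm p \<le> norm (fst p) + norm (snd p)" using norm_Pair_le[of "fst p" "snd p"] by simp
    then have "r < norm (fst p) \<or> R < norm (snd p)" using a by linarith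
    then show "F (fst p) (snd p) = 0" using C(3) by (auto simp: F_def)
  qed
  then have Fi: "integrable (lborel \<Otimes>\<^sub>M lborel) (\<lambda>(h, x). F h x)"
    by (simp add: lborel_prod case_prod_unfold)
  have sw: "(\<integral>x. (\<integral>h. F h x \<partial>lborel) \<partial>lborel) = (\<integral>h. (\<integral>x. F h x \<partial>lborel) \<partial>lborel)"
    by (rule lborel_pair.Fubini_integral[OF Fi])
  have inner: "(\<integral>h. F h x \<partial>lborel) = \<phi> x * m x" for x
  proof -
    have "(\<integral>h. F h x \<partial>lborel) = \<phi> x * (\<integral>h. indicator ?B h * \<phi> (x + h) \<partial>lborel)"
      by (simp add: F_def mult.left_commute flip: integral_mult_right_zero)
    also have "(\<integral>h. indicator ?B h * \<phi> (x + h) \<partial>lborel) = (\<integral>h. \<phi> (h + x) * indicator (cball x r) (h + x) \<partial>lborel)"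
      by (intro Bochner_Integration.integral_cong refl) (auto simp: indicator_def dist_norm add.commute mult.commute)
    also have "\<dots> = (\<integral>y. \<phi> y * indicator (cball x r) y \<partial>lborel)"
      by (rule lborel_integral_translate[OF indm])
    also have "\<dots> = m x" unfolding m_def by (rule integral_domain_lborel[OF indm, symmetric]) (simp add: out)
    finally show ?thesis .
  qed
  have cm: "(\<lambda>x. (\<integral>y. \<phi> y * indicator (cball x r) y \<partial>lborel)) \<in> borel_measurable lborel"
  proof (rule lborel.borel_measurable_lebesgue_integral)
    have "(\<lambda>p::'a\<times>'a. \<phi> (snd p) * indicator {..r} (dist (fst p) (snd p))) \<in> borel_measurable (lborel \<Otimes>\<^sub>M lborel)"
      by measurable
    moreover have "(\<lambda>(x, y). \<phi> y * indicator (cball x r) y) = (\<lambda>p::'a\<times>'a. \<phi> (snd p) * indicator {..r} (dist (fst p) (snd p)))"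
      by (auto simp: indicator_def fun_eq_iff)
    ultimately show "(\<lambda>(x, y). \<phi> y * indicator (cball x r) y) \<in> borel_measurable (lborel \<Otimes>\<^sub>M lborel)"
      by simp
  qed
  have mm: "m = (\<lambda>x. (\<integral>y. \<phi> y * indicator (cball x r) y \<partial>lborel))"
    unfolding m_def by (rule ext, rule integral_domain_lborel[OF indm]) (simp add: out)
  then have mb [measurable]: "m \<in> borel_measurable borel" using cm by simp
  then show "m \<in> borel_measurable M\<Omega>" by (rule borel_imp_measurable_domain)
  have fin: "emeasure lborel ?B < \<infinity>" by (rule emeasure_lborel_cball_finite)
  have "measure lborel ?B * (nrm2 M\<Omega> \<phi>)\<^sup>2 - measure lborel ?B * (r\<^sup>2 * (nrm2 M\<Omega> (grad \<phi>))\<^sup>2)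
      = (\<integral>h. indicator ?B h * ((nrm2 M\<Omega> \<phi>)\<^sup>2 - r\<^sup>2 * (nrm2 M\<Omega> (grad \<phi>))\<^sup>2) \<partial>lborel)"
    by (subst integral_mult_left_zero) (simp add: algebra_simps)
  also have "\<dots> \<le> (\<integral>h. (\<integral>x. F h x \<partial>lborel) \<partial>lborel)"
  proof (rule integral_mono)
    show "integrable lborel (\<lambda>h. indicator ?B h * ((nrm2 M\<Omega> \<phi>)\<^sup>2 - r\<^sup>2 * (nrm2 M\<Omega> (grad \<phi>))\<^sup>2))"
      using fin by (intro integrable_mult_left integrable_real_indicator) auto
    show "integrable lborel (\<lambda>h. \<integral>x. F h x \<partial>lborel)" by (rule lborel_pair.integrable_fst[OF Fi])
    fix h :: 'a
    show "indicator ?B h * ((nrm2 M\<Omega> \<phi>)\<^sup>2 - r\<^sup>2 * (nrm2 M\<Omega> (grad \<phi>))\<^sup>2) \<le> (\<integral>x. F h x \<partial>lborel)"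
    proof (cases "h \<in> ?B")
      case True
      then have "(norm h)\<^sup>2 \<le> r\<^sup>2" by (intro power_mono) auto
      then have "(norm h)\<^sup>2 * (nrm2 M\<Omega> (grad \<phi>))\<^sup>2 \<le> r\<^sup>2 * (nrm2 M\<Omega> (grad \<phi>))\<^sup>2" by (rule mult_right_mono) simp
      then show ?thesis using test_fun_autocorrelation[OF t, of h] True by (simp add: F_def)
    qed (simp add: F_def)
  qed
  also have "\<dots> = (\<integral>x. \<phi> x * m x \<partial>lborel)" by (simp only: sw[symmetric] inner)
  also have "\<dots> = (\<integral>x. \<phi> x * m x \<partial>M\<Omega>)" using out by (subst integral_domain_lborel) auto
  finally show "measure lborel ?B * (nrm2 M\<Omega> \<phi>)\<^sup>2 \<le> measure lborel ?B * (r\<^sup>2 * (nrm2 M\<Omega> (grad \<phi>))\<^sup>2) + (\<integral>x. \<phi> x * m x \<partial>M\<Omega>)"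
    by linarith
qed

text \<open>A ball mean is the pairing with a fixed indicator, so weak convergence sends the means
  to zero at every point, and they are uniformly bounded. What remains is at most r^2 B^2 with
  \<open>r\<close> arbitrary.\<close>

lemma Rellich_test_fun:
  assumes t: "\<And>n. test_fun \<Omega> (\<phi> n)" and B: "\<And>n. nrm2 M\<Omega> (\<phi> n) \<le> B" "\<And>n. nrm2 M\<Omega> (grad (\<phi> n)) \<le> B"
    and w: "weakly_conv M\<Omega> \<phi> (\<lambda>x. 0)"
  shows "(\<lambda>n. nrm2 M\<Omega> (\<phi> n)) \<longlonglongrightarrow> 0"
proof -
  note s = test_fun_sqi[OF t]
  have B0: "0 \<le> B" using B(1)[of 0] nrm2_nonneg order_trans by blast
  have ev: "\<forall>\<^sub>F n in sequentially. (nrm2 M\<Omega> (\<phi> n))\<^sup>2 < r\<^sup>2 * B\<^sup>2 + e" if r: "0 < r" and e: "0 < e" for r e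
  proof -
    define m where "m n x = (\<integral>y. \<phi> n y * indicator (cball x r) y \<partial>M\<Omega>)" for n x
    define \<mu> where "\<mu> = measure lborel (cball (0::'a) r)"
    have \<mu>: "0 < \<mu>" unfolding \<mu>_def using content_cball_pos[OF r, of "0::'a"] by simp
    have ind: "sqi M\<Omega> (\<lambda>y. indicator (cball x r) y :: real)" for x
      by (rule sqi_bounded[of _ 1], rule borel_imp_measurable_domain, rule borel_measurable_indicator) (auto simp: indicator_def)
    have ml: "(\<lambda>n. m n x) \<longlonglongrightarrow> 0" for x
      using w[unfolded weakly_conv_def, rule_format, OF ind[of x]] by (simp add: m_def)
    have mb: "\<bar>m n x\<bar> \<le> B * nrm2 M\<Omega> (\<lambda>x. 1::real)" for n x
    proof -
      have "\<bar>m n x\<bar> \<le> nrm2 M\<Omega> (\<phi> n) * nrm2 M\<Omega> (\<lambda>y. indicator (cball x r) y :: real)"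
        using Cauchy_Schwarz_sqi[OF s(1)[of n] ind[of x]] by (simp add: m_def)
      also have "\<dots> \<le> B * nrm2 M\<Omega> (\<lambda>x. 1::real)"
        by (intro mult_mono B nrm2_nonneg B0 nrm2_mono[OF sqi_const sqi_measurable[OF ind]]) (simp add: indicator_def)
      finally show ?thesis .
    qed
    have "(\<lambda>n. \<integral>x. \<phi> n x \<bullet> m n x \<partial>M\<Omega>) \<longlonglongrightarrow> 0"
    proof (rule bounded_times_dominated[OF s(1) B(1) sqi_const[of "B * nrm2 M\<Omega> (\<lambda>x. 1::real)"]])
      show "m n \<in> borel_measurable M\<Omega>" for n
        using test_fun_averaged_autocorrelation(2)[OF t[of n] r] by (simp add: m_def[abs_def])
      show "AE x in M\<Omega>. norm (m n x) \<le> norm (B * nrm2 M\<Omega> (\<lambda>x. 1::real))" for n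
        using mb by (auto intro: order_trans[OF _ abs_ge_self])
    qed (use ml in simp)
    then have "(\<lambda>n. (\<integral>x. \<phi> n x * m n x \<partial>M\<Omega>) / \<mu>) \<longlonglongrightarrow> 0 / \<mu>" by (intro tendsto_divide tendsto_const) (use \<mu> in auto)
    then have "\<forall>\<^sub>F n in sequentially. (\<integral>x. \<phi> n x * m n x \<partial>M\<Omega>) / \<mu> < e"
      using e by (intro order_tendstoD(2)[where y=0]) auto
    then show ?thesis
    proof eventually_elim
      case (elim n)
      have "\<mu> * (nrm2 M\<Omega> (\<phi> n))\<^sup>2 \<le> \<mu> * (r\<^sup>2 * (nrm2 M\<Omega> (grad (\<phi> n)))\<^sup>2) + (\<integral>x. \<phi> n x * m n x \<partial>M\<Omega>)"
        using test_fun_averaged_autocorrelation(1)[OF t[of n] r] by (simp add: m_def \<mu>_def)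
      then have "(nrm2 M\<Omega> (\<phi> n))\<^sup>2 \<le> r\<^sup>2 * (nrm2 M\<Omega> (grad (\<phi> n)))\<^sup>2 + (\<integral>x. \<phi> n x * m n x \<partial>M\<Omega>) / \<mu>"
        using \<mu> by (simp add: field_simps)
      moreover have "r\<^sup>2 * (nrm2 M\<Omega> (grad (\<phi> n)))\<^sup>2 \<le> r\<^sup>2 * B\<^sup>2"
        by (intro mult_left_mono power_mono B nrm2_nonneg) simp
      ultimately show ?case using elim by linarith
    qed
  qed
  have "(\<lambda>n. (nrm2 M\<Omega> (\<phi> n))\<^sup>2) \<longlonglongrightarrow> 0"
  proof (rule order_tendstoI)
    fix a :: real assume "a < 0"
    then show "\<forall>\<^sub>F n in sequentially. a < (nrm2 M\<Omega> (\<phi> n))\<^sup>2" by (intro always_eventually allI) (auto intro: less_le_trans)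
  next
    fix a :: real assume a: "0 < a"
    \<comment> \<open>This radius gives r^2 (B^2 + 1) = a / 2; the summand 1 covers the case
      \<open>B = 0\<close>.\<close>
    define r where "r = sqrt (a / (2 * (B\<^sup>2 + 1)))"
    have p: "0 < B\<^sup>2 + 1" by (simp add: add_nonneg_pos)
    have r: "0 < r" using a p by (simp add: r_def)
    have r2: "r\<^sup>2 = a / (2 * (B\<^sup>2 + 1))" using a p by (simp add: r_def)
    have "r\<^sup>2 * B\<^sup>2 \<le> r\<^sup>2 * (B\<^sup>2 + 1)" by (intro mult_left_mono) auto
    also have "\<dots> = a / 2" unfolding r2 using p by (simp add: divide_simps)
    finally have "r\<^sup>2 * B\<^sup>2 \<le> a / 2" .
    then show "\<forall>\<^sub>F n in sequentially. (nrm2 M\<Omega> (\<phi> n))\<^sup>2 < a"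
      using ev[OF r, of "a / 2"] a by (auto elim!: eventually_mono)
  qed
  from tendsto_real_sqrt[OF this] show ?thesis by (simp add: nrm2_nonneg)
qed

text \<open>Each \<open>u n - v\<close> is replaced by a test function whose value and gradient
  errors are below 1/(n + 1). These test functions are bounded and converge weakly to zero, so the
  case of test functions applies.\<close>

lemma Rellich:
  assumes H: "\<And>n. H10 (u n) (g n)" and H0: "H10 v h" and B: "\<And>n. nrm2 M\<Omega> (u n) \<le> B" "\<And>n. nrm2 M\<Omega> (g n) \<le> B"
    and w: "weakly_conv M\<Omega> u v"
  shows "(\<lambda>n. nrm2 M\<Omega> (\<lambda>x. u n x - v x)) \<longlonglongrightarrow> 0"
proof -
  note d = H10_diff[OF H H0]
  note s = H10_sqi[OF H] note s0 = H10_sqi[OF H0] note ds = H10_sqi[OF d]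
  have "\<exists>\<phi>. test_fun \<Omega> \<phi> \<and> nrm2 M\<Omega> (\<lambda>x. \<phi> x - (u n x - v x)) < 1 / real (Suc n) \<and> nrm2 M\<Omega> (\<lambda>x. grad \<phi> x - (g n x - h x)) < 1 / real (Suc n)" for n
  proof -
    obtain f where f: "\<And>k. test_fun \<Omega> (f k)" "(\<lambda>k. nrm2 M\<Omega> (\<lambda>x. f k x - (u n x - v x))) \<longlonglongrightarrow> 0"
      "(\<lambda>k. nrm2 M\<Omega> (\<lambda>x. grad (f k) x - (g n x - h x))) \<longlonglongrightarrow> 0" using H10_approx[OF d[of n]] by blast
    have "\<forall>\<^sub>F k in sequentially. nrm2 M\<Omega> (\<lambda>x. f k x - (u n x - v x)) < 1 / real (Suc n) \<and> nrm2 M\<Omega> (\<lambda>x. grad (f k) x - (g n x - h x)) < 1 / real (Suc n)"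
      by (intro eventually_conj order_tendstoD(2)[OF f(2)] order_tendstoD(2)[OF f(3)]) auto
    then obtain k where "nrm2 M\<Omega> (\<lambda>x. f k x - (u n x - v x)) < 1 / real (Suc n) \<and> nrm2 M\<Omega> (\<lambda>x. grad (f k) x - (g n x - h x)) < 1 / real (Suc n)"
      using eventually_happens'[OF sequentially_bot] by blast
    with f(1) show ?thesis by blast
  qed
  then have "\<exists>\<phi>. \<forall>n. test_fun \<Omega> (\<phi> n) \<and> nrm2 M\<Omega> (\<lambda>x. \<phi> n x - (u n x - v x)) < 1 / real (Suc n) \<and> nrm2 M\<Omega> (\<lambda>x. grad (\<phi> n) x - (g n x - h x)) < 1 / real (Suc n)"
    by (intro choice allI)
  then obtain \<phi> where t: "\<And>n. test_fun \<Omega> (\<phi> n)" and c1: "\<And>n. nrm2 M\<Omega> (\<lambda>x. \<phi> n x - (u n x - v x)) < 1 / real (Suc n)"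
    and c2: "\<And>n. nrm2 M\<Omega> (\<lambda>x. grad (\<phi> n) x - (g n x - h x)) < 1 / real (Suc n)" by blast
  note ts = test_fun_sqi[OF t]
  have inv: "(\<lambda>n. 1 / real (Suc n)) \<longlonglongrightarrow> 0" using LIMSEQ_inverse_real_of_nat by (simp only: inverse_eq_divide)
  have z: "(\<lambda>n. nrm2 M\<Omega> (\<lambda>x. \<phi> n x - (u n x - v x))) \<longlonglongrightarrow> 0"
    by (rule tendsto_zero_le[OF nrm2_nonneg less_imp_le[OF c1] inv])
  have one: "1 / real (Suc n) \<le> 1" for n by simp
  have b1: "nrm2 M\<Omega> (\<phi> n) \<le> 1 + (B + (nrm2 M\<Omega> v + nrm2 M\<Omega> h))" for n
    using nrm2_le_diff_add[OF ts(1)[of n] ds(1)[of n]] nrm2_diff_le[OF s(1)[of n] s0(1)] c1[of n] one[of n] B(1)[of n] nrm2_nonneg[of M\<Omega> h] by linarith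
  have b2: "nrm2 M\<Omega> (grad (\<phi> n)) \<le> 1 + (B + (nrm2 M\<Omega> v + nrm2 M\<Omega> h))" for n
    using nrm2_le_diff_add[OF ts(2)[of n] ds(2)[of n]] nrm2_diff_le[OF s(2)[of n] s0(2)] c2[of n] one[of n] B(2)[of n] nrm2_nonneg[of M\<Omega> v] by linarith
  have "weakly_conv M\<Omega> \<phi> (\<lambda>x. 0)"
    unfolding weakly_conv_def
  proof (intro allI impI)
    fix k :: "'a \<Rightarrow> real" assume k: "sqi M\<Omega> k"
    have 1: "(\<lambda>n. \<integral>x. k x \<bullet> (\<phi> n x - (u n x - v x)) \<partial>M\<Omega>) \<longlonglongrightarrow> 0"
      by (rule bounded_times_vanishing[OF k order_refl sqi_diff[OF ts(1) ds(1)] z])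
    have "(\<lambda>n. (\<integral>x. u n x \<bullet> k x \<partial>M\<Omega>) - (\<integral>x. v x \<bullet> k x \<partial>M\<Omega>)) \<longlonglongrightarrow> 0"
      using w k by (simp add: weakly_conv_def LIM_zero)
    from tendsto_add[OF 1 this]
    have "(\<lambda>n. (\<integral>x. k x \<bullet> (\<phi> n x - (u n x - v x)) \<partial>M\<Omega>) + ((\<integral>x. u n x \<bullet> k x \<partial>M\<Omega>) - (\<integral>x. v x \<bullet> k x \<partial>M\<Omega>))) \<longlonglongrightarrow> 0" by simp
    moreover have "(\<integral>x. k x \<bullet> (\<phi> n x - (u n x - v x)) \<partial>M\<Omega>) + ((\<integral>x. u n x \<bullet> k x \<partial>M\<Omega>) - (\<integral>x. v x \<bullet> k x \<partial>M\<Omega>)) = (\<integral>x. \<phi> n x \<bullet> k x \<partial>M\<Omega>)" for n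
    proof -
      have "(\<integral>x. k x \<bullet> (\<phi> n x - (u n x - v x)) \<partial>M\<Omega>) = (\<integral>x. \<phi> n x \<bullet> k x - (u n x \<bullet> k x - v x \<bullet> k x) \<partial>M\<Omega>)"
        by (intro Bochner_Integration.integral_cong refl) (simp add: algebra_simps)
      also have "\<dots> = (\<integral>x. \<phi> n x \<bullet> k x \<partial>M\<Omega>) - ((\<integral>x. u n x \<bullet> k x \<partial>M\<Omega>) - (\<integral>x. v x \<bullet> k x \<partial>M\<Omega>))"
        using sqi_inner_integrable[OF ts(1)[of n] k] sqi_inner_integrable[OF s(1)[of n] k] sqi_inner_integrable[OF s0(1) k] by simp
      finally show ?thesis by simp
    qed
    ultimately show "(\<lambda>n. \<integral>x. \<phi> n x \<bullet> k x \<partial>M\<Omega>) \<longlonglongrightarrow> (\<integral>x. 0 \<bullet> k x \<partial>M\<Omega>)" by simp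
  qed
  from Rellich_test_fun[OF t b1 b2 this] have "(\<lambda>n. nrm2 M\<Omega> (\<phi> n)) \<longlonglongrightarrow> 0" .
  from tendsto_add[OF z this] have "(\<lambda>n. nrm2 M\<Omega> (\<lambda>x. \<phi> n x - (u n x - v x)) + nrm2 M\<Omega> (\<phi> n)) \<longlonglongrightarrow> 0" by simp
  moreover have "nrm2 M\<Omega> (\<lambda>x. u n x - v x) \<le> nrm2 M\<Omega> (\<lambda>x. \<phi> n x - (u n x - v x)) + nrm2 M\<Omega> (\<phi> n)" for n
    using nrm2_diff_le[OF ts(1)[of n] sqi_diff[OF ts(1)[of n] ds(1)[of n]]] by (simp add: add.commute)
  ultimately show ?thesis by (intro tendsto_zero_le[OF nrm2_nonneg])
qed

text \<open>A point of the closure is a class of functions on the whole space. Completeness of L2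
  over \<Omega> supplies an actual pair of functions on \<Omega> that represents it.\<close>

lemma closure_test_graph_rep:
  assumes "l \<in> closure test_graph"
  shows "\<exists>u g. H10 u g \<and> l = emb \<Omega> (\<lambda>x. (u x, g x))"
proof -
  obtain z where z: "\<forall>n. z n \<in> test_graph" "z \<longlonglongrightarrow> l" using assms unfolding closure_sequential by blast
  have "\<forall>n. \<exists>\<phi>. test_fun \<Omega> \<phi> \<and> z n = emb \<Omega> (\<lambda>x. (\<phi> x, grad \<phi> x))" using z(1) by (auto simp: test_graph_def)
  then obtain \<phi> where \<phi>: "\<And>n. test_fun \<Omega> (\<phi> n)" "\<And>n. z n = emb \<Omega> (\<lambda>x. (\<phi> n x, grad (\<phi> n) x))" by metis
  have f: "sqi M\<Omega> (\<lambda>x. (\<phi> n x, grad (\<phi> n) x))" for n using test_fun_sqi[OF \<phi>(1)] by (simp add: sqi_fst_snd)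
  have "Cauchy z" using z(2) by (rule LIMSEQ_imp_Cauchy)
  then have "\<exists>N. \<forall>m\<ge>N. \<forall>n\<ge>N. nrm2 M\<Omega> (\<lambda>x. (\<phi> m x, grad (\<phi> m) x) - (\<phi> n x, grad (\<phi> n) x)) < e" if "0 < e" for e
    using that unfolding Cauchy_def dist_norm \<phi>(2) by (simp add: emb_diff[OF sets_domain] emb_norm[OF sets_domain] f sqi_diff[OF f f, simplified])
  from Cauchy_sqi_convergent[OF f this] obtain F where F: "sqi M\<Omega> F" "(\<lambda>n. nrm2 M\<Omega> (\<lambda>x. (\<phi> n x, grad (\<phi> n) x) - F x)) \<longlonglongrightarrow> 0" by blast
  have "(\<lambda>n. dist (z n) (emb \<Omega> F)) \<longlonglongrightarrow> 0"
    using F by (simp add: dist_norm \<phi>(2) emb_diff[OF sets_domain f] emb_norm[OF sets_domain sqi_diff[OF f]])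
  then have "z \<longlonglongrightarrow> emb \<Omega> F" by (rule iffD2[OF tendsto_dist_iff])
  with z(2) have l: "l = emb \<Omega> F" by (rule LIMSEQ_unique)
  then have l': "l = emb \<Omega> (\<lambda>x. (fst (F x), snd (F x)))" by simp
  have "sqi M\<Omega> (\<lambda>x. (fst (F x), snd (F x)))" using F(1) by simp
  then have "H10 (\<lambda>x. fst (F x)) (\<lambda>x. snd (F x))"
    using assms unfolding H10_def l'[symmetric] sqi_fst_snd by blast
  with l' show ?thesis by blast
qed

text \<open>Weak convergence of the pairs is tested with (k, 0) for the functions and with (0, k)
  for the gradients.\<close>

lemma H10_weak_compactness:
  assumes H: "\<And>n. H10 (u n) (g n)" and B: "\<And>n. nrm2 M\<Omega> (\<lambda>x. (u n x, g n x)) \<le> B"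
  shows "\<exists>r v h. strict_mono (r::nat\<Rightarrow>nat) \<and> H10 v h \<and> weakly_conv M\<Omega> (\<lambda>n. u (r n)) v \<and> weakly_conv M\<Omega> (\<lambda>n. g (r n)) h"
proof -
  note s = H10_sqi[OF H]
  obtain r l where r: "strict_mono (r::nat\<Rightarrow>nat)" and l: "l \<in> closure test_graph"
    and lim: "\<And>y. (\<lambda>n. emb \<Omega> (\<lambda>x. (u (r n) x, g (r n) x)) \<bullet> y) \<longlonglongrightarrow> l \<bullet> y"
  proof (rule bounded_imp_weakly_convergent_subsequence[OF closed_closure subspace_closure_test_graph, of "\<lambda>n. emb \<Omega> (\<lambda>x. (u n x, g n x))" B])
    show "emb \<Omega> (\<lambda>x. (u n x, g n x)) \<in> closure test_graph" for n using H by (simp add: H10_def)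
    show "norm (emb \<Omega> (\<lambda>x. (u n x, g n x))) \<le> B" for n using B s(3) by (simp add: emb_norm[OF sets_domain])
  qed (rule that)
  obtain v h where vh: "H10 v h" and le: "l = emb \<Omega> (\<lambda>x. (v x, h x))" using closure_test_graph_rep[OF l] by blast
  note s0 = H10_sqi[OF vh]
  have lim': "(\<lambda>n. \<integral>x. (u (r n) x, g (r n) x) \<bullet> k x \<partial>M\<Omega>) \<longlonglongrightarrow> (\<integral>x. (v x, h x) \<bullet> k x \<partial>M\<Omega>)" if "sqi M\<Omega> k" for k
    using lim[of "emb \<Omega> k"] unfolding le emb_inner[OF sets_domain s(3) that] emb_inner[OF sets_domain s0(3) that] .
  have "weakly_conv M\<Omega> (\<lambda>n. u (r n)) v" unfolding weakly_conv_def
  proof (intro allI impI)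
    fix k :: "'a \<Rightarrow> real" assume "sqi M\<Omega> k"
    then have "sqi M\<Omega> (\<lambda>x. (k x, 0::'a))" by (simp add: sqi_fst_snd sqi_zero)
    from lim'[OF this] show "(\<lambda>n. \<integral>x. u (r n) x \<bullet> k x \<partial>M\<Omega>) \<longlonglongrightarrow> (\<integral>x. v x \<bullet> k x \<partial>M\<Omega>)" by simp
  qed
  moreover have "weakly_conv M\<Omega> (\<lambda>n. g (r n)) h" unfolding weakly_conv_def
  proof (intro allI impI)
    fix k :: "'a \<Rightarrow> 'a" assume "sqi M\<Omega> k"
    then have "sqi M\<Omega> (\<lambda>x. (0::real, k x))" by (simp add: sqi_fst_snd sqi_zero)
    from lim'[OF this] show "(\<lambda>n. \<integral>x. g (r n) x \<bullet> k x \<partial>M\<Omega>) \<longlonglongrightarrow> (\<integral>x. h x \<bullet> k x \<partial>M\<Omega>)" by simp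
  qed
  ultimately show ?thesis using r vh by blast
qed

end

section \<open>Functionals and integrands\<close>

context bounded_domain
begin

lemma Hm1_diff:
  assumes "Hm1 \<Omega> W" "Hm1 \<Omega> w" shows "Hm1 \<Omega> (\<lambda>v. W v - w v)"
proof -
  obtain C D where C: "\<forall>v. H01 \<Omega> v \<longrightarrow> \<bar>W v\<bar> \<le> C * h1norm \<Omega> v" and D: "\<forall>v. H01 \<Omega> v \<longrightarrow> \<bar>w v\<bar> \<le> D * h1norm \<Omega> v"
    using assms unfolding Hm1_def by blast
  have "\<forall>v. H01 \<Omega> v \<longrightarrow> \<bar>W v - w v\<bar> \<le> (C + D) * h1norm \<Omega> v"
  proof (intro allI impI)
    fix v assume "H01 \<Omega> v"
    with C D have "\<bar>W v\<bar> \<le> C * h1norm \<Omega> v" "\<bar>w v\<bar> \<le> D * h1norm \<Omega> v" by blast+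
    then show "\<bar>W v - w v\<bar> \<le> (C + D) * h1norm \<Omega> v" unfolding distrib_right by linarith
  qed
  then have b: "\<exists>C. \<forall>v. H01 \<Omega> v \<longrightarrow> \<bar>W v - w v\<bar> \<le> C * h1norm \<Omega> v" by blast
  have "W (\<lambda>x. u x + v x) - w (\<lambda>x. u x + v x) = (W u - w u) + (W v - w v)" if "H01 \<Omega> u" "H01 \<Omega> v" for u v
    using assms that unfolding Hm1_def by (metis add_diff_add)
  moreover have "W (\<lambda>x. c * u x) - w (\<lambda>x. c * u x) = c * (W u - w u)" if "H01 \<Omega> u" for u c
    using assms that unfolding Hm1_def by (metis right_diff_distrib)
  ultimately show ?thesis unfolding Hm1_def using b by blast
qed

text \<open>The supremum in \<open>hm1norm\<close> is finite by the bound in \<open>Hm1\<close>, and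
  normalizing \<open>v\<close> gives the estimate. A function of norm zero is handled by the bound
  itself.\<close>

lemma Hm1_le_hm1norm:
  assumes D: "Hm1 \<Omega> D" and v: "H10 v h"
  shows "\<bar>D v\<bar> \<le> hm1norm \<Omega> D * nrm2 M\<Omega> (\<lambda>x. (v x, h x))"
proof -
  obtain C where C: "\<And>v. H01 \<Omega> v \<Longrightarrow> \<bar>D v\<bar> \<le> C * h1norm \<Omega> v" using D unfolding Hm1_def by blast
  let ?A = "{\<bar>D v\<bar> | v. H01 \<Omega> v \<and> h1norm \<Omega> v \<le> 1}"
  let ?c = "nrm2 M\<Omega> (\<lambda>x. (v x, h x))"
  have hn: "0 \<le> h1norm \<Omega> w" for w by (simp add: h1norm_def set_integral_domain)
  have bdd: "bdd_above ?A"
  proof (rule bdd_aboveI)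
    fix y assume "y \<in> ?A"
    then obtain w where w: "H01 \<Omega> w" "h1norm \<Omega> w \<le> 1" and y: "y = \<bar>D w\<bar>" by blast
    have "y \<le> C * h1norm \<Omega> w" using C[OF w(1)] y by simp
    also have "\<dots> \<le> \<bar>C\<bar> * 1" using w(2) hn by (intro mult_mono) auto
    finally show "y \<le> \<bar>C\<bar>" by simp
  qed
  show ?thesis
  proof (cases "?c = 0")
    case True
    then show ?thesis using C[OF H10_imp_H01[OF v]] H10_h1norm[OF v] by simp
  next
    case False
    then have c: "0 < ?c" using nrm2_nonneg[of M\<Omega> "\<lambda>x. (v x, h x)"] by linarith
    note v' = H10_scale[OF v, of "1 / ?c"]
    have "h1norm \<Omega> (\<lambda>x. (1 / ?c) * v x) = nrm2 M\<Omega> (\<lambda>x. (1 / ?c) *\<^sub>R (v x, h x))"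
      using H10_h1norm[OF v'] by simp
    also have "\<dots> = 1" unfolding nrm2_scaleR using c by simp
    finally have "\<bar>D (\<lambda>x. (1 / ?c) * v x)\<bar> \<in> ?A" using H10_imp_H01[OF v'] by (intro CollectI exI[of _ "\<lambda>x. (1 / ?c) * v x"]) simp
    then have "\<bar>D (\<lambda>x. (1 / ?c) * v x)\<bar> \<le> hm1norm \<Omega> D" unfolding hm1norm_def by (rule cSup_upper[OF _ bdd])
    moreover have "D (\<lambda>x. (1 / ?c) * v x) = (1 / ?c) * D v" using D H10_imp_H01[OF v] unfolding Hm1_def by blast
    ultimately have "\<bar>D v\<bar> / ?c \<le> hm1norm \<Omega> D" using c by (simp add: abs_mult)
    then show ?thesis using c by (simp add: divide_le_eq)
  qed
qed

text \<open>The functional is transferred to the closure of the test graph, where the Riesz theorem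
  applies. With square integrable densities, the action on functions concentrated on a tail involves
  only the norm of the densities over that tail.\<close>

lemma Hm1_representation:
  assumes w: "Hm1 \<Omega> w"
  shows "\<exists>z k. sqi M\<Omega> z \<and> sqi M\<Omega> k \<and> (\<forall>v h. H10 v h \<longrightarrow> w v = (\<integral>x. (z x, k x) \<bullet> (v x, h x) \<partial>M\<Omega>))"
proof -
  obtain C where C: "\<And>v. H01 \<Omega> v \<Longrightarrow> \<bar>w v\<bar> \<le> C * h1norm \<Omega> v" using w unfolding Hm1_def by blast
  have wadd: "w (\<lambda>x. u x + v x) = w u + w v" if "H10 u g" "H10 v h" for u v g h
    using w H10_imp_H01[OF that(1)] H10_imp_H01[OF that(2)] unfolding Hm1_def by blast
  have wscale: "w (\<lambda>x. c * u x) = c * w u" if "H10 u g" for u g c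
    using w H10_imp_H01[OF that] unfolding Hm1_def by blast
  have wb: "\<bar>w v\<bar> \<le> C * norm (emb \<Omega> (\<lambda>x. (v x, h x)))" if "H10 v h" for v h
    using C[OF H10_imp_H01[OF that]] H10_h1norm[OF that] H10_sqi(3)[OF that] by (simp add: emb_norm[OF sets_domain])
  \<comment> \<open>Functions with equal classes differ by a function of norm zero, which
    \<open>w\<close> annihilates; so the value of \<open>f\<close> below is independent of the
    chosen representative.\<close>
  have wd: "w u = w v" if "H10 u g" "H10 v h" and e: "emb \<Omega> (\<lambda>x. (u x, g x)) = emb \<Omega> (\<lambda>x. (v x, h x))" for u v g h
  proof -
    note d = H10_diff[OF that(1,2)]
    have "emb \<Omega> (\<lambda>x. (u x - v x, g x - h x)) = emb \<Omega> (\<lambda>x. (u x, g x)) - emb \<Omega> (\<lambda>x. (v x, h x))"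
      using H10_sqi(3)[OF that(1)] H10_sqi(3)[OF that(2)] by (simp add: emb_diff[OF sets_domain])
    then have "\<bar>w (\<lambda>x. u x - v x)\<bar> \<le> 0" using wb[OF d] e by simp
    moreover have "w (\<lambda>x. v x + (u x - v x)) = w v + w (\<lambda>x. u x - v x)" by (rule wadd[OF that(2) d])
    ultimately show ?thesis by simp
  qed
  define f where "f l = w (SOME v. \<exists>h. H10 v h \<and> l = emb \<Omega> (\<lambda>x. (v x, h x)))" for l
  have f: "f (emb \<Omega> (\<lambda>x. (v x, h x))) = w v" if vh: "H10 v h" for v h
  proof -
    have "\<exists>v'. \<exists>h'. H10 v' h' \<and> emb \<Omega> (\<lambda>x. (v x, h x)) = emb \<Omega> (\<lambda>x. (v' x, h' x))" using vh by blast
    from someI_ex[OF this] obtain h' where "H10 (SOME v'. \<exists>h'. H10 v' h' \<and> emb \<Omega> (\<lambda>x. (v x, h x)) = emb \<Omega> (\<lambda>x. (v' x, h' x))) h'"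
      "emb \<Omega> (\<lambda>x. (v x, h x)) = emb \<Omega> (\<lambda>x. ((SOME v'. \<exists>h'. H10 v' h' \<and> emb \<Omega> (\<lambda>x. (v x, h x)) = emb \<Omega> (\<lambda>x. (v' x, h' x))) x, h' x))" by blast
    from wd[OF vh this] show ?thesis unfolding f_def by simp
  qed
  obtain y where y: "y \<in> closure test_graph" "\<And>l. l \<in> closure test_graph \<Longrightarrow> f l = y \<bullet> l"
  proof (rule Riesz_representation_subspace[OF closed_closure subspace_closure_test_graph, of f C])
    fix l m assume "l \<in> closure test_graph" "m \<in> closure test_graph"
    then obtain u g v h where H: "H10 u g" "H10 v h" and l: "l = emb \<Omega> (\<lambda>x. (u x, g x))" and m: "m = emb \<Omega> (\<lambda>x. (v x, h x))"
      using closure_test_graph_rep by meson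
    have "l + m = emb \<Omega> (\<lambda>x. (u x + v x, g x + h x))"
      unfolding l m using H10_sqi(3)[OF H(1)] H10_sqi(3)[OF H(2)] by (simp add: emb_add[OF sets_domain])
    then show "f (l + m) = f l + f m" using f[OF H10_add[OF H]] f[OF H(1)] f[OF H(2)] wadd[OF H] by (simp add: l m)
  next
    fix c l assume "l \<in> closure test_graph"
    then obtain u g where H: "H10 u g" and l: "l = emb \<Omega> (\<lambda>x. (u x, g x))" using closure_test_graph_rep by meson
    have "c *\<^sub>R l = emb \<Omega> (\<lambda>x. (c * u x, c *\<^sub>R g x))"
      unfolding l using H10_sqi(3)[OF H(1)] by (simp add: emb_scaleR[OF sets_domain])
    then show "f (c *\<^sub>R l) = c * f l" using f[OF H10_scale[OF H]] f[OF H] wscale[OF H] by (simp add: l)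
  next
    fix l assume "l \<in> closure test_graph"
    then obtain u g where H: "H10 u g" and l: "l = emb \<Omega> (\<lambda>x. (u x, g x))" using closure_test_graph_rep by meson
    show "\<bar>f l\<bar> \<le> C * norm l" using wb[OF H] f[OF H] by (simp add: l)
  qed (rule that)
  obtain z k where zk: "H10 z k" and yl: "y = emb \<Omega> (\<lambda>x. (z x, k x))" using closure_test_graph_rep[OF y(1)] by blast
  have "w v = (\<integral>x. (z x, k x) \<bullet> (v x, h x) \<partial>M\<Omega>)" if "H10 v h" for v h
    using y(2)[of "emb \<Omega> (\<lambda>x. (v x, h x))"] f[OF that] that emb_inner[OF sets_domain H10_sqi(3)[OF zk] H10_sqi(3)[OF that]]
    unfolding yl H10_def by simp
  then show ?thesis using H10_sqi[OF zk] by blast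
qed

text \<open>With a simple function in place of \<open>(u, g)\<close> the composition is a finite
  case distinction; pointwise approximation by simple functions and continuity in
  \<open>(s, \<xi>)\<close> give the general case.\<close>

lemma Caratheodory_measurable:
  fixes f :: "'a \<Rightarrow> real \<Rightarrow> 'a \<Rightarrow> real"
  assumes f: "\<And>s \<xi>. (\<lambda>x. f x s \<xi>) \<in> borel_measurable M\<Omega>"
    and c: "\<And>x. x \<in> \<Omega> \<Longrightarrow> continuous_on UNIV (\<lambda>(s, \<xi>). f x s \<xi>)"
    and u: "u \<in> borel_measurable M\<Omega>" and g: "g \<in> borel_measurable M\<Omega>"
  shows "(\<lambda>x. f x (u x) (g x)) \<in> borel_measurable M\<Omega>"
proof -
  have "(\<lambda>x. (u x, g x)) \<in> borel_measurable M\<Omega>" using u g by (rule borel_measurable_Pair)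
  from borel_measurable_implies_sequence_metric[OF this, of "(0, 0)"]
  obtain F where F: "\<And>i. simple_function M\<Omega> (F i)" "\<And>x. x \<in> space M\<Omega> \<Longrightarrow> (\<lambda>i. F i x) \<longlonglongrightarrow> (u x, g x)" by blast
  have Fm: "(\<lambda>x. (\<lambda>(s, \<xi>). f x s \<xi>) (F i x)) \<in> borel_measurable M\<Omega>" for i
  proof (rule measurable_compose_countable'[of "F i ` space M\<Omega>" "\<lambda>p x. (\<lambda>(s, \<xi>). f x s \<xi>) p"])
    note sf = simple_functionD[OF F(1)[of i]]
    show "countable (F i ` space M\<Omega>)" using sf(1) by (rule countable_finite)
    show "F i \<in> M\<Omega> \<rightarrow>\<^sub>M count_space (F i ` space M\<Omega>)"
      unfolding measurable_count_space_eq2[OF sf(1)] using sf(2) by auto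
    show "(\<lambda>x. (\<lambda>(s, \<xi>). f x s \<xi>) p) \<in> borel_measurable M\<Omega>" for p using f by (simp add: case_prod_unfold)
  qed
  show ?thesis
  proof (rule borel_measurable_LIMSEQ_metric[OF Fm])
    fix x assume x: "x \<in> space M\<Omega>"
    then have "x \<in> \<Omega>" by simp
    have "(\<lambda>i. (\<lambda>(s, \<xi>). f x s \<xi>) (F i x)) \<longlonglongrightarrow> (\<lambda>(s, \<xi>). f x s \<xi>) (u x, g x)"
      by (rule continuous_on_tendsto_compose[OF c[OF \<open>x \<in> \<Omega>\<close>] F(2)[OF x]]) auto
    then show "(\<lambda>i. (\<lambda>(s, \<xi>). f x s \<xi>) (F i x)) \<longlonglongrightarrow> f x (u x) (g x)" by simp
  qed
qed

end

section \<open>Consequences of convexity and growth of the integrand\<close>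

locale quasilinear_integrand = bounded_domain \<Omega> for \<Omega> :: "'a::euclidean_space set" +
  fixes j js :: "'a \<Rightarrow> real \<Rightarrow> 'a \<Rightarrow> real" and jxi :: "'a \<Rightarrow> real \<Rightarrow> 'a \<Rightarrow> 'a"
    and \<alpha> \<beta> :: "real \<Rightarrow> real" and \<alpha>0 R :: real
  assumes j_meas: "\<And>s \<xi>. set_borel_measurable lebesgue \<Omega> (\<lambda>x. j x s \<xi>)"
    and j_C1: "\<And>x s \<xi>. x \<in> \<Omega> \<Longrightarrow>
        ((\<lambda>(s', \<xi>'). j x s' \<xi>') has_derivative (\<lambda>(ds, d\<xi>). js x s \<xi> * ds + jxi x s \<xi> \<bullet> d\<xi>)) (at (s, \<xi>))"
    and jxi_cont: "\<And>x. x \<in> \<Omega> \<Longrightarrow> continuous_on UNIV (\<lambda>(s, \<xi>). jxi x s \<xi>)"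
    and H1: "\<And>x s. x \<in> \<Omega> \<Longrightarrow> strictly_convex_fun (j x s)"
    and \<alpha>0_pos: "\<alpha>0 > 0"
    and \<alpha>_pos: "\<And>t. t \<ge> 0 \<Longrightarrow> \<alpha> t > 0"
    and \<alpha>_mono: "mono_on {0..} \<alpha>"
    and H2: "\<And>x s \<xi>. x \<in> \<Omega> \<Longrightarrow>
        \<alpha>0 * (norm \<xi>)\<^sup>2 \<le> j x s \<xi> \<and> j x s \<xi> \<le> \<alpha> \<bar>s\<bar> * (norm \<xi>)\<^sup>2"
    and \<beta>_pos: "\<And>t. t \<ge> 0 \<Longrightarrow> \<beta> t > 0"
    and \<beta>_mono: "mono_on {0..} \<beta>"
    and H3: "\<And>x s \<xi>. x \<in> \<Omega> \<Longrightarrow> \<bar>js x s \<xi>\<bar> \<le> \<beta> \<bar>s\<bar> * (norm \<xi>)\<^sup>2"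
    and R_pos: "R > 0"
    and H4: "\<And>x s \<xi>. x \<in> \<Omega> \<Longrightarrow> \<bar>s\<bar> \<ge> R \<Longrightarrow> js x s \<xi> * s \<ge> 0"
begin

text \<open>The limit is along the sequence of steps 1/(n + 1), so that it serves both the convexity
  inequalities and the measurability of the partial derivatives.\<close>

lemma j_directional_limit:
  assumes "x \<in> \<Omega>"
  shows "(\<lambda>n. (j x (s + (1 / real (Suc n)) * ds) (\<xi> + (1 / real (Suc n)) *\<^sub>R d) - j x s \<xi>) * real (Suc n))
    \<longlonglongrightarrow> js x s \<xi> * ds + jxi x s \<xi> \<bullet> d"
proof -
  have p: "((\<lambda>t. (s + t * ds, \<xi> + t *\<^sub>R d)) has_derivative (\<lambda>t. (t * ds, t *\<^sub>R d))) (at 0)"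
    by (auto intro!: derivative_eq_intros)
  have "((\<lambda>(s', \<xi>'). j x s' \<xi>') has_derivative (\<lambda>(ds, d\<xi>). js x s \<xi> * ds + jxi x s \<xi> \<bullet> d\<xi>))
      (at (s + 0 * ds, \<xi> + 0 *\<^sub>R d))" using j_C1[OF assms, of s \<xi>] by simp
  from has_derivative_compose[OF p this]
  have "((\<lambda>t. j x (s + t * ds) (\<xi> + t *\<^sub>R d)) has_derivative (\<lambda>t. js x s \<xi> * (t * ds) + jxi x s \<xi> \<bullet> (t *\<^sub>R d))) (at 0)"
    by simp
  moreover have "(\<lambda>t. js x s \<xi> * (t * ds) + jxi x s \<xi> \<bullet> (t *\<^sub>R d)) = (*) (js x s \<xi> * ds + jxi x s \<xi> \<bullet> d)"
    by (auto simp: algebra_simps)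
  ultimately have "((\<lambda>t. j x (s + t * ds) (\<xi> + t *\<^sub>R d)) has_real_derivative (js x s \<xi> * ds + jxi x s \<xi> \<bullet> d)) (at 0)"
    by (simp only: has_field_derivative_def)
  then have "((\<lambda>t. (j x (s + t * ds) (\<xi> + t *\<^sub>R d) - j x s \<xi>) / t) \<longlongrightarrow> js x s \<xi> * ds + jxi x s \<xi> \<bullet> d) (at 0)"
    by (simp add: DERIV_def)
  moreover have "filterlim (\<lambda>n. 1 / real (Suc n)) (at 0) sequentially"
    using LIMSEQ_inverse_real_of_nat by (auto simp: filterlim_at inverse_eq_divide)
  ultimately have "(\<lambda>n. (j x (s + (1 / real (Suc n)) * ds) (\<xi> + (1 / real (Suc n)) *\<^sub>R d) - j x s \<xi>) / (1 / real (Suc n)))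
    \<longlonglongrightarrow> js x s \<xi> * ds + jxi x s \<xi> \<bullet> d"
    by (rule filterlim_compose)
  then show ?thesis by simp
qed

text \<open>Convexity bounds each difference quotient from \<xi> towards \<eta> by the full
  increment, and the quotients tend to the slope of the tangent.\<close>

lemma j_gradient_inequality:
  assumes x: "x \<in> \<Omega>" shows "j x s \<xi> + jxi x s \<xi> \<bullet> (\<eta> - \<xi>) \<le> j x s \<eta>"
proof (cases "\<xi> = \<eta>")
  case False
  have lim: "(\<lambda>n. (j x s (\<xi> + (1 / real (Suc n)) *\<^sub>R (\<eta> - \<xi>)) - j x s \<xi>) * real (Suc n)) \<longlonglongrightarrow> jxi x s \<xi> \<bullet> (\<eta> - \<xi>)"
    using j_directional_limit[OF x, of s 0 \<xi> "\<eta> - \<xi>"] by simp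
  \<comment> \<open>\<open>1 \<le> n\<close> keeps the step below 1, as the definition of strict
    convexity requires.\<close>
  have "(j x s (\<xi> + (1 / real (Suc n)) *\<^sub>R (\<eta> - \<xi>)) - j x s \<xi>) * real (Suc n) \<le> j x s \<eta> - j x s \<xi>" if "1 \<le> n" for n
  proof -
    let ?t = "1 / real (Suc n)"
    have t: "0 < ?t" "?t < 1" using that by auto
    have "j x s ((1 - ?t) *\<^sub>R \<xi> + ?t *\<^sub>R \<eta>) < (1 - ?t) * j x s \<xi> + ?t * j x s \<eta>"
      using H1[OF x, of s] False t unfolding strictly_convex_fun_def by blast
    also have "(1 - ?t) *\<^sub>R \<xi> + ?t *\<^sub>R \<eta> = \<xi> + ?t *\<^sub>R (\<eta> - \<xi>)" by (simp add: scaleR_diff_left scaleR_diff_right)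
    finally have "j x s (\<xi> + ?t *\<^sub>R (\<eta> - \<xi>)) - j x s \<xi> \<le> ?t * (j x s \<eta> - j x s \<xi>)" by (simp add: algebra_simps)
    then show ?thesis by (simp add: field_simps)
  qed
  then have "jxi x s \<xi> \<bullet> (\<eta> - \<xi>) \<le> j x s \<eta> - j x s \<xi>"
    by (intro LIMSEQ_le_const2[OF lim]) auto
  then show ?thesis by simp
qed simp

text \<open>The limit of difference quotients loses strictness. It is recovered at the midpoint,
  which lies above the tangent and strictly below the chord.\<close>

lemma j_strict_gradient_inequality:
  assumes x: "x \<in> \<Omega>" and ne: "\<xi> \<noteq> \<eta>" shows "j x s \<xi> + jxi x s \<xi> \<bullet> (\<eta> - \<xi>) < j x s \<eta>"
proof -
  let ?m = "(1 - 1/2) *\<^sub>R \<xi> + (1/2) *\<^sub>R \<eta>"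
  have "j x s ?m < (1 - 1/2) * j x s \<xi> + (1/2) * j x s \<eta>"
    using H1[OF x, of s, unfolded strictly_convex_fun_def, rule_format, of \<xi> \<eta> "1/2"] ne by simp
  moreover have "j x s \<xi> + jxi x s \<xi> \<bullet> (?m - \<xi>) \<le> j x s ?m" by (rule j_gradient_inequality[OF x])
  moreover have "?m - \<xi> = (1/2) *\<^sub>R (\<eta> - \<xi>)" by (simp add: scaleR_diff_right algebra_simps) (simp add: scaleR_2[symmetric] flip: scaleR_add_left)
  ultimately show ?thesis by simp
qed

lemma j_zero: "x \<in> \<Omega> \<Longrightarrow> j x s 0 = 0"
  using H2[of x 0 s] by simp

text \<open>The tangent inequality from \<xi> to 0, where the integrand vanishes.\<close>

lemma jxi_coercive:
  assumes x: "x \<in> \<Omega>" shows "\<alpha>0 * (norm \<xi>)\<^sup>2 \<le> jxi x s \<xi> \<bullet> \<xi>"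
  using j_gradient_inequality[OF x, of s \<xi> 0] j_zero[OF x] H2[OF x, of \<xi> s] by simp

text \<open>The tangent inequality is tested in the direction of \<open>jxi\<close> itself at
  distance \<open>r\<close>, and the upper growth bound on \<open>j\<close> limits the result. The
  choice r = |\<xi>| produces (2 |\<xi>|)^2, hence the constant 4.\<close>

lemma jxi_growth:
  assumes x: "x \<in> \<Omega>" shows "norm (jxi x s \<xi>) \<le> 4 * \<alpha> \<bar>s\<bar> * norm \<xi>"
proof -
  let ?v = "jxi x s \<xi>" and ?a = "\<alpha> \<bar>s\<bar>"
  have a: "0 < ?a" by (rule \<alpha>_pos) simp
  have key: "r * norm ?v \<le> ?a * (norm \<xi> + r)\<^sup>2" if r: "0 \<le> r" for r
  proof (cases "?v = 0")
    case False
    let ?d = "(r / norm ?v) *\<^sub>R ?v"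
    have "j x s \<xi> + ?v \<bullet> ((\<xi> + ?d) - \<xi>) \<le> j x s (\<xi> + ?d)" by (rule j_gradient_inequality[OF x])
    moreover have "?v \<bullet> ?d = r * norm ?v" using False by (simp add: dot_square_norm power2_eq_square)
    moreover have "0 \<le> j x s \<xi>" using H2[OF x, of \<xi> s] \<alpha>0_pos by (meson less_imp_le mult_nonneg_nonneg order_trans zero_le_power2)
    moreover have "j x s (\<xi> + ?d) \<le> ?a * (norm (\<xi> + ?d))\<^sup>2" using H2[OF x] by blast
    moreover have "norm (\<xi> + ?d) \<le> norm \<xi> + r" using norm_triangle_ineq[of \<xi> ?d] r False by simp
    then have "?a * (norm (\<xi> + ?d))\<^sup>2 \<le> ?a * (norm \<xi> + r)\<^sup>2" using a by (intro mult_left_mono power_mono) auto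
    ultimately show ?thesis by simp
  qed (use a in simp)
  show ?thesis
  proof (cases "\<xi> = 0")
    case True
    have "norm ?v \<le> 0"
    proof (rule field_le_epsilon)
      fix e :: real assume e: "0 < e"
      \<comment> \<open>For \<xi> = 0 the radius in \<open>key\<close> is free; this one yields
        \<open>norm ?v \<le> e\<close> for every positive \<open>e\<close>.\<close>
      have "(e / ?a) * norm ?v \<le> ?a * (norm \<xi> + e / ?a)\<^sup>2" using e a by (intro key) auto
      also have "\<dots> = (e / ?a) * e" using True a by (simp add: power2_eq_square)
      finally show "norm ?v \<le> 0 + e" using e a by (simp add: field_simps)
    qed
    then show ?thesis using True by simp
  next
    case False
    have "norm \<xi> * norm ?v \<le> ?a * (norm \<xi> + norm \<xi>)\<^sup>2" by (rule key) simp
    also have "\<dots> = norm \<xi> * (4 * ?a * norm \<xi>)" by (simp add: power2_eq_square algebra_simps)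
    finally show ?thesis using False by simp
  qed
qed

lemma jxi_zero: "x \<in> \<Omega> \<Longrightarrow> jxi x s 0 = 0"
  using jxi_growth[of x s 0] by simp

lemma jxi_growth_bounded:
  assumes x: "x \<in> \<Omega>" and "\<bar>s\<bar> \<le> k" shows "norm (jxi x s \<xi>) \<le> 4 * \<alpha> k * norm \<xi>"
proof -
  have "\<alpha> \<bar>s\<bar> \<le> \<alpha> k" using assms(2) by (intro mono_onD[OF \<alpha>_mono]) auto
  then have "4 * \<alpha> \<bar>s\<bar> * norm \<xi> \<le> 4 * \<alpha> k * norm \<xi>" by (intro mult_right_mono) auto
  then show ?thesis using jxi_growth[OF x, of s \<xi>] by linarith
qed

lemma js_growth_bounded:
  assumes x: "x \<in> \<Omega>" and "\<bar>s\<bar> \<le> k" shows "\<bar>js x s \<xi>\<bar> \<le> \<beta> k * (norm \<xi>)\<^sup>2"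
proof -
  have "\<beta> \<bar>s\<bar> \<le> \<beta> k" using assms(2) by (intro mono_onD[OF \<beta>_mono]) auto
  then have "\<beta> \<bar>s\<bar> * (norm \<xi>)\<^sup>2 \<le> \<beta> k * (norm \<xi>)\<^sup>2" by (intro mult_right_mono) auto
  then show ?thesis using H3[OF x, of s \<xi>] by linarith
qed

lemma jxi_monotone: "x \<in> \<Omega> \<Longrightarrow> 0 \<le> (jxi x s \<xi> - jxi x s \<eta>) \<bullet> (\<xi> - \<eta>)"
  using j_gradient_inequality[of x s \<xi> \<eta>] j_gradient_inequality[of x s \<eta> \<xi>]
  by (simp add: inner_diff_left inner_diff_right)

lemma jxi_strictly_monotone: "x \<in> \<Omega> \<Longrightarrow> \<xi> \<noteq> \<eta> \<Longrightarrow> 0 < (jxi x s \<xi> - jxi x s \<eta>) \<bullet> (\<xi> - \<eta>)"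
  using j_strict_gradient_inequality[of x \<xi> \<eta> s] j_strict_gradient_inequality[of x \<eta> \<xi> s]
  by (simp add: inner_diff_left inner_diff_right)

text \<open>The sequence \<xi> may be unbounded. If it stayed at distance \<open>e\<close> from
  \<eta> along a subsequence, monotonicity along rays would allow the points \<eta> + e d, with unit
  directions d, to replace it, the gap per unit of length being no larger. These points lie in a
  compact set, and their limit contradicts strict monotonicity.\<close>

lemma jxi_monotone_gap_imp_convergence:
  assumes x: "x \<in> \<Omega>" and s: "s \<longlonglongrightarrow> s0"
    and gap: "(\<lambda>n. (jxi x (s n) (\<xi> n) - jxi x (s n) \<eta>) \<bullet> (\<xi> n - \<eta>)) \<longlonglongrightarrow> 0"
  shows "\<xi> \<longlonglongrightarrow> \<eta>"
proof (rule ccontr)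
  assume "\<not> \<xi> \<longlonglongrightarrow> \<eta>"
  then obtain e where e: "0 < e" and "\<And>N. \<exists>n\<ge>N. e \<le> norm (\<xi> n - \<eta>)"
    unfolding LIMSEQ_iff by (meson not_le)
  then have "\<exists>r. \<forall>n. e \<le> norm (\<xi> (r n) - \<eta>) \<and> r n < (r (Suc n) :: nat)"
    by (intro dependent_nat_choice) (auto simp: Suc_le_eq[symmetric])
  then obtain r :: "nat \<Rightarrow> nat" where r: "\<And>n. e \<le> norm (\<xi> (r n) - \<eta>)" "strict_mono r"
    by (auto simp: strict_mono_Suc_iff)
  define d where "d n = (\<xi> (r n) - \<eta>) /\<^sub>R norm (\<xi> (r n) - \<eta>)" for n
  have p: "0 < norm (\<xi> (r n) - \<eta>)" for n using r(1)[of n] e by linarith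
  have "d n \<in> sphere 0 1" for n using p[of n] by (simp add: d_def)
  then obtain d0 q where d0: "d0 \<in> sphere 0 1" and q: "strict_mono (q::nat\<Rightarrow>nat)" and dq: "(d \<circ> q) \<longlonglongrightarrow> d0"
    using compact_sphere[of "0::'a" 1] unfolding compact_def by blast
  let ?t = "\<lambda>n. r (q n)"
  have sm: "strict_mono ?t" using r(2) q by (simp add: strict_mono_def)
  have st: "(\<lambda>n. s (?t n)) \<longlonglongrightarrow> s0" using LIMSEQ_subseq_LIMSEQ[OF s sm] by (simp add: o_def)
  have gt: "(\<lambda>n. ((jxi x (s (?t n)) (\<xi> (?t n)) - jxi x (s (?t n)) \<eta>) \<bullet> (\<xi> (?t n) - \<eta>)) / e) \<longlonglongrightarrow> 0 / e"
    using LIMSEQ_subseq_LIMSEQ[OF gap sm] e by (intro tendsto_divide tendsto_const) (auto simp: o_def)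
  have le: "(jxi x (s (?t n)) (\<eta> + e *\<^sub>R d (q n)) - jxi x (s (?t n)) \<eta>) \<bullet> d (q n)
      \<le> ((jxi x (s (?t n)) (\<xi> (?t n)) - jxi x (s (?t n)) \<eta>) \<bullet> (\<xi> (?t n) - \<eta>)) / e" for n
  proof -
    let ?l = "norm (\<xi> (?t n) - \<eta>)" and ?s = "s (?t n)" and ?d = "d (q n)"
    have l: "e \<le> ?l" "0 < ?l" using r(1) p by auto
    have xi: "\<xi> (?t n) - \<eta> = ?l *\<^sub>R ?d" using l by (simp add: d_def)
    then have xi': "\<xi> (?t n) = \<eta> + ?l *\<^sub>R ?d" by (simp add: algebra_simps)
    \<comment> \<open>Along the ray from \<eta> in direction \<open>?d\<close> the component of
      \<open>jxi\<close> in that direction is nondecreasing, and the distance goes down from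
      \<open>?l\<close> to \<open>e\<close>.\<close>
    have mono: "(jxi x ?s (\<eta> + e *\<^sub>R ?d)) \<bullet> ?d \<le> (jxi x ?s (\<xi> (?t n))) \<bullet> ?d"
    proof (cases "?l = e")
      case True
      then show ?thesis using xi' by simp
    next
      case False
      have "0 \<le> (jxi x ?s (\<xi> (?t n)) - jxi x ?s (\<eta> + e *\<^sub>R ?d)) \<bullet> (\<xi> (?t n) - (\<eta> + e *\<^sub>R ?d))"
        by (rule jxi_monotone[OF x])
      also have "\<xi> (?t n) - (\<eta> + e *\<^sub>R ?d) = (?l - e) *\<^sub>R ?d" using xi by (simp add: algebra_simps)
      finally show ?thesis using False l by (simp add: inner_diff_left zero_le_mult_iff)
    qed
    have "(jxi x ?s (\<eta> + e *\<^sub>R ?d) - jxi x ?s \<eta>) \<bullet> ?d \<le> (jxi x ?s (\<xi> (?t n)) - jxi x ?s \<eta>) \<bullet> ?d"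
      using mono by (simp add: inner_diff_left)
    also have "\<dots> = ((jxi x ?s (\<xi> (?t n)) - jxi x ?s \<eta>) \<bullet> (\<xi> (?t n) - \<eta>)) / ?l"
      unfolding d_def using l by (simp add: divide_inverse mult.commute)
    also have "\<dots> \<le> ((jxi x ?s (\<xi> (?t n)) - jxi x ?s \<eta>) \<bullet> (\<xi> (?t n) - \<eta>)) / e"
      using l e jxi_monotone[OF x] by (intro divide_left_mono) auto
    finally show ?thesis .
  qed
  have c: "(\<lambda>n. jxi x (s (?t n)) (\<eta> + e *\<^sub>R d (q n))) \<longlonglongrightarrow> jxi x s0 (\<eta> + e *\<^sub>R d0)"
  proof -
    have "(\<lambda>n. (s (?t n), \<eta> + e *\<^sub>R d (q n))) \<longlonglongrightarrow> (s0, \<eta> + e *\<^sub>R d0)"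
      using dq by (intro tendsto_intros st) (simp add: o_def)
    from continuous_on_tendsto_compose[OF jxi_cont[OF x] this] show ?thesis by simp
  qed
  have c2: "(\<lambda>n. jxi x (s (?t n)) \<eta>) \<longlonglongrightarrow> jxi x s0 \<eta>"
  proof -
    have "(\<lambda>n. (s (?t n), \<eta>)) \<longlonglongrightarrow> (s0, \<eta>)" by (intro tendsto_intros st)
    from continuous_on_tendsto_compose[OF jxi_cont[OF x] this] show ?thesis by simp
  qed
  have "(\<lambda>n. (jxi x (s (?t n)) (\<eta> + e *\<^sub>R d (q n)) - jxi x (s (?t n)) \<eta>) \<bullet> d (q n)) \<longlonglongrightarrow> (jxi x s0 (\<eta> + e *\<^sub>R d0) - jxi x s0 \<eta>) \<bullet> d0"
    using dq by (intro tendsto_inner tendsto_diff c c2) (simp add: o_def)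
  from LIMSEQ_le[OF this gt] le have "(jxi x s0 (\<eta> + e *\<^sub>R d0) - jxi x s0 \<eta>) \<bullet> d0 \<le> 0" by simp
  moreover have "0 < (jxi x s0 (\<eta> + e *\<^sub>R d0) - jxi x s0 \<eta>) \<bullet> ((\<eta> + e *\<^sub>R d0) - \<eta>)"
    using d0 e by (intro jxi_strictly_monotone[OF x]) auto
  ultimately show False using e by (simp add: zero_less_mult_iff)
qed

lemma j_continuous: "x \<in> \<Omega> \<Longrightarrow> continuous_on UNIV (\<lambda>(s, \<xi>). j x s \<xi>)"
  by (rule continuous_at_imp_continuous_on) (metis has_derivative_continuous j_C1 surj_pair)

lemma j_measurable:
  "u \<in> borel_measurable M\<Omega> \<Longrightarrow> g \<in> borel_measurable M\<Omega> \<Longrightarrow> (\<lambda>x. j x (u x) (g x)) \<in> borel_measurable M\<Omega>"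
  by (rule Caratheodory_measurable[OF j_meas[unfolded set_borel_measurable_domain] j_continuous])

text \<open>Measurability in \<open>x\<close> is given for \<open>j\<close>; the partial derivatives
  inherit it as pointwise limits of difference quotients.\<close>

lemma js_measurable:
  assumes u: "u \<in> borel_measurable M\<Omega>" and g: "g \<in> borel_measurable M\<Omega>"
  shows "(\<lambda>x. js x (u x) (g x)) \<in> borel_measurable M\<Omega>"
proof (rule borel_measurable_LIMSEQ_metric)
  show "(\<lambda>x. (j x (u x + 1 / real (Suc n)) (g x) - j x (u x) (g x)) * real (Suc n)) \<in> borel_measurable M\<Omega>" for n
    using j_measurable[OF borel_measurable_add[OF u borel_measurable_const[of "1 / real (Suc n)"]] g] j_measurable[OF u g] by simp
  show "(\<lambda>n. (j x (u x + 1 / real (Suc n)) (g x) - j x (u x) (g x)) * real (Suc n)) \<longlonglongrightarrow> js x (u x) (g x)" if "x \<in> space M\<Omega>" for x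
    using j_directional_limit[of x "u x" 1 "g x" 0] that by simp
qed

lemma jxi_measurable:
  assumes u: "u \<in> borel_measurable M\<Omega>" and g: "g \<in> borel_measurable M\<Omega>"
  shows "(\<lambda>x. jxi x (u x) (g x)) \<in> borel_measurable M\<Omega>"
proof (rule borel_measurable_euclidean_space[THEN iffD2], rule ballI)
  fix b :: 'a assume "b \<in> Basis"
  show "(\<lambda>x. jxi x (u x) (g x) \<bullet> b) \<in> borel_measurable M\<Omega>"
  proof (rule borel_measurable_LIMSEQ_metric)
    show "(\<lambda>x. (j x (u x) (g x + (1 / real (Suc n)) *\<^sub>R b) - j x (u x) (g x)) * real (Suc n)) \<in> borel_measurable M\<Omega>" for n
      using j_measurable[OF u borel_measurable_add[OF g borel_measurable_const[of "(1 / real (Suc n)) *\<^sub>R b"]]] j_measurable[OF u g] by simp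
    show "(\<lambda>n. (j x (u x) (g x + (1 / real (Suc n)) *\<^sub>R b) - j x (u x) (g x)) * real (Suc n)) \<longlonglongrightarrow> jxi x (u x) (g x) \<bullet> b" if "x \<in> space M\<Omega>" for x
      using j_directional_limit[of x "u x" 0 "g x" b] that by simp
  qed
qed

end

section \<open>Strong convergence\<close>

text \<open>For \<open>0 \<le> a\<close> this is \<open>s\<close> minus its truncation to
  [-a, a].\<close>

definition oddtail :: "real \<Rightarrow> real \<Rightarrow> real" where
  "oddtail a s = max 0 (s - a) - max 0 (- s - a)"

text \<open>For \<open>0 \<le> a\<close> this is the positive part of |s| - a.\<close>

definition eventail :: "real \<Rightarrow> real \<Rightarrow> real" where
  "eventail a s = max 0 (s - a) + max 0 (- s - a)"

context bounded_domain
begin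

lemma H10_tails:
  assumes u: "H10 u g" and a: "0 \<le> a"
  shows "H10 (\<lambda>x. oddtail a (u x)) (\<lambda>x. (if \<bar>u x\<bar> > a then 1 else 0) *\<^sub>R g x)"
    and "H10 (\<lambda>x. eventail a (u x)) (\<lambda>x. ((if u x > a then 1 else 0) - (if - u x > a then 1 else 0)) *\<^sub>R g x)"
proof -
  note p = H10_pospart[OF u a]
  have m: "H10 (\<lambda>x. max 0 (- u x - a)) (\<lambda>x. (if - u x > a then 1 else 0) *\<^sub>R - g x)"
    using H10_pospart[OF H10_scale[OF u, of "-1"] a] by simp
  have "(if u x > a then 1 else 0) *\<^sub>R g x - (if - u x > a then 1 else 0) *\<^sub>R - g x = (if \<bar>u x\<bar> > a then 1 else 0) *\<^sub>R g x" for x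
    using a by auto
  then show "H10 (\<lambda>x. oddtail a (u x)) (\<lambda>x. (if \<bar>u x\<bar> > a then 1 else 0) *\<^sub>R g x)"
    using H10_diff[OF p m] by (simp only: oddtail_def)
  have "(if u x > a then 1 else 0) *\<^sub>R g x + (if - u x > a then 1 else 0) *\<^sub>R - g x
      = ((if u x > a then 1 else 0) - (if - u x > a then 1 else 0)) *\<^sub>R g x" for x
    using a by auto
  then show "H10 (\<lambda>x. eventail a (u x)) (\<lambda>x. ((if u x > a then 1 else 0) - (if - u x > a then 1 else 0)) *\<^sub>R g x)"
    using H10_add[OF p m] by (simp only: eventail_def)
qed

end

lemma norm_Pair_mono:
  fixes a c :: "'b::real_normed_vector" and b d :: "'c::real_normed_vector"
  assumes "norm a \<le> norm c" "norm b \<le> norm d" shows "norm (a, b) \<le> norm (c, d)"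
  unfolding norm_Pair using assms by (intro real_sqrt_le_mono add_mono power_mono) auto

lemma tendsto_zero_if_subsubsequence:
  fixes a :: "nat \<Rightarrow> real"
  assumes "\<And>r::nat\<Rightarrow>nat. strict_mono r \<Longrightarrow> \<exists>q::nat\<Rightarrow>nat. strict_mono q \<and> (\<lambda>n. a (r (q n))) \<longlonglongrightarrow> 0"
  shows "a \<longlonglongrightarrow> 0"
proof (rule ccontr)
  assume "\<not> a \<longlonglongrightarrow> 0"
  then obtain e where e: "0 < e" and "\<And>N. \<exists>n\<ge>N. e \<le> norm (a n - 0)"
    unfolding LIMSEQ_iff by (meson not_le)
  then have "\<exists>r. \<forall>n. e \<le> norm (a (r n) - 0) \<and> r n < (r (Suc n) :: nat)"
    by (intro dependent_nat_choice) (auto simp: Suc_le_eq[symmetric])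
  then obtain r :: "nat \<Rightarrow> nat" where r: "\<And>n. e \<le> norm (a (r n) - 0)" "strict_mono r"
    by (auto simp: strict_mono_Suc_iff)
  from assms[OF r(2)] obtain q :: "nat \<Rightarrow> nat" where "(\<lambda>n. a (r (q n))) \<longlonglongrightarrow> 0" by blast
  then have "\<exists>N. \<forall>n\<ge>N. norm (a (r (q n)) - 0) < e" using e unfolding LIMSEQ_iff by blast
  with r(1) show False by (meson not_le order_refl)
qed

text \<open>The situation after a subsequence has been extracted: \<open>g n\<close> are explicit
  gradients, \<open>(z, y)\<close> are the densities of the limit functional, and
  \<open>\<delta> n\<close> controls the dual norm of the remaining error. The equation asks for
  bounds at every point, which all test functions built below satisfy.\<close>

locale approximate_solutions = quasilinear_integrand \<Omega> j js jxi \<alpha> \<beta> \<alpha>0 R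
  for \<Omega> :: "'a::euclidean_space set" and j js jxi \<alpha> \<beta> \<alpha>0 R +
  fixes u :: "nat \<Rightarrow> 'a \<Rightarrow> real" and g :: "nat \<Rightarrow> 'a \<Rightarrow> 'a" and u0 :: "'a \<Rightarrow> real" and g0 :: "'a \<Rightarrow> 'a"
    and W :: "nat \<Rightarrow> ('a \<Rightarrow> real) \<Rightarrow> real" and z :: "'a \<Rightarrow> real" and y :: "'a \<Rightarrow> 'a" and \<delta> :: "nat \<Rightarrow> real" and B :: real
  assumes H: "\<And>n. H10 (u n) (g n)" and H0: "H10 u0 g0"
    and uB: "\<And>n. nrm2 M\<Omega> (u n) \<le> B" and gB: "\<And>n. nrm2 M\<Omega> (g n) \<le> B"
    and L1: "\<And>n. integrable M\<Omega> (\<lambda>x. jxi x (u n x) (g n x) \<bullet> g n x)"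
    and weak: "weakly_conv M\<Omega> g g0" and ae: "AE x in M\<Omega>. (\<lambda>n. u n x) \<longlonglongrightarrow> u0 x"
    and eq: "\<And>n v h C. H10 v h \<Longrightarrow> (\<And>x. \<bar>v x\<bar> \<le> C) \<Longrightarrow> (\<And>x. v x \<noteq> 0 \<Longrightarrow> \<bar>u n x\<bar> \<le> C) \<Longrightarrow>
      (\<integral>x. js x (u n x) (g n x) * v x \<partial>M\<Omega>) + (\<integral>x. jxi x (u n x) (g n x) \<bullet> h x \<partial>M\<Omega>) = W n v"
    and zs: "sqi M\<Omega> z" and ys: "sqi M\<Omega> y"
    and Wb: "\<And>n v h. H10 v h \<Longrightarrow> \<bar>W n v - (\<integral>x. (z x, y x) \<bullet> (v x, h x) \<partial>M\<Omega>)\<bar> \<le> \<delta> n * nrm2 M\<Omega> (\<lambda>x. (v x, h x))"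
    and \<delta>0: "\<And>n. 0 \<le> \<delta> n" and \<delta>lim: "\<delta> \<longlonglongrightarrow> 0"
begin

section \<open>Energy on the large values of the solutions\<close>

abbreviation flux :: "nat \<Rightarrow> 'a \<Rightarrow> 'a" where "flux n x \<equiv> jxi x (u n x) (g n x)"

lemmas us = H10_sqi(1)[OF H] and gs = H10_sqi(2)[OF H] and u0s = H10_sqi(1)[OF H0] and g0s = H10_sqi(2)[OF H0]

lemma um [measurable]: "u n \<in> borel_measurable M\<Omega>" and gm [measurable]: "g n \<in> borel_measurable M\<Omega>"
  and u0m [measurable]: "u0 \<in> borel_measurable M\<Omega>" and g0m [measurable]: "g0 \<in> borel_measurable M\<Omega>"
  and ym [measurable]: "y \<in> borel_measurable M\<Omega>" and zm [measurable]: "z \<in> borel_measurable M\<Omega>"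
  using us gs u0s g0s zs ys by (auto intro: sqi_measurable)

lemma fluxm [measurable]: "flux n \<in> borel_measurable M\<Omega>"
  by (rule jxi_measurable[OF um gm])

lemma B_nonneg: "0 \<le> B"
  using uB[of 0] nrm2_nonneg order_trans by blast

lemma zys: "sqi M\<Omega> (\<lambda>x. (z x, y x))"
  using zs ys by (simp add: sqi_fst_snd)

lemma nrm2_pair_le: "nrm2 M\<Omega> (\<lambda>x. (u n x, g n x)) \<le> 2 * B"
  using nrm2_components(3)[OF us[of n] gs[of n]] uB[of n] gB[of n] by linarith

lemma energy_nonneg: "x \<in> \<Omega> \<Longrightarrow> 0 \<le> flux n x \<bullet> g n x"
  using jxi_coercive[of x "g n x" "u n x"] mult_nonneg_nonneg[OF less_imp_le[OF \<alpha>0_pos] zero_le_power2[of "norm (g n x)"]]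
  by linarith

text \<open>The growth factor of \<open>jxi\<close> depends on \<open>u n\<close>. A coefficient
  that vanishes where \<open>u n\<close> exceeds \<open>K\<close> freezes it at the value for
  \<open>K\<close>, which gives square integrability and a bound uniform in
  \<open>n\<close>.\<close>

lemma cutoff_flux:
  assumes c: "c \<in> borel_measurable M\<Omega>" "\<And>x. \<bar>c x\<bar> \<le> C" "\<And>x. c x \<noteq> 0 \<Longrightarrow> \<bar>u n x\<bar> \<le> K" and K: "0 \<le> K" and q: "sqi M\<Omega> q"
  shows "sqi M\<Omega> (\<lambda>x. c x *\<^sub>R jxi x (u n x) (q x))" "nrm2 M\<Omega> (\<lambda>x. c x *\<^sub>R jxi x (u n x) (q x)) \<le> C * (4 * \<alpha> K) * nrm2 M\<Omega> q"
    "\<And>x. x \<in> \<Omega> \<Longrightarrow> norm (c x *\<^sub>R jxi x (u n x) (q x)) \<le> C * (4 * \<alpha> K) * norm (q x)"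
proof -
  have C0: "0 \<le> C" using c(2)[of undefined] by linarith
  have a0: "0 \<le> \<alpha> K" using \<alpha>_pos[OF K] by simp
  show le: "norm (c x *\<^sub>R jxi x (u n x) (q x)) \<le> C * (4 * \<alpha> K) * norm (q x)" if "x \<in> \<Omega>" for x
  proof (cases "c x = 0")
    case False
    have "\<bar>c x\<bar> * norm (jxi x (u n x) (q x)) \<le> C * (4 * \<alpha> K * norm (q x))"
      using jxi_growth_bounded[OF that c(3)[OF False], of "q x"] c(2)[of x] C0 by (intro mult_mono) auto
    then show ?thesis by (simp add: mult.assoc)
  qed (use C0 a0 in simp)
  have m: "(\<lambda>x. c x *\<^sub>R jxi x (u n x) (q x)) \<in> borel_measurable M\<Omega>"
    by (rule borel_measurable_scaleR[OF c(1) jxi_measurable[OF um sqi_measurable[OF q]]])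
  have ae: "AE x in M\<Omega>. norm (c x *\<^sub>R jxi x (u n x) (q x)) \<le> norm ((C * (4 * \<alpha> K)) *\<^sub>R q x)"
    using le C0 a0 by (intro AE_I2) auto
  show "sqi M\<Omega> (\<lambda>x. c x *\<^sub>R jxi x (u n x) (q x))" by (rule sqi_dominated[OF sqi_scaleR[OF q] m ae])
  have "nrm2 M\<Omega> (\<lambda>x. c x *\<^sub>R jxi x (u n x) (q x)) \<le> nrm2 M\<Omega> (\<lambda>x. (C * (4 * \<alpha> K)) *\<^sub>R q x)"
    by (rule nrm2_mono[OF sqi_scaleR[OF q] m ae])
  then show "nrm2 M\<Omega> (\<lambda>x. c x *\<^sub>R jxi x (u n x) (q x)) \<le> C * (4 * \<alpha> K) * nrm2 M\<Omega> q"
    unfolding nrm2_scaleR using C0 a0 by simp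
qed

text \<open>The test function follows the odd tail up to the level \<open>M\<close> and then descends to zero with
  slope \<open>-1\<close>, so that it lies in \<open>V\<^sub>u\<close>; the descending part disappears for \<open>M \<rightarrow> \<infinity>\<close> because the energy is
  integrable.\<close>

lemma tail_estimate:
  assumes k: "R \<le> k"
  shows "(\<integral>x. (if \<bar>u n x\<bar> > k then 1 else 0) * (flux n x \<bullet> g n x) \<partial>M\<Omega>)
    \<le> 2 * B * (\<delta> n + nrm2 M\<Omega> (\<lambda>x. (if \<bar>u n x\<bar> > k then 1 else 0) *\<^sub>R (z x, y x)))"
proof -
  have k0: "0 < k" using k R_pos by linarith
  \<comment> \<open>\<open>\<psi> M\<close> is the slope of \<open>\<Phi> M\<close>: it is 1 for |s|
    between k and M, -1 between M and 2M - k, and 0 elsewhere. The descent ends at 2M - k because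
    the ascent has length M - k.\<close>
  define \<psi> :: "real \<Rightarrow> real \<Rightarrow> real" where "\<psi> M s = (if \<bar>s\<bar> > k then 1 else 0) - 2 * (if \<bar>s\<bar> > M then 1 else 0) + (if \<bar>s\<bar> > 2 * M - k then 1 else 0)" for M s
  define \<Phi> where "\<Phi> M s = oddtail k s - 2 * oddtail M s + oddtail (2 * M - k) s" for M s
  let ?Z = "\<lambda>x. (if \<bar>u n x\<bar> > k then 1 else 0) *\<^sub>R (z x, y x)"
  have Zs: "sqi M\<Omega> ?Z" by (rule sqi_bounded_scaleR[OF zys, of _ 1]) auto
  have \<psi>m: "(\<lambda>x. \<psi> M (u n x)) \<in> borel_measurable M\<Omega>" for M unfolding \<psi>_def by measurable
  have main: "(\<integral>x. \<psi> M (u n x) * (flux n x \<bullet> g n x) \<partial>M\<Omega>) \<le> 2 * B * (\<delta> n + nrm2 M\<Omega> ?Z)" if M: "k \<le> M" for M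
  proof -
    have H\<Phi>: "H10 (\<lambda>x. \<Phi> M (u n x)) (\<lambda>x. \<psi> M (u n x) *\<^sub>R g n x)"
    proof -
      have "H10 (\<lambda>x. oddtail k (u n x) - 2 * oddtail M (u n x) + oddtail (2 * M - k) (u n x))
        (\<lambda>x. (if \<bar>u n x\<bar> > k then 1 else 0) *\<^sub>R g n x - 2 *\<^sub>R ((if \<bar>u n x\<bar> > M then 1 else 0) *\<^sub>R g n x)
          + (if \<bar>u n x\<bar> > 2 * M - k then 1 else 0) *\<^sub>R g n x)"
        using k0 M by (intro H10_add H10_diff H10_scale H10_tails(1) H) auto
      then show ?thesis by (simp only: \<Phi>_def \<psi>_def scaleR_add_left scaleR_diff_left scaleR_scaleR)
    qed
    have \<Phi>0: "\<Phi> M s = 0" if "\<bar>s\<bar> \<le> k \<or> 2 * M - k \<le> \<bar>s\<bar>" for s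
      using that k0 M by (auto simp: \<Phi>_def oddtail_def max_def)
    have \<Phi>s: "\<bar>\<Phi> M s\<bar> \<le> \<bar>s\<bar>" "\<bar>\<Phi> M s\<bar> \<le> M" "0 \<le> s \<Longrightarrow> 0 \<le> \<Phi> M s" "s \<le> 0 \<Longrightarrow> \<Phi> M s \<le> 0" for s
      using k0 M by (auto simp: \<Phi>_def oddtail_def max_def)
    have \<psi>s: "\<bar>\<psi> M s\<bar> \<le> 1" "\<bar>s\<bar> \<le> k \<Longrightarrow> \<psi> M s = 0" for s using k0 M by (auto simp: \<psi>_def)
    have "(\<integral>x. js x (u n x) (g n x) * \<Phi> M (u n x) \<partial>M\<Omega>) + (\<integral>x. flux n x \<bullet> (\<psi> M (u n x) *\<^sub>R g n x) \<partial>M\<Omega>) = W n (\<lambda>x. \<Phi> M (u n x))"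
    proof (rule eq[OF H\<Phi>, where C="2 * M - k"])
      show "\<bar>\<Phi> M (u n x)\<bar> \<le> 2 * M - k" for x using \<Phi>s(2)[of "u n x"] M by linarith
      show "\<bar>u n x\<bar> \<le> 2 * M - k" if "\<Phi> M (u n x) \<noteq> 0" for x using that \<Phi>0[of "u n x"] by linarith
    qed
    moreover have "0 \<le> (\<integral>x. js x (u n x) (g n x) * \<Phi> M (u n x) \<partial>M\<Omega>)"
    proof (rule integral_nonneg_AE, rule AE_I2)
      fix x assume "x \<in> space M\<Omega>"
      then have x: "x \<in> \<Omega>" by simp
      show "0 \<le> js x (u n x) (g n x) * \<Phi> M (u n x)"
      proof (cases "\<bar>u n x\<bar> \<le> k")
        case True
        then show ?thesis using \<Phi>0 by simp
      next
        case False
        then have "0 \<le> js x (u n x) (g n x) * u n x" using k by (intro H4[OF x]) simp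
        then show ?thesis using False k0 \<Phi>s(3)[of "u n x"] \<Phi>s(4)[of "u n x"]
          by (cases "0 \<le> u n x") (auto simp: zero_le_mult_iff)
      qed
    qed
    ultimately have "(\<integral>x. \<psi> M (u n x) * (flux n x \<bullet> g n x) \<partial>M\<Omega>) \<le> W n (\<lambda>x. \<Phi> M (u n x))" by simp
    also have "\<dots> \<le> (\<integral>x. (z x, y x) \<bullet> (\<Phi> M (u n x), \<psi> M (u n x) *\<^sub>R g n x) \<partial>M\<Omega>) + \<delta> n * nrm2 M\<Omega> (\<lambda>x. (\<Phi> M (u n x), \<psi> M (u n x) *\<^sub>R g n x))"
      using Wb[OF H\<Phi>, of n] by linarith
    \<comment> \<open>The test function and its gradient vanish for |u_n| <= k, so only the part of
      (z, y) over the tail counts. This is the source of smallness.\<close>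
    also have "(\<integral>x. (z x, y x) \<bullet> (\<Phi> M (u n x), \<psi> M (u n x) *\<^sub>R g n x) \<partial>M\<Omega>) = (\<integral>x. ?Z x \<bullet> (\<Phi> M (u n x), \<psi> M (u n x) *\<^sub>R g n x) \<partial>M\<Omega>)"
      using \<Phi>0 \<psi>s(2) by (intro Bochner_Integration.integral_cong refl) auto
    also have "\<dots> \<le> nrm2 M\<Omega> ?Z * nrm2 M\<Omega> (\<lambda>x. (\<Phi> M (u n x), \<psi> M (u n x) *\<^sub>R g n x))"
      using Cauchy_Schwarz_sqi[OF Zs H10_sqi(3)[OF H\<Phi>]] by linarith
    also have "nrm2 M\<Omega> ?Z * nrm2 M\<Omega> (\<lambda>x. (\<Phi> M (u n x), \<psi> M (u n x) *\<^sub>R g n x)) + \<delta> n * nrm2 M\<Omega> (\<lambda>x. (\<Phi> M (u n x), \<psi> M (u n x) *\<^sub>R g n x))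
        = (\<delta> n + nrm2 M\<Omega> ?Z) * nrm2 M\<Omega> (\<lambda>x. (\<Phi> M (u n x), \<psi> M (u n x) *\<^sub>R g n x))" by (simp add: algebra_simps)
    \<comment> \<open>The test pair is dominated by \<open>(u n, g n)\<close>, because
      \<open>\<Phi> M\<close> is at most |s| and \<open>\<psi> M\<close> at most 1 in absolute
      value.\<close>
    also have "\<dots> \<le> (\<delta> n + nrm2 M\<Omega> ?Z) * (2 * B)"
    proof (intro mult_left_mono order_trans[OF _ nrm2_pair_le[of n]] nrm2_mono[OF H10_sqi(3)[OF H]])
      show "(\<lambda>x. (\<Phi> M (u n x), \<psi> M (u n x) *\<^sub>R g n x)) \<in> borel_measurable M\<Omega>" by (rule sqi_measurable[OF H10_sqi(3)[OF H\<Phi>]])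
      show "AE x in M\<Omega>. norm (\<Phi> M (u n x), \<psi> M (u n x) *\<^sub>R g n x) \<le> norm (u n x, g n x)"
        using \<Phi>s(1) \<psi>s(1) by (intro AE_I2 norm_Pair_mono) (auto simp: mult_left_le_one_le)
    qed (simp add: \<delta>0 nrm2_nonneg)
    finally show ?thesis by (simp add: mult.commute)
  qed
  \<comment> \<open>With M = k + m the descending part eventually leaves every point, and the
    integrable energy dominates.\<close>
  have "(\<lambda>m. \<integral>x. \<psi> (k + real m) (u n x) * (flux n x \<bullet> g n x) \<partial>M\<Omega>) \<longlonglongrightarrow> (\<integral>x. (if \<bar>u n x\<bar> > k then 1 else 0) * (flux n x \<bullet> g n x) \<partial>M\<Omega>)"
  proof (rule integral_dominated_convergence[where w="\<lambda>x. norm (flux n x \<bullet> g n x)"])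
    show "AE x in M\<Omega>. (\<lambda>m. \<psi> (k + real m) (u n x) * (flux n x \<bullet> g n x)) \<longlonglongrightarrow> (if \<bar>u n x\<bar> > k then 1 else 0) * (flux n x \<bullet> g n x)"
    proof (intro AE_I2 tendsto_mult tendsto_const tendsto_eventually)
      fix x
      obtain N :: nat where N: "\<bar>u n x\<bar> < real N" using reals_Archimedean2 by blast
      show "\<forall>\<^sub>F m in sequentially. \<psi> (k + real m) (u n x) = (if \<bar>u n x\<bar> > k then 1 else 0)"
        using eventually_ge_at_top[of N]
      proof eventually_elim
        case (elim m)
        then have "\<bar>u n x\<bar> < real m" using N by linarith
        then show ?case using k0 by (simp add: \<psi>_def)
      qed
    qed
    show "AE x in M\<Omega>. norm (\<psi> (k + real m) (u n x) * (flux n x \<bullet> g n x)) \<le> norm (flux n x \<bullet> g n x)" for m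
    proof (rule AE_I2)
      fix x
      have "\<bar>\<psi> (k + real m) (u n x)\<bar> \<le> 1" using k0 by (auto simp: \<psi>_def)
      then show "norm (\<psi> (k + real m) (u n x) * (flux n x \<bullet> g n x)) \<le> norm (flux n x \<bullet> g n x)"
        by (simp add: abs_mult mult_left_le_one_le)
    qed
    show "integrable M\<Omega> (\<lambda>x. norm (flux n x \<bullet> g n x))" by (rule integrable_norm[OF L1])
    show "(\<lambda>x. \<psi> (k + real m) (u n x) * (flux n x \<bullet> g n x)) \<in> borel_measurable M\<Omega>" for m
      by (rule borel_measurable_times[OF \<psi>m]) measurable
  qed measurable
  then show ?thesis using main by (intro LIMSEQ_le_const2) auto
qed

lemma tail_indicator_integrable: "integrable M\<Omega> (\<lambda>x. (if \<bar>u n x\<bar> > k then 1 else 0) * (flux n x \<bullet> g n x))"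
  by (rule Bochner_Integration.integrable_bound[OF L1[of n]]) auto

text \<open>Bounding the densities over the tail by their full norm makes the estimate uniform in
  \<open>n\<close> and in the level. The error from the slope of the cutoff relies on it.\<close>

lemma tail_bounded:
  obtains C where "0 \<le> C" "\<And>n k. R \<le> k \<Longrightarrow> (\<integral>x. (if \<bar>u n x\<bar> > k then 1 else 0) * (flux n x \<bullet> g n x) \<partial>M\<Omega>) \<le> C"
proof -
  obtain D where D: "\<And>n. \<bar>\<delta> n\<bar> \<le> D" using convergent_imp_Bseq[of \<delta>] \<delta>lim unfolding convergent_def Bseq_def by auto
  show thesis
  proof (rule that[of "2 * B * (D + nrm2 M\<Omega> (\<lambda>x. (z x, y x)))"])
    have D0: "0 \<le> D" using D[of 0] by linarith
    then show "0 \<le> 2 * B * (D + nrm2 M\<Omega> (\<lambda>x. (z x, y x)))" using B_nonneg by (simp add: nrm2_nonneg)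
    fix n k assume k: "R \<le> k"
    have "nrm2 M\<Omega> (\<lambda>x. (if \<bar>u n x\<bar> > k then 1 else 0) *\<^sub>R (z x, y x)) \<le> nrm2 M\<Omega> (\<lambda>x. (z x, y x))"
      by (rule nrm2_mono[OF zys]) (use sqi_measurable[OF zys] in \<open>auto intro!: borel_measurable_scaleR\<close>)
    then have "2 * B * (\<delta> n + nrm2 M\<Omega> (\<lambda>x. (if \<bar>u n x\<bar> > k then 1 else 0) *\<^sub>R (z x, y x))) \<le> 2 * B * (D + nrm2 M\<Omega> (\<lambda>x. (z x, y x)))"
      using D[of n] B_nonneg by (intro mult_left_mono) auto
    then show "(\<integral>x. (if \<bar>u n x\<bar> > k then 1 else 0) * (flux n x \<bullet> g n x) \<partial>M\<Omega>) \<le> 2 * B * (D + nrm2 M\<Omega> (\<lambda>x. (z x, y x)))"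
      using tail_estimate[OF k, of n] by linarith
  qed
qed

end

text \<open>The function is sinh((c + 1) t): its derivative minus c |sinh| is at least cosh, hence
  at least 1. This surplus is what stays in front of the monotonicity gap once the term with
  \<open>js\<close> is absorbed.\<close>

lemma exponential_test_function:
  fixes c :: real
  assumes c: "0 \<le> c"
  obtains \<phi> \<phi>' :: "real \<Rightarrow> real"
  where "\<phi> 0 = 0" "\<And>t. (\<phi> has_real_derivative \<phi>' t) (at t)" "continuous_on UNIV \<phi>'"
    "\<And>t. 1 \<le> \<phi>' t - c * \<bar>\<phi> t\<bar>" "\<And>t. 0 \<le> t \<Longrightarrow> 0 \<le> \<phi> t" "\<And>t. t \<le> 0 \<Longrightarrow> \<phi> t \<le> 0"
proof -
  let ?l = "c + 1"
  define \<phi> where "\<phi> t = (exp (?l * t) - exp (- (?l * t))) / 2" for t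
  define \<phi>' where "\<phi>' t = ?l * ((exp (?l * t) + exp (- (?l * t))) / 2)" for t
  show thesis
  proof (rule that[of \<phi> \<phi>'])
    show "\<phi> 0 = 0" by (simp add: \<phi>_def)
    show "(\<phi> has_real_derivative \<phi>' t) (at t)" for t
      unfolding \<phi>_def[abs_def] \<phi>'_def by (auto intro!: derivative_eq_intros simp: algebra_simps)
    show "continuous_on UNIV \<phi>'" unfolding \<phi>'_def[abs_def] by (intro continuous_intros) auto
    show "1 \<le> \<phi>' t - c * \<bar>\<phi> t\<bar>" for t
    proof -
      let ?C = "(exp (?l * t) + exp (- (?l * t))) / 2"
      have "\<bar>(a - b) / 2\<bar> \<le> (a + b) / 2" if "0 < a" "0 < b" for a b :: real using that by (simp add: abs_le_iff field_simps)
      then have "\<bar>\<phi> t\<bar> \<le> ?C" unfolding \<phi>_def by (simp only: exp_gt_zero)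
      then have "c * \<bar>\<phi> t\<bar> \<le> c * ?C" using c by (intro mult_left_mono)
      moreover have "1 \<le> (exp s + exp (- s)) / 2" for s :: real
      proof -
        have "2 \<le> exp s + exp (- s)" using add_mono[OF exp_ge_add_one_self[of s] exp_ge_add_one_self[of "- s"]] by simp
        then show ?thesis by simp
      qed
      then have "1 \<le> ?C" .
      moreover have "\<phi>' t = c * ?C + ?C" unfolding \<phi>'_def by (simp only: distrib_right mult_1_left)
      ultimately show ?thesis by linarith
    qed
    have "- (?l * t) \<le> ?l * t" if "0 \<le> t" for t using c that by simp
    then show "0 \<le> \<phi> t" if "0 \<le> t" for t using that by (simp add: \<phi>_def)
    have "?l * t \<le> - (?l * t)" if "t \<le> 0" for t using c that mult_nonneg_nonpos[of ?l t] by linarith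
    then show "\<phi> t \<le> 0" if "t \<le> 0" for t using that by (simp add: \<phi>_def)
  qed
qed

section \<open>Convergence of the truncations\<close>

context approximate_solutions
begin

text \<open>The indicator of [-k, k] is discontinuous only at |s| = k, a value that the limit
  \<open>u0\<close> avoids almost everywhere.\<close>

lemma truncation_indicator_tendsto:
  assumes good: "AE x in M\<Omega>. \<bar>u0 x\<bar> \<noteq> k"
  shows "AE x in M\<Omega>. (\<forall>\<^sub>F n in sequentially. (if \<bar>u n x\<bar> \<le> k then 1 else 0::real) = (if \<bar>u0 x\<bar> \<le> k then 1 else 0))"
  using good ae
proof eventually_elim
  case (elim x)
  have l: "(\<lambda>n. \<bar>u n x\<bar>) \<longlonglongrightarrow> \<bar>u0 x\<bar>" by (intro tendsto_intros elim)
  consider "\<bar>u0 x\<bar> < k" | "k < \<bar>u0 x\<bar>" using elim by linarith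
  then show ?case
  proof cases
    case 1
    from order_tendstoD(2)[OF l 1] show ?thesis by eventually_elim (use 1 in auto)
  next
    case 2
    from order_tendstoD(1)[OF l 2] show ?thesis by eventually_elim (use 2 in auto)
  qed
qed

text \<open>The gradient of the truncation of \<open>u0\<close> at level \<open>k\<close>.\<close>

definition tgrad :: "real \<Rightarrow> 'a \<Rightarrow> 'a" where
  "tgrad k x = (if \<bar>u0 x\<bar> \<le> k then 1 else 0) *\<^sub>R g0 x"

lemma tgrad_sqi: "sqi M\<Omega> (tgrad k)"
  unfolding tgrad_def[abs_def] by (rule sqi_bounded_scaleR[OF g0s, of _ 1]) auto

lemma tgrad_measurable [measurable]: "tgrad k \<in> borel_measurable M\<Omega>"
  by (rule sqi_measurable[OF tgrad_sqi])

text \<open>Where |u_n| <= k the gradient of the truncation of \<open>u n\<close> is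
  \<open>g n\<close>; the indicator in front also keeps the growth of \<open>jxi\<close>
  bounded.\<close>

definition gap :: "real \<Rightarrow> nat \<Rightarrow> 'a \<Rightarrow> real" where
  "gap k n x = (if \<bar>u n x\<bar> \<le> k then 1 else 0) * ((flux n x - jxi x (u n x) (tgrad k x)) \<bullet> (g n x - tgrad k x))"

lemma gap_nonneg: "x \<in> \<Omega> \<Longrightarrow> 0 \<le> gap k n x"
  unfolding gap_def using jxi_monotone by simp

lemma gap_integrable:
  assumes k: "0 \<le> k" shows "integrable M\<Omega> (gap k n)"
proof -
  let ?c = "\<lambda>x. if \<bar>u n x\<bar> \<le> k then 1 else 0::real"
  have 1: "sqi M\<Omega> (\<lambda>x. ?c x *\<^sub>R flux n x)" by (rule cutoff_flux(1)[OF _ _ _ k gs, of _ 1]) (auto split: if_splits)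
  have 2: "sqi M\<Omega> (\<lambda>x. ?c x *\<^sub>R jxi x (u n x) (tgrad k x))" by (rule cutoff_flux(1)[OF _ _ _ k tgrad_sqi, of _ 1]) (auto split: if_splits)
  have "integrable M\<Omega> (\<lambda>x. (?c x *\<^sub>R flux n x - ?c x *\<^sub>R jxi x (u n x) (tgrad k x)) \<bullet> (g n x - tgrad k x))"
    by (rule sqi_inner_integrable[OF sqi_diff[OF 1 2] sqi_diff[OF gs tgrad_sqi]])
  then show ?thesis by (simp add: gap_def[abs_def] flip: scaleR_diff_right)
qed

text \<open>The test function is \<open>\<phi> (T\<^sub>k u\<^sub>n - T\<^sub>k u)\<close> times a cutoff that equals one up to the level \<open>M\<close> and
  vanishes above \<open>2 M\<close>; the derivative of the cutoff contributes the error \<open>C / M\<close>.\<close>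

lemma truncated_gap_bound:
  assumes k: "R \<le> k" and good: "AE x in M\<Omega>. \<bar>u0 x\<bar> \<noteq> k"
  obtains C where "0 \<le> C" "\<And>M. 1 \<le> M \<Longrightarrow> k \<le> M \<Longrightarrow> \<exists>e. e \<longlonglongrightarrow> 0 \<and> (\<forall>n. (\<integral>x. gap k n x \<partial>M\<Omega>) \<le> e n + C / M)"
proof -
  have k0: "0 < k" using k R_pos by linarith
  \<comment> \<open>Where |u_n| <= k, (H3) and coercivity bound |js| by \<open>c\<close> times the
    energy density.\<close>
  define c where "c = \<beta> k / \<alpha>0"
  have c0: "0 \<le> c" using \<beta>_pos[of k] k0 \<alpha>0_pos by (simp add: c_def)
  obtain \<phi> \<phi>' where \<phi>: "\<phi> 0 = 0" "\<And>t. (\<phi> has_real_derivative \<phi>' t) (at t)" "continuous_on UNIV \<phi>'"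
    "\<And>t. 1 \<le> \<phi>' t - c * \<bar>\<phi> t\<bar>" "\<And>t. 0 \<le> t \<Longrightarrow> 0 \<le> \<phi> t" "\<And>t. t \<le> 0 \<Longrightarrow> \<phi> t \<le> 0"
    using exponential_test_function[OF c0] by metis
  have \<phi>c: "continuous_on UNIV \<phi>" using \<phi>(2) by (meson DERIV_isCont continuous_at_imp_continuous_on)
  \<comment> \<open>Both truncations take values in [-k, k], so their difference \<open>d\<close>
    below stays in [-2k, 2k].\<close>
  have "bounded (\<phi> ` {-2*k..2*k})" "bounded (\<phi>' ` {-2*k..2*k})"
    using \<phi>(3) \<phi>c by (auto intro!: compact_imp_bounded compact_continuous_image intro: continuous_on_subset)
  then obtain E1 E2 where E12: "\<And>t. t \<in> {-2*k..2*k} \<Longrightarrow> \<bar>\<phi> t\<bar> \<le> E1" "\<And>t. t \<in> {-2*k..2*k} \<Longrightarrow> \<bar>\<phi>' t\<bar> \<le> E2"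
    unfolding bounded_iff by (metis imageI real_norm_def)
  define E where "E = max E1 E2"
  have [measurable]: "\<phi> \<in> borel_measurable borel" "\<phi>' \<in> borel_measurable borel"
    using \<phi>(3) \<phi>c by (auto intro: borel_measurable_continuous_onI)
  define T where "T s = s - oddtail k s" for s
  have Tb: "\<bar>T s\<bar> \<le> k" "k \<le> s \<Longrightarrow> T s = k" "s \<le> - k \<Longrightarrow> T s = - k" for s
    using k0 by (auto simp: T_def oddtail_def max_def)
  have Tc: "continuous_on UNIV T" unfolding T_def[abs_def] oddtail_def by (intro continuous_intros)
  have [measurable]: "T \<in> borel_measurable borel" by (rule borel_measurable_continuous_onI[OF Tc])
  define I :: "nat \<Rightarrow> 'a \<Rightarrow> real" where "I n x = (if \<bar>u n x\<bar> \<le> k then 1 else 0)" for n x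
  define I0 :: "'a \<Rightarrow> real" where "I0 x = (if \<bar>u0 x\<bar> \<le> k then 1 else 0)" for x
  let ?\<xi> = "tgrad k"
  have \<xi>: "?\<xi> x = I0 x *\<^sub>R g0 x" for x by (simp add: tgrad_def I0_def)
  have Im [measurable]: "I n \<in> borel_measurable M\<Omega>" "I0 \<in> borel_measurable M\<Omega>" for n unfolding I_def[abs_def] I0_def[abs_def] by measurable
  have Ilim: "AE x in M\<Omega>. (\<lambda>n. I n x) \<longlonglongrightarrow> I0 x"
    using truncation_indicator_tendsto[OF good] by eventually_elim (simp add: I_def I0_def tendsto_eventually)
  have HT: "H10 (\<lambda>x. T (v x)) (\<lambda>x. (if \<bar>v x\<bar> \<le> k then 1 else 0) *\<^sub>R h x)" if "H10 v h" for v h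
  proof -
    have "H10 (\<lambda>x. v x - oddtail k (v x)) (\<lambda>x. h x - (if \<bar>v x\<bar> > k then 1 else 0) *\<^sub>R h x)"
      using k0 by (intro H10_diff that H10_tails(1)[OF that]) simp
    moreover have "h x - (if \<bar>v x\<bar> > k then 1 else 0) *\<^sub>R h x = (if \<bar>v x\<bar> \<le> k then 1 else 0) *\<^sub>R h x" for x by auto
    ultimately show ?thesis by (simp only: T_def)
  qed
  define d where "d n x = T (u n x) - T (u0 x)" for n x
  have Hd: "H10 (d n) (\<lambda>x. I n x *\<^sub>R g n x - ?\<xi> x)" for n
    using H10_diff[OF HT[OF H[of n]] HT[OF H0]] by (simp add: d_def[abs_def] I_def tgrad_def)
  have db: "\<bar>d n x\<bar> \<le> 2 * k" for n x unfolding d_def using Tb(1)[of "u n x"] Tb(1)[of "u0 x"] by linarith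
  have dI: "d n x \<in> {-2*k..2*k}" for n x using db[of n x] unfolding atLeastAtMost_iff by linarith
  have \<phi>E: "\<bar>\<phi> (d n x)\<bar> \<le> E" "\<bar>\<phi>' (d n x)\<bar> \<le> E" for n x
    using E12[OF dI[of n x]] by (auto simp: E_def)
  have E0: "0 \<le> E" using \<phi>E(1)[of 0 undefined] by linarith
  have dm [measurable]: "d n \<in> borel_measurable M\<Omega>" for n unfolding d_def[abs_def] by measurable
  have dlim: "AE x in M\<Omega>. (\<lambda>n. d n x) \<longlonglongrightarrow> 0"
    using ae
  proof eventually_elim
    case (elim x)
    have "(\<lambda>n. T (u n x)) \<longlonglongrightarrow> T (u0 x)" by (rule continuous_on_tendsto_compose[OF Tc elim]) auto
    then show ?case by (simp add: d_def LIM_zero)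
  qed
  have \<phi>lim: "AE x in M\<Omega>. (\<lambda>n. \<phi> (d n x)) \<longlonglongrightarrow> 0" "AE x in M\<Omega>. (\<lambda>n. \<phi>' (d n x)) \<longlonglongrightarrow> \<phi>' 0"
    using dlim
  proof (eventually_elim)
    case (elim x)
    show "(\<lambda>n. \<phi> (d n x)) \<longlonglongrightarrow> 0" using continuous_on_tendsto_compose[OF \<phi>c elim] \<phi>(1) by simp
  next
    show "AE x in M\<Omega>. (\<lambda>n. \<phi>' (d n x)) \<longlonglongrightarrow> \<phi>' 0"
      using dlim by eventually_elim (rule continuous_on_tendsto_compose[OF \<phi>(3)], auto)
  qed
  \<comment> \<open>The coefficient left in front of the gap after the term with \<open>js\<close>
    has taken c |\<phi>| from \<phi>'.\<close>
  define \<kappa> where "\<kappa> n x = \<phi>' (d n x) - c * \<bar>\<phi> (d n x)\<bar>" for n x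
  have \<kappa>1: "1 \<le> \<kappa> n x" for n x unfolding \<kappa>_def by (rule \<phi>(4))
  have \<kappa>E: "\<bar>\<kappa> n x\<bar> \<le> E" for n x
    using \<kappa>1[of n x] \<phi>E(2)[of n x] mult_nonneg_nonneg[OF c0 abs_ge_zero[of "\<phi> (d n x)"]] unfolding \<kappa>_def by linarith
  have \<kappa>m [measurable]: "\<kappa> n \<in> borel_measurable M\<Omega>" for n unfolding \<kappa>_def[abs_def] by measurable
  have \<kappa>lim: "AE x in M\<Omega>. (\<lambda>n. \<kappa> n x) \<longlonglongrightarrow> \<phi>' 0"
    using \<phi>lim
  proof eventually_elim
    case (elim x)
    have "(\<lambda>n. \<phi>' (d n x) - c * \<bar>\<phi> (d n x)\<bar>) \<longlonglongrightarrow> \<phi>' 0 - c * \<bar>0\<bar>" by (intro tendsto_intros elim)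
    then show ?case by (simp add: \<kappa>_def)
  qed
  obtain CA where CA: "0 \<le> CA" "\<And>n k. R \<le> k \<Longrightarrow> (\<integral>x. (if \<bar>u n x\<bar> > k then 1 else 0) * (flux n x \<bullet> g n x) \<partial>M\<Omega>) \<le> CA"
    using tail_bounded by blast
  show thesis
  \<comment> \<open>\<open>E\<close> bounds \<phi> and \<open>CA\<close> bounds the tail energy; the
    slope of the cutoff supplies the factor 1/M.\<close>
  proof (rule that[of "E * CA"])
    show "0 \<le> E * CA" using E0 CA(1) by simp
    fix M :: real assume M1: "1 \<le> M" and kM: "k \<le> M"
    \<comment> \<open>A ramp from 0 at |s| = M to 1 at |s| = 2M with slope \<open>q\<close>; the
      cutoff is 1 - Q.\<close>
    define Q where "Q s = (1 / M) * (eventail M s - eventail (2 * M) s)" for s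
    define q :: "real \<Rightarrow> real" where "q s = (1 / M) * (((if s > M then 1 else 0) - (if - s > M then 1 else 0)) - ((if s > 2 * M then 1 else 0) - (if - s > 2 * M then 1 else 0)))" for s
    have Qs: "0 \<le> Q s" "Q s \<le> 1" "\<bar>s\<bar> \<le> M \<Longrightarrow> Q s = 0" "2 * M \<le> \<bar>s\<bar> \<Longrightarrow> Q s = 1" for s
      using M1 by (auto simp: Q_def eventail_def max_def field_simps)
    have qs: "\<bar>q s\<bar> \<le> (1 / M) * (if \<bar>s\<bar> > M then 1 else 0)" "\<bar>s\<bar> > 2 * M \<Longrightarrow> q s = 0" for s using M1 by (auto simp: q_def)
    have q1: "\<bar>q s\<bar> \<le> 1" "\<bar>s\<bar> \<le> k \<Longrightarrow> q s = 0" for s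
    proof -
      have "(1 / M) * (if \<bar>s\<bar> > M then 1 else 0) \<le> 1" using M1 by simp
      then show "\<bar>q s\<bar> \<le> 1" using qs(1)[of s] by linarith
      show "q s = 0" if "\<bar>s\<bar> \<le> k" using qs(1)[of s] that kM by simp
    qed
    have Qc: "continuous_on UNIV Q" unfolding Q_def[abs_def] eventail_def by (intro continuous_intros)
    have [measurable]: "Q \<in> borel_measurable borel" by (rule borel_measurable_continuous_onI[OF Qc])
    have qm [measurable]: "(\<lambda>x. q (u n x)) \<in> borel_measurable M\<Omega>" for n unfolding q_def by measurable
    have HQ: "H10 (\<lambda>x. Q (u n x)) (\<lambda>x. q (u n x) *\<^sub>R g n x)" for n
    proof -
      have "H10 (\<lambda>x. (1 / M) * (eventail M (u n x) - eventail (2 * M) (u n x)))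
        (\<lambda>x. (1 / M) *\<^sub>R (((if u n x > M then 1 else 0) - (if - u n x > M then 1 else 0)) *\<^sub>R g n x - ((if u n x > 2 * M then 1 else 0) - (if - u n x > 2 * M then 1 else 0)) *\<^sub>R g n x))"
        using M1 by (intro H10_scale H10_diff H10_tails(2) H) auto
      then show ?thesis by (simp only: Q_def q_def scaleR_diff_left[symmetric] scaleR_scaleR)
    qed
    define v where "v n x = \<phi> (d n x) * (1 - Q (u n x))" for n x
    \<comment> \<open>The gradient of \<open>v n\<close> is \<open>a1 n\<close> times
      \<open>g n\<close> minus \<open>a2 n\<close> times the truncated limit gradient. The first
      term of \<open>a1\<close> carries no factor 1 - Q because Q = 0 wherever \<open>I n\<close> is
      nonzero.\<close>
    define a1 where "a1 n x = \<phi>' (d n x) * I n x - \<phi> (d n x) * q (u n x)" for n x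
    define a2 where "a2 n x = \<phi>' (d n x) * (1 - Q (u n x))" for n x
    have Hv: "H10 (v n) (\<lambda>x. a1 n x *\<^sub>R g n x - a2 n x *\<^sub>R ?\<xi> x)" for n
    proof -
      have V: "H10 (\<lambda>x. \<phi> (d n x)) (\<lambda>x. \<phi>' (d n x) *\<^sub>R (I n x *\<^sub>R g n x - ?\<xi> x))"
        by (rule H10_chain_bounded[OF Hd db \<phi>(2,3,1)])
      have "H10 (\<lambda>x. \<phi> (d n x) - \<phi> (d n x) * Q (u n x))
         (\<lambda>x. \<phi>' (d n x) *\<^sub>R (I n x *\<^sub>R g n x - ?\<xi> x) - (\<phi> (d n x) *\<^sub>R (q (u n x) *\<^sub>R g n x) + Q (u n x) *\<^sub>R (\<phi>' (d n x) *\<^sub>R (I n x *\<^sub>R g n x - ?\<xi> x))))"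
        by (rule H10_diff[OF V H10_mult[OF V \<phi>E(1)[of n] HQ[of n], where B=1]]) (use Qs(1,2) in auto)
      moreover have "\<phi> (d n x) - \<phi> (d n x) * Q (u n x) = v n x" for x by (simp add: v_def algebra_simps)
      moreover have "\<phi>' (d n x) *\<^sub>R (I n x *\<^sub>R g n x - ?\<xi> x) - (\<phi> (d n x) *\<^sub>R (q (u n x) *\<^sub>R g n x) + Q (u n x) *\<^sub>R (\<phi>' (d n x) *\<^sub>R (I n x *\<^sub>R g n x - ?\<xi> x)))
          = a1 n x *\<^sub>R g n x - a2 n x *\<^sub>R ?\<xi> x" for x
      proof (cases "\<bar>u n x\<bar> \<le> k")
        case True
        then have "Q (u n x) = 0" using Qs(3) kM by simp
        then show ?thesis by (simp add: a1_def a2_def algebra_simps)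
      next
        case False
        then have "I n x = 0" by (simp add: I_def)
        then show ?thesis by (simp add: a1_def a2_def algebra_simps)
      qed
      ultimately show ?thesis by (simp add: fun_eq_iff)
    qed
    have vE: "\<bar>v n x\<bar> \<le> E" for n x
    proof -
      have "\<bar>\<phi> (d n x)\<bar> * \<bar>1 - Q (u n x)\<bar> \<le> E * 1" using \<phi>E(1)[of n x] Qs(1,2)[of "u n x"] E0 by (intro mult_mono) auto
      then show ?thesis by (simp add: v_def abs_mult)
    qed
    have a1E: "\<bar>a1 n x\<bar> \<le> 2 * E" for n x
    proof -
      have "\<bar>\<phi>' (d n x)\<bar> * \<bar>I n x\<bar> \<le> E * 1" "\<bar>\<phi> (d n x)\<bar> * \<bar>q (u n x)\<bar> \<le> E * 1"
        using \<phi>E[of n x] E0 q1(1)[of "u n x"] by (intro mult_mono; auto simp: I_def)+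
      then show ?thesis unfolding a1_def abs_mult[symmetric] by linarith
    qed
    have a2E: "\<bar>a2 n x\<bar> \<le> E" for n x
    proof -
      have "\<bar>\<phi>' (d n x)\<bar> * \<bar>1 - Q (u n x)\<bar> \<le> E * 1" using \<phi>E(2)[of n x] Qs(1,2)[of "u n x"] E0 by (intro mult_mono) auto
      then show ?thesis by (simp add: a2_def abs_mult)
    qed
    have vm [measurable]: "v n \<in> borel_measurable M\<Omega>" "a1 n \<in> borel_measurable M\<Omega>" "a2 n \<in> borel_measurable M\<Omega>" for n
      unfolding v_def[abs_def] a1_def[abs_def] a2_def[abs_def] by measurable
    have out: "a1 n x = 0" "a2 n x = 0" "v n x = 0" if "2 * M < \<bar>u n x\<bar>" for n x
      using that Qs(4)[of "u n x"] qs(2)[of "u n x"] kM M1 by (auto simp: a1_def a2_def v_def I_def)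
    \<comment> \<open>\<open>v n\<close>, \<open>a1 n\<close> and \<open>a2 n\<close> vanish above
      2M, so this indicator can be inserted without changing the integrals; with it the flux is
      bounded in L2 uniformly in \<open>n\<close>.\<close>
    define J :: "nat \<Rightarrow> 'a \<Rightarrow> real" where "J n x = (if \<bar>u n x\<bar> \<le> 2 * M then 1 else 0)" for n x
    have Jm [measurable]: "J n \<in> borel_measurable M\<Omega>" for n unfolding J_def[abs_def] by measurable
    have Js: "sqi M\<Omega> (\<lambda>x. J n x *\<^sub>R flux n x)" "nrm2 M\<Omega> (\<lambda>x. J n x *\<^sub>R flux n x) \<le> (4 * \<alpha> (2 * M)) * B" for n
    proof -
      note cf = cutoff_flux[OF Jm, of n 1 n "2 * M" "g n"]
      show "sqi M\<Omega> (\<lambda>x. J n x *\<^sub>R flux n x)" using M1 by (intro cf(1) gs) (auto simp: J_def split: if_splits)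
      have "nrm2 M\<Omega> (\<lambda>x. J n x *\<^sub>R flux n x) \<le> 1 * (4 * \<alpha> (2 * M)) * nrm2 M\<Omega> (g n)"
        using M1 by (intro cf(2) gs) (auto simp: J_def split: if_splits)
      also have "\<dots> \<le> 1 * (4 * \<alpha> (2 * M)) * B" using \<alpha>_pos[of "2 * M"] M1 gB[of n] by (intro mult_left_mono) auto
      finally show "nrm2 M\<Omega> (\<lambda>x. J n x *\<^sub>R flux n x) \<le> (4 * \<alpha> (2 * M)) * B" by simp
    qed
    have Is: "sqi M\<Omega> (\<lambda>x. I n x *\<^sub>R flux n x)" "nrm2 M\<Omega> (\<lambda>x. I n x *\<^sub>R flux n x) \<le> (4 * \<alpha> k) * B" for n
    proof -
      note cf = cutoff_flux[OF Im(1), of n 1 n k "g n"]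
      show "sqi M\<Omega> (\<lambda>x. I n x *\<^sub>R flux n x)" using k0 by (intro cf(1) gs) (auto simp: I_def split: if_splits)
      have "nrm2 M\<Omega> (\<lambda>x. I n x *\<^sub>R flux n x) \<le> 1 * (4 * \<alpha> k) * nrm2 M\<Omega> (g n)"
        using k0 by (intro cf(2) gs) (auto simp: I_def split: if_splits)
      also have "\<dots> \<le> 1 * (4 * \<alpha> k) * B" using \<alpha>_pos[of k] k0 gB[of n] by (intro mult_left_mono) auto
      finally show "nrm2 M\<Omega> (\<lambda>x. I n x *\<^sub>R flux n x) \<le> (4 * \<alpha> k) * B" by simp
    qed
    \<comment> \<open>The half of the gap in which \<open>jxi\<close> is taken at the truncated
      limit gradient, weighted by \<kappa>. With that argument fixed it is dominated and converges
      almost everywhere, so it can be paired with the weakly convergent \<open>g n\<close>.\<close>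
    define h4 where "h4 n x = (I n x * \<kappa> n x) *\<^sub>R jxi x (u n x) (?\<xi> x)" for n x
    have h4s: "sqi M\<Omega> (h4 n)" "\<And>x. x \<in> \<Omega> \<Longrightarrow> norm (h4 n x) \<le> E * (4 * \<alpha> k) * norm (?\<xi> x)" for n
    proof -
      have "\<bar>I n x * \<kappa> n x\<bar> \<le> E" for x using \<kappa>E[of n x] E0 by (simp add: I_def)
      note cf = cutoff_flux[OF borel_measurable_times[OF Im(1) \<kappa>m] this, of n k ?\<xi>]
      show "sqi M\<Omega> (h4 n)" unfolding h4_def[abs_def] using k0 by (intro cf(1) tgrad_sqi) (auto simp: I_def split: if_splits)
      show "norm (h4 n x) \<le> E * (4 * \<alpha> k) * norm (?\<xi> x)" if "x \<in> \<Omega>" for x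
        unfolding h4_def using k0 that by (intro cf(3) tgrad_sqi) (auto simp: I_def split: if_splits)
    qed
    \<comment> \<open>The errors: \<open>e1\<close> comes from |u_n| > k, \<open>e2\<close> from the
      slope of the cutoff, \<open>e3\<close> from the absorption of \<open>js\<close>, and
      \<open>e4\<close> from the half of the gap that is linear in \<open>g n\<close>. All but
      \<open>e2\<close> vanish as \<open>n\<close> grows; \<open>e2\<close> is of order 1/M.\<close>
    define e1 where "e1 n = (\<integral>x. (J n x *\<^sub>R flux n x) \<bullet> (((1 - I n x) * a2 n x) *\<^sub>R ?\<xi> x) \<partial>M\<Omega>)" for n
    define e2 where "e2 n = (\<integral>x. (\<phi> (d n x) * q (u n x)) * (flux n x \<bullet> g n x) \<partial>M\<Omega>)" for n
    define e3 where "e3 n = (\<integral>x. (I n x *\<^sub>R flux n x) \<bullet> ((c * \<bar>\<phi> (d n x)\<bar>) *\<^sub>R ?\<xi> x) \<partial>M\<Omega>)" for n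
    define e4 where "e4 n = (\<integral>x. (g n x - ?\<xi> x) \<bullet> h4 n x \<partial>M\<Omega>)" for n
    have i1: "integrable M\<Omega> (\<lambda>x. (J n x *\<^sub>R flux n x) \<bullet> (((1 - I n x) * a2 n x) *\<^sub>R ?\<xi> x))" for n
    proof (rule sqi_inner_integrable[OF Js(1) sqi_bounded_scaleR[OF tgrad_sqi, of _ E]])
      show "\<bar>(1 - I n x) * a2 n x\<bar> \<le> E" for x using a2E[of n x] E0 by (simp add: I_def)
    qed measurable
    have i2: "integrable M\<Omega> (\<lambda>x. (\<phi> (d n x) * q (u n x)) * (flux n x \<bullet> g n x))" for n
    proof (rule Bochner_Integration.integrable_bound[OF integrable_mult_right[OF L1[of n], of E]])
      show "AE x in M\<Omega>. norm ((\<phi> (d n x) * q (u n x)) * (flux n x \<bullet> g n x)) \<le> norm (E * (flux n x \<bullet> g n x))"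
      proof (rule AE_I2)
        fix x
        have "\<bar>\<phi> (d n x)\<bar> * \<bar>q (u n x)\<bar> \<le> E * 1" using \<phi>E(1)[of n x] E0 q1(1)[of "u n x"] by (intro mult_mono) auto
        then show "norm ((\<phi> (d n x) * q (u n x)) * (flux n x \<bullet> g n x)) \<le> norm (E * (flux n x \<bullet> g n x))"
          using E0 by (simp add: abs_mult mult_right_mono)
      qed
    qed measurable
    have i3s: "sqi M\<Omega> (\<lambda>x. (c * \<bar>\<phi> (d n x)\<bar>) *\<^sub>R ?\<xi> x)" "\<And>x. \<bar>c * \<bar>\<phi> (d n x)\<bar>\<bar> \<le> c * E" for n
    proof -
      show b: "\<bar>c * \<bar>\<phi> (d n x)\<bar>\<bar> \<le> c * E" for x using \<phi>E(1)[of n x] c0 by (simp add: abs_mult mult_left_mono)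
      show "sqi M\<Omega> (\<lambda>x. (c * \<bar>\<phi> (d n x)\<bar>) *\<^sub>R ?\<xi> x)" by (rule sqi_bounded_scaleR[OF tgrad_sqi _ b]) measurable
    qed
    have i3: "integrable M\<Omega> (\<lambda>x. (I n x *\<^sub>R flux n x) \<bullet> ((c * \<bar>\<phi> (d n x)\<bar>) *\<^sub>R ?\<xi> x))" for n
      by (rule sqi_inner_integrable[OF Is(1) i3s(1)])
    have i4: "integrable M\<Omega> (\<lambda>x. (g n x - ?\<xi> x) \<bullet> h4 n x)" for n
      by (rule sqi_inner_integrable[OF sqi_diff[OF gs tgrad_sqi] h4s(1)])
    have i5: "integrable M\<Omega> (\<lambda>x. flux n x \<bullet> (a1 n x *\<^sub>R g n x - a2 n x *\<^sub>R ?\<xi> x))" for n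
    proof -
      have "integrable M\<Omega> (\<lambda>x. (J n x *\<^sub>R flux n x) \<bullet> (a1 n x *\<^sub>R g n x - a2 n x *\<^sub>R ?\<xi> x))"
        by (rule sqi_inner_integrable[OF Js(1) H10_sqi(2)[OF Hv]])
      moreover have "(J n x *\<^sub>R flux n x) \<bullet> (a1 n x *\<^sub>R g n x - a2 n x *\<^sub>R ?\<xi> x) = flux n x \<bullet> (a1 n x *\<^sub>R g n x - a2 n x *\<^sub>R ?\<xi> x)" for x
        using out[of n x] by (cases "\<bar>u n x\<bar> \<le> 2 * M") (auto simp: J_def)
      ultimately show ?thesis by (simp only:)
    qed
    have i6: "integrable M\<Omega> (\<lambda>x. js x (u n x) (g n x) * v n x)" for n
    proof (rule Bochner_Integration.integrable_bound[OF integrable_mult_right[OF sqi_integrable[OF gs[of n]], of "\<beta> (2 * M) * E"]])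
      show "(\<lambda>x. js x (u n x) (g n x) * v n x) \<in> borel_measurable M\<Omega>" by (rule borel_measurable_times[OF js_measurable[OF um gm] vm(1)])
      show "AE x in M\<Omega>. norm (js x (u n x) (g n x) * v n x) \<le> norm (\<beta> (2 * M) * E * (norm (g n x))\<^sup>2)"
      proof (rule AE_I2)
        fix x assume "x \<in> space M\<Omega>"
        then have x: "x \<in> \<Omega>" by simp
        have b0: "0 \<le> \<beta> (2 * M)" using \<beta>_pos[of "2 * M"] M1 by simp
        show "norm (js x (u n x) (g n x) * v n x) \<le> norm (\<beta> (2 * M) * E * (norm (g n x))\<^sup>2)"
        proof (cases "\<bar>u n x\<bar> \<le> 2 * M")
          case True
          have "\<bar>js x (u n x) (g n x)\<bar> * \<bar>v n x\<bar> \<le> (\<beta> (2 * M) * (norm (g n x))\<^sup>2) * E"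
            using js_growth_bounded[OF x True, of "g n x"] vE[of n x] b0 by (intro mult_mono) auto
          then show ?thesis using b0 E0 by (simp add: abs_mult mult_ac)
        next
          case False
          then show ?thesis using out(3)[of n x] by simp
        qed
      qed
    qed
    have ident: "(\<integral>x. js x (u n x) (g n x) * v n x \<partial>M\<Omega>) + (\<integral>x. flux n x \<bullet> (a1 n x *\<^sub>R g n x - a2 n x *\<^sub>R ?\<xi> x) \<partial>M\<Omega>) = W n (v n)" for n
    proof (rule eq[OF Hv, where C="max E (2 * M)"])
      show "\<bar>v n x\<bar> \<le> max E (2 * M)" for x using vE[of n x] by simp
      show "\<bar>u n x\<bar> \<le> max E (2 * M)" if "v n x \<noteq> 0" for x using that out(3)[of n x] by (cases "2 * M < \<bar>u n x\<bar>") auto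
    qed
    \<comment> \<open>The comparison is pointwise. Where |u_n| <= k the gap is enlarged by \<kappa>
      and expanded; above \<open>k\<close> the gap is zero, the terms with \<open>flux\<close> on
      the right cancel, and the product of \<open>js\<close> with the test function remains.\<close>
    have key: "(\<integral>x. gap k n x \<partial>M\<Omega>) \<le> W n (v n) + e1 n + e2 n + e3 n - e4 n" for n
    proof -
      let ?r = "\<lambda>x. js x (u n x) (g n x) * v n x + flux n x \<bullet> (a1 n x *\<^sub>R g n x - a2 n x *\<^sub>R ?\<xi> x)
          + (J n x *\<^sub>R flux n x) \<bullet> (((1 - I n x) * a2 n x) *\<^sub>R ?\<xi> x) + (\<phi> (d n x) * q (u n x)) * (flux n x \<bullet> g n x)
          + (I n x *\<^sub>R flux n x) \<bullet> ((c * \<bar>\<phi> (d n x)\<bar>) *\<^sub>R ?\<xi> x) - (g n x - ?\<xi> x) \<bullet> h4 n x"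
      have "(\<integral>x. gap k n x \<partial>M\<Omega>) \<le> (\<integral>x. ?r x \<partial>M\<Omega>)"
      proof (rule integral_mono_AE[OF gap_integrable])
        show "0 \<le> k" using k0 by simp
        show "integrable M\<Omega> ?r" using i1[of n] i2[of n] i3[of n] i4[of n] i5[of n] i6[of n]
          by (intro Bochner_Integration.integrable_diff Bochner_Integration.integrable_add)
        show "AE x in M\<Omega>. gap k n x \<le> ?r x"
        proof (rule AE_I2)
          fix x assume "x \<in> space M\<Omega>"
          then have x: "x \<in> \<Omega>" by simp
          let ?js = "js x (u n x) (g n x)" and ?A = "flux n x" and ?A' = "jxi x (u n x) (?\<xi> x)" and ?\<phi> = "\<phi> (d n x)" and ?\<phi>' = "\<phi>' (d n x)"
          show "gap k n x \<le> ?r x"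
          proof (cases "\<bar>u n x\<bar> \<le> k")
            case True
            then have I1: "I n x = 1" by (simp add: I_def)
            have Q0: "Q (u n x) = 0" using True kM by (intro Qs(3)) simp
            have q0: "q (u n x) = 0" by (rule q1(2)[OF True])
            have "\<bar>?js\<bar> \<le> \<beta> k * (norm (g n x))\<^sup>2" by (rule js_growth_bounded[OF x True])
            also have "\<dots> = c * (\<alpha>0 * (norm (g n x))\<^sup>2)" using \<alpha>0_pos by (simp add: c_def)
            also have "\<dots> \<le> c * (?A \<bullet> g n x)" by (intro mult_left_mono jxi_coercive[OF x] c0)
            finally have "\<bar>?js\<bar> * \<bar>?\<phi>\<bar> \<le> (c * (?A \<bullet> g n x)) * \<bar>?\<phi>\<bar>" by (intro mult_right_mono) auto
            then have j1: "- (c * \<bar>?\<phi>\<bar> * (?A \<bullet> g n x)) \<le> ?js * ?\<phi>"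
              using abs_ge_minus_self[of "?js * ?\<phi>"] by (simp add: abs_mult mult_ac)
            let ?D = "(?A - ?A') \<bullet> (g n x - ?\<xi> x)"
            have "?D \<le> \<kappa> n x * ?D" using jxi_monotone[OF x, of "u n x" "g n x" "?\<xi> x"] \<kappa>1[of n x]
              by (simp add: mult_le_cancel_right1)
            also have "\<dots> = ?\<phi>' * (?A \<bullet> g n x) - ?\<phi>' * (?A \<bullet> ?\<xi> x) - c * \<bar>?\<phi>\<bar> * (?A \<bullet> g n x) + c * \<bar>?\<phi>\<bar> * (?A \<bullet> ?\<xi> x) - \<kappa> n x * ((g n x - ?\<xi> x) \<bullet> ?A')"
              unfolding \<kappa>_def by (simp add: inner_diff_left inner_diff_right inner_commute algebra_simps)
            also have "\<dots> \<le> ?js * ?\<phi> + ?\<phi>' * (?A \<bullet> g n x) - ?\<phi>' * (?A \<bullet> ?\<xi> x) + c * \<bar>?\<phi>\<bar> * (?A \<bullet> ?\<xi> x) - \<kappa> n x * ((g n x - ?\<xi> x) \<bullet> ?A')"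
              using j1 by linarith
            also have "\<dots> = ?r x" by (simp add: v_def a1_def a2_def h4_def I1 Q0 q0 inner_diff_right)
            finally show ?thesis using True by (simp add: gap_def)
          next
            case False
            then have I0': "I n x = 0" by (simp add: I_def)
            have jk: "0 \<le> ?js * u n x" using False k by (intro H4[OF x]) simp
            \<comment> \<open>Above \<open>k\<close> the truncation of \<open>u n\<close> is an
              endpoint of [-k, k], so \<open>d n\<close> has the sign of \<open>u n\<close> wherever
              the truncation of \<open>u0\<close> lies in that interval, and (H4) applies.\<close>
            have "0 \<le> ?js * ?\<phi>"
            proof (cases "0 \<le> u n x")
              case True
              then have "T (u n x) = k" using False by (intro Tb(2)) simp
              then have "0 \<le> d n x" using Tb(1)[of "u0 x"] by (simp add: d_def)
              then show ?thesis using \<phi>(5) jk True False k0 by (auto simp: zero_le_mult_iff)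
            next
              case neg: False
              then have "T (u n x) = - k" using False by (intro Tb(3)) simp
              then have "d n x \<le> 0" using Tb(1)[of "u0 x"] by (simp add: d_def)
              then show ?thesis using \<phi>(6) jk neg False k0 by (auto simp: zero_le_mult_iff)
            qed
            then have "0 \<le> (?js * ?\<phi>) * (1 - Q (u n x))" by (rule mult_nonneg_nonneg) (use Qs(2)[of "u n x"] in simp)
            then have "0 \<le> ?js * v n x" by (simp add: v_def mult.assoc)
            moreover have "(J n x *\<^sub>R ?A) \<bullet> (((1 - I n x) * a2 n x) *\<^sub>R ?\<xi> x) = a2 n x * (?A \<bullet> ?\<xi> x)"
              using out(2)[of n x] by (cases "\<bar>u n x\<bar> \<le> 2 * M") (auto simp: J_def I0')
            ultimately have "0 \<le> ?r x" by (auto simp: I0' a1_def h4_def inner_diff_right)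
            then show ?thesis using False by (simp add: gap_def)
          qed
        qed
      qed
      also have "(\<integral>x. ?r x \<partial>M\<Omega>) = W n (v n) + e1 n + e2 n + e3 n - e4 n"
        using i1[of n] i2[of n] i3[of n] i4[of n] i5[of n] i6[of n] ident[of n]
        by (simp add: e1_def e2_def e3_def e4_def)
      finally show ?thesis .
    qed
    \<comment> \<open>Almost everywhere \<open>I n\<close> eventually equals \<open>I0\<close>, and
      the factor 1 - I0 annihilates the truncated limit gradient.\<close>
    have e1lim: "e1 \<longlonglongrightarrow> 0" unfolding e1_def
    proof (rule bounded_times_dominated[OF Js sqi_scaleR[OF tgrad_sqi, of E]])
      show "(\<lambda>x. ((1 - I n x) * a2 n x) *\<^sub>R ?\<xi> x) \<in> borel_measurable M\<Omega>" for n by measurable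
      have "\<bar>(1 - I n x) * a2 n x\<bar> \<le> E" for n x using a2E[of n x] E0 by (simp add: I_def)
      then show "AE x in M\<Omega>. norm (((1 - I n x) * a2 n x) *\<^sub>R ?\<xi> x) \<le> norm (E *\<^sub>R ?\<xi> x)" for n
        using E0 by (intro AE_I2) (simp add: mult_right_mono)
      show "AE x in M\<Omega>. (\<lambda>n. ((1 - I n x) * a2 n x) *\<^sub>R ?\<xi> x) \<longlonglongrightarrow> 0"
        using truncation_indicator_tendsto[OF good]
      proof eventually_elim
        case (elim x)
        then have "\<forall>\<^sub>F n in sequentially. I n x = I0 x" by (simp add: I_def I0_def)
        then have "\<forall>\<^sub>F n in sequentially. ((1 - I n x) * a2 n x) *\<^sub>R ?\<xi> x = 0"
          by eventually_elim (simp add: \<xi> I0_def)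
        then show ?case by (rule tendsto_eventually)
      qed
    qed
    have e3lim: "e3 \<longlonglongrightarrow> 0" unfolding e3_def
    proof (rule bounded_times_dominated[OF Is sqi_scaleR[OF tgrad_sqi, of "c * E"] sqi_measurable[OF i3s(1)]])
      show "AE x in M\<Omega>. norm ((c * \<bar>\<phi> (d n x)\<bar>) *\<^sub>R ?\<xi> x) \<le> norm ((c * E) *\<^sub>R ?\<xi> x)" for n
        unfolding norm_scaleR using order_trans[OF i3s(2) abs_ge_self] by (intro AE_I2 mult_right_mono) auto
      show "AE x in M\<Omega>. (\<lambda>n. (c * \<bar>\<phi> (d n x)\<bar>) *\<^sub>R ?\<xi> x) \<longlonglongrightarrow> 0"
        using \<phi>lim(1)
      proof eventually_elim
        case (elim x)
        have "(\<lambda>n. (c * \<bar>\<phi> (d n x)\<bar>) *\<^sub>R ?\<xi> x) \<longlonglongrightarrow> (c * \<bar>0\<bar>) *\<^sub>R ?\<xi> x" by (intro tendsto_intros elim)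
        then show ?case by simp
      qed
    qed
    have cst: "weakly_conv M\<Omega> (\<lambda>n. ?\<xi>) ?\<xi>" by (simp add: weakly_conv_def)
    have e4lim: "e4 \<longlonglongrightarrow> 0"
    proof -
      define h40 where "h40 x = \<phi>' 0 *\<^sub>R jxi x (u0 x) (?\<xi> x)" for x
      have h40m: "h40 \<in> borel_measurable M\<Omega>" unfolding h40_def[abs_def]
        by (intro borel_measurable_scaleR borel_measurable_const jxi_measurable u0m tgrad_measurable)
      have le: "AE x in M\<Omega>. norm (h4 n x) \<le> norm ((E * (4 * \<alpha> k)) *\<^sub>R ?\<xi> x)" for n
        using h4s(2)[of _ n] E0 \<alpha>_pos[of k] k0 by (intro AE_I2) (auto simp: abs_mult)
      have hl: "AE x in M\<Omega>. (\<lambda>n. h4 n x) \<longlonglongrightarrow> h40 x"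
        using Ilim \<kappa>lim ae AE_space
      proof eventually_elim
        case (elim x)
        then have x: "x \<in> \<Omega>" by simp
        show ?case
        proof (cases "\<bar>u0 x\<bar> \<le> k")
          case True
          have "(\<lambda>n. (u n x, ?\<xi> x)) \<longlonglongrightarrow> (u0 x, ?\<xi> x)" by (intro tendsto_intros elim)
          from continuous_on_tendsto_compose[OF jxi_cont[OF x] this]
          have "(\<lambda>n. jxi x (u n x) (?\<xi> x)) \<longlonglongrightarrow> jxi x (u0 x) (?\<xi> x)" by simp
          then have "(\<lambda>n. (I n x * \<kappa> n x) *\<^sub>R jxi x (u n x) (?\<xi> x)) \<longlonglongrightarrow> (I0 x * \<phi>' 0) *\<^sub>R jxi x (u0 x) (?\<xi> x)"
            by (intro tendsto_intros elim)
          then show ?thesis using True by (simp add: h4_def h40_def I0_def)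
        next
          case False
          then have "?\<xi> x = 0" by (simp add: tgrad_def)
          then show ?thesis by (simp add: h4_def h40_def jxi_zero[OF x])
        qed
      qed
      have l1: "(\<lambda>n. \<integral>x. g n x \<bullet> h4 n x \<partial>M\<Omega>) \<longlonglongrightarrow> (\<integral>x. g0 x \<bullet> h40 x \<partial>M\<Omega>)"
        by (rule weak_times_dominated[OF gs gB weak sqi_scaleR[OF tgrad_sqi] sqi_measurable[OF h4s(1)] h40m le hl])
      have l2: "(\<lambda>n. \<integral>x. ?\<xi> x \<bullet> h4 n x \<partial>M\<Omega>) \<longlonglongrightarrow> (\<integral>x. ?\<xi> x \<bullet> h40 x \<partial>M\<Omega>)"
        by (rule weak_times_dominated[OF tgrad_sqi order_refl cst sqi_scaleR[OF tgrad_sqi] sqi_measurable[OF h4s(1)] h40m le hl])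
      \<comment> \<open>The two limits agree: where |u0| > k the gradient argument of
        \<open>jxi\<close> is 0, so \<open>h40\<close> vanishes and the difference between
        \<open>g0\<close> and its truncation is not seen.\<close>
      have "(\<integral>x. g0 x \<bullet> h40 x \<partial>M\<Omega>) = (\<integral>x. ?\<xi> x \<bullet> h40 x \<partial>M\<Omega>)"
      proof (rule Bochner_Integration.integral_cong[OF refl])
        fix x assume "x \<in> space M\<Omega>"
        then have x: "x \<in> \<Omega>" by simp
        show "g0 x \<bullet> h40 x = ?\<xi> x \<bullet> h40 x"
          by (cases "\<bar>u0 x\<bar> \<le> k") (simp_all add: tgrad_def h40_def jxi_zero[OF x])
      qed
      with tendsto_diff[OF l1 l2] have "(\<lambda>n. (\<integral>x. g n x \<bullet> h4 n x \<partial>M\<Omega>) - (\<integral>x. ?\<xi> x \<bullet> h4 n x \<partial>M\<Omega>)) \<longlonglongrightarrow> 0" by simp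
      moreover have "e4 = (\<lambda>n. (\<integral>x. g n x \<bullet> h4 n x \<partial>M\<Omega>) - (\<integral>x. ?\<xi> x \<bullet> h4 n x \<partial>M\<Omega>))"
        unfolding e4_def inner_diff_left
        by (rule ext, rule Bochner_Integration.integral_diff[OF sqi_inner_integrable[OF gs h4s(1)] sqi_inner_integrable[OF tgrad_sqi h4s(1)]])
      ultimately show ?thesis by (simp only:)
    qed
    \<comment> \<open>The limit functional applied to \<open>v n\<close>, rearranged so that the
      weakly convergent \<open>g n\<close> is paired with a bounded multiple of the fixed
      \<open>y\<close>.\<close>
    define w1 where "w1 n = (\<integral>x. z x \<bullet> v n x \<partial>M\<Omega>) + ((\<integral>x. g n x \<bullet> (a1 n x *\<^sub>R y x) \<partial>M\<Omega>) - (\<integral>x. ?\<xi> x \<bullet> (a2 n x *\<^sub>R y x) \<partial>M\<Omega>))" for n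
    have a1y: "sqi M\<Omega> (\<lambda>x. a1 n x *\<^sub>R y x)" and a2y: "sqi M\<Omega> (\<lambda>x. a2 n x *\<^sub>R y x)" for n
      by (rule sqi_bounded_scaleR[OF ys vm(2) a1E], rule sqi_bounded_scaleR[OF ys vm(3) a2E])
    have vs: "sqi M\<Omega> (v n)" for n by (rule H10_sqi(1)[OF Hv])
    have w1lim: "w1 \<longlonglongrightarrow> 0"
    proof -
      have q\<phi>: "AE x in M\<Omega>. (\<lambda>n. \<phi> (d n x) * q (u n x)) \<longlonglongrightarrow> 0"
        using \<phi>lim(1)
      proof eventually_elim
        case (elim x)
        have "\<bar>\<phi> (d n x) * q (u n x)\<bar> \<le> \<bar>\<phi> (d n x)\<bar>" for n
          using q1(1)[of "u n x"] by (simp add: abs_mult mult_left_le)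
        then show ?case by (intro Lim_null_comparison[OF _ tendsto_rabs_zero[OF elim]]) auto
      qed
      have Qlim: "AE x in M\<Omega>. (\<lambda>n. Q (u n x)) \<longlonglongrightarrow> Q (u0 x)"
        using ae by eventually_elim (rule continuous_on_tendsto_compose[OF Qc], auto)
      have "AE x in M\<Omega>. (\<lambda>n. v n x) \<longlonglongrightarrow> 0"
        using \<phi>lim(1) Qlim
      proof eventually_elim
        case (elim x)
        have "(\<lambda>n. \<phi> (d n x) * (1 - Q (u n x))) \<longlonglongrightarrow> 0 * (1 - Q (u0 x))" by (intro tendsto_intros elim)
        then show ?case by (simp add: v_def)
      qed
      then have l0: "(\<lambda>n. \<integral>x. z x \<bullet> v n x \<partial>M\<Omega>) \<longlonglongrightarrow> 0"
        by (intro bounded_times_dominated[OF zs order_refl sqi_const[of E] vm(1)]) (use vE E0 in auto)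
      have l1: "(\<lambda>n. \<integral>x. g n x \<bullet> (a1 n x *\<^sub>R y x) \<partial>M\<Omega>) \<longlonglongrightarrow> (\<integral>x. g0 x \<bullet> ((\<phi>' 0 * I0 x) *\<^sub>R y x) \<partial>M\<Omega>)"
      proof (rule weak_times_dominated[OF gs gB weak sqi_scaleR[OF ys, of "2 * E"] sqi_measurable[OF a1y]])
        show "AE x in M\<Omega>. norm (a1 n x *\<^sub>R y x) \<le> norm ((2 * E) *\<^sub>R y x)" for n
          unfolding norm_scaleR using order_trans[OF a1E abs_ge_self] by (intro AE_I2 mult_right_mono) auto
        show "AE x in M\<Omega>. (\<lambda>n. a1 n x *\<^sub>R y x) \<longlonglongrightarrow> (\<phi>' 0 * I0 x) *\<^sub>R y x"
          using \<phi>lim(2) Ilim q\<phi>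
        proof eventually_elim
          case (elim x)
          have "(\<lambda>n. (\<phi>' (d n x) * I n x - \<phi> (d n x) * q (u n x)) *\<^sub>R y x) \<longlonglongrightarrow> (\<phi>' 0 * I0 x - 0) *\<^sub>R y x"
            by (intro tendsto_intros elim)
          then show ?case by (simp add: a1_def)
        qed
      qed measurable
      have l2: "(\<lambda>n. \<integral>x. ?\<xi> x \<bullet> (a2 n x *\<^sub>R y x) \<partial>M\<Omega>) \<longlonglongrightarrow> (\<integral>x. ?\<xi> x \<bullet> ((\<phi>' 0 * (1 - Q (u0 x))) *\<^sub>R y x) \<partial>M\<Omega>)"
      proof (rule weak_times_dominated[OF tgrad_sqi order_refl cst sqi_scaleR[OF ys, of E] sqi_measurable[OF a2y]])
        show "AE x in M\<Omega>. norm (a2 n x *\<^sub>R y x) \<le> norm (E *\<^sub>R y x)" for n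
          unfolding norm_scaleR using order_trans[OF a2E abs_ge_self] by (intro AE_I2 mult_right_mono) auto
        show "AE x in M\<Omega>. (\<lambda>n. a2 n x *\<^sub>R y x) \<longlonglongrightarrow> (\<phi>' 0 * (1 - Q (u0 x))) *\<^sub>R y x"
          using \<phi>lim(2) Qlim
        proof eventually_elim
          case (elim x)
          then show ?case unfolding a2_def by (intro tendsto_intros)
        qed
      qed measurable
      \<comment> \<open>Where |u0| <= k the cutoff is 1, since \<open>k \<le> M\<close>; elsewhere
        both integrands vanish.\<close>
      have "(\<integral>x. g0 x \<bullet> ((\<phi>' 0 * I0 x) *\<^sub>R y x) \<partial>M\<Omega>) = (\<integral>x. ?\<xi> x \<bullet> ((\<phi>' 0 * (1 - Q (u0 x))) *\<^sub>R y x) \<partial>M\<Omega>)"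
      proof (rule Bochner_Integration.integral_cong[OF refl])
        fix x
        show "g0 x \<bullet> ((\<phi>' 0 * I0 x) *\<^sub>R y x) = ?\<xi> x \<bullet> ((\<phi>' 0 * (1 - Q (u0 x))) *\<^sub>R y x)"
        proof (cases "\<bar>u0 x\<bar> \<le> k")
          case True
          then have "Q (u0 x) = 0" using kM by (intro Qs(3)) simp
          then show ?thesis using True by (simp add: \<xi> I0_def)
        qed (simp add: \<xi> I0_def)
      qed
      with tendsto_add[OF l0 tendsto_diff[OF l1 l2]] show ?thesis by (simp add: w1_def[abs_def])
    qed
    \<comment> \<open>A bound for the Sobolev norm of \<open>v n\<close> that is uniform in
      \<open>n\<close>; multiplied by \<open>\<delta> n\<close> it disappears.\<close>
    define N where "N = nrm2 M\<Omega> (\<lambda>x. E) + (2 * E * B + E * nrm2 M\<Omega> ?\<xi>)"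
    have Wle: "W n (v n) \<le> w1 n + \<delta> n * N" for n
    proof -
      let ?h = "\<lambda>x. a1 n x *\<^sub>R g n x - a2 n x *\<^sub>R ?\<xi> x"
      have s1: "sqi M\<Omega> (\<lambda>x. a1 n x *\<^sub>R g n x)" by (rule sqi_bounded_scaleR[OF gs vm(2) a1E])
      have s2: "sqi M\<Omega> (\<lambda>x. a2 n x *\<^sub>R ?\<xi> x)" by (rule sqi_bounded_scaleR[OF tgrad_sqi vm(3) a2E])
      have n1: "nrm2 M\<Omega> (\<lambda>x. a1 n x *\<^sub>R g n x) \<le> 2 * E * B"
      proof -
        have "nrm2 M\<Omega> (\<lambda>x. a1 n x *\<^sub>R g n x) \<le> nrm2 M\<Omega> (\<lambda>x. (2 * E) *\<^sub>R g n x)"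
          by (rule nrm2_mono[OF sqi_scaleR[OF gs] sqi_measurable[OF s1]], unfold norm_scaleR)
            (use order_trans[OF a1E abs_ge_self] in \<open>auto intro!: AE_I2 mult_right_mono\<close>)
        also have "\<dots> \<le> 2 * E * B" unfolding nrm2_scaleR using E0 gB[of n] by (simp add: mult_left_mono)
        finally show ?thesis .
      qed
      have n2: "nrm2 M\<Omega> (\<lambda>x. a2 n x *\<^sub>R ?\<xi> x) \<le> E * nrm2 M\<Omega> ?\<xi>"
      proof -
        have "nrm2 M\<Omega> (\<lambda>x. a2 n x *\<^sub>R ?\<xi> x) \<le> nrm2 M\<Omega> (\<lambda>x. E *\<^sub>R ?\<xi> x)"
          by (rule nrm2_mono[OF sqi_scaleR[OF tgrad_sqi] sqi_measurable[OF s2]], unfold norm_scaleR)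
            (use order_trans[OF a2E abs_ge_self] in \<open>auto intro!: AE_I2 mult_right_mono\<close>)
        also have "\<dots> = E * nrm2 M\<Omega> ?\<xi>" unfolding nrm2_scaleR using E0 by simp
        finally show ?thesis .
      qed
      have n0: "nrm2 M\<Omega> (v n) \<le> nrm2 M\<Omega> (\<lambda>x. E)" by (rule nrm2_mono[OF sqi_const vm(1)]) (use vE E0 in auto)
      have "nrm2 M\<Omega> (\<lambda>x. (v n x, ?h x)) \<le> N"
        using nrm2_components(3)[OF vs[of n] sqi_diff[OF s1 s2]] nrm2_diff_le[OF s1 s2] n0 n1 n2 unfolding N_def by linarith
      then have "\<delta> n * nrm2 M\<Omega> (\<lambda>x. (v n x, ?h x)) \<le> \<delta> n * N" by (intro mult_left_mono \<delta>0)
      moreover have "(\<integral>x. (z x, y x) \<bullet> (v n x, ?h x) \<partial>M\<Omega>) = w1 n"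
      proof -
        have "(\<integral>x. (z x, y x) \<bullet> (v n x, ?h x) \<partial>M\<Omega>) = (\<integral>x. z x \<bullet> v n x + (g n x \<bullet> (a1 n x *\<^sub>R y x) - ?\<xi> x \<bullet> (a2 n x *\<^sub>R y x)) \<partial>M\<Omega>)"
          by (intro Bochner_Integration.integral_cong refl) (simp add: inner_diff_right inner_commute)
        also have "\<dots> = w1 n" unfolding w1_def
          using sqi_inner_integrable[OF zs vs[of n]] sqi_inner_integrable[OF gs a1y, of n n] sqi_inner_integrable[OF tgrad_sqi a2y, of k n]
          by (subst Bochner_Integration.integral_add[OF _ Bochner_Integration.integrable_diff]; simp)
        finally show ?thesis .
      qed
      ultimately show ?thesis using Wb[OF Hv[of n], of n] by linarith
    qed
    have e2le: "e2 n \<le> E * CA / M" for n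
    proof -
      have "e2 n \<le> (\<integral>x. (E / M) * ((if \<bar>u n x\<bar> > M then 1 else 0) * (flux n x \<bullet> g n x)) \<partial>M\<Omega>)"
        unfolding e2_def
      proof (rule integral_mono_AE[OF i2 integrable_mult_right[OF tail_indicator_integrable]])
        show "AE x in M\<Omega>. \<phi> (d n x) * q (u n x) * (flux n x \<bullet> g n x) \<le> (E / M) * ((if \<bar>u n x\<bar> > M then 1 else 0) * (flux n x \<bullet> g n x))"
        proof (rule AE_I2)
          fix x assume "x \<in> space M\<Omega>"
          then have x: "x \<in> \<Omega>" by simp
          have "\<phi> (d n x) * q (u n x) \<le> \<bar>\<phi> (d n x)\<bar> * \<bar>q (u n x)\<bar>" by (metis abs_ge_self abs_mult)
          also have "\<dots> \<le> E * ((1 / M) * (if \<bar>u n x\<bar> > M then 1 else 0))"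
            using \<phi>E(1)[of n x] qs(1)[of "u n x"] E0 by (intro mult_mono) auto
          finally have "\<phi> (d n x) * q (u n x) * (flux n x \<bullet> g n x) \<le> E * ((1 / M) * (if \<bar>u n x\<bar> > M then 1 else 0)) * (flux n x \<bullet> g n x)"
            by (intro mult_right_mono energy_nonneg[OF x])
          then show "\<phi> (d n x) * q (u n x) * (flux n x \<bullet> g n x) \<le> (E / M) * ((if \<bar>u n x\<bar> > M then 1 else 0) * (flux n x \<bullet> g n x))"
            by (simp add: mult_ac)
        qed
      qed
      also have "\<dots> = (E / M) * (\<integral>x. (if \<bar>u n x\<bar> > M then 1 else 0) * (flux n x \<bullet> g n x) \<partial>M\<Omega>)" by simp
      also have "\<dots> \<le> (E / M) * CA" using E0 M1 k kM by (intro mult_left_mono CA(2)) auto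
      finally show ?thesis by simp
    qed
    have "(\<lambda>n. (w1 n + \<delta> n * N) + e1 n + e3 n - e4 n) \<longlonglongrightarrow> (0 + 0 * N) + 0 + 0 - 0"
      by (intro tendsto_intros w1lim \<delta>lim e1lim e3lim e4lim)
    moreover have "(\<integral>x. gap k n x \<partial>M\<Omega>) \<le> ((w1 n + \<delta> n * N) + e1 n + e3 n - e4 n) + E * CA / M" for n
      using key[of n] Wle[of n] e2le[of n] by linarith
    ultimately show "\<exists>e. e \<longlonglongrightarrow> 0 \<and> (\<forall>n. (\<integral>x. gap k n x \<partial>M\<Omega>) \<le> e n + E * CA / M)"
      by (intro exI[of _ "\<lambda>n. (w1 n + \<delta> n * N) + e1 n + e3 n - e4 n"]) simp
  qed
qed

end

section \<open>From the vanishing gap to strong convergence of the gradients\<close>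

context approximate_solutions
begin

lemma truncated_gap_tendsto:
  assumes k: "R \<le> k" and good: "AE x in M\<Omega>. \<bar>u0 x\<bar> \<noteq> k"
  shows "(\<lambda>n. \<integral>x. gap k n x \<partial>M\<Omega>) \<longlonglongrightarrow> 0"
proof -
  obtain C where C: "0 \<le> C" "\<And>M. 1 \<le> M \<Longrightarrow> k \<le> M \<Longrightarrow> \<exists>e. e \<longlonglongrightarrow> 0 \<and> (\<forall>n. (\<integral>x. gap k n x \<partial>M\<Omega>) \<le> e n + C / M)"
    using truncated_gap_bound[OF k good] by blast
  have nn: "0 \<le> (\<integral>x. gap k n x \<partial>M\<Omega>)" for n
    by (rule integral_nonneg_AE, rule AE_I2) (simp add: gap_nonneg)
  show ?thesis
  proof (rule order_tendstoI)
    fix a :: real assume "a < 0"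
    then show "\<forall>\<^sub>F n in sequentially. a < (\<integral>x. gap k n x \<partial>M\<Omega>)"
      using nn by (intro always_eventually allI) (auto intro: less_le_trans)
  next
    fix a :: real assume a: "0 < a"
    \<comment> \<open>The last entry makes C / M strictly less than a / 2, and C + 1 keeps the
      inequality strict; the rest of the tolerance is left to \<open>e n\<close>.\<close>
    define M where "M = max (max 1 k) (2 * (C + 1) / a)"
    have M: "1 \<le> M" "k \<le> M" "2 * (C + 1) / a \<le> M" by (auto simp: M_def)
    have "2 * (C + 1) \<le> M * a" using M(3) a by (simp add: divide_le_eq)
    then have CM: "C / M < a / 2" using M(1) a by (simp add: field_simps)
    obtain e where e: "e \<longlonglongrightarrow> 0" "\<And>n. (\<integral>x. gap k n x \<partial>M\<Omega>) \<le> e n + C / M" using C(2)[OF M(1,2)] by blast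
    have "\<forall>\<^sub>F n in sequentially. e n < a / 2" using a by (intro order_tendstoD(2)[OF e(1)]) simp
    then show "\<forall>\<^sub>F n in sequentially. (\<integral>x. gap k n x \<partial>M\<Omega>) < a"
    proof eventually_elim
      case (elim n)
      then show ?case using e(2)[of n] CM by linarith
    qed
  qed
qed

text \<open>Expanding the gap gives the energy up to cross terms, at most 8 \<alpha>(k) times the
  product of the two gradient norms by the growth of \<open>jxi\<close>. Young's inequality absorbs
  half of the coercive term.\<close>

lemma gradient_le_gap:
  assumes x: "x \<in> \<Omega>" and uk: "\<bar>u n x\<bar> \<le> k"
  shows "(norm (g n x))\<^sup>2 \<le> (2 / \<alpha>0) * gap k n x + (64 * (\<alpha> k)\<^sup>2 / \<alpha>0\<^sup>2) * (norm (tgrad k x))\<^sup>2"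
proof -
  let ?A = "flux n x" and ?A' = "jxi x (u n x) (tgrad k x)" and ?G = "norm (g n x)" and ?X = "norm (tgrad k x)"
  have "\<alpha>0 * ?G\<^sup>2 \<le> ?A \<bullet> g n x" by (rule jxi_coercive[OF x])
  also have "\<dots> = gap k n x + ?A \<bullet> tgrad k x + ?A' \<bullet> g n x - ?A' \<bullet> tgrad k x"
    using uk by (simp add: gap_def inner_diff_left inner_diff_right)
  also have "\<dots> \<le> gap k n x + 4 * \<alpha> k * ?G * ?X + 4 * \<alpha> k * ?X * ?G"
  proof -
    have "?A \<bullet> tgrad k x \<le> 4 * \<alpha> k * ?G * ?X"
      using Cauchy_Schwarz_ineq2[of ?A "tgrad k x"] mult_right_mono[OF jxi_growth_bounded[OF x uk, of "g n x"] norm_ge_zero[of "tgrad k x"]] by linarith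
    moreover have "?A' \<bullet> g n x \<le> 4 * \<alpha> k * ?X * ?G"
      using Cauchy_Schwarz_ineq2[of ?A' "g n x"] mult_right_mono[OF jxi_growth_bounded[OF x uk, of "tgrad k x"] norm_ge_zero[of "g n x"]] by linarith
    moreover have "0 \<le> ?A' \<bullet> tgrad k x"
      using jxi_coercive[OF x, of "tgrad k x" "u n x"] mult_nonneg_nonneg[OF less_imp_le[OF \<alpha>0_pos] zero_le_power2[of ?X]] by linarith
    ultimately show ?thesis by linarith
  qed
  finally have 1: "\<alpha>0 * ?G\<^sup>2 \<le> gap k n x + 8 * \<alpha> k * ?G * ?X" by simp
  have "0 \<le> (\<alpha>0 * ?G - 8 * \<alpha> k * ?X)\<^sup>2" by simp
  then have "2 * \<alpha>0 * (8 * \<alpha> k * ?G * ?X) \<le> \<alpha>0\<^sup>2 * ?G\<^sup>2 + 64 * (\<alpha> k)\<^sup>2 * ?X\<^sup>2"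
    by (simp add: power2_eq_square algebra_simps)
  moreover have "2 * \<alpha>0 * (\<alpha>0 * ?G\<^sup>2) \<le> 2 * \<alpha>0 * (gap k n x + 8 * \<alpha> k * ?G * ?X)"
    using 1 \<alpha>0_pos by (intro mult_left_mono) auto
  ultimately have "\<alpha>0\<^sup>2 * ?G\<^sup>2 \<le> 2 * \<alpha>0 * gap k n x + 64 * (\<alpha> k)\<^sup>2 * ?X\<^sup>2"
    by (simp add: power2_eq_square algebra_simps)
  then have "?G\<^sup>2 \<le> (2 * \<alpha>0 * gap k n x + 64 * (\<alpha> k)\<^sup>2 * ?X\<^sup>2) / \<alpha>0\<^sup>2"
    using \<alpha>0_pos by (simp add: pos_le_divide_eq mult.commute)
  also have "\<dots> = (2 / \<alpha>0) * gap k n x + (64 * (\<alpha> k)\<^sup>2 / \<alpha>0\<^sup>2) * ?X\<^sup>2"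
    using \<alpha>0_pos by (simp add: add_divide_distrib power2_eq_square)
  finally show ?thesis .
qed

text \<open>Dominated convergence with a moving majorant: the integrand is bounded by a multiple of
  the gap, which vanishes in L1, plus a fixed integrable function.\<close>

lemma truncated_gradient_tendsto:
  assumes k: "R \<le> k" and good: "AE x in M\<Omega>. \<bar>u0 x\<bar> \<noteq> k"
  shows "(\<lambda>n. \<integral>x. (if \<bar>u n x\<bar> \<le> k then 1 else 0) * (norm (g n x - tgrad k x))\<^sup>2 \<partial>M\<Omega>) \<longlonglongrightarrow> 0"
proof -
  have k0: "0 \<le> k" using k R_pos by linarith
  define Y where "Y n x = (if \<bar>u n x\<bar> \<le> k then 1 else 0) * (norm (g n x - tgrad k x))\<^sup>2" for n x
  define c1 where "c1 = 2 * (2 / \<alpha>0)"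
  define c2 where "c2 = 2 * (64 * (\<alpha> k)\<^sup>2 / \<alpha>0\<^sup>2) + 2"
  have c0: "0 \<le> c1" "0 \<le> c2" using \<alpha>0_pos by (auto simp: c1_def c2_def)
  have Ym: "Y n \<in> borel_measurable M\<Omega>" for n unfolding Y_def[abs_def] by measurable
  have gm': "gap k n \<in> borel_measurable M\<Omega>" for n using gap_integrable[OF k0, of n] by (rule borel_measurable_integrable)
  have Y0: "0 \<le> Y n x" for n x by (simp add: Y_def)
  have Yle: "Y n x \<le> c1 * gap k n x + c2 * (norm (tgrad k x))\<^sup>2" if x: "x \<in> \<Omega>" for n x
  proof (cases "\<bar>u n x\<bar> \<le> k")
    case True
    have "Y n x \<le> 2 * (norm (g n x))\<^sup>2 + 2 * (norm (tgrad k x))\<^sup>2"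
      using True power2_norm_add_le[of "g n x" "- tgrad k x"] by (simp add: Y_def)
    also have "\<dots> \<le> 2 * ((2 / \<alpha>0) * gap k n x + (64 * (\<alpha> k)\<^sup>2 / \<alpha>0\<^sup>2) * (norm (tgrad k x))\<^sup>2) + 2 * (norm (tgrad k x))\<^sup>2"
      by (intro add_mono mult_left_mono gradient_le_gap[OF x True]) auto
    also have "\<dots> = c1 * gap k n x + c2 * (norm (tgrad k x))\<^sup>2" by (simp add: c1_def c2_def algebra_simps)
    finally show ?thesis .
  next
    case False
    then show ?thesis using c0 gap_nonneg[OF x, of k n] by (simp add: Y_def)
  qed
  have Xi: "integrable M\<Omega> (\<lambda>x. c2 * (norm (tgrad k x))\<^sup>2)" by (rule integrable_mult_right[OF sqi_integrable[OF tgrad_sqi]])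
  have Yi: "integrable M\<Omega> (Y n)" for n
  proof (rule Bochner_Integration.integrable_bound[OF Bochner_Integration.integrable_add[OF integrable_mult_right[OF gap_integrable[OF k0, of n], of c1] Xi] Ym])
    show "AE x in M\<Omega>. norm (Y n x) \<le> norm (c1 * gap k n x + c2 * (norm (tgrad k x))\<^sup>2)"
      using Yle Y0 by (intro AE_I2) (auto intro: order_trans[OF _ abs_ge_self])
  qed
  have "(\<lambda>n. \<integral>x. Y n x \<partial>M\<Omega>) \<longlonglongrightarrow> 0"
  \<comment> \<open>The gap tends to zero almost everywhere only along subsequences of a given
    subsequence.\<close>
  proof (rule tendsto_zero_if_subsubsequence)
    fix r :: "nat \<Rightarrow> nat" assume r: "strict_mono r"
    have gr: "(\<lambda>n. \<integral>x. gap k (r n) x \<partial>M\<Omega>) \<longlonglongrightarrow> 0"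
      using LIMSEQ_subseq_LIMSEQ[OF truncated_gap_tendsto[OF k good] r] by (simp add: o_def)
    have "(\<integral>x. norm (gap k n x) \<partial>M\<Omega>) = (\<integral>x. gap k n x \<partial>M\<Omega>)" for n
      by (intro Bochner_Integration.integral_cong refl) (simp add: gap_nonneg)
    with gr have "(\<lambda>n. \<integral>x. norm (gap k (r n) x) \<partial>M\<Omega>) \<longlonglongrightarrow> 0" by (simp only:)
    from tendsto_L1_AE_subseq[OF gap_integrable[OF k0] this]
    obtain q :: "nat \<Rightarrow> nat" where q: "strict_mono q" and qg: "AE x in M\<Omega>. (\<lambda>n. gap k (r (q n)) x) \<longlonglongrightarrow> 0" by blast
    have rq: "strict_mono (\<lambda>n. r (q n))" using r q by (simp add: strict_mono_def)
    have Yl: "AE x in M\<Omega>. (\<lambda>n. Y (r (q n)) x) \<longlonglongrightarrow> 0"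
      using qg good ae AE_space
    proof eventually_elim
      case (elim x)
      then have x: "x \<in> \<Omega>" by simp
      have ul: "(\<lambda>n. u (r (q n)) x) \<longlonglongrightarrow> u0 x" using LIMSEQ_subseq_LIMSEQ[OF elim(3) rq] by (simp add: o_def)
      then have al: "(\<lambda>n. \<bar>u (r (q n)) x\<bar>) \<longlonglongrightarrow> \<bar>u0 x\<bar>" by (intro tendsto_intros)
      consider "\<bar>u0 x\<bar> < k" | "k < \<bar>u0 x\<bar>" using elim by linarith
      then show ?case
      proof cases
        case 1
        have ev: "\<forall>\<^sub>F n in sequentially. \<bar>u (r (q n)) x\<bar> \<le> k"
          using order_tendstoD(2)[OF al 1] by eventually_elim simp
        have "(\<lambda>n. (jxi x (u (r (q n)) x) (g (r (q n)) x) - jxi x (u (r (q n)) x) (tgrad k x)) \<bullet> (g (r (q n)) x - tgrad k x)) \<longlonglongrightarrow> 0"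
        proof (rule Lim_transform_eventually[OF elim(1)])
          show "\<forall>\<^sub>F n in sequentially. gap k (r (q n)) x = (jxi x (u (r (q n)) x) (g (r (q n)) x) - jxi x (u (r (q n)) x) (tgrad k x)) \<bullet> (g (r (q n)) x - tgrad k x)"
            using ev by eventually_elim (simp add: gap_def)
        qed
        from jxi_monotone_gap_imp_convergence[OF x ul this]
        have "(\<lambda>n. (norm (g (r (q n)) x - tgrad k x))\<^sup>2) \<longlonglongrightarrow> (norm (tgrad k x - tgrad k x))\<^sup>2" by (intro tendsto_intros)
        then have l: "(\<lambda>n. (norm (g (r (q n)) x - tgrad k x))\<^sup>2) \<longlonglongrightarrow> 0" by simp
        show ?thesis by (rule tendsto_zero_le[OF Y0 _ l]) (simp add: Y_def)
      next
        case 2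
        have "\<forall>\<^sub>F n in sequentially. Y (r (q n)) x = 0"
          using order_tendstoD(1)[OF al 2] by eventually_elim (simp add: Y_def)
        then show ?thesis by (rule tendsto_eventually)
      qed
    qed
    \<comment> \<open>After the multiple of the gap is subtracted, the remainder has a fixed
      integrable majorant.\<close>
    define P where "P n x = max 0 (Y (r (q n)) x - c1 * gap k (r (q n)) x)" for n x
    have Pm: "P n \<in> borel_measurable M\<Omega>" for n
      unfolding P_def[abs_def] by (intro borel_measurable_max borel_measurable_const borel_measurable_diff borel_measurable_times Ym gm')
    have PX: "AE x in M\<Omega>. norm (P n x) \<le> c2 * (norm (tgrad k x))\<^sup>2" for n
    proof (rule AE_I2)
      fix x assume "x \<in> space M\<Omega>"
      then have "x \<in> \<Omega>" by simp
      from Yle[OF this, of "r (q n)"] show "norm (P n x) \<le> c2 * (norm (tgrad k x))\<^sup>2" using c0 by (simp add: P_def)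
    qed
    have Pl: "(\<lambda>n. \<integral>x. P n x \<partial>M\<Omega>) \<longlonglongrightarrow> (\<integral>x. 0 \<partial>M\<Omega>)"
    proof (rule integral_dominated_convergence[OF _ Pm Xi _ PX])
      show "AE x in M\<Omega>. (\<lambda>n. P n x) \<longlonglongrightarrow> 0"
        using Yl AE_space
      proof eventually_elim
        case (elim x)
        then have x: "x \<in> \<Omega>" by simp
        have "P n x \<le> Y (r (q n)) x" for n using Y0[of "r (q n)" x] mult_nonneg_nonneg[OF c0(1) gap_nonneg[OF x, of k "r (q n)"]] by (simp add: P_def)
        then show ?case by (intro tendsto_zero_le[OF _ _ elim(1)]) (simp add: P_def)
      qed
    qed simp
    have Pi: "integrable M\<Omega> (P n)" for n
    proof (rule Bochner_Integration.integrable_bound[OF Xi Pm])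
      show "AE x in M\<Omega>. norm (P n x) \<le> norm (c2 * (norm (tgrad k x))\<^sup>2)"
        using PX[of n] by eventually_elim (metis abs_ge_self order_trans real_norm_def)
    qed
    have "(\<lambda>n. c1 * (\<integral>x. gap k (r (q n)) x \<partial>M\<Omega>) + (\<integral>x. P n x \<partial>M\<Omega>)) \<longlonglongrightarrow> c1 * 0 + (\<integral>x. 0 \<partial>M\<Omega>)"
      using LIMSEQ_subseq_LIMSEQ[OF gr q] by (intro tendsto_intros Pl) (simp add: o_def)
    then have lim: "(\<lambda>n. c1 * (\<integral>x. gap k (r (q n)) x \<partial>M\<Omega>) + (\<integral>x. P n x \<partial>M\<Omega>)) \<longlonglongrightarrow> 0" by simp
    have "(\<lambda>n. \<integral>x. Y (r (q n)) x \<partial>M\<Omega>) \<longlonglongrightarrow> 0"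
    proof (rule tendsto_zero_le[OF _ _ lim])
      show "0 \<le> (\<integral>x. Y (r (q n)) x \<partial>M\<Omega>)" for n using Y0 by (simp add: integral_nonneg_AE)
      show "(\<integral>x. Y (r (q n)) x \<partial>M\<Omega>) \<le> c1 * (\<integral>x. gap k (r (q n)) x \<partial>M\<Omega>) + (\<integral>x. P n x \<partial>M\<Omega>)" for n
      proof -
        have "(\<integral>x. Y (r (q n)) x \<partial>M\<Omega>) \<le> (\<integral>x. c1 * gap k (r (q n)) x + P n x \<partial>M\<Omega>)"
          by (rule integral_mono[OF Yi Bochner_Integration.integrable_add[OF integrable_mult_right[OF gap_integrable[OF k0]] Pi]]) (simp add: P_def)
        also have "\<dots> = c1 * (\<integral>x. gap k (r (q n)) x \<partial>M\<Omega>) + (\<integral>x. P n x \<partial>M\<Omega>)"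
          using Bochner_Integration.integral_add[OF integrable_mult_right[OF gap_integrable[OF k0, of "r (q n)"], of c1] Pi[of n]] by simp
        finally show ?thesis .
      qed
    qed
    with q show "\<exists>q::nat\<Rightarrow>nat. strict_mono q \<and> (\<lambda>n. \<integral>x. Y (r (q n)) x \<partial>M\<Omega>) \<longlonglongrightarrow> 0" by blast
  qed
  then show ?thesis by (simp add: Y_def)
qed

text \<open>The distribution of |u0| is a finite measure and has at most countably many atoms, so
  one shift \<open>t\<close> avoids them at all the levels R + t + m at once.\<close>

lemma good_levels: obtains t where "0 < t" "\<And>m::nat. AE x in M\<Omega>. \<bar>u0 x\<bar> \<noteq> R + t + real m"
proof -
  let ?D = "distr M\<Omega> borel (\<lambda>x. \<bar>u0 x\<bar>)"
  have um': "(\<lambda>x. \<bar>u0 x\<bar>) \<in> borel_measurable M\<Omega>" by measurable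
  interpret D: finite_measure ?D by (rule finite_measure_distr[OF um'])
  let ?S = "{y. measure ?D {y} \<noteq> 0}"
  have "countable (\<Union>m::nat. (\<lambda>y. y - R - real m) ` ?S)" by (intro countable_UN countable_image D.countable_support) auto
  then have "\<not> {0<..<1::real} \<subseteq> (\<Union>m::nat. (\<lambda>y. y - R - real m) ` ?S)"
    using uncountable_open_interval[of 0 "1::real"] countable_subset by auto
  then obtain t where "t \<in> {0<..<1}" and t2: "t \<notin> (\<Union>m::nat. (\<lambda>y. y - R - real m) ` ?S)" by blast
  then have t1: "0 < t" by simp
  show thesis
  proof (rule that[OF t1])
    fix m :: nat
    let ?k = "R + t + real m"
    have "?k \<notin> ?S"
    proof
      assume "?k \<in> ?S"
      then have "?k - R - real m \<in> (\<Union>m::nat. (\<lambda>y. y - R - real m) ` ?S)" by blast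
      then show False using t2 by simp
    qed
    then have "measure M\<Omega> ((\<lambda>x. \<bar>u0 x\<bar>) -` {?k} \<inter> space M\<Omega>) = 0" using um' by (simp add: measure_distr)
    then have "(\<lambda>x. \<bar>u0 x\<bar>) -` {?k} \<inter> space M\<Omega> \<in> null_sets M\<Omega>"
      using measurable_sets[OF um', of "{?k}"] by (simp add: null_sets_def emeasure_eq_measure)
    from AE_not_in[OF this] AE_space show "AE x in M\<Omega>. \<bar>u0 x\<bar> \<noteq> ?k" by eventually_elim auto
  qed
qed

text \<open>The squared distance splits at the level \<open>K m\<close> into the error of the
  truncated gradients, the energy of the tail, and the parts of \<open>g0\<close> where |u0| or
  |u_n| exceeds the level. The limit is taken in \<open>n\<close> for fixed \<open>m\<close>, and
  the resulting bound vanishes as \<open>m\<close> grows.\<close>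

lemma gradient_tendsto: "(\<lambda>n. nrm2 M\<Omega> (\<lambda>x. g n x - g0 x)) \<longlonglongrightarrow> 0"
proof -
  obtain t where t: "0 < t" "\<And>m::nat. AE x in M\<Omega>. \<bar>u0 x\<bar> \<noteq> R + t + real m" using good_levels by blast
  define K where "K m = R + t + real m" for m :: nat
  have RK: "R \<le> K m" for m using t(1) by (simp add: K_def)
  have good: "AE x in M\<Omega>. \<bar>u0 x\<bar> \<noteq> K m" for m unfolding K_def by (rule t(2))
  define i :: "real \<Rightarrow> real \<Rightarrow> real" where "i k s = (if \<bar>s\<bar> > k then 1 else 0)" for k s
  have im: "(\<lambda>x. i k (u n x)) \<in> borel_measurable M\<Omega>" "(\<lambda>x. i k (u0 x)) \<in> borel_measurable M\<Omega>" for k n unfolding i_def by measurable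
  have ib: "\<bar>i k s\<bar> \<le> 1" for k s by (simp add: i_def)
  have gsi: "sqi M\<Omega> (\<lambda>x. i k (u0 x) *\<^sub>R g0 x)" for k by (rule sqi_bounded_scaleR[OF g0s im(2) ib])
  have zsi: "sqi M\<Omega> (\<lambda>x. i k (u0 x) *\<^sub>R (z x, y x))" for k by (rule sqi_bounded_scaleR[OF zys im(2) ib])
  define \<rho> where "\<rho> k = nrm2 M\<Omega> (\<lambda>x. i k (u0 x) *\<^sub>R g0 x)" for k
  define \<sigma> where "\<sigma> k = nrm2 M\<Omega> (\<lambda>x. i k (u0 x) *\<^sub>R (z x, y x))" for k
  have iK: "\<forall>\<^sub>F m in sequentially. i (K m) s = 0" for s
  proof -
    obtain N :: nat where N: "\<bar>s\<bar> < real N" using reals_Archimedean2 by blast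
    show ?thesis using eventually_ge_at_top[of N]
    proof eventually_elim
      case (elim m)
      then have "\<bar>s\<bar> \<le> K m" using N R_pos t(1) unfolding K_def by linarith
      then show ?case by (simp add: i_def)
    qed
  qed
  have lim0: "(\<lambda>m. nrm2 M\<Omega> (\<lambda>x. i (K m) (u0 x) *\<^sub>R f x)) \<longlonglongrightarrow> 0" if f: "sqi M\<Omega> f" for f :: "'a \<Rightarrow> real \<times> 'a"
  proof -
    have s: "sqi M\<Omega> (\<lambda>x. i (K m) (u0 x) *\<^sub>R f x)" for m by (rule sqi_bounded_scaleR[OF f im(2) ib])
    have "(\<lambda>m. nrm2 M\<Omega> (\<lambda>x. i (K m) (u0 x) *\<^sub>R f x - 0)) \<longlonglongrightarrow> 0"
    proof (rule nrm2_dominated_convergence(2)[OF f sqi_measurable[OF s]])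
      show "AE x in M\<Omega>. norm (i (K m) (u0 x) *\<^sub>R f x) \<le> norm (f x)" for m using ib by (simp add: mult_left_le_one_le)
      show "AE x in M\<Omega>. (\<lambda>m. i (K m) (u0 x) *\<^sub>R f x) \<longlonglongrightarrow> 0"
      proof (rule AE_I2)
        fix x
        have "\<forall>\<^sub>F m in sequentially. i (K m) (u0 x) *\<^sub>R f x = 0" using iK[of "u0 x"] by eventually_elim simp
        then show "(\<lambda>m. i (K m) (u0 x) *\<^sub>R f x) \<longlonglongrightarrow> 0" by (rule tendsto_eventually)
      qed
    qed simp
    then show ?thesis by simp
  qed
  have \<sigma>0: "(\<lambda>m. \<sigma> (K m)) \<longlonglongrightarrow> 0" unfolding \<sigma>_def by (rule lim0[OF zys])
  have \<rho>0: "(\<lambda>m. \<rho> (K m)) \<longlonglongrightarrow> 0"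
  proof -
    \<comment> \<open>Writing \<open>g0\<close> as the pair \<open>(0, g0)\<close> reuses the limit
      proved for pairs.\<close>
    have "nrm2 M\<Omega> (\<lambda>x. i k (u0 x) *\<^sub>R (0::real, g0 x)) = \<rho> k" for k by (simp add: \<rho>_def nrm2_def norm_Pair)
    with lim0[of "\<lambda>x. (0, g0 x)"] g0s show ?thesis by (simp add: sqi_fst_snd sqi_zero)
  qed
  have ilim: "(\<lambda>n. nrm2 M\<Omega> (\<lambda>x. i (K m) (u n x) *\<^sub>R f x)) \<longlonglongrightarrow> nrm2 M\<Omega> (\<lambda>x. i (K m) (u0 x) *\<^sub>R f x)"
    if f: "sqi M\<Omega> f" for f :: "'a \<Rightarrow> real \<times> 'a" and m
  proof -
    have s: "sqi M\<Omega> (\<lambda>x. i k (u n x) *\<^sub>R f x)" "sqi M\<Omega> (\<lambda>x. i k (u0 x) *\<^sub>R f x)" for k n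
      by (rule sqi_bounded_scaleR[OF f im(1) ib], rule sqi_bounded_scaleR[OF f im(2) ib])
    have l: "(\<lambda>n. nrm2 M\<Omega> (\<lambda>x. i (K m) (u n x) *\<^sub>R f x - i (K m) (u0 x) *\<^sub>R f x)) \<longlonglongrightarrow> 0"
    proof (rule nrm2_dominated_convergence(2)[OF f sqi_measurable[OF s(1)] sqi_measurable[OF s(2)]])
      show "AE x in M\<Omega>. norm (i (K m) (u n x) *\<^sub>R f x) \<le> norm (f x)" for n using ib by (simp add: mult_left_le_one_le)
      show "AE x in M\<Omega>. (\<lambda>n. i (K m) (u n x) *\<^sub>R f x) \<longlonglongrightarrow> i (K m) (u0 x) *\<^sub>R f x"
        using truncation_indicator_tendsto[OF good[of m]]
      proof eventually_elim
        case (elim x)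
        have "\<forall>\<^sub>F n in sequentially. i (K m) (u n x) *\<^sub>R f x = i (K m) (u0 x) *\<^sub>R f x"
          using elim by eventually_elim (auto simp: i_def split: if_splits)
        then show ?case by (rule tendsto_eventually)
      qed
    qed
    have "\<bar>nrm2 M\<Omega> (\<lambda>x. i (K m) (u n x) *\<^sub>R f x) - nrm2 M\<Omega> (\<lambda>x. i (K m) (u0 x) *\<^sub>R f x)\<bar>
        \<le> nrm2 M\<Omega> (\<lambda>x. i (K m) (u n x) *\<^sub>R f x - i (K m) (u0 x) *\<^sub>R f x)" for n
    proof -
      have "nrm2 M\<Omega> (\<lambda>x. i (K m) (u0 x) *\<^sub>R f x - i (K m) (u n x) *\<^sub>R f x) = nrm2 M\<Omega> (\<lambda>x. i (K m) (u n x) *\<^sub>R f x - i (K m) (u0 x) *\<^sub>R f x)"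
        by (simp add: nrm2_def norm_minus_commute)
      then show ?thesis using nrm2_le_diff_add[OF s(1)[of "K m" n] s(2)[of "K m"]] nrm2_le_diff_add[OF s(2)[of "K m"] s(1)[of "K m" n]] by linarith
    qed
    then have "\<forall>\<^sub>F n in sequentially. norm (nrm2 M\<Omega> (\<lambda>x. i (K m) (u n x) *\<^sub>R f x) - nrm2 M\<Omega> (\<lambda>x. i (K m) (u0 x) *\<^sub>R f x))
        \<le> nrm2 M\<Omega> (\<lambda>x. i (K m) (u n x) *\<^sub>R f x - i (K m) (u0 x) *\<^sub>R f x)" by (intro always_eventually allI) simp
    then show ?thesis by (rule LIM_zero_cancel[OF Lim_null_comparison[OF _ l]])
  qed
  define E where "E m n = (\<integral>x. (if \<bar>u n x\<bar> \<le> K m then 1 else 0) * (norm (g n x - tgrad (K m) x))\<^sup>2 \<partial>M\<Omega>)" for m n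
  have E0: "(\<lambda>n. E m n) \<longlonglongrightarrow> 0" for m unfolding E_def by (rule truncated_gradient_tendsto[OF RK good])
  \<comment> \<open>Below the level the comparison passes through \<open>tgrad\<close>; above it
    coercivity converts the gradient of \<open>u n\<close> into energy, which
    \<open>tail_estimate\<close> controls.\<close>
  have key: "(nrm2 M\<Omega> (\<lambda>x. g n x - g0 x))\<^sup>2 \<le> 2 * E m n + 2 * (\<rho> (K m))\<^sup>2
      + (2 / \<alpha>0) * (2 * B * (\<delta> n + nrm2 M\<Omega> (\<lambda>x. i (K m) (u n x) *\<^sub>R (z x, y x)))) + 2 * (nrm2 M\<Omega> (\<lambda>x. i (K m) (u n x) *\<^sub>R g0 x))\<^sup>2" for m n
  proof -
    let ?k = "K m"
    let ?a = "\<lambda>x. (if \<bar>u n x\<bar> \<le> ?k then 1 else 0) * (norm (g n x - tgrad ?k x))\<^sup>2"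
    let ?b = "\<lambda>x. (norm (i ?k (u0 x) *\<^sub>R g0 x))\<^sup>2" and ?c = "\<lambda>x. (if \<bar>u n x\<bar> > ?k then 1 else 0) * (flux n x \<bullet> g n x)" and ?d = "\<lambda>x. (norm (i ?k (u n x) *\<^sub>R g0 x))\<^sup>2"
    have ia: "integrable M\<Omega> ?a"
      by (rule Bochner_Integration.integrable_bound[OF sqi_integrable[OF sqi_diff[OF gs[of n] tgrad_sqi[of ?k]]]]) auto
    have ib': "integrable M\<Omega> ?b" by (rule sqi_integrable[OF gsi])
    have ic: "integrable M\<Omega> ?c" by (rule tail_indicator_integrable)
    have id: "integrable M\<Omega> ?d" by (rule sqi_integrable[OF sqi_bounded_scaleR[OF g0s im(1) ib]])
    have "(\<integral>x. (norm (g n x - g0 x))\<^sup>2 \<partial>M\<Omega>) \<le> (\<integral>x. 2 * ?a x + 2 * ?b x + (2 / \<alpha>0) * ?c x + 2 * ?d x \<partial>M\<Omega>)"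
    proof (rule integral_mono)
      show "integrable M\<Omega> (\<lambda>x. (norm (g n x - g0 x))\<^sup>2)" by (rule sqi_integrable[OF sqi_diff[OF gs g0s]])
      show "integrable M\<Omega> (\<lambda>x. 2 * ?a x + 2 * ?b x + (2 / \<alpha>0) * ?c x + 2 * ?d x)"
        using ia ib' ic id by (intro Bochner_Integration.integrable_add integrable_mult_right)
      fix x assume "x \<in> space M\<Omega>"
      then have x: "x \<in> \<Omega>" by simp
      show "(norm (g n x - g0 x))\<^sup>2 \<le> 2 * ?a x + 2 * ?b x + (2 / \<alpha>0) * ?c x + 2 * ?d x"
      proof (cases "\<bar>u n x\<bar> \<le> ?k")
        case True
        have "(norm (g n x - g0 x))\<^sup>2 \<le> 2 * (norm (g n x - tgrad ?k x))\<^sup>2 + 2 * (norm (tgrad ?k x - g0 x))\<^sup>2"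
          using power2_norm_add_le[of "g n x - tgrad ?k x" "tgrad ?k x - g0 x"] by simp
        moreover have "norm (tgrad ?k x - g0 x) = norm (i ?k (u0 x) *\<^sub>R g0 x)" by (simp add: tgrad_def i_def)
        ultimately show ?thesis using True by (simp add: i_def)
      next
        case False
        have s1: "(norm (g n x - g0 x))\<^sup>2 \<le> 2 * (norm (g n x))\<^sup>2 + 2 * (norm (g0 x))\<^sup>2"
          using power2_norm_add_le[of "g n x" "- g0 x"] by simp
        have s2: "(norm (g n x))\<^sup>2 \<le> (1 / \<alpha>0) * (flux n x \<bullet> g n x)"
          using jxi_coercive[OF x, of "g n x" "u n x"] \<alpha>0_pos by (simp add: field_simps)
        have s3: "?a x = 0" "?c x = flux n x \<bullet> g n x" "?d x = (norm (g0 x))\<^sup>2" using False by (simp_all add: i_def)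
        have s4: "(2 / \<alpha>0) * (flux n x \<bullet> g n x) = 2 * ((1 / \<alpha>0) * (flux n x \<bullet> g n x))" by simp
        have "0 \<le> ?b x" by simp
        then show ?thesis unfolding s3 s4 using s1 s2 by linarith
      qed
    qed
    also have "\<dots> = 2 * E m n + 2 * (\<rho> ?k)\<^sup>2 + (2 / \<alpha>0) * (\<integral>x. ?c x \<partial>M\<Omega>) + 2 * (nrm2 M\<Omega> (\<lambda>x. i ?k (u n x) *\<^sub>R g0 x))\<^sup>2"
      unfolding E_def \<rho>_def nrm2_power2 using ia ib' ic id by (simp del: norm_scaleR)
    also have "\<dots> \<le> 2 * E m n + 2 * (\<rho> ?k)\<^sup>2 + (2 / \<alpha>0) * (2 * B * (\<delta> n + nrm2 M\<Omega> (\<lambda>x. i ?k (u n x) *\<^sub>R (z x, y x)))) + 2 * (nrm2 M\<Omega> (\<lambda>x. i ?k (u n x) *\<^sub>R g0 x))\<^sup>2"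
      using tail_estimate[OF RK, of m n] \<alpha>0_pos by (intro add_mono mult_left_mono order_refl) (auto simp: i_def)
    finally show ?thesis by (simp only: nrm2_power2)
  qed
  \<comment> \<open>The limit in \<open>n\<close> of the bound in \<open>key\<close>, left
    unsimplified in the shape that the limit rules produce.\<close>
  define L where "L m = 2 * 0 + 2 * (\<rho> (K m))\<^sup>2 + (2 / \<alpha>0) * (2 * B * (0 + \<sigma> (K m))) + 2 * (\<rho> (K m))\<^sup>2" for m
  have Ll: "(\<lambda>n. 2 * E m n + 2 * (\<rho> (K m))\<^sup>2
      + (2 / \<alpha>0) * (2 * B * (\<delta> n + nrm2 M\<Omega> (\<lambda>x. i (K m) (u n x) *\<^sub>R (z x, y x)))) + 2 * (nrm2 M\<Omega> (\<lambda>x. i (K m) (u n x) *\<^sub>R g0 x))\<^sup>2) \<longlonglongrightarrow> L m" for m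
  proof -
    have "nrm2 M\<Omega> (\<lambda>x. i (K m) (v x) *\<^sub>R (0::real, g0 x)) = nrm2 M\<Omega> (\<lambda>x. i (K m) (v x) *\<^sub>R g0 x)" for v by (simp add: nrm2_def norm_Pair)
    with ilim[of "\<lambda>x. (0, g0 x)" m] g0s have "(\<lambda>n. nrm2 M\<Omega> (\<lambda>x. i (K m) (u n x) *\<^sub>R g0 x)) \<longlonglongrightarrow> \<rho> (K m)"
      by (simp add: sqi_fst_snd sqi_zero \<rho>_def)
    then show ?thesis unfolding L_def
      by (intro tendsto_intros E0 \<delta>lim ilim[OF zys, folded \<sigma>_def])
  qed
  have L0: "L \<longlonglongrightarrow> 0"
  proof -
    have "L \<longlonglongrightarrow> 2 * 0 + 2 * 0\<^sup>2 + (2 / \<alpha>0) * (2 * B * (0 + 0)) + 2 * 0\<^sup>2"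
      unfolding L_def[abs_def] by (intro tendsto_intros \<rho>0 \<sigma>0)
    then show ?thesis by simp
  qed
  have "(\<lambda>n. (nrm2 M\<Omega> (\<lambda>x. g n x - g0 x))\<^sup>2) \<longlonglongrightarrow> 0"
  proof (rule order_tendstoI)
    fix a :: real assume "a < 0"
    then show "\<forall>\<^sub>F n in sequentially. a < (nrm2 M\<Omega> (\<lambda>x. g n x - g0 x))\<^sup>2" by (intro always_eventually allI) (auto intro: less_le_trans)
  next
    fix a :: real assume a: "0 < a"
    obtain m where m: "L m < a" using order_tendstoD(2)[OF L0 a] eventually_happens'[OF sequentially_bot] by blast
    from order_tendstoD(2)[OF Ll[of m] m] show "\<forall>\<^sub>F n in sequentially. (nrm2 M\<Omega> (\<lambda>x. g n x - g0 x))\<^sup>2 < a"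
      by eventually_elim (rule le_less_trans[OF key])
  qed
  from tendsto_real_sqrt[OF this] show ?thesis by (simp add: nrm2_nonneg)
qed

end

theorem theorem5p1:
  fixes \<Omega> :: "'a::euclidean_space set"
    and j js :: "'a \<Rightarrow> real \<Rightarrow> 'a \<Rightarrow> real"
    and jxi :: "'a \<Rightarrow> real \<Rightarrow> 'a \<Rightarrow> 'a"
    and \<alpha> \<beta> :: "real \<Rightarrow> real" and \<alpha>0 R :: real
    and U :: "nat \<Rightarrow> 'a \<Rightarrow> real"
    and W :: "nat \<Rightarrow> ('a \<Rightarrow> real) \<Rightarrow> real"
  assumes dim: "DIM('a) \<ge> 3"
    and open_\<Omega>: "open \<Omega>" and bdd_\<Omega>: "bounded \<Omega>"
    and j_meas: "\<And>s \<xi>. set_borel_measurable lebesgue \<Omega> (\<lambda>x. j x s \<xi>)"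
    and j_C1: "\<And>x s \<xi>. x \<in> \<Omega> \<Longrightarrow>
        ((\<lambda>(s', \<xi>'). j x s' \<xi>') has_derivative (\<lambda>(ds, d\<xi>). js x s \<xi> * ds + jxi x s \<xi> \<bullet> d\<xi>)) (at (s, \<xi>))"
    and js_cont: "\<And>x. x \<in> \<Omega> \<Longrightarrow> continuous_on UNIV (\<lambda>(s, \<xi>). js x s \<xi>)"
    and jxi_cont: "\<And>x. x \<in> \<Omega> \<Longrightarrow> continuous_on UNIV (\<lambda>(s, \<xi>). jxi x s \<xi>)"
    and H1: "\<And>x s. x \<in> \<Omega> \<Longrightarrow> strictly_convex_fun (j x s)"
    and \<alpha>0_pos: "\<alpha>0 > 0"
    and \<alpha>_pos: "\<And>t. t \<ge> 0 \<Longrightarrow> \<alpha> t > 0"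
    and \<alpha>_mono: "mono_on {0..} \<alpha>" and \<alpha>_cont: "continuous_on {0..} \<alpha>"
    and H2: "\<And>x s \<xi>. x \<in> \<Omega> \<Longrightarrow>
        \<alpha>0 * (norm \<xi>)\<^sup>2 \<le> j x s \<xi> \<and> j x s \<xi> \<le> \<alpha> \<bar>s\<bar> * (norm \<xi>)\<^sup>2"
    and \<beta>_pos: "\<And>t. t \<ge> 0 \<Longrightarrow> \<beta> t > 0"
    and \<beta>_mono: "mono_on {0..} \<beta>" and \<beta>_cont: "continuous_on {0..} \<beta>"
    and H3: "\<And>x s \<xi>. x \<in> \<Omega> \<Longrightarrow> \<bar>js x s \<xi>\<bar> \<le> \<beta> \<bar>s\<bar> * (norm \<xi>)\<^sup>2"
    and R_pos: "R > 0"
    and H4: "\<And>x s \<xi>. x \<in> \<Omega> \<Longrightarrow> \<bar>s\<bar> \<ge> R \<Longrightarrow> js x s \<xi> * s \<ge> 0"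
    and U_H01: "\<And>n. H01 \<Omega> (U n)"
    and U_bdd: "\<exists>M. \<forall>n. h1norm \<Omega> (U n) \<le> M"
    and U_L1: "\<And>n. set_integrable lebesgue \<Omega>
        (\<lambda>x. jxi x (U n x) (wgrad \<Omega> (U n) x) \<bullet> wgrad \<Omega> (U n) x)"
    and W_Hm1: "\<And>n. Hm1 \<Omega> (W n)"
    and eq: "\<And>n v. v \<in> Vset \<Omega> (U n) \<Longrightarrow>
        (LINT x:\<Omega>|lebesgue. js x (U n x) (wgrad \<Omega> (U n) x) * v x)
        + (LINT x:\<Omega>|lebesgue. jxi x (U n x) (wgrad \<Omega> (U n) x) \<bullet> wgrad \<Omega> v x) = W n v"
    and W_conv: "\<exists>w. Hm1 \<Omega> w \<and> (\<lambda>n. hm1norm \<Omega> (\<lambda>v. W n v - w v)) \<longlonglongrightarrow> 0"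
  shows "\<exists>r u. strict_mono r \<and> H01 \<Omega> u \<and>
           (\<lambda>k. h1norm \<Omega> (\<lambda>x. U (r k) x - u x)) \<longlonglongrightarrow> 0"
proof -
  interpret quasilinear_integrand \<Omega> j js jxi \<alpha> \<beta> \<alpha>0 R
    by unfold_locales (fact open_\<Omega> bdd_\<Omega> j_meas j_C1 jxi_cont H1 \<alpha>0_pos \<alpha>_pos \<alpha>_mono H2 \<beta>_pos \<beta>_mono H3 R_pos H4)+
  define G where "G n = wgrad \<Omega> (U n)" for n
  have HU: "H10 (U n) (G n)" for n unfolding G_def by (rule H01_imp_H10[OF U_H01])
  obtain B where B: "\<And>n. h1norm \<Omega> (U n) \<le> B" using U_bdd by blast
  have pB: "nrm2 M\<Omega> (\<lambda>x. (U n x, G n x)) \<le> B" for n using B[of n] H10_h1norm[OF HU[of n]] by simp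
  have UB: "nrm2 M\<Omega> (U n) \<le> B" "nrm2 M\<Omega> (G n) \<le> B" for n
    using nrm2_components(1,2)[OF H10_sqi(1,2)[OF HU[of n]]] pB[of n] by linarith+
  obtain w where w: "Hm1 \<Omega> w" and wlim: "(\<lambda>n. hm1norm \<Omega> (\<lambda>v. W n v - w v)) \<longlonglongrightarrow> 0" using W_conv by blast
  obtain z y where zy: "sqi M\<Omega> z" "sqi M\<Omega> y" and wrep: "\<And>v h. H10 v h \<Longrightarrow> w v = (\<integral>x. (z x, y x) \<bullet> (v x, h x) \<partial>M\<Omega>)"
    using Hm1_representation[OF w] by blast
  obtain r u0 g0 where r: "strict_mono (r::nat\<Rightarrow>nat)" and H0: "H10 u0 g0"
    and wu: "weakly_conv M\<Omega> (\<lambda>n. U (r n)) u0" and wg: "weakly_conv M\<Omega> (\<lambda>n. G (r n)) g0"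
    using H10_weak_compactness[of U G B, OF HU pB] by blast
  have strong: "(\<lambda>n. nrm2 M\<Omega> (\<lambda>x. U (r n) x - u0 x)) \<longlonglongrightarrow> 0" by (rule Rellich[OF HU H0 UB wu])
  \<comment> \<open>Strong convergence in L2 gives almost everywhere convergence along a further
    subsequence.\<close>
  obtain q where q: "strict_mono (q::nat\<Rightarrow>nat)" and qae: "AE x in M\<Omega>. (\<lambda>n. U (r (q n)) x - u0 x) \<longlonglongrightarrow> 0"
    using nrm2_tendsto_zero_AE_subseq[OF sqi_diff[OF H10_sqi(1)[OF HU] H10_sqi(1)[OF H0]] strong] by blast
  define s where "s n = r (q n)" for n
  have s: "strict_mono s" using r q by (simp add: s_def strict_mono_def)
  define \<delta> where "\<delta> n = \<bar>hm1norm \<Omega> (\<lambda>v. W (s n) v - w v)\<bar>" for n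
  interpret approximate_solutions \<Omega> j js jxi \<alpha> \<beta> \<alpha>0 R "\<lambda>n. U (s n)" "\<lambda>n. G (s n)" u0 g0 "\<lambda>n. W (s n)" z y \<delta> B
  proof unfold_locales
    show "H10 (U (s n)) (G (s n))" for n by (rule HU)
    show "H10 u0 g0" by (rule H0)
    show "nrm2 M\<Omega> (U (s n)) \<le> B" "nrm2 M\<Omega> (G (s n)) \<le> B" for n by (rule UB)+
    show "integrable M\<Omega> (\<lambda>x. jxi x (U (s n) x) (G (s n) x) \<bullet> G (s n) x)" for n
      using U_L1[of "s n"] unfolding set_integrable_domain G_def .
    show "weakly_conv M\<Omega> (\<lambda>n. G (s n)) g0" unfolding weakly_conv_def
    proof (intro allI impI)
      fix h :: "'a \<Rightarrow> 'a" assume "sqi M\<Omega> h"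
      then have "(\<lambda>n. \<integral>x. G (r n) x \<bullet> h x \<partial>M\<Omega>) \<longlonglongrightarrow> (\<integral>x. g0 x \<bullet> h x \<partial>M\<Omega>)" using wg unfolding weakly_conv_def by blast
      from LIMSEQ_subseq_LIMSEQ[OF this q] show "(\<lambda>n. \<integral>x. G (s n) x \<bullet> h x \<partial>M\<Omega>) \<longlonglongrightarrow> (\<integral>x. g0 x \<bullet> h x \<partial>M\<Omega>)" by (simp add: o_def s_def)
    qed
    show "AE x in M\<Omega>. (\<lambda>n. U (s n) x) \<longlonglongrightarrow> u0 x" using qae by eventually_elim (simp add: s_def LIM_zero_cancel)
    show "sqi M\<Omega> z" "sqi M\<Omega> y" by (fact zy)+
    show "0 \<le> \<delta> n" for n by (simp add: \<delta>_def)
    show "\<delta> \<longlonglongrightarrow> 0" using tendsto_rabs_zero[OF LIMSEQ_subseq_LIMSEQ[OF wlim s]] by (simp add: \<delta>_def[abs_def] o_def)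
    show "\<bar>W (s n) v - (\<integral>x. (z x, y x) \<bullet> (v x, h x) \<partial>M\<Omega>)\<bar> \<le> \<delta> n * nrm2 M\<Omega> (\<lambda>x. (v x, h x))" if vh: "H10 v h" for n v h
    proof -
      have "\<bar>W (s n) v - w v\<bar> \<le> hm1norm \<Omega> (\<lambda>v. W (s n) v - w v) * nrm2 M\<Omega> (\<lambda>x. (v x, h x))"
        by (rule Hm1_le_hm1norm[OF Hm1_diff[OF W_Hm1 w] vh])
      also have "\<dots> \<le> \<delta> n * nrm2 M\<Omega> (\<lambda>x. (v x, h x))" unfolding \<delta>_def by (intro mult_right_mono abs_ge_self nrm2_nonneg)
      finally show ?thesis by (simp only: wrep[OF vh])
    qed
    show "(\<integral>x. js x (U (s n) x) (G (s n) x) * v x \<partial>M\<Omega>) + (\<integral>x. jxi x (U (s n) x) (G (s n) x) \<bullet> h x \<partial>M\<Omega>) = W (s n) v"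
      if vh: "H10 v h" and C: "\<And>x. \<bar>v x\<bar> \<le> C" "\<And>x. v x \<noteq> 0 \<Longrightarrow> \<bar>U (s n) x\<bar> \<le> C" for n v h C
    proof -
      have "AE x in lebesgue. x \<in> \<Omega> \<longrightarrow> \<bar>v x\<bar> \<le> C" "AE x in lebesgue. x \<in> \<Omega> \<and> v x \<noteq> 0 \<longrightarrow> \<bar>U (s n) x\<bar> \<le> C"
        using C by (auto intro!: AE_I2)
      then have V: "v \<in> Vset \<Omega> (U (s n))" unfolding Vset_def using H10_imp_H01[OF vh] by blast
      have m: "(\<lambda>x. jxi x (U (s n) x) (G (s n) x)) \<in> borel_measurable M\<Omega>"
        by (rule jxi_measurable[OF sqi_measurable[OF H10_sqi(1)[OF HU]] sqi_measurable[OF H10_sqi(2)[OF HU]]])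
      \<comment> \<open>The equation is stated with the chosen gradient \<open>wgrad\<close>, which
        equals the explicit gradient \<open>h\<close> almost everywhere.\<close>
      have "(\<integral>x. jxi x (U (s n) x) (G (s n) x) \<bullet> wgrad \<Omega> v x \<partial>M\<Omega>) = (\<integral>x. jxi x (U (s n) x) (G (s n) x) \<bullet> h x \<partial>M\<Omega>)"
      proof (rule integral_cong_AE)
        show "(\<lambda>x. jxi x (U (s n) x) (G (s n) x) \<bullet> wgrad \<Omega> v x) \<in> borel_measurable M\<Omega>"
          by (rule borel_measurable_inner[OF m sqi_measurable[OF H10_sqi(2)[OF H01_imp_H10[OF H10_imp_H01[OF vh]]]]])
        show "(\<lambda>x. jxi x (U (s n) x) (G (s n) x) \<bullet> h x) \<in> borel_measurable M\<Omega>"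
          by (rule borel_measurable_inner[OF m sqi_measurable[OF H10_sqi(2)[OF vh]]])
        show "AE x in M\<Omega>. jxi x (U (s n) x) (G (s n) x) \<bullet> wgrad \<Omega> v x = jxi x (U (s n) x) (G (s n) x) \<bullet> h x"
          using H10_wgrad_AE[OF vh] by eventually_elim simp
      qed
      then show ?thesis using eq[OF V] unfolding set_integral_domain G_def by simp
    qed
  qed
  have d: "H10 (\<lambda>x. U (s n) x - u0 x) (\<lambda>x. G (s n) x - g0 x)" for n by (rule H10_diff[OF HU H0])
  have "(\<lambda>n. nrm2 M\<Omega> (\<lambda>x. U (s n) x - u0 x)) \<longlonglongrightarrow> 0" using LIMSEQ_subseq_LIMSEQ[OF strong q] by (simp add: o_def s_def)
  from tendsto_add[OF this gradient_tendsto]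
  have "(\<lambda>n. nrm2 M\<Omega> (\<lambda>x. U (s n) x - u0 x) + nrm2 M\<Omega> (\<lambda>x. G (s n) x - g0 x)) \<longlonglongrightarrow> 0" by simp
  then have "(\<lambda>n. h1norm \<Omega> (\<lambda>x. U (s n) x - u0 x)) \<longlonglongrightarrow> 0"
    unfolding H10_h1norm[OF d]
    by (rule tendsto_zero_le[OF nrm2_nonneg nrm2_components(3)[OF H10_sqi(1)[OF d] H10_sqi(2)[OF d]]])
  with s H10_imp_H01[OF H0] show ?thesis by blast
qed

end
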